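(* Let $$\mathcal{A}_1=\inf_{\substack{f\in \mathcal{F}_1\\ f(0)\neq 0}}\frac{\|f\|_1}{f(0)},$$ where $\mathcal{F}_1$ is the family of real entire functions $f:\mathbb{C}\to\mathbb{C}$ of exponential type at most $2\pi$ such that $f\in L^1(\mathbb{R})$, $f(x)\ge 0$ for all $x\in\mathbb{R}$, and $f$ is radially decreasing, i.e. $f$ is increasing on $(-\infty,0)$ and decreasing on $(0,\infty)$. Then: (a) There exists an even function $F\in\mathcal{F}_1$ with $F(0)=1$ that attains the infimum, i.e. $\|F\|_1/F(0)=\mathcal{A}_1$. (b) If $F\in\mathcal{F}_1$ is any even extremizer (that is, $F$ is even, $F(0)\ne0$ and $\|F\|_1/F(0)=\mathcal{A}_1$), then all the zeros of $F$ in $\mathbb{C}$ lie in the set $$S=\{z\in\mathbb{C}: |\operatorname{Re} z|>|\operatorname{Im} z|>0\}.$$ (c) The constant $\mathcal{A}_1$ satisfies $1.2750<\mathcal{A}_1<1.27714$.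
   Context: For $\Delta>0$, an entire function $G:\mathbb{C}\to\mathbb{C}$ has exponential type at most $2\pi\Delta$ if for every $\varepsilon>0$ there is a constant $C_\varepsilon>0$ with $|G(z)|\le C_\varepsilon e^{(2\pi\Delta+\varepsilon)|z|}$ for all $z\in\mathbb{C}$. An entire function is called real if its restriction to $\mathbb{R}$ is real-valued. $\|f\|_1=\int_{-\infty}^\infty|f(x)|\,dx$. "Increasing" and "decreasing" are understood in the non-strict sense. *)

theory Defs
  imports "HOL-Complex_Analysis.Complex_Analysis"
begin

definition exponential_type_at_most :: "real \<Rightarrow> (complex \<Rightarrow> complex) \<Rightarrow> bool" where
  "exponential_type_at_most \<tau> G \<longleftrightarrow>
     (\<forall>\<epsilon>>0. \<exists>C>0. \<forall>z. cmod (G z) \<le> C * exp ((\<tau> + \<epsilon>) * cmod z))"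

definition real_entire :: "(complex \<Rightarrow> complex) \<Rightarrow> bool" where
  "real_entire G \<longleftrightarrow> G holomorphic_on UNIV \<and> (\<forall>x::real. G (of_real x) \<in> \<real>)"

definition radially_decreasing :: "(real \<Rightarrow> real) \<Rightarrow> bool" where
  "radially_decreasing g \<longleftrightarrow> mono_on {..<0} g \<and> antimono_on {0<..} g"

definition norm_L1 :: "(complex \<Rightarrow> complex) \<Rightarrow> real" where
  "norm_L1 f = (LBINT x. cmod (f (of_real x)))"

(* Members of F1 are real on the real line, so Re there merely passes from complex to real. *)
definition F1 :: "(complex \<Rightarrow> complex) set" where
  "F1 = {f. real_entire f \<and> exponential_type_at_most (2 * pi) f \<and>
            integrable lborel (\<lambda>x::real. f (of_real x)) \<and>
            (\<forall>x::real. 0 \<le> Re (f (of_real x))) \<and>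
            radially_decreasing (\<lambda>x. Re (f (of_real x)))}"

(* The set below is bounded below by 0; if it were empty, the value would be unspecified. *)
definition A1 :: real where
  "A1 = (INF f\<in>{f \<in> F1. f 0 \<noteq> 0}. norm_L1 f / Re (f 0))"

definition even_fun :: "(complex \<Rightarrow> complex) \<Rightarrow> bool" where
  "even_fun f \<longleftrightarrow> (\<forall>z. f (- z) = f z)"

definition even_extremizer :: "(complex \<Rightarrow> complex) \<Rightarrow> bool" where
  "even_extremizer F \<longleftrightarrow>
     F \<in> F1 \<and> even_fun F \<and> F 0 \<noteq> 0 \<and> norm_L1 F / Re (F 0) = A1"

end

theory Submission
  imports Defs "HOL-Probability.Sinc_Integral" "HOL-Computational_Algebra.Fundamental_Theorem_Algebra"
begin

text \<open>
  The existence of an even extremizer is a normal family argument: members of the class with value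
  \<open>1\<close> at the origin are bounded by \<open>exp (2 \<pi> \<bar>Im z\<bar>)\<close> by the Phragmen-Lindelof principle, all conditions
  survive locally uniform limits, Fatou's lemma controls the norm, and averaging with the reflection makes
  the function even (\<open>even_extremizer_exists\<close>).

  The location of the zeros is a variational argument. If an extremizer \<open>F\<close> is divisible by an even
  polynomial that is positive and increasing in \<open>\<bar>x\<bar>\<close>, then the quotient is still radially decreasing
  and has a strictly smaller norm relative to its value at \<open>0\<close>. Real zeros are impossible by
  monotonicity, and the quadruple \<open>\<plusminus>a \<plusminus> \<i> b\<close> generated by a zero with \<open>\<bar>a\<bar> \<le> \<bar>b\<bar>\<close> gives such a polynomial
  (\<open>even_extremizer_zeros\<close>).

  The numerical bounds come from one quadratic form. For an even member \<open>F\<close> write \<open>F' = - x \<gamma>\<close>; then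
  \<open>\<gamma> \<ge> 0\<close>, and \<open>F 0\<close> and \<open>\<parallel>F\<parallel>\<^sub>1 / 2\<close> are the integrals of \<open>x \<gamma>\<close> and of \<open>x\<^sup>2 \<gamma>\<close> over the half-line. If
  \<open>x\<^sup>2 \<gamma>\<close> is the square of the sine transform \<open>K\<close> of a function \<open>\<Phi>\<close> on an interval, these integrals
  are those of \<open>K\<^sup>2 / x\<close> and of \<open>K\<^sup>2\<close>, which are, after rescaling the interval to \<open>[0, 1]\<close>, multiples
  of the form with kernel \<open>ln ((s + t) / \<bar>s - t\<bar>)\<close> and of \<open>\<parallel>\<Phi>\<parallel>\<^sup>2\<close> (\<open>nn_integral_K_sq_div\<close>,
  \<open>nn_integral_K_sq_le\<close>). With \<open>\<lambda>\<close> the largest eigenvalue of this kernel on \<open>[0, 1]\<close>, the extremal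
  constant is \<open>2 / \<lambda>\<close>.

  For the upper bound a polynomial \<open>\<Phi>\<close> of degree \<open>7\<close> gives a member of the class with quotient
  \<open>2 \<parallel>\<Phi>\<parallel>\<^sup>2\<close> divided by the form (\<open>F1_from_odd_poly\<close>, \<open>A1_upper\<close>). For the lower bound two things are
  needed. The first is the estimate \<open>\<lambda> \<le> 3137/2000\<close> (\<open>log_form_le\<close>): a cubic trial function nearly
  solves the eigenvalue equation, and on its orthogonal complement the Hilbert-Schmidt norm is small
  enough.

  The second is that a general \<open>\<gamma>\<close> behaves like a square. A factorization of \<open>\<gamma>\<close> itself is avoided by
  periodization: the sum of the translates of \<open>\<gamma>\<close> by multiples of \<open>N\<close> is a nonnegative trigonometric
  polynomial, hence a square by the Fejer-Riesz theorem (\<open>periodization_square\<close>). The window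
  \<open>sin\<^sup>4 (\<pi> x / N)\<close> makes all integrals converge, supplies the moment conditions under which the
  estimate of the form applies to trigonometric sums (\<open>trig_sum_inequality\<close>), and cancels the extra
  translates through the partial fractions of \<open>1 / sin\<^sup>2\<close>. Letting \<open>N\<close> tend to infinity gives
  \<open>\<integral> x \<gamma> \<le> 3137/2000 \<integral> x\<^sup>2 \<gamma>\<close> (\<open>moment_inequality\<close>), that is \<open>1 \<le> 3137/2000 \<cdot> \<parallel>F\<parallel>\<^sub>1 / 2\<close> when
  \<open>F 0 = 1\<close>.\<close>

section \<open>A Phragmen-Lindelof principle\<close>

text \<open>In the sector of opening \<open>\<pi>/2\<close> the root \<open>a \<plusminus> \<i> b\<close> of \<open>z\<close> has argument at most \<open>\<pi>/8\<close>, so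
  \<open>b / a \<le> 5 / 12\<close>, and the real part \<open>a (a\<^sup>2 - 3 b\<^sup>2)\<close> of its cube is comparable to \<open>a\<^sup>3\<close>.\<close>

lemma Re_csqrt_cube_ge:
  assumes "\<bar>Im z\<bar> \<le> Re z"
  shows "Re (csqrt z ^ 3) \<ge> cmod z * sqrt (cmod z) / 8"
proof -
  define a b where "a = Re (csqrt z)" and "b = \<bar>Im (csqrt z)\<bar>"
  have a0: "a \<ge> 0" and b0: "b \<ge> 0" using csqrt_principal[of z] unfolding a_def b_def by auto
  have sq: "(csqrt z)\<^sup>2 = z" by simp
  have re: "Re z = a\<^sup>2 - b\<^sup>2" unfolding a_def b_def
    by (metis Re_power2 power2_abs sq)
  have im: "\<bar>Im z\<bar> = 2 * a * b" unfolding a_def b_def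
    by (metis Im_power2 a0 a_def abs_mult abs_numeral abs_of_nonneg sq)
  have h: "a\<^sup>2 - b\<^sup>2 \<ge> 2 * a * b" using assms re im by simp
  have ab: "a \<ge> b"
  proof (rule ccontr)
    assume "\<not> a \<ge> b"
    then have "a\<^sup>2 < b\<^sup>2" using a0 by (simp add: power_strict_mono)
    with h a0 b0 show False by (smt (verit) mult_nonneg_nonneg)
  qed
  have "(a - b)\<^sup>2 \<ge> 2 * b\<^sup>2" using h by (simp add: power2_eq_square algebra_simps)
  also have "2 * b\<^sup>2 \<ge> (1.4 * b)\<^sup>2" by (simp add: power2_eq_square)
  finally have "1.4 * b \<le> a - b" using ab
    by (meson diff_ge_0_iff_ge power2_le_imp_le)
  then have b: "2.4 * b \<le> a" by simp
  then have b2: "(2.4 * b)\<^sup>2 \<le> a\<^sup>2" using b0 by (intro power_mono) auto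
  have re3: "Re (csqrt z ^ 3) = a * (a\<^sup>2 - 3 * b\<^sup>2)"
    by (simp add: a_def b_def power3_eq_cube power2_eq_square algebra_simps)
  have cm: "cmod (csqrt z) \<le> a + b"
    unfolding a_def b_def using a0 a_def cmod_le[of "csqrt z"] by simp
  then have cm': "cmod (csqrt z) \<le> 1.5 * a" using b b0 by simp
  have "cmod z * sqrt (cmod z) = cmod (csqrt z) ^ 3"
    by (simp add: power3_eq_cube)
  also have "\<dots> \<le> (1.5 * a) ^ 3" using cm' by (intro power_mono) auto
  also have "\<dots> = 3.375 * (a * a\<^sup>2)" by (simp add: power3_eq_cube power2_eq_square)
  finally have 1: "cmod z * sqrt (cmod z) / 8 \<le> 0.421875 * (a * a\<^sup>2)" by simp
  have "144 * b\<^sup>2 \<le> 25 * a\<^sup>2" using b2 by (simp add: power_mult_distrib power2_eq_square)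
  then have "a\<^sup>2 - 3 * b\<^sup>2 \<ge> 9 / 20 * a\<^sup>2" using zero_le_power2[of a] by linarith
  then have "a * (a\<^sup>2 - 3 * b\<^sup>2) \<ge> a * (9 / 20 * a\<^sup>2)" using a0 by (intro mult_left_mono)
  moreover have "a * a\<^sup>2 \<ge> 0" using a0 by simp
  ultimately show ?thesis using 1 re3 by simp
qed

text \<open>Removes an auxiliary convergence factor by letting its parameter tend to \<open>0\<close>.\<close>

lemma le_of_le_exp_small:
  fixes a b M :: real
  assumes "\<And>\<eta>. \<eta> > 0 \<Longrightarrow> a \<le> M * exp (\<eta> * b)"
  shows "a \<le> M"
proof -
  have "((\<lambda>\<eta>. M * exp (\<eta> * b)) \<longlongrightarrow> M * exp (0 * b)) (at_right 0)"
    by (intro tendsto_intros)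
  moreover have "eventually (\<lambda>\<eta>. a \<le> M * exp (\<eta> * b)) (at_right 0)"
    using assms by (auto simp: eventually_at_right_field intro: exI[of _ 1])
  ultimately show ?thesis
    by (intro tendsto_lowerbound[of "\<lambda>\<eta>. M * exp (\<eta> * b)" _ "at_right 0"]) auto
qed

text \<open>The maximum principle for an unbounded domain \<open>U\<close> cut off at radius \<open>R\<close>; the set \<open>V\<close> is the
  closed domain, on which the boundary bounds are available.\<close>

lemma maximum_modulus_truncated:
  fixes U :: "complex set"
  assumes "open U" "closure U \<subseteq> V" "open W" "V \<subseteq> W"
    and hol: "f holomorphic_on W"
    and bd: "\<And>z. z \<in> V \<Longrightarrow> z \<notin> U \<Longrightarrow> cmod (f z) \<le> M"
    and far: "\<And>z. z \<in> V \<Longrightarrow> cmod z = R \<Longrightarrow> cmod (f z) \<le> M"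
    and z0: "z0 \<in> U" "cmod z0 < R"
  shows "cmod (f z0) \<le> M"
proof -
  define S where "S = U \<inter> ball 0 R"
  have S: "open S" "bounded S" by (auto simp: S_def assms bounded_Int)
  have clo: "closure S \<subseteq> V \<inter> cball 0 R"
  proof -
    have "closure S \<subseteq> closure U" by (simp add: S_def closure_mono)
    moreover have "closure S \<subseteq> closure (ball 0 R)" unfolding S_def by (intro closure_mono) auto
    ultimately show ?thesis using assms(2) closure_minimal[OF ball_subset_cball closed_cball, of "0::complex" R] by blast
  qed
  show ?thesis
  proof (rule maximum_modulus_frontier[of f S])
    show "f holomorphic_on interior S"
      using hol clo closure_subset[of S] \<open>V \<subseteq> W\<close> interior_subset[of S]
      by (meson holomorphic_on_subset inf.boundedE order_trans)
    show "continuous_on (closure S) f"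
      using hol clo \<open>V \<subseteq> W\<close> by (meson holomorphic_on_imp_continuous_on holomorphic_on_subset inf.boundedE order_trans)
    show "cmod (f z) \<le> M" if "z \<in> frontier S" for z
    proof -
      have "z \<in> closure S" "z \<notin> S" using that S by (auto simp: frontier_def interior_open)
      moreover have "z \<in> V" "cmod z \<le> R" using clo \<open>z \<in> closure S\<close> by auto
      ultimately show ?thesis using bd[of z] far[of z] by (cases "cmod z = R") (auto simp: S_def dist_norm)
    qed
  qed (use S z0 in \<open>auto simp: S_def dist_norm\<close>)
qed

text \<open>In a sector of opening \<open>\<pi>/2\<close> the function \<open>z\<^bsup>3/2\<^esup>\<close> still has positive
  real part, so \<open>exp (-\<eta> z\<^bsup>3/2\<^esup>)\<close> beats every growth of order one while
  having modulus at most one; letting \<open>\<eta>\<close> tend to \<open>0\<close> removes it.  The branch point is moved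
  away from the sector by replacing \<open>z\<close> with \<open>1 + z\<close>.\<close>

lemma phragmen_lindelof_sector:
  assumes hol: "f holomorphic_on UNIV"
    and growth: "\<And>z. cmod (f z) \<le> C * exp (c * cmod z)"
    and bd: "\<And>z. \<bar>Im z\<bar> = Re z \<Longrightarrow> cmod (f z) \<le> M"
    and "M > 0" "C > 0" "c \<ge> 0"
    and z0: "\<bar>Im z0\<bar> \<le> Re z0"
  shows "cmod (f z0) \<le> M"
proof (cases "\<bar>Im z0\<bar> = Re z0")
  case True
  then show ?thesis by (rule bd)
next
  case False
  with z0 have z0: "\<bar>Im z0\<bar> < Re z0" by simp
  define s where "s = (\<lambda>z. csqrt (1 + z) ^ 3)"
  have s_ge: "Re (s z) \<ge> cmod z * sqrt (cmod z) / 8" if "\<bar>Im z\<bar> \<le> Re z" for z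
  proof -
    have "(cmod z)\<^sup>2 \<le> (cmod (1 + z))\<^sup>2" unfolding cmod_power2
      using power_mono[of "Re z" "1 + Re z" 2] that by simp
    then have "cmod z \<le> cmod (1 + z)" by (rule power2_le_imp_le) auto
    then have "cmod z * sqrt (cmod z) \<le> cmod (1 + z) * sqrt (cmod (1 + z))"
      by (intro mult_mono) auto
    moreover have "Re (s z) \<ge> cmod (1 + z) * sqrt (cmod (1 + z)) / 8"
      unfolding s_def using that by (intro Re_csqrt_cube_ge) auto
    ultimately show ?thesis by simp
  qed
  have "cmod (f z0) \<le> M * exp (\<eta> * Re (s z0))" if "\<eta> > 0" for \<eta>
  proof -
    define g where "g = (\<lambda>z. f z * exp (- of_real \<eta> * s z))"
    define R where "R = max (cmod z0 + 1) (max (C / M) ((8 * (c + 1) / \<eta>)\<^sup>2))"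
    have nexp: "cmod (g z) = cmod (f z) * exp (- \<eta> * Re (s z))" for z
      by (simp add: g_def norm_mult)
    have "cmod (g z0) \<le> M"
    proof (rule maximum_modulus_truncated[where f = g and R = R and U = "{z. \<bar>Im z\<bar> < Re z}"
        and V = "{z. \<bar>Im z\<bar> \<le> Re z}" and W = "{z. Re z > -1}"])
      show "open {z. \<bar>Im z\<bar> < Re z}" by (intro open_Collect_less continuous_intros)
      have "closed {z. \<bar>Im z\<bar> \<le> Re z}" by (intro closed_Collect_le continuous_intros)
      then show "closure {z. \<bar>Im z\<bar> < Re z} \<subseteq> {z. \<bar>Im z\<bar> \<le> Re z}"
        by (intro closure_minimal) auto
      show "open {z. Re z > -1}" by (intro open_Collect_less continuous_intros)
      show "{z. \<bar>Im z\<bar> \<le> Re z} \<subseteq> {z. Re z > -1}" by auto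
      show "g holomorphic_on {z. Re z > -1}" unfolding g_def s_def
        by (intro holomorphic_intros holomorphic_on_subset[OF hol])
           (auto simp: complex_nonpos_Reals_iff)
      show "cmod (g z) \<le> M" if "z \<in> {z. \<bar>Im z\<bar> \<le> Re z}" "z \<notin> {z. \<bar>Im z\<bar> < Re z}" for z
      proof -
        have 1: "\<bar>Im z\<bar> = Re z" using that by auto
        have "Re (s z) \<ge> 0" using s_ge[of z] 1 by (smt (verit) divide_nonneg_nonneg mult_nonneg_nonneg norm_ge_zero real_sqrt_ge_zero)
        then have "exp (- \<eta> * Re (s z)) \<le> 1" using \<open>\<eta> > 0\<close> by simp
        then show ?thesis unfolding nexp using bd[OF 1] \<open>M > 0\<close>
          by (smt (verit) exp_gt_zero mult_left_le norm_ge_zero)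
      qed
      show "cmod (g z) \<le> M" if "z \<in> {z. \<bar>Im z\<bar> \<le> Re z}" "cmod z = R" for z
      proof -
        have R: "R > 0" "C / M \<le> R" "(8 * (c + 1) / \<eta>)\<^sup>2 \<le> R"
          unfolding R_def by (auto simp: less_max_iff_disj add_nonneg_pos le_max_iff_disj)
        have "8 * (c + 1) / \<eta> \<le> sqrt R" using R(3) by (rule real_le_rsqrt)
        then have "c + 1 \<le> \<eta> * (sqrt R / 8)" using \<open>\<eta> > 0\<close> by (simp add: field_simps)
        then have "R * (c + 1) \<le> R * (\<eta> * (sqrt R / 8))" using R(1) by (intro mult_left_mono) auto
        also have "\<dots> = \<eta> * (R * sqrt R / 8)" by simp
        also have "\<dots> \<le> \<eta> * Re (s z)" using s_ge[of z] that \<open>\<eta> > 0\<close> by (intro mult_left_mono) auto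
        finally have e: "c * R + - \<eta> * Re (s z) \<le> - R" by (simp add: algebra_simps)
        have "cmod (g z) \<le> C * exp (c * R) * exp (- \<eta> * Re (s z))"
          unfolding nexp using growth[of z] that by (intro mult_right_mono) auto
        also have "\<dots> = C * exp (c * R + - \<eta> * Re (s z))" by (simp add: mult_exp_exp)
        also have "\<dots> \<le> C * exp (- R)" using e \<open>C > 0\<close> by simp
        also have "\<dots> \<le> M"
        proof -
          have "C \<le> M * R" using R(2) \<open>M > 0\<close> by (simp add: field_simps)
          also have "\<dots> \<le> M * exp R" using \<open>M > 0\<close> exp_ge_add_one_self[of R]
            by (intro mult_left_mono) linarith+
          finally show ?thesis by (simp add: exp_minus field_simps)
        qed
        finally show ?thesis .
      qed
      show "cmod z0 < R" by (simp add: R_def)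
    qed (use z0 in auto)
    then show ?thesis unfolding nexp by (simp add: exp_minus field_simps)
  qed
  then show ?thesis by (rule le_of_le_exp_small)
qed

text \<open>A bounded function is turned into one that vanishes at infinity by the factor
  \<open>1 / (1 - \<i> \<eta> z)\<close>, whose modulus is at most one in the upper half-plane.\<close>

lemma bounded_halfplane_le_boundary:
  assumes hol: "f holomorphic_on UNIV"
    and B: "\<And>z. Im z \<ge> 0 \<Longrightarrow> cmod (f z) \<le> B"
    and bd: "\<And>x::real. cmod (f (of_real x)) \<le> M"
    and "M > 0" and z0: "Im z0 \<ge> 0"
  shows "cmod (f z0) \<le> M"
proof (cases "Im z0 = 0")
  case True
  then show ?thesis using bd[of "Re z0"] by (simp add: complex_is_Real_iff of_real_Re)
next
  case False
  with z0 have z0: "Im z0 > 0" by simp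
  have "cmod (f z0) \<le> M * exp (\<eta> * cmod z0)" if "\<eta> > 0" for \<eta>
  proof -
    define d where "d = (\<lambda>z. 1 - \<i> * of_real \<eta> * z)"
    define g where "g = (\<lambda>z. f z / d z)"
    have d1: "cmod (d z) \<ge> 1" if "Im z \<ge> 0" for z
    proof -
      have "Re (d z) = 1 + \<eta> * Im z" by (simp add: d_def)
      moreover have "\<eta> * Im z \<ge> 0" using that \<open>\<eta> > 0\<close> by simp
      ultimately show ?thesis using complex_Re_le_cmod[of "d z"] by linarith
    qed
    have B0: "B \<ge> 0" using order_trans[OF norm_ge_zero B[of 0]] by simp
    define R where "R = max (cmod z0 + 1) ((B / M + 1) / \<eta>)"
    have "cmod (g z0) \<le> M"
    proof (rule maximum_modulus_truncated[where f = g and R = R and U = "{z. Im z > 0}"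
        and V = "{z. Im z \<ge> 0}" and W = "{z. Im z > - 1 / \<eta>}"])
      show "open {z. Im z > 0}" by (intro open_Collect_less continuous_intros)
      have "closed {z. Im z \<ge> 0}" by (intro closed_Collect_le continuous_intros)
      then show "closure {z. Im z > 0} \<subseteq> {z. Im z \<ge> 0}"
        by (intro closure_minimal) auto
      show "open {z. Im z > - 1 / \<eta>}" by (intro open_Collect_less continuous_intros)
      show "{z. Im z \<ge> 0} \<subseteq> {z. Im z > -1 / \<eta>}" using \<open>\<eta> > 0\<close> by (auto simp: field_simps intro: less_le_trans[of _ 0])
      have "d z \<noteq> 0" if "Im z > - 1 / \<eta>" for z
      proof
        assume "d z = 0"
        then have "Re (d z) = 0" by simp
        then have "1 + \<eta> * Im z = 0" by (simp add: d_def)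
        with that \<open>\<eta> > 0\<close> show False by (simp add: field_simps)
      qed
      then show "g holomorphic_on {z. Im z > - 1 / \<eta>}" unfolding g_def d_def
        by (intro holomorphic_intros holomorphic_on_subset[OF hol]) auto
      show "cmod (g z) \<le> M" if "z \<in> {z. Im z \<ge> 0}" "z \<notin> {z. Im z > 0}" for z
      proof -
        have "cmod (f z) \<le> M" using bd[of "Re z"] that by (simp add: complex_is_Real_iff of_real_Re)
        then show ?thesis unfolding g_def norm_divide using d1[of z] that
          by (smt (verit) divide_le_eq_1 frac_le div_by_1 mem_Collect_eq norm_ge_zero)
      qed
      show "cmod (g z) \<le> M" if "z \<in> {z. Im z \<ge> 0}" "cmod z = R" for z
      proof -
        have "(B / M + 1) / \<eta> \<le> R" by (simp add: R_def)
        then have 1: "B / M \<le> \<eta> * R - 1" using \<open>\<eta> > 0\<close> by (simp add: field_simps)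
        have "cmod (\<i> * of_real \<eta> * z) - cmod 1 \<le> cmod (d z)"
          unfolding d_def by (metis norm_minus_commute norm_triangle_ineq2)
        then have "\<eta> * R - 1 \<le> cmod (d z)" using that \<open>\<eta> > 0\<close> by (simp add: norm_mult)
        with 1 have 2: "B / M \<le> cmod (d z)" by simp
        have "cmod (f z) \<le> B" using B that by auto
        also have "\<dots> \<le> M * cmod (d z)" using 2 \<open>M > 0\<close> by (simp add: field_simps)
        finally show ?thesis using d1[of z] that \<open>M > 0\<close> by (simp add: g_def norm_divide divide_le_eq)
      qed
      show "cmod z0 < R" by (simp add: R_def)
    qed (use z0 in auto)
    then have "cmod (f z0) \<le> M * cmod (d z0)" using d1[of z0] z0 \<open>M > 0\<close>
      by (simp add: g_def norm_divide divide_le_eq split: if_splits)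
    also have "cmod (d z0) \<le> 1 + \<eta> * cmod z0"
      unfolding d_def using norm_triangle_ineq4[of 1 "\<i> * of_real \<eta> * z0"] \<open>\<eta> > 0\<close> by (simp add: norm_mult)
    also have "\<dots> \<le> exp (\<eta> * cmod z0)" by (rule exp_ge_add_one_self)
    finally show ?thesis using \<open>M > 0\<close> by simp
  qed
  then show ?thesis by (rule le_of_le_exp_small)
qed

text \<open>The factor \<open>exp (\<i> \<sigma> z)\<close> with \<open>\<sigma> > \<tau>\<close> compensates the growth on the positive imaginary axis, so the
  sector estimate applies in both quadrants of the half-plane and shows that the product is bounded
  there; for a bounded function only the boundary values on the real line count.\<close>

theorem phragmen_lindelof_upper_halfplane:
  assumes hol: "f holomorphic_on UNIV"
    and type: "exponential_type_at_most \<tau> f" and "\<tau> \<ge> 0"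
    and bd: "\<And>x::real. cmod (f (of_real x)) \<le> M"
    and z: "Im z \<ge> 0"
  shows "cmod (f z) \<le> M * exp (\<tau> * Im z)"
proof -
  have pos: "cmod (f z) \<le> m * exp (\<tau> * Im z)" if "m > M" for m
  proof -
    have "M \<ge> 0" using bd[of 0] norm_ge_zero order_trans by blast
    with that have "m > 0" by simp
    have bdm: "cmod (f (of_real x)) \<le> m" for x :: real using bd[of x] that by simp
    have "cmod (f z) \<le> m * exp (\<tau> * Im z) * exp (\<epsilon> * Im z)" if "\<epsilon> > 0" for \<epsilon>
    proof -
      define \<sigma> where "\<sigma> = \<tau> + \<epsilon>"
      have "\<sigma> > 0" using \<open>\<tau> \<ge> 0\<close> \<open>\<epsilon> > 0\<close> by (simp add: \<sigma>_def)
      obtain C where C: "C > 0" "\<And>z. cmod (f z) \<le> C * exp (\<sigma> * cmod z)"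
        using type \<open>\<epsilon> > 0\<close> unfolding exponential_type_at_most_def \<sigma>_def by blast
      define v where "v = (\<lambda>z. f z * exp (\<i> * of_real \<sigma> * z))"
      have nv: "cmod (v z) = cmod (f z) * exp (- \<sigma> * Im z)" for z
        by (simp add: v_def norm_mult)
      have vhol: "v holomorphic_on UNIV" unfolding v_def by (intro holomorphic_intros hol)
      have vgrow: "cmod (v z) \<le> C * exp (2 * \<sigma> * cmod z)" for z
      proof -
        have "- \<sigma> * Im z \<le> \<sigma> * cmod z" using abs_Im_le_cmod[of z] \<open>\<sigma> > 0\<close>
          by (metis abs_le_D2 minus_mult_commute mult_le_cancel_left_pos)
        then have "cmod (v z) \<le> C * exp (\<sigma> * cmod z) * exp (\<sigma> * cmod z)"
          unfolding nv using C by (intro mult_mono) auto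
        then show ?thesis by (simp add: exp_add[symmetric] mult.assoc)
      qed
      define m' where "m' = max m C"
      have m': "m' > 0" "m \<le> m'" "C \<le> m'" using C by (auto simp: m'_def)
      have vreal: "cmod (v z) \<le> m'" if "Im z = 0" for z
        using bdm[of "Re z"] that m' by (simp add: nv complex_is_Real_iff of_real_Re)
      have vim: "cmod (v z) \<le> m'" if "Re z = 0" "Im z \<ge> 0" for z
      proof -
        have "cmod z = Im z" using that by (simp add: cmod_def)
        then have "cmod (v z) \<le> C * exp (\<sigma> * Im z) * exp (- \<sigma> * Im z)"
          unfolding nv using C(2)[of z] by (intro mult_right_mono) auto
        also have "\<dots> = C" by (simp add: exp_minus)
        finally show ?thesis using m' by simp
      qed
      have quadrant: "cmod (v (c * w)) \<le> m'" if w: "\<bar>Im w\<bar> \<le> Re w" and c: "c = 1 + \<i> \<or> c = \<i> - 1" for c w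
      proof (rule phragmen_lindelof_sector[where f = "\<lambda>w. v (c * w)" and C = C and c = "2 * \<sigma> * cmod c"])
        have "(v \<circ> (*) c) holomorphic_on UNIV"
          by (rule holomorphic_on_compose_gen[OF _ vhol]) (auto intro!: holomorphic_intros)
        then show "(\<lambda>w. v (c * w)) holomorphic_on UNIV" by (simp add: o_def)
        show "cmod (v (c * z)) \<le> C * exp (2 * \<sigma> * cmod c * cmod z)" for z
          using vgrow[of "c * z"] by (simp add: norm_mult mult.assoc)
        show "cmod (v (c * z)) \<le> m'" if "\<bar>Im z\<bar> = Re z" for z
        proof -
          have "Re z \<ge> 0" "Im z = Re z \<or> Im z = - Re z" using that by linarith+
          then have "Im (c * z) = 0 \<or> Re (c * z) = 0 \<and> Im (c * z) \<ge> 0"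
            using c by (elim disjE) simp_all
          then show ?thesis using vreal[of "c * z"] vim[of "c * z"] by blast
        qed
      qed (use m' C w \<open>\<sigma> > 0\<close> in auto)
      have vbound: "cmod (v z) \<le> m'" if "Im z \<ge> 0" for z
      proof (cases "Re z \<ge> 0")
        case True
        define w where "w = z / (1 + \<i>)"
        have "w = Complex ((Re z + Im z) / 2) ((Im z - Re z) / 2)"
          by (simp add: w_def complex_eq_iff Re_divide Im_divide power2_eq_square)
        then have "\<bar>Im w\<bar> \<le> Re w" using that True by (simp add: abs_le_iff field_simps)
        moreover have "1 + \<i> \<noteq> 0" by (simp add: complex_eq_iff)
        ultimately show ?thesis using quadrant[of w "1 + \<i>"] by (simp add: w_def)
      next
        case False
        define w where "w = z / (\<i> - 1)"
        have "w = Complex ((Im z - Re z) / 2) (- (Im z + Re z) / 2)"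
          by (simp add: w_def complex_eq_iff Re_divide Im_divide power2_eq_square)
        then have "\<bar>Im w\<bar> \<le> Re w" using that False by (simp add: abs_le_iff field_simps)
        moreover have "\<i> - 1 \<noteq> 0" by (simp add: complex_eq_iff)
        ultimately show ?thesis using quadrant[of w "\<i> - 1"] by (simp add: w_def)
      qed
      have "cmod (v z) \<le> m"
        by (rule bounded_halfplane_le_boundary[OF vhol vbound _ \<open>m > 0\<close> z]) (use bdm in \<open>auto simp: nv\<close>)
      then have "cmod (v z) * exp (\<sigma> * Im z) \<le> m * exp (\<sigma> * Im z)" by simp
      moreover have "cmod (v z) * exp (\<sigma> * Im z) = cmod (f z)" by (simp add: nv exp_minus)
      ultimately have "cmod (f z) \<le> m * exp (\<sigma> * Im z)" by metis
      then show ?thesis unfolding \<sigma>_def ring_distribs exp_add mult.assoc .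
    qed
    then show ?thesis by (rule le_of_le_exp_small)
  qed
  have "cmod (f z) / exp (\<tau> * Im z) \<le> M"
  proof (rule dense_ge)
    fix m assume "M < m"
    from pos[OF this] show "cmod (f z) / exp (\<tau> * Im z) \<le> m" by (simp add: divide_le_eq)
  qed
  then show ?thesis by (simp add: divide_le_eq)
qed

section \<open>Radially decreasing functions of exponential type\<close>

lemma F1_D:
  assumes "f \<in> F1"
  shows F1_holomorphic: "f holomorphic_on UNIV"
    and F1_type: "exponential_type_at_most (2 * pi) f"
    and F1_real: "f (of_real x) = of_real (Re (f (of_real x)))"
    and F1_nonneg: "0 \<le> Re (f (of_real x))"
    and F1_cmod: "cmod (f (of_real x)) = Re (f (of_real x))"
    and F1_integrable: "integrable lborel (\<lambda>x::real. Re (f (of_real x)))"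
    and F1_norm_L1: "norm_L1 f = (LBINT x. Re (f (of_real x)))"
proof -
  have h: "real_entire f" "integrable lborel (\<lambda>x::real. f (of_real x))"
    "\<And>x::real. 0 \<le> Re (f (of_real x))" "exponential_type_at_most (2 * pi) f"
    using assms by (auto simp: F1_def)
  then show "f holomorphic_on UNIV" "0 \<le> Re (f (of_real x))" "exponential_type_at_most (2 * pi) f"
    by (auto simp: real_entire_def)
  show r: "f (of_real x) = of_real (Re (f (of_real x)))" for x :: real
    using h(1) by (simp add: real_entire_def of_real_Re)
  show c: "cmod (f (of_real x)) = Re (f (of_real x))" for x :: real
    using h(3)[of x] by (subst r) simp
  show "integrable lborel (\<lambda>x::real. Re (f (of_real x)))" using h(2) by simp
  show "norm_L1 f = (LBINT x. Re (f (of_real x)))" by (simp add: norm_L1_def c)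
qed

lemma F1_I:
  assumes "f holomorphic_on UNIV" "exponential_type_at_most (2 * pi) f"
    "\<And>x::real. f (of_real x) \<in> \<real>" "\<And>x::real. 0 \<le> Re (f (of_real x))"
    "integrable lborel (\<lambda>x::real. Re (f (of_real x)))"
    "\<And>x y::real. 0 < x \<Longrightarrow> x \<le> y \<Longrightarrow> Re (f (of_real y)) \<le> Re (f (of_real x))"
    "\<And>x y::real. 0 < x \<Longrightarrow> x \<le> y \<Longrightarrow> Re (f (of_real (-y))) \<le> Re (f (of_real (-x)))"
  shows "f \<in> F1"
proof -
  have eq: "f (of_real x) = of_real (Re (f (of_real x)))" for x :: real
    using assms(3) by (simp add: of_real_Re)
  have "integrable lborel (\<lambda>x::real. complex_of_real (Re (f (of_real x))))"
    using assms(5) by simp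
  then have "integrable lborel (\<lambda>x::real. f (of_real x))" by (simp add: eq[symmetric])
  moreover have "Re (f (of_real x)) \<le> Re (f (of_real y))" if "x < 0" "y < 0" "x \<le> y" for x y :: real
    using assms(7)[of "-y" "-x"] that by simp
  ultimately show ?thesis
    unfolding F1_def real_entire_def radially_decreasing_def monotone_on_def using assms by auto
qed

lemma F1_continuous:
  assumes "f \<in> F1" shows "isCont (\<lambda>x::real. Re (f (of_real x))) x"
proof -
  have "isCont f (of_real x)"
    using holomorphic_on_imp_continuous_on[OF F1_holomorphic[OF assms]]
    by (simp add: continuous_on_eq_continuous_at)
  then have "isCont (\<lambda>x::real. f (of_real x)) x"
    using isCont_o2[where g = f and f = of_real and a = x] isCont_of_real[OF continuous_ident] by auto
  then show ?thesis by (rule continuous_Re)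
qed

lemma F1_antimono:
  assumes "f \<in> F1" "0 \<le> x" "x \<le> y"
  shows "Re (f (of_real y)) \<le> Re (f (of_real x))"
proof (cases "x > 0")
  case True
  then show ?thesis
    using assms by (auto simp: F1_def radially_decreasing_def monotone_on_def)
next
  case False
  with assms have [simp]: "x = 0" by simp
  show ?thesis
  proof (cases "y = 0")
    case False
    with assms have "y > 0" by simp
    have "((\<lambda>t. Re (f (of_real t))) \<longlongrightarrow> Re (f (of_real 0))) (at_right 0)"
      using F1_continuous[OF assms(1), of 0] unfolding isCont_def
      by (rule filterlim_at_split[THEN iffD1, THEN conjunct2])
    moreover have "eventually (\<lambda>t. Re (f (of_real y)) \<le> Re (f (of_real t))) (at_right 0)"
      using assms(1) \<open>y > 0\<close> unfolding eventually_at_right_field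
      by (intro exI[of _ y]) (auto simp: F1_def radially_decreasing_def monotone_on_def)
    ultimately show ?thesis
      using tendsto_lowerbound[of _ _ "at_right (0::real)"] by simp
  qed simp
qed

lemma exponential_type_minus:
  "exponential_type_at_most \<tau> f \<Longrightarrow> exponential_type_at_most \<tau> (\<lambda>z. f (- z))"
  unfolding exponential_type_at_most_def by (metis norm_minus_cancel)

lemma holomorphic_on_UNIV_minus:
  assumes "f holomorphic_on UNIV" shows "(\<lambda>z. f (- z)) holomorphic_on UNIV"
proof -
  have "(f \<circ> uminus) holomorphic_on UNIV"
    by (rule holomorphic_on_compose_gen[OF _ assms]) (auto intro!: holomorphic_intros)
  then show ?thesis by (simp add: o_def)
qed

lemma integrable_lborel_minus:
  fixes g :: "real \<Rightarrow> real"
  shows "integrable lborel (\<lambda>x. g (- x)) \<longleftrightarrow> integrable lborel g"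
    and "(LBINT x. g (- x)) = (LBINT x. g x)"
  using lborel_integrable_real_affine_iff[of "-1" g 0] lborel_integral_real_affine[of "-1" g 0] by simp_all

lemma F1_reflect:
  assumes "f \<in> F1" shows "(\<lambda>z. f (- z)) \<in> F1"
proof (rule F1_I)
  have mono: "Re (f (of_real x)) \<le> Re (f (of_real y))" if "x < 0" "y < 0" "x \<le> y" for x y :: real
    using assms that unfolding F1_def radially_decreasing_def monotone_on_def by auto
  show "(\<lambda>z. f (- z)) holomorphic_on UNIV"
    using F1_holomorphic[OF assms] by (rule holomorphic_on_UNIV_minus)
  show "exponential_type_at_most (2 * pi) (\<lambda>z. f (- z))"
    using F1_type[OF assms] by (rule exponential_type_minus)
  show "f (- of_real x) \<in> \<real>" for x :: real
    using F1_real[OF assms, of "-x"] by (metis Reals_of_real of_real_minus)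
  show "0 \<le> Re (f (- of_real x))" for x :: real
    using F1_nonneg[OF assms, of "-x"] by simp
  show "integrable lborel (\<lambda>x::real. Re (f (- of_real x)))"
    using F1_integrable[OF assms] integrable_lborel_minus(1)[of "\<lambda>x. Re (f (of_real x))"] by simp
  show "Re (f (- of_real y)) \<le> Re (f (- of_real x))" if "0 < x" "x \<le> y" for x y :: real
    using mono[of "-y" "-x"] that by simp
  show "Re (f (- of_real (- y))) \<le> Re (f (- of_real (- x)))" if "0 < x" "x \<le> y" for x y :: real
    using F1_antimono[OF assms, of x y] that by simp
qed

lemma F1_le_center:
  assumes "f \<in> F1" shows "Re (f (of_real x)) \<le> Re (f 0)"
proof (cases "x \<ge> 0")
  case True
  then show ?thesis using F1_antimono[OF assms, of 0 x] by simp
next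
  case False
  then show ?thesis using F1_antimono[OF F1_reflect[OF assms], of 0 "-x"] by simp
qed

lemma F1_center_pos:
  assumes "f \<in> F1" "f 0 \<noteq> 0" shows "Re (f 0) > 0" "f 0 = of_real (Re (f 0))"
proof -
  show 1: "f 0 = of_real (Re (f 0))" using F1_real[OF assms(1), of 0] by (metis of_real_0)
  have "Re (f 0) \<noteq> 0" using 1 assms(2) by (metis of_real_0)
  then show "Re (f 0) > 0" using F1_nonneg[OF assms(1), of 0] by simp
qed

lemma F1_bound:
  assumes "f \<in> F1" shows "cmod (f z) \<le> Re (f 0) * exp (2 * pi * \<bar>Im z\<bar>)"
proof -
  have *: "cmod (g w) \<le> Re (g 0) * exp (2 * pi * Im w)" if "g \<in> F1" "Im w \<ge> 0" for g w
    using that F1_le_center[OF that(1)]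
    by (intro phragmen_lindelof_upper_halfplane F1_holomorphic F1_type) (auto simp: F1_cmod)
  show ?thesis
  proof (cases "Im z \<ge> 0")
    case True
    then show ?thesis using *[OF assms, of z] by simp
  next
    case False
    then show ?thesis using *[OF F1_reflect[OF assms], of "-z"] by simp
  qed
qed

lemma exponential_type_of_strip_bound:
  assumes "\<And>z. cmod (f z) \<le> C * exp (\<tau> * \<bar>Im z\<bar>)" "\<tau> \<ge> 0"
  shows "exponential_type_at_most \<tau> f"
  unfolding exponential_type_at_most_def
proof (intro allI impI)
  fix \<epsilon> :: real assume "\<epsilon> > 0"
  show "\<exists>C>0. \<forall>z. cmod (f z) \<le> C * exp ((\<tau> + \<epsilon>) * cmod z)"
  proof (intro exI[of _ "max C 1"] conjI allI)
    fix z
    have "\<tau> * \<bar>Im z\<bar> \<le> (\<tau> + \<epsilon>) * cmod z"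
      using abs_Im_le_cmod[of z] \<open>\<epsilon> > 0\<close> assms(2) by (intro mult_mono) auto
    then have "C * exp (\<tau> * \<bar>Im z\<bar>) \<le> max C 1 * exp ((\<tau> + \<epsilon>) * cmod z)"
      by (intro mult_mono) auto
    then show "cmod (f z) \<le> max C 1 * exp ((\<tau> + \<epsilon>) * cmod z)"
      using assms(1)[of z] by simp
  qed auto
qed

text \<open>Averaging with the reflection and rescaling changes neither the quotient nor membership,
  so only even functions with value one at the origin matter.\<close>

lemma F1_symmetrize:
  assumes "f \<in> F1" "f 0 \<noteq> 0"
  defines "h \<equiv> (\<lambda>z. (f z + f (- z)) / of_real (2 * Re (f 0)))"
  shows "h \<in> F1" "even_fun h" "h 0 = 1" "norm_L1 h = norm_L1 f / Re (f 0)"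
proof -
  define c where "c = Re (f 0)"
  have c: "c > 0" "f 0 = of_real c" using F1_center_pos[OF assms(1,2)] by (auto simp: c_def)
  note r = F1_reflect[OF assms(1)]
  have Reh: "Re (h (of_real x)) = (Re (f (of_real x)) + Re (f (- of_real x))) / (2 * c)" for x :: real
    by (simp add: h_def c_def[symmetric] del: of_real_mult)
  have int: "integrable lborel (\<lambda>x. Re (f (of_real x)))" "integrable lborel (\<lambda>x. Re (f (- of_real x)))"
    using F1_integrable[OF assms(1)] F1_integrable[OF r] by simp_all
  show mem: "h \<in> F1"
  proof (rule F1_I)
    have "of_real (2 * Re (f 0)) \<noteq> (0 :: complex)" using c(1) unfolding c_def of_real_eq_0_iff by linarith
    then show "h holomorphic_on UNIV" unfolding h_def
      by (intro holomorphic_on_divide holomorphic_on_add holomorphic_on_const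
        F1_holomorphic[OF assms(1)] F1_holomorphic[OF r])
    have "cmod (h z) \<le> 1 * exp (2 * pi * \<bar>Im z\<bar>)" for z
    proof -
      have "cmod (f z + f (- z)) \<le> 2 * c * exp (2 * pi * \<bar>Im z\<bar>)"
        using norm_triangle_ineq[of "f z" "f (- z)"] F1_bound[OF assms(1), of z] F1_bound[OF r, of z]
        by (simp add: c_def)
      then show ?thesis using c by (simp add: h_def norm_divide c_def[symmetric] field_simps)
    qed
    then show "exponential_type_at_most (2 * pi) h" by (rule exponential_type_of_strip_bound) auto
    show "h (of_real x) \<in> \<real>" for x :: real
      unfolding h_def using F1_real[OF assms(1), of x] F1_real[OF r, of x]
      by (metis Reals_add Reals_divide Reals_of_real)
    show "0 \<le> Re (h (of_real x))" for x :: real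
      unfolding Reh using F1_nonneg[OF assms(1), of x] F1_nonneg[OF r, of x] c by simp
    show "integrable lborel (\<lambda>x::real. Re (h (of_real x)))"
      unfolding Reh using int by simp
    show "Re (h (of_real y)) \<le> Re (h (of_real x))" if "0 < x" "x \<le> y" for x y :: real
      unfolding Reh using F1_antimono[OF assms(1), of x y] F1_antimono[OF r, of x y] that c
      by (intro divide_right_mono) auto
    show "Re (h (of_real (- y))) \<le> Re (h (of_real (- x)))" if "0 < x" "x \<le> y" for x y :: real
      unfolding Reh using F1_antimono[OF assms(1), of x y] F1_antimono[OF r, of x y] that c
      by (intro divide_right_mono) auto
  qed
  show "even_fun h" by (simp add: even_fun_def h_def add.commute)
  show "h 0 = 1" using c by (simp add: h_def)
  have "norm_L1 h = (LBINT x. (Re (f (of_real x)) + Re (f (- of_real x))) / (2 * c))"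
    by (simp add: F1_norm_L1[OF mem] Reh)
  also have "\<dots> = ((LBINT x. Re (f (of_real x))) + (LBINT x. Re (f (- of_real x)))) / (2 * c)"
    using int by simp
  also have "(LBINT x. Re (f (- of_real x))) = (LBINT x. Re (f (of_real x)))"
    using integrable_lborel_minus(2)[of "\<lambda>x. Re (f (of_real x))"] by simp
  finally show "norm_L1 h = norm_L1 f / Re (f 0)"
    using F1_norm_L1[OF assms(1)] by (simp add: c_def)
qed

lemma norm_L1_nonneg: "norm_L1 f \<ge> 0"
  by (simp add: norm_L1_def)

lemma A1_le:
  assumes "f \<in> F1" "f 0 \<noteq> 0" shows "A1 \<le> norm_L1 f / Re (f 0)"
  unfolding A1_def
proof (rule cINF_lower)
  show "bdd_below ((\<lambda>f. norm_L1 f / Re (f 0)) ` {f \<in> F1. f 0 \<noteq> 0})"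
    by (intro bdd_belowI[of _ 0]) (auto simp: norm_L1_nonneg dest: F1_center_pos(1))
qed (use assms in auto)

section \<open>Existence of an even extremizer\<close>

text \<open>A normalized minimizing sequence is bounded by \<open>exp (2 \<pi> \<bar>Im z\<bar>)\<close>, hence normal; the limit
  inherits all pointwise conditions, and Fatou's lemma bounds its integral.\<close>

lemma even_extremizer_exists:
  assumes "f0 \<in> F1" "f0 0 \<noteq> 0"
  shows "\<exists>F\<in>F1. even_fun F \<and> F 0 = 1 \<and> norm_L1 F = A1"
proof -
  define N where "N = {h \<in> F1. even_fun h \<and> h 0 = 1}"
  have "\<exists>h\<in>N. norm_L1 h < A1 + 1 / Suc n" for n
  proof -
    have "A1 < A1 + 1 / Suc n" by simp
    then obtain f where f: "f \<in> F1" "f 0 \<noteq> 0" "norm_L1 f / Re (f 0) < A1 + 1 / Suc n"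
      unfolding A1_def using cInf_lessD[of "(\<lambda>f. norm_L1 f / Re (f 0)) ` {f \<in> F1. f 0 \<noteq> 0}"] assms
      by (smt (verit, best) empty_iff imageE image_eqI mem_Collect_eq)
    have "\<exists>h. h \<in> F1 \<and> even_fun h \<and> h 0 = 1 \<and> norm_L1 h = norm_L1 f / Re (f 0)"
      by (intro exI conjI) (rule F1_symmetrize[OF f(1,2)])+
    then show ?thesis using f(3) unfolding N_def by auto
  qed
  then obtain h where h: "\<And>n. h n \<in> N" "\<And>n. norm_L1 (h n) < A1 + 1 / Suc n" by metis
  have hF: "h n \<in> F1" "even_fun (h n)" "h n 0 = 1" for n using h(1)[of n] by (auto simp: N_def)
  obtain F r where F: "F holomorphic_on UNIV" "strict_mono (r :: nat \<Rightarrow> nat)"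
    and lim: "\<And>z. (\<lambda>n. h (r n) z) \<longlonglongrightarrow> F z"
  proof (rule Montel[of UNIV N h])
    show "\<exists>B. \<forall>g\<in>N. \<forall>z\<in>K. cmod (g z) \<le> B" if "compact K" "K \<subseteq> UNIV" for K
    proof -
      obtain b where b: "\<And>z. z \<in> K \<Longrightarrow> cmod z \<le> b"
        using compact_imp_bounded[OF \<open>compact K\<close>] by (auto simp: bounded_iff)
      have "cmod (g z) \<le> exp (2 * pi * b)" if "g \<in> N" "z \<in> K" for g z
        using F1_bound[of g z] b[OF \<open>z \<in> K\<close>] abs_Im_le_cmod[of z] \<open>g \<in> N\<close>
        by (auto simp: N_def elim!: order_trans)
      then show ?thesis by blast
    qed
  qed (use h(1) in \<open>auto simp: N_def F1_holomorphic\<close>)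
  have limR: "(\<lambda>n. Re (h (r n) (of_real x))) \<longlonglongrightarrow> Re (F (of_real x))" for x :: real
    by (intro tendsto_intros lim)
  have Fb: "cmod (F z) \<le> 1 * exp (2 * pi * \<bar>Im z\<bar>)" for z
  proof (rule tendsto_upperbound[OF tendsto_norm[OF lim[of z]]])
    show "\<forall>\<^sub>F n in sequentially. cmod (h (r n) z) \<le> 1 * exp (2 * pi * \<bar>Im z\<bar>)"
      using F1_bound[OF hF(1)] hF(3) by (auto intro!: always_eventually)
  qed simp
  have nonneg: "0 \<le> Re (F (of_real x))" for x :: real
    by (rule tendsto_lowerbound[OF limR]) (use F1_nonneg[OF hF(1)] in \<open>auto intro!: always_eventually\<close>)
  have meas: "(\<lambda>x::real. Re (g (of_real x))) \<in> borel_measurable borel" if "g holomorphic_on UNIV" for g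
    using that by (intro borel_measurable_continuous_onI continuous_intros
      continuous_on_compose2[OF holomorphic_on_imp_continuous_on[OF that]]) auto
  have "(\<integral>\<^sup>+x. ennreal (Re (F (of_real x))) \<partial>lborel) \<le> liminf (\<lambda>n. \<integral>\<^sup>+x. ennreal (Re (h (r n) (of_real x))) \<partial>lborel)"
  proof -
    have "ennreal (Re (F (of_real x))) = liminf (\<lambda>n. ennreal (Re (h (r n) (of_real x))))" for x :: real
      using lim_imp_Liminf[OF sequentially_bot tendsto_ennrealI[OF limR[of x]]] by (rule sym)
    then show ?thesis
      using meas[OF F1_holomorphic[OF hF(1)]]
      by (simp add: nn_integral_liminf)
  qed
  also have "\<dots> = liminf (\<lambda>n. ennreal (norm_L1 (h (r n))))"
    using F1_integrable[OF hF(1)] F1_nonneg[OF hF(1)] F1_norm_L1[OF hF(1)]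
    by (simp add: nn_integral_eq_integral)
  also have "\<dots> \<le> liminf (\<lambda>n. ennreal (A1 + 1 / Suc (r n)))"
    using h(2) by (intro Liminf_mono always_eventually allI ennreal_leI) (auto simp: less_imp_le)
  also have "\<dots> = ennreal A1"
  proof (rule lim_imp_Liminf)
    have "(\<lambda>n. 1 / real (Suc (r n))) \<longlonglongrightarrow> 0"
      using LIMSEQ_subseq_LIMSEQ[OF LIMSEQ_inverse_real_of_nat F(2)] by (simp add: o_def inverse_eq_divide)
    from tendsto_add[OF tendsto_const[of A1] this] have "(\<lambda>n. A1 + 1 / real (Suc (r n))) \<longlonglongrightarrow> A1" by simp
    then show "(\<lambda>n. ennreal (A1 + 1 / real (Suc (r n)))) \<longlonglongrightarrow> ennreal A1" by (rule tendsto_ennrealI)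
  qed simp
  finally have fatou: "(\<integral>\<^sup>+x. ennreal (Re (F (of_real x))) \<partial>lborel) \<le> ennreal A1" .
  have int: "integrable lborel (\<lambda>x::real. Re (F (of_real x)))"
    using fatou nonneg meas[OF F(1)] by (intro integrableI_nonneg) (auto simp: le_less_trans[OF _ ennreal_less_top])
  have even: "even_fun F" unfolding even_fun_def
  proof
    fix z
    have "(\<lambda>n. h (r n) (- z)) \<longlonglongrightarrow> F z" using lim[of z] hF(2) by (simp add: even_fun_def)
    with lim[of "-z"] show "F (- z) = F z" by (rule LIMSEQ_unique)
  qed
  have F0: "F 0 = 1" using lim[of 0] hF(3) by (simp add: LIMSEQ_const_iff)
  have dec: "Re (F (of_real y)) \<le> Re (F (of_real x))" if "0 < x" "x \<le> y" for x y :: real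
    by (rule tendsto_le[OF _ limR limR]) (use that F1_antimono[OF hF(1)] in \<open>auto intro!: always_eventually\<close>)
  have mem: "F \<in> F1"
  proof (rule F1_I)
    show "exponential_type_at_most (2 * pi) F" using Fb by (rule exponential_type_of_strip_bound) auto
    show "F (of_real x) \<in> \<real>" for x :: real
    proof (rule closed_sequentially[OF closed_complex_Reals _ lim])
      show "h (r n) (of_real x) \<in> \<real>" for n using F1_real[OF hF(1)[of "r n"], of x] by (metis Reals_of_real)
    qed
    show "Re (F (of_real (- y))) \<le> Re (F (of_real (- x)))" if "0 < x" "x \<le> y" for x y :: real
      using dec[OF that] even by (simp add: even_fun_def)
  qed (use F nonneg int dec in auto)
  have A1_nn: "A1 \<ge> 0"
    unfolding A1_def using assms F1_center_pos(1)
    by (intro cINF_greatest) (auto simp: norm_L1_nonneg less_imp_le)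
  have "norm_L1 F \<le> A1"
    using fatou int nonneg A1_nn by (simp add: F1_norm_L1[OF mem] nn_integral_eq_integral)
  moreover have "A1 \<le> norm_L1 F" using A1_le[OF mem] F0 by simp
  ultimately show ?thesis using mem even F0 by force
qed

section \<open>Zeros of even extremizers\<close>

lemma entire_divide_zero:
  assumes "F holomorphic_on UNIV" "F a = 0"
  obtains G where "G holomorphic_on UNIV" "\<And>z. F z = (z - a) * G z"
proof
  show "(\<lambda>z. if z = a then deriv F a else (F z - F a) / (z - a)) holomorphic_on UNIV"
    using pole_theorem_open_0[of F UNIV a] pole_lemma[of F UNIV a] assms by simp
qed (use assms in simp)

lemma entire_divide_zeros:
  assumes "finite Z" "F holomorphic_on UNIV" "\<And>a. a \<in> Z \<Longrightarrow> F a = 0"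
  obtains G where "G holomorphic_on UNIV" "\<And>z. F z = (\<Prod>a\<in>Z. z - a) * G z"
proof -
  have "\<exists>G. G holomorphic_on UNIV \<and> (\<forall>z. F z = (\<Prod>a\<in>Z. z - a) * G z)"
    using assms(1,3)
  proof (induction Z)
    case empty
    then show ?case using assms(2) by auto
  next
    case (insert b Z)
    then obtain G where G: "G holomorphic_on UNIV" "\<And>z. F z = (\<Prod>a\<in>Z. z - a) * G z" by auto
    have "(\<Prod>a\<in>Z. b - a) \<noteq> 0" using insert by auto
    then have "G b = 0" using G(2)[of b] insert.prems[of b] by auto
    then obtain H where H: "H holomorphic_on UNIV" "\<And>z. G z = (z - b) * H z"
      using entire_divide_zero[OF G(1)] by blast
    show ?case using insert H G(2) by (intro exI[of _ H]) (auto simp: mult_ac)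
  qed
  with that show thesis by blast
qed

lemma real_entire_cnj:
  assumes hol: "F holomorphic_on UNIV" and r: "\<And>x::real. F (of_real x) \<in> \<real>"
  shows "F (cnj z) = cnj (F z)"
proof -
  have h: "(\<lambda>z. cnj (F (cnj z))) holomorphic_on UNIV"
    using holomorphic_on_compose_cnj_cnj[of F UNIV] hol
    by (simp add: o_def surjI[of cnj cnj])
  have "(\<lambda>w. cnj (F (cnj w)) - F w) z = 0"
  proof (rule analytic_continuation[where f = "\<lambda>w. cnj (F (cnj w)) - F w" and U = "\<real>" and S = UNIV and \<xi> = 0])
    show "(\<lambda>w. cnj (F (cnj w)) - F w) holomorphic_on UNIV" using h hol by (intro holomorphic_intros)
    show "(0::complex) islimpt \<real>"
    proof (subst islimpt_approachable, intro allI impI)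
      fix e :: real assume "e > 0"
      then show "\<exists>x'\<in>\<real>. x' \<noteq> 0 \<and> dist x' (0::complex) < e"
        by (intro bexI[of _ "of_real (e / 2)"]) auto
    qed
    show "cnj (F (cnj w)) - F w = 0" if "w \<in> \<real>" for w
      using that r by (auto elim!: Reals_cases simp: Reals_cnj_iff[symmetric])
  qed auto
  then show ?thesis by (metis complex_cnj_cnj eq_iff_diff_eq_0)
qed

text \<open>A radially decreasing function that vanishes at one real point vanishes on a half-line, hence
  everywhere.\<close>

lemma F1_even_pos:
  assumes F: "F \<in> F1" "even_fun F" "F 0 \<noteq> 0"
  shows "Re (F (of_real x)) > 0"
proof (rule ccontr)
  assume "\<not> ?thesis"
  then have z: "Re (F (of_real x)) = 0" using F1_nonneg[OF F(1), of x] by simp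
  define a where "a = \<bar>x\<bar>"
  have za: "Re (F (of_real a)) = 0"
    using z F(2) by (auto simp: a_def even_fun_def abs_if)
  have zero: "F (of_real y) = 0" if "y \<ge> a" for y
  proof -
    have "Re (F (of_real y)) \<le> 0" using F1_antimono[OF F(1), of a y] that za by (simp add: a_def)
    then have "Re (F (of_real y)) = 0" using F1_nonneg[OF F(1), of y] by simp
    then show ?thesis by (subst F1_real[OF F(1)]) simp
  qed
  have "F 0 = 0"
  proof (rule analytic_continuation[where f = F and U = "of_real ` {a..}" and S = UNIV and \<xi> = "of_real a"])
    show "complex_of_real a islimpt complex_of_real ` {a..}"
    proof (subst islimpt_approachable, intro allI impI)
      fix e :: real assume "e > 0"
      then show "\<exists>x'\<in>complex_of_real ` {a..}. x' \<noteq> complex_of_real a \<and> dist x' (complex_of_real a) < e"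
        by (intro bexI[of _ "of_real (a + e / 2)"] imageI) (simp_all add: dist_norm)
    qed
  qed (use F1_holomorphic[OF F(1)] zero in auto)
  with F(3) show False by simp
qed

lemma lborel_integral_pos:
  fixes f :: "real \<Rightarrow> real"
  assumes "integrable lborel f" "AE x in lborel. 0 < f x"
  shows "0 < (LBINT x. f x)"
proof (rule ccontr)
  have nn: "AE x in lborel. 0 \<le> f x" using assms(2) by eventually_elim simp
  assume "\<not> ?thesis"
  then have "(LBINT x. f x) = 0" using integral_nonneg_AE[OF nn] by simp
  then have "AE x in lborel. f x = 0" using integral_nonneg_eq_0_iff_AE[OF assms(1) nn] by simp
  with assms(2) have "AE x::real in lborel. False" by (rule eventually_elim2) simp
  then obtain N :: "real set" where "N \<in> null_sets lborel" "UNIV \<subseteq> N"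
    by (auto simp: eventually_ae_filter)
  then have "emeasure lborel (UNIV :: real set) = 0" using emeasure_mono[of UNIV N lborel] by (auto simp: null_sets_def)
  then show False by simp
qed

text \<open>If \<open>F = Q G\<close> with a factor \<open>Q\<close> that is positive and increasing in \<open>\<bar>x\<bar>\<close>, then \<open>G\<close> is again
  radially decreasing, and \<open>G / G 0 = (F / F 0) (Q 0 / Q)\<close> lies strictly below \<open>F / F 0\<close> off the origin:
  \<open>F\<close> cannot have been extremal.\<close>

lemma extremizer_no_increasing_factor:
  assumes ext: "even_extremizer F"
    and G: "G holomorphic_on UNIV" "\<And>z. F z = Q z * G z"
    and Q: "\<And>x::real. Q (of_real x) = of_real (q x)" "\<And>x. q (- x) = q x" "q 0 > 0"
      "\<And>x y. 0 \<le> x \<Longrightarrow> x < y \<Longrightarrow> q x < q y"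
    and far: "\<And>z. R \<le> cmod z \<Longrightarrow> 1 \<le> cmod (Q z)"
  shows False
proof -
  from ext have F: "F \<in> F1" "even_fun F" "F 0 \<noteq> 0" "norm_L1 F / Re (F 0) = A1"
    by (auto simp: even_extremizer_def)
  have q_abs: "q \<bar>x\<bar> = q x" for x using Q(2)[of x] by (auto simp: abs_if)
  have q_ge: "q 0 < q x" if "x \<noteq> 0" for x using Q(4)[of 0 "\<bar>x\<bar>"] that by (simp add: q_abs)
  have q_pos: "q x > 0" for x using q_ge[of x] Q(3) by (cases "x = 0") auto
  have G_eq: "G (of_real x) = of_real (Re (F (of_real x)) / q x)" for x :: real
  proof -
    have "of_real (Re (F (of_real x))) = of_real (q x) * G (of_real x)"
      using G(2)[of "of_real x"] Q(1)[of x] F1_real[OF F(1), of x] by metis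
    then show ?thesis using q_pos[of x] by (simp add: field_simps)
  qed
  have ReG: "Re (G (of_real x)) = Re (F (of_real x)) / q x" for x :: real by (simp add: G_eq)
  have F_even: "Re (F (of_real (- x))) = Re (F (of_real x))" for x :: real
    using F(2) by (simp add: even_fun_def)
  note Fpos = F1_even_pos[OF F(1-3)]
  have intF: "integrable lborel (\<lambda>x::real. Re (F (of_real x)))" by (rule F1_integrable[OF F(1)])
  have contG: "continuous_on UNIV (\<lambda>x::real. Re (G (of_real x)))"
    by (intro continuous_intros continuous_on_compose2[OF holomorphic_on_imp_continuous_on[OF G(1)]]) auto
  have intG: "integrable lborel (\<lambda>x::real. Re (G (of_real x)))"
  proof (rule Bochner_Integration.integrable_bound)
    show "integrable lborel (\<lambda>x::real. Re (F (of_real x)) / q 0)" using intF by simp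
    show "(\<lambda>x::real. Re (G (of_real x))) \<in> borel_measurable lborel"
      using borel_measurable_continuous_onI[OF contG] by simp
    show "AE x in lborel. norm (Re (G (of_real x))) \<le> norm (Re (F (of_real x)) / q 0)"
    proof (intro AE_I2)
      fix x
      show "norm (Re (G (of_real x))) \<le> norm (Re (F (of_real x)) / q 0)"
        using Fpos[of x] q_pos[of x] q_ge[of x] Q(3) unfolding ReG
        by (cases "x = 0") (auto intro!: divide_left_mono simp: less_imp_le)
    qed
  qed
  have dec: "Re (G (of_real y)) \<le> Re (G (of_real x))" if "0 < x" "x \<le> y" for x y :: real
  proof -
    have "q x \<le> q y" using Q(4)[of x y] that by (cases "x = y") auto
    then show ?thesis unfolding ReG
      using F1_antimono[OF F(1), of x y] that Fpos[of x] q_pos[of x] Fpos[of y]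
      by (intro frac_le) (auto simp: less_imp_le)
  qed
  have mem: "G \<in> F1"
  proof (rule F1_I[OF G(1)])
    show "exponential_type_at_most (2 * pi) G" unfolding exponential_type_at_most_def
    proof (intro allI impI)
      fix \<epsilon> :: real assume "\<epsilon> > 0"
      then obtain C where C: "C > 0" "\<And>z. cmod (F z) \<le> C * exp ((2 * pi + \<epsilon>) * cmod z)"
        using F1_type[OF F(1)] unfolding exponential_type_at_most_def by blast
      have "bounded (G ` cball 0 R)"
        by (intro compact_imp_bounded compact_continuous_image
          continuous_on_subset[OF holomorphic_on_imp_continuous_on[OF G(1)]]) auto
      then obtain B where B: "\<And>z. cmod z \<le> R \<Longrightarrow> cmod (G z) \<le> B"
        unfolding bounded_iff by (metis imageI mem_cball_0)
      show "\<exists>C>0. \<forall>z. cmod (G z) \<le> C * exp ((2 * pi + \<epsilon>) * cmod z)"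
      proof (intro exI[of _ "max B C"] conjI allI)
        fix z
        show "cmod (G z) \<le> max B C * exp ((2 * pi + \<epsilon>) * cmod z)"
        proof (cases "cmod z \<le> R")
          case True
          have "max B C * 1 \<le> max B C * exp ((2 * pi + \<epsilon>) * cmod z)"
            using \<open>\<epsilon> > 0\<close> C(1) by (intro mult_left_mono) auto
          then show ?thesis using B[OF True] by simp
        next
          case False
          then have "1 * cmod (G z) \<le> cmod (Q z) * cmod (G z)" using far[of z]
            by (intro mult_right_mono) auto
          also have "\<dots> = cmod (F z)" by (simp add: G(2) norm_mult)
          also have "\<dots> \<le> C * exp ((2 * pi + \<epsilon>) * cmod z)" by (rule C)
          also have "\<dots> \<le> max B C * exp ((2 * pi + \<epsilon>) * cmod z)" by (intro mult_right_mono) auto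
          finally show ?thesis by simp
        qed
      qed (use C in auto)
    qed
    show "G (of_real x) \<in> \<real>" for x :: real unfolding G_eq by (rule Reals_of_real)
    show "0 \<le> Re (G (of_real x))" for x :: real
      unfolding ReG using Fpos[of x] q_pos[of x] by simp
    show "Re (G (of_real (- y))) \<le> Re (G (of_real (- x)))" if "0 < x" "x \<le> y" for x y :: real
      using dec[OF that] unfolding ReG F_even Q(2) .
  qed (use intG dec in auto)
  have G0: "Re (G 0) = Re (F 0) / q 0" using ReG[of 0] by simp
  have F0: "Re (F 0) > 0" using Fpos[of 0] by simp
  have less: "(LBINT x. Re (F (of_real x)) - Re (G (of_real x)) * q 0) > 0"
  proof (rule lborel_integral_pos)
    have "AE x in lborel. x \<noteq> (0::real)" by (rule AE_lborel_singleton)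
    then show "AE x in lborel. 0 < Re (F (complex_of_real x)) - Re (G (complex_of_real x)) * q 0"
    proof eventually_elim
      case (elim x)
      have "Re (F (of_real x)) * q 0 < Re (F (of_real x)) * q x"
        using Fpos[of x] q_ge[OF elim] by simp
      then show ?case unfolding ReG using q_pos[of x] by (simp add: field_simps)
    qed
  qed (use intG intF in auto)
  have "norm_L1 G / Re (G 0) = (LBINT x. Re (G (of_real x)) * q 0) / Re (F 0)"
    unfolding G0 F1_norm_L1[OF mem] by simp
  also have "\<dots> < norm_L1 F / Re (F 0)"
    unfolding F1_norm_L1[OF F(1)] using less F0 intF intG by (intro divide_strict_right_mono) auto
  finally have "norm_L1 G / Re (G 0) < A1" using F(4) by simp
  moreover have "G 0 \<noteq> 0" using G0 F0 Q(3) by auto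
  ultimately show False using A1_le[OF mem] by simp
qed

text \<open>By evenness and reality the zeros come in quadruples \<open>\<plusminus>a \<plusminus> \<i> b\<close>, with monic polynomial
  \<open>x\<^sup>4 + 2 (b\<^sup>2 - a\<^sup>2) x\<^sup>2 + (a\<^sup>2 + b\<^sup>2)\<^sup>2\<close>; this is increasing for \<open>x \<ge> 0\<close> as soon as \<open>\<bar>a\<bar> \<le> \<bar>b\<bar>\<close>, and then
  it could be divided out.\<close>

theorem even_extremizer_zeros:
  assumes ext: "even_extremizer F" and z: "F z = 0"
  shows "\<bar>Im z\<bar> < \<bar>Re z\<bar>" "0 < \<bar>Im z\<bar>"
proof -
  from ext have F: "F \<in> F1" "even_fun F" "F 0 \<noteq> 0" by (auto simp: even_extremizer_def)
  define a b where "a = Re z" and "b = Im z"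
  have zab: "z = Complex a b" by (simp add: a_def b_def)
  show b0: "0 < \<bar>Im z\<bar>"
  proof (rule ccontr)
    assume "\<not> 0 < \<bar>Im z\<bar>"
    then have "z = of_real (Re z)" by (simp add: complex_eq_iff)
    then show False using F1_even_pos[OF F, of "Re z"] z by simp
  qed
  show "\<bar>Im z\<bar> < \<bar>Re z\<bar>"
  proof (rule ccontr)
    assume "\<not> \<bar>Im z\<bar> < \<bar>Re z\<bar>"
    then have ab: "a\<^sup>2 \<le> b\<^sup>2" by (simp add: a_def b_def abs_le_square_iff[symmetric])
    have b: "b \<noteq> 0" using b0 by (simp add: b_def)
    have cnj: "F (cnj w) = cnj (F w)" for w
      using F1_holomorphic[OF F(1)] F1_real[OF F(1)]
      by (intro real_entire_cnj) (metis Reals_of_real)+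
    have Fz: "F (Complex a b) = 0" "F (Complex a (- b)) = 0" "F (Complex (- a) b) = 0" "F (Complex (- a) (- b)) = 0"
    proof -
      show 1: "F (Complex a b) = 0" using z zab by simp
      show 2: "F (Complex a (- b)) = 0" using cnj[of z] z by (simp add: zab cnj.code Complex_eq_0)
      show "F (Complex (- a) b) = 0" "F (Complex (- a) (- b)) = 0"
        using 1 2 F(2) unfolding even_fun_def by (metis complex_minus minus_minus)+
    qed
    \<comment> \<open>For \<open>a = 0\<close> the quadruple collapses to a pair, and only the pair may be divided out.\<close>
    define Z where "Z = (if a = 0 then {Complex 0 b, Complex 0 (- b)}
      else {Complex a b, Complex a (- b), Complex (- a) b, Complex (- a) (- b)})"
    define q where "q = (\<lambda>x::real. if a = 0 then x\<^sup>2 + b\<^sup>2 else x ^ 4 + 2 * (b\<^sup>2 - a\<^sup>2) * x\<^sup>2 + (a\<^sup>2 + b\<^sup>2)\<^sup>2)"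
    have "finite Z" by (simp add: Z_def)
    have normZ: "cmod w = cmod z" if "w \<in> Z" for w
      using that by (auto simp: Z_def zab cmod_def split: if_splits)
    obtain G where G: "G holomorphic_on UNIV" "\<And>w. F w = (\<Prod>a\<in>Z. w - a) * G w"
    proof (rule entire_divide_zeros[OF \<open>finite Z\<close> F1_holomorphic[OF F(1)]])
      show "F w = 0" if "w \<in> Z" for w using that Fz by (auto simp: Z_def split: if_splits)
    qed blast
    show False
    proof (rule extremizer_no_increasing_factor[OF ext G])
      show "(\<Prod>a\<in>Z. of_real x - a) = of_real (q x)" for x :: real
      proof (cases "a = 0")
        case True
        then show ?thesis using b
          by (simp add: Z_def q_def complex_eq_iff power2_eq_square)
      next
        case False
        then have "(\<Prod>w\<in>Z. of_real x - w) = (of_real x - Complex a b) * ((of_real x - Complex a (- b)) * ((of_real x - Complex (- a) b) * (of_real x - Complex (- a) (- b))))"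
          using b by (simp add: Z_def)
        also have "\<dots> = of_real (q x)"
          using False by (simp add: q_def complex_eq_iff power2_eq_square power4_eq_xxxx algebra_simps)
        finally show ?thesis .
      qed
      show "q (- x) = q x" for x by (simp add: q_def)
      show "q 0 > 0" using b by (auto simp: q_def sum_power2_gt_zero_iff)
      show "q x < q y" if "0 \<le> x" "x < y" for x y
      proof -
        have "x\<^sup>2 < y\<^sup>2" "x ^ 4 < y ^ 4" using that by (auto intro: power_strict_mono)
        moreover from this have "2 * (b\<^sup>2 - a\<^sup>2) * x\<^sup>2 \<le> 2 * (b\<^sup>2 - a\<^sup>2) * y\<^sup>2"
          using ab by (intro mult_left_mono) auto
        ultimately show ?thesis unfolding q_def by auto
      qed
      show "1 \<le> cmod (\<Prod>a\<in>Z. w - a)" if "cmod z + 1 \<le> cmod w" for w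
        unfolding prod_norm[symmetric]
      proof (rule prod_ge_1)
        fix v assume "v \<in> Z"
        then show "1 \<le> cmod (w - v)" using norm_triangle_ineq2[of w v] normZ[of v] that by simp
      qed
    qed
  qed
qed

section \<open>Sine transforms and the logarithmic kernel\<close>

lemma exp_cos_integral:
  fixes \<mu> a :: real
  assumes "\<mu> > 0"
  shows "has_bochner_integral lborel (\<lambda>x. indicator {0<..} x * exp (- (\<mu> * x)) * cos (a * x)) (\<mu> / (\<mu>\<^sup>2 + a\<^sup>2))"
proof -
  have exp_int: "set_integrable lborel {0<..} (\<lambda>x. exp (- (\<mu> * x)))"
    using integrable_I0i_exp_mscale[OF assms] by (simp add: mult.commute)
  have int: "set_integrable lborel {0<..} (\<lambda>x. exp (- (\<mu> * x)) * cos (a * x))"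
    unfolding set_integrable_def
    by (rule Bochner_Integration.integrable_bound[OF exp_int[unfolded set_integrable_def]])
       (auto simp: abs_mult mult_left_le split: split_indicator)
  define D where "D = \<mu>\<^sup>2 + a\<^sup>2"
  have D: "D > 0" using assms by (simp add: D_def add_pos_nonneg)
  define F where "F = (\<lambda>x. exp (- (\<mu> * x)) * (a * sin (a * x) - \<mu> * cos (a * x)) / D)"
  have lim: "(F \<longlongrightarrow> 0) at_top"
  proof (rule Lim_null_comparison)
    have "\<bar>a * sin (a * x) - \<mu> * cos (a * x)\<bar> \<le> \<bar>a\<bar> * 1 + \<mu> * 1" for x
    proof -
      have "\<bar>a * sin (a * x)\<bar> \<le> \<bar>a\<bar>" "\<bar>\<mu> * cos (a * x)\<bar> \<le> \<mu>"
        using assms by (simp_all add: abs_mult mult_left_le)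
      then show ?thesis by linarith
    qed
    then show "\<forall>\<^sub>F x in at_top. norm (F x) \<le> exp (- (\<mu> * x)) * ((\<bar>a\<bar> + \<mu>) / D)"
      using D by (auto intro!: always_eventually mult_left_mono divide_right_mono simp: F_def abs_mult)
    have "((\<lambda>x. exp (- (\<mu> * x))) \<longlongrightarrow> 0) at_top"
      using assms by (auto intro!: exp_at_bot[THEN filterlim_compose] filterlim_tendsto_pos_mult_at_top filterlim_ident
             simp: filterlim_uminus_at_bot)
    from tendsto_mult_left_zero[OF this, of "(\<bar>a\<bar> + \<mu>) / D"]
    show "((\<lambda>x. exp (- (\<mu> * x)) * ((\<bar>a\<bar> + \<mu>) / D)) \<longlongrightarrow> 0) at_top" .
  qed
  have "(LBINT x=0..\<infinity>. exp (- (\<mu> * x)) * cos (a * x)) = 0 - (- \<mu> / D)"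
  proof (rule interval_integral_FTC_integrable[where F = F])
    show "(F has_vector_derivative exp (- (\<mu> * x)) * cos (a * x)) (at x)" for x
    proof -
      have "((\<lambda>x. exp (- (\<mu> * x)) * (a * sin (a * x) - \<mu> * cos (a * x))) has_real_derivative
          exp (- (\<mu> * x)) * cos (a * x) * D) (at x)"
        by (auto intro!: derivative_eq_intros simp: D_def power2_eq_square algebra_simps)
      from DERIV_cdivide[OF this, of D] show ?thesis
        unfolding F_def has_real_derivative_iff_has_vector_derivative[symmetric] using D by simp
    qed
    show "set_integrable lborel (einterval 0 \<infinity>) (\<lambda>x. exp (- (\<mu> * x)) * cos (a * x))"
      using int by (simp add: zero_ereal_def)
    have "isCont F 0" unfolding F_def using D by (intro continuous_intros) auto
    then have "(F \<longlongrightarrow> F 0) (at_right 0)"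
      unfolding isCont_def by (rule filterlim_at_split[THEN iffD1, THEN conjunct2])
    then show "((F \<circ> real_of_ereal) \<longlongrightarrow> - \<mu> / D) (at_right 0)"
      unfolding zero_ereal_def by (simp add: ereal_tendsto_simps F_def)
    show "((F \<circ> real_of_ereal) \<longlongrightarrow> 0) (at_left \<infinity>)"
      using lim by (simp add: ereal_tendsto_simps)
  qed (auto intro!: continuous_intros)
  then have "(LBINT x. indicator {0<..} x * exp (- (\<mu> * x)) * cos (a * x)) = \<mu> / D"
    by (simp add: interval_lebesgue_integral_0_infty set_lebesgue_integral_def mult.assoc)
  with int show ?thesis
    by (simp add: has_bochner_integral_iff set_integrable_def D_def mult.assoc)
qed

text \<open>The Laplace transform in \<open>x\<close>, at \<open>\<mu>\<close>, of \<open>sin (s x) sin (t x)\<close>: a difference of two Poisson kernels.\<close>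

definition poisson_diff :: "real \<Rightarrow> real \<Rightarrow> real \<Rightarrow> real" where
  "poisson_diff \<mu> s t = (\<mu> / (\<mu>\<^sup>2 + (s - t)\<^sup>2) - \<mu> / (\<mu>\<^sup>2 + (s + t)\<^sup>2)) / 2"

text \<open>Since \<open>1 / x\<close> is the integral of \<open>exp (- \<mu> x)\<close> over \<open>\<mu> > 0\<close>, integrating \<open>poisson_diff \<mu> s t\<close> over \<open>\<mu>\<close>
  evaluates the integral of \<open>sin (s x) sin (t x) / x\<close>; the result is half of this kernel.\<close>

definition log_kernel :: "real \<Rightarrow> real \<Rightarrow> real" where
  "log_kernel s t = ln ((s + t) / \<bar>s - t\<bar>)"

lemma poisson_diff_measurable [measurable]:
  assumes [measurable]: "f \<in> borel_measurable M" "g \<in> borel_measurable M" "h \<in> borel_measurable M"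
  shows "(\<lambda>x. poisson_diff (f x) (g x) (h x)) \<in> borel_measurable M"
  unfolding poisson_diff_def by measurable

lemma log_kernel_measurable [measurable]:
  assumes [measurable]: "g \<in> borel_measurable M" "h \<in> borel_measurable M"
  shows "(\<lambda>x. log_kernel (g x) (h x)) \<in> borel_measurable M"
  unfolding log_kernel_def by measurable

lemma exp_sin_sin_integral:
  assumes "\<mu> > 0"
  shows "(LBINT x. indicator {0<..} x * exp (- (\<mu> * x)) * sin (s * x) * sin (t * x)) = poisson_diff \<mu> s t"
proof -
  have eq: "indicator {0<..} x * exp (- (\<mu> * x)) * sin (s * x) * sin (t * x) =
      (indicator {0<..} x * exp (- (\<mu> * x)) * cos ((s - t) * x) -
       indicator {0<..} x * exp (- (\<mu> * x)) * cos ((s + t) * x)) / 2" for x :: real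
  proof -
    have "sin (s * x) * sin (t * x) = (cos ((s - t) * x) - cos ((s + t) * x)) / 2"
      by (simp add: sin_times_sin algebra_simps)
    then show ?thesis by (simp add: mult.assoc right_diff_distrib)
  qed
  show ?thesis
    unfolding eq poisson_diff_def
    using exp_cos_integral[OF assms, of "s - t"] exp_cos_integral[OF assms, of "s + t"]
    by (simp add: has_bochner_integral_iff)
qed

lemma poisson_diff_nonneg:
  assumes "0 \<le> s" "0 \<le> t" "0 \<le> \<mu>" shows "poisson_diff \<mu> s t \<ge> 0"
proof (cases "\<mu> = 0")
  case False
  have "(s - t)\<^sup>2 \<le> (s + t)\<^sup>2" using assms by (simp add: power2_eq_square algebra_simps)
  then have "\<mu> / (\<mu>\<^sup>2 + (s + t)\<^sup>2) \<le> \<mu> / (\<mu>\<^sup>2 + (s - t)\<^sup>2)"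
    using assms False by (intro divide_left_mono) (auto intro!: mult_pos_pos add_pos_nonneg)
  then show ?thesis by (simp add: poisson_diff_def)
qed (simp add: poisson_diff_def)

lemma poisson_diff_commute: "poisson_diff \<mu> s t = poisson_diff \<mu> t s"
  by (simp add: poisson_diff_def power2_commute add.commute)

lemma log_kernel_commute: "log_kernel s t = log_kernel t s"
  by (simp add: log_kernel_def abs_minus_commute add.commute)

lemma log_kernel_nonneg:
  assumes "0 \<le> s" "0 \<le> t" shows "log_kernel s t \<ge> 0"
proof (cases "s = t")
  case False
  then have "1 \<le> (s + t) / \<bar>s - t\<bar>" using assms by (simp add: le_divide_eq_1 abs_if)
  then show ?thesis by (simp add: log_kernel_def)
qed (simp add: log_kernel_def)

text \<open>The row bound for Schur's test, uniform in \<open>\<mu>\<close> and \<open>s\<close>.\<close>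

lemma nn_integral_poisson_diff_le:
  assumes "\<mu> > 0" "s \<ge> 0"
  shows "(\<integral>\<^sup>+t. ennreal (poisson_diff \<mu> s t) * indicator {0..} t \<partial>lborel) \<le> ennreal (pi / 2)"
proof -
  define F where "F = (\<lambda>t. (arctan ((t - s) / \<mu>) - arctan ((t + s) / \<mu>)) / 2)"
  have "(\<integral>\<^sup>+t. ennreal (poisson_diff \<mu> s t) * indicator {0..} t \<partial>lborel) = 0 - F 0"
  proof (rule nn_integral_FTC_atLeast)
    show "(F has_real_derivative poisson_diff \<mu> s x) (at x)" for x
      unfolding F_def poisson_diff_def
      using \<open>\<mu> > 0\<close> by (auto intro!: derivative_eq_intros simp: divide_simps power2_eq_square add_nonneg_eq_0_iff)
         (auto simp: algebra_simps)
    have "LIM t at_top. (t - s) / \<mu> :> at_top" "LIM t at_top. (t + s) / \<mu> :> at_top"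
      using \<open>\<mu> > 0\<close> by real_asymp+
    then have "((\<lambda>t. arctan ((t - s) / \<mu>)) \<longlongrightarrow> pi / 2) at_top" "((\<lambda>t. arctan ((t + s) / \<mu>)) \<longlongrightarrow> pi / 2) at_top"
      by (auto intro: filterlim_compose[OF tendsto_arctan_at_top])
    from tendsto_divide[OF tendsto_diff[OF this] tendsto_const[of 2]]
    show "(F \<longlongrightarrow> 0) at_top" unfolding F_def by simp
  qed (use assms in \<open>auto intro!: poisson_diff_nonneg\<close>)
  also have "0 - F 0 = arctan (s / \<mu>)" by (simp add: F_def arctan_minus)
  also have "ennreal (arctan (s / \<mu>)) \<le> ennreal (pi / 2)"
    using arctan_ubound[of "s / \<mu>"] by (intro ennreal_leI) simp
  finally show ?thesis .
qed

lemma nn_integral_poisson_diff_eq_log_kernel: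
  assumes "0 < s" "0 < t" "s \<noteq> t"
  shows "(\<integral>\<^sup>+\<mu>. ennreal (poisson_diff \<mu> s t) * indicator {0..} \<mu> \<partial>lborel) = ennreal (log_kernel s t / 2)"
proof -
  define F where "F = (\<lambda>\<mu>. (ln (\<mu>\<^sup>2 + (s - t)\<^sup>2) - ln (\<mu>\<^sup>2 + (s + t)\<^sup>2)) / 4)"
  have p: "\<mu>\<^sup>2 + (s - t)\<^sup>2 > 0" "\<mu>\<^sup>2 + (s + t)\<^sup>2 > 0" for \<mu>
    using assms by (auto intro: add_nonneg_pos)
  have "(\<integral>\<^sup>+\<mu>. ennreal (poisson_diff \<mu> s t) * indicator {0..} \<mu> \<partial>lborel) = 0 - F 0"
  proof (rule nn_integral_FTC_atLeast)
    show "(F has_real_derivative poisson_diff x s t) (at x)" for x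
      unfolding F_def poisson_diff_def
      by ((rule derivative_eq_intros refl p | simp)+) (simp add: mult.commute)
    show "(F \<longlongrightarrow> 0) at_top" unfolding F_def
      using assms by real_asymp
  qed (use assms in \<open>auto intro!: poisson_diff_nonneg\<close>)
  also have "0 - F 0 = log_kernel s t / 2"
  proof -
    have aux: "0 - (2 * a - 2 * b) / 4 = (b - a) / 2" for a b :: real by (simp add: field_simps)
    have 1: "ln ((s - t)\<^sup>2) = 2 * ln \<bar>s - t\<bar>" "ln ((s + t)\<^sup>2) = 2 * ln (s + t)"
      using assms ln_realpow[of "\<bar>s - t\<bar>" 2] ln_realpow[of "s + t" 2] by simp_all
    have 2: "ln ((s + t) / \<bar>s - t\<bar>) = ln (s + t) - ln \<bar>s - t\<bar>" using assms by (simp add: ln_div)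
    have 3: "F 0 = (ln ((s - t)\<^sup>2) - ln ((s + t)\<^sup>2)) / 4" by (simp add: F_def)
    show ?thesis unfolding log_kernel_def 3 1 2 by (rule aux)
  qed
  finally show ?thesis .
qed


text \<open>The finite exceptional set admits primitives with a logarithmic singularity inside the interval.\<close>

lemma nn_integral_FTC_interior:
  fixes f F :: "real \<Rightarrow> real"
  assumes "a \<le> b" "finite S" and cont: "continuous_on {a..b} F"
    and deriv: "\<And>x. x \<in> {a<..<b} - S \<Longrightarrow> (F has_real_derivative f x) (at x)"
    and [measurable]: "f \<in> borel_measurable borel"
    and nonneg: "\<And>x. x \<in> {a..b} \<Longrightarrow> 0 \<le> f x"
  shows "(\<integral>\<^sup>+x. ennreal (f x) * indicator {a..b} x \<partial>lborel) = ennreal (F b - F a)"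
proof -
  have "(f has_integral (F b - F a)) {a..b}"
    using assms by (intro fundamental_theorem_of_calculus_interior_strong[of S])
      (auto simp: has_real_derivative_iff_has_vector_derivative)
  then have "((\<lambda>x. if x \<in> {a..b} then f x else 0) has_integral (F b - F a)) UNIV"
    by (simp only: has_integral_restrict_UNIV)
  then have "(\<integral>\<^sup>+x. ennreal (if x \<in> {a..b} then f x else 0) \<partial>lborel) = ennreal (F b - F a)"
    using nonneg by (intro nn_integral_has_integral_lborel) auto
  moreover have "(\<integral>\<^sup>+x. ennreal (if x \<in> {a..b} then f x else 0) \<partial>lborel) = (\<integral>\<^sup>+x. ennreal (f x) * indicator {a..b} x \<partial>lborel)"
    by (intro nn_integral_cong) (auto split: split_indicator)
  ultimately show ?thesis by simp
qed

lemma isCont_mult_ln_abs: "isCont (\<lambda>u::real. u * ln \<bar>u\<bar>) u"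
proof (cases "u = 0")
  case True
  have "((\<lambda>u::real. u * ln \<bar>u\<bar>) \<longlongrightarrow> 0) (at_right 0)" "((\<lambda>u::real. u * ln \<bar>u\<bar>) \<longlongrightarrow> 0) (at_left 0)"
    by real_asymp+
  then have "((\<lambda>u::real. u * ln \<bar>u\<bar>) \<longlongrightarrow> 0) (at 0)" by (simp add: filterlim_at_split)
  then show ?thesis using True by (simp add: isCont_def)
next
  case False
  then show ?thesis by (intro continuous_intros) auto
qed

lemma continuous_on_mult_ln_abs [continuous_intros]:
  fixes f :: "real \<Rightarrow> real"
  assumes "continuous_on A f" shows "continuous_on A (\<lambda>x. f x * ln \<bar>f x\<bar>)"
  using continuous_on_compose2[of UNIV "\<lambda>u. u * ln \<bar>u\<bar>", OF _ assms] isCont_mult_ln_abs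
  by (auto simp: continuous_at_imp_continuous_on)

lemma log_kernel_le:
  assumes "s \<in> {0..1}" "t \<in> {0..1}" shows "log_kernel s t \<le> ln 2 - ln \<bar>s - t\<bar>"
proof (cases "s = t")
  case False
  then have "log_kernel s t \<le> ln (2 / \<bar>s - t\<bar>)"
    unfolding log_kernel_def using assms by (subst ln_le_cancel_iff) (auto intro!: divide_right_mono)
  also have "\<dots> = ln 2 - ln \<bar>s - t\<bar>" using False by (simp add: ln_div)
  finally show ?thesis .
qed (simp add: log_kernel_def)

lemma nn_integral_log_kernel_le:
  assumes s: "s \<in> {0..1}"
  shows "(\<integral>\<^sup>+t. ennreal (log_kernel s t) * indicator {0..1} t \<partial>lborel) \<le> ennreal 4"
proof -
  have ln2: "ln 2 - ln \<bar>u\<bar> \<ge> 0" if "u \<in> {-1..1}" for u :: real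
    using that ln_le_zero_iff[of "\<bar>u\<bar>"] by (cases "u = 0") (auto intro: order_trans[of _ 0])
  have "(\<integral>\<^sup>+t. ennreal (log_kernel s t) * indicator {0..1} t \<partial>lborel)
      \<le> (\<integral>\<^sup>+t. ennreal (ln 2 - ln \<bar>t - s\<bar>) * indicator {-1..1} (t - s) \<partial>lborel)"
    using log_kernel_le[OF s] s
    by (intro nn_integral_mono) (auto intro!: ennreal_leI simp: abs_minus_commute split: split_indicator)
  also have "\<dots> = (\<integral>\<^sup>+u. ennreal (ln 2 - ln \<bar>u\<bar>) * indicator {-1..1} u \<partial>lborel)"
    using nn_integral_real_affine[of "\<lambda>t. ennreal (ln 2 - ln \<bar>t\<bar>) * indicator {-1..1} t" 1 "-s"]
    by (simp add: add.commute)
  also have "\<dots> = ennreal ((\<lambda>u. (ln 2 + 1) * u - u * ln \<bar>u\<bar>) 1 - (\<lambda>u. (ln 2 + 1) * u - u * ln \<bar>u\<bar>) (-1))"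
  proof (rule nn_integral_FTC_interior[of _ _ "{0}"])
    show "((\<lambda>u. (ln 2 + 1) * u - u * ln \<bar>u\<bar>) has_real_derivative ln 2 - ln \<bar>x\<bar>) (at x)"
      if "x \<in> {- 1<..<1} - {0}" for x :: real
    proof (cases "x > 0")
      case True
      have "((\<lambda>u. (ln 2 + 1) * u - u * ln u) has_real_derivative ln 2 - ln \<bar>x\<bar>) (at x)"
        using True by (auto intro!: derivative_eq_intros simp: field_simps)
      then show ?thesis
        by (rule has_field_derivative_transform_within_open[of _ _ _ "{0<..}"]) (use True in auto)
    next
      case False
      with that have "x < 0" by auto
      have "((\<lambda>u. (ln 2 + 1) * u - u * ln (- u)) has_real_derivative ln 2 - ln \<bar>x\<bar>) (at x)"
        using \<open>x < 0\<close> by (auto intro!: derivative_eq_intros simp: field_simps)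
      then show ?thesis
        by (rule has_field_derivative_transform_within_open[of _ _ _ "{..<0}"]) (use \<open>x < 0\<close> in auto)
    qed
  qed (use ln2 in \<open>auto intro!: continuous_intros\<close>)
  also have "\<dots> \<le> ennreal 4" using ln_2_less_1 by (intro ennreal_leI) simp
  finally show ?thesis .
qed

lemma lborel_Fubini_of_finite:
  fixes f :: "real \<Rightarrow> real \<Rightarrow> real"
  assumes [measurable]: "(\<lambda>(x, y). f x y) \<in> borel_measurable (borel \<Otimes>\<^sub>M borel)"
    and fin: "(\<integral>\<^sup>+x. \<integral>\<^sup>+y. ennreal \<bar>f x y\<bar> \<partial>lborel \<partial>lborel) < \<infinity>"
  shows "integrable lborel (\<lambda>x. LBINT y. f x y)"
    and "(LBINT x. LBINT y. f x y) = (LBINT y. LBINT x. f x y)"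
proof -
  have "(\<lambda>(x, y). f x y) \<in> borel_measurable (lborel \<Otimes>\<^sub>M lborel)" by measurable
  moreover have "(\<integral>\<^sup>+p. ennreal (norm (case p of (x, y) \<Rightarrow> f x y)) \<partial>(lborel \<Otimes>\<^sub>M lborel)) < \<infinity>"
    using fin by (subst lborel.nn_integral_fst[symmetric]) auto
  ultimately have int: "integrable (lborel \<Otimes>\<^sub>M lborel) (\<lambda>(x, y). f x y)"
    by (rule integrableI_bounded)
  show "integrable lborel (\<lambda>x. LBINT y. f x y)"
    using lborel_pair.integrable_fst'[OF int] by simp
  show "(LBINT x. LBINT y. f x y) = (LBINT y. LBINT x. f x y)"
    using lborel_pair.Fubini_integral[OF int] by simp
qed

lemma ennreal_integral_le:
  fixes f :: "'a \<Rightarrow> real"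
  shows "ennreal \<bar>integral\<^sup>L M f\<bar> \<le> (\<integral>\<^sup>+x. ennreal \<bar>f x\<bar> \<partial>M)"
proof (cases "integrable M f")
  case True
  then show ?thesis using integral_norm_bound_ennreal[of M f] by simp
qed (simp add: not_integrable_integral_eq)

lemma ennreal_mean_self: "0 \<le> c \<Longrightarrow> (ennreal c + ennreal c) / 2 = ennreal c"
  using divide_ennreal[of "c + c" 2] by (simp only: ennreal_plus ennreal_numeral) simp

text \<open>A bounded function \<open>\<Phi>\<close> supported in the unit interval, together with its sine transform \<open>K\<close>. The
  integrals of \<open>K\<^sup>2\<close> and of \<open>K\<^sup>2 / x\<close> over the half-line are reached through the damped integrals with
  weight \<open>exp (- \<mu> x)\<close>, for which every interchange of integrations converges absolutely.\<close>

locale sine_window =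
  fixes \<Phi> :: "real \<Rightarrow> real" and B :: real
  assumes \<Phi>_measurable [measurable]: "\<Phi> \<in> borel_measurable borel"
    and \<Phi>_bound: "\<bar>\<Phi> t\<bar> \<le> B"
    and \<Phi>_support: "t \<notin> {0..1} \<Longrightarrow> \<Phi> t = 0"
begin

definition K :: "real \<Rightarrow> real" where
  "K x = (LBINT t. \<Phi> t * sin (t * x))"

lemma B_nonneg: "B \<ge> 0" using \<Phi>_bound[of 0] by linarith

lemma \<Phi>_le_indicator: "\<bar>\<Phi> t\<bar> \<le> B * indicator {0..1} t"
  using \<Phi>_bound[of t] \<Phi>_support[of t] by (auto split: split_indicator)

lemma integrable_\<Phi>_mult:
  assumes [measurable]: "g \<in> borel_measurable borel" and "\<And>t. \<bar>g t\<bar> \<le> C"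
  shows "integrable lborel (\<lambda>t. \<Phi> t * g t)"
proof (rule Bochner_Integration.integrable_bound)
  show "integrable lborel (\<lambda>t. B * C * indicator {0..1::real} t)" by simp
  have "\<bar>\<Phi> t * g t\<bar> \<le> \<bar>B * C * indicator {0..1} t\<bar>" for t
  proof -
    have "\<bar>\<Phi> t * g t\<bar> \<le> (B * indicator {0..1} t) * C"
      unfolding abs_mult using \<Phi>_le_indicator[of t] assms(2)[of t] B_nonneg by (intro mult_mono) auto
    then show ?thesis by (simp add: mult_ac)
  qed
  then show "AE t in lborel. norm (\<Phi> t * g t) \<le> norm (B * C * indicator {0..1} t)" by simp
qed simp

lemma integrable_\<Phi>: "integrable lborel \<Phi>"
  using integrable_\<Phi>_mult[of "\<lambda>_. 1" 1] by simp

lemma integrable_\<Phi>_sq: "integrable lborel (\<lambda>t. (\<Phi> t)\<^sup>2)"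
  using integrable_\<Phi>_mult[of \<Phi> B] \<Phi>_bound by (simp add: power2_eq_square)

lemma K_measurable [measurable]: "K \<in> borel_measurable borel"
  unfolding K_def[abs_def] by measurable

lemma K_bound: "\<bar>K x\<bar> \<le> B"
proof -
  have "\<bar>K x\<bar> \<le> (LBINT t. \<bar>\<Phi> t * sin (t * x)\<bar>)"
    unfolding K_def by (rule integral_abs_bound)
  also have "\<dots> \<le> (LBINT t. B * indicator {0..1::real} t)"
  proof (rule integral_mono)
    show "integrable lborel (\<lambda>t. \<bar>\<Phi> t * sin (t * x)\<bar>)"
      by (intro integrable_abs integrable_\<Phi>_mult[of _ 1]) auto
    fix t
    show "\<bar>\<Phi> t * sin (t * x)\<bar> \<le> B * indicator {0..1} t"
      using \<Phi>_le_indicator[of t] mult_left_le[of "\<bar>sin (t * x)\<bar>" "\<bar>\<Phi> t\<bar>"] by (simp add: abs_mult)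
  qed simp
  finally show ?thesis by simp
qed

lemma integral_mult_K:
  assumes \<psi>: "integrable lborel \<psi>"
  shows "(LBINT x. \<psi> x * K x) = (LBINT s. \<Phi> s * (LBINT x. \<psi> x * sin (s * x)))"
proof -
  have [measurable]: "\<psi> \<in> borel_measurable borel" using borel_measurable_integrable[OF \<psi>] by simp
  have int: "integrable (lborel \<Otimes>\<^sub>M lborel) (\<lambda>(x, s). \<psi> x * (\<Phi> s * sin (s * x)))"
  proof (rule lborel_pair.Fubini_integrable)
    have eq: "(LBINT s. norm (case (x, s) of (x, s) \<Rightarrow> \<psi> x * (\<Phi> s * sin (s * x)))) =
        \<bar>\<psi> x\<bar> * (LBINT s. \<bar>\<Phi> s * sin (s * x)\<bar>)" for x
      by (simp add: abs_mult)
    show "integrable lborel (\<lambda>x. LBINT s. norm (case (x, s) of (x, s) \<Rightarrow> \<psi> x * (\<Phi> s * sin (s * x))))"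
      unfolding eq
    proof (rule Bochner_Integration.integrable_bound)
      show "integrable lborel (\<lambda>x. \<bar>\<psi> x\<bar> * (LBINT s. \<bar>\<Phi> s\<bar>))" using \<psi> by simp
      have "(LBINT s. \<bar>\<Phi> s * sin (s * x)\<bar>) \<le> (LBINT s. \<bar>\<Phi> s\<bar>)" for x
        using integrable_\<Phi> by (intro integral_mono integrable_abs integrable_\<Phi>_mult[of _ 1])
          (auto simp: abs_mult mult_left_le)
      then have "\<bar>\<psi> x\<bar> * (LBINT s. \<bar>\<Phi> s * sin (s * x)\<bar>) \<le> \<bar>\<psi> x\<bar> * (LBINT s. \<bar>\<Phi> s\<bar>)" for x
        by (intro mult_left_mono) auto
      then show "AE x in lborel. norm (\<bar>\<psi> x\<bar> * (LBINT s. \<bar>\<Phi> s * sin (s * x)\<bar>)) \<le> norm (\<bar>\<psi> x\<bar> * (LBINT s. \<bar>\<Phi> s\<bar>))"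
        by (simp add: abs_mult)
    qed measurable
    show "AE x in lborel. integrable lborel (\<lambda>s. case (x, s) of (x, s) \<Rightarrow> \<psi> x * (\<Phi> s * sin (s * x)))"
      by (auto intro!: integrable_\<Phi>_mult[of _ 1])
  qed measurable
  have "(LBINT x. \<psi> x * K x) = (LBINT x. LBINT s. \<psi> x * (\<Phi> s * sin (s * x)))"
    by (simp add: K_def)
  also have "\<dots> = (LBINT s. LBINT x. \<psi> x * (\<Phi> s * sin (s * x)))"
    using lborel_pair.Fubini_integral[OF int] by simp
  also have "\<dots> = (LBINT s. \<Phi> s * (LBINT x. \<psi> x * sin (s * x)))"
    by (simp add: mult.left_commute)
  finally show ?thesis .
qed

lemma integrable_exp_weight:
  fixes g :: "real \<Rightarrow> real" and C \<mu> :: real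
  assumes "\<mu> > 0" and [measurable]: "g \<in> borel_measurable borel" and "\<And>t. \<bar>g t\<bar> \<le> C"
  shows "integrable lborel (\<lambda>x. indicator {0<..} x * exp (- (\<mu> * x)) * g x)"
proof (rule Bochner_Integration.integrable_bound)
  show "integrable lborel (\<lambda>x. C * (indicator {0<..} x * exp (- (\<mu> * x)) * cos (0 * x)))"
    using exp_cos_integral[OF assms(1), of 0] by (simp add: has_bochner_integral_iff)
  have "C \<ge> 0" using assms(3)[of 0] by linarith
  then show "AE x in lborel. norm (indicator {0<..} x * exp (- (\<mu> * x)) * g x)
      \<le> norm (C * (indicator {0<..} x * exp (- (\<mu> * x)) * cos (0 * x)))"
    using assms(3) by (auto simp: abs_mult mult.commute split: split_indicator)
qed simp

definition poisson_form :: "real \<Rightarrow> real" where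
  "poisson_form \<mu> = (LBINT s. \<Phi> s * (LBINT t. \<Phi> t * poisson_diff \<mu> s t))"

lemma integral_exp_K_sq:
  assumes "\<mu> > 0"
  shows "(LBINT x. indicator {0<..} x * exp (- (\<mu> * x)) * (K x)\<^sup>2) = poisson_form \<mu>"
proof -
  have "(LBINT x. indicator {0<..} x * exp (- (\<mu> * x)) * (K x)\<^sup>2)
      = (LBINT x. (indicator {0<..} x * exp (- (\<mu> * x)) * K x) * K x)"
    by (simp add: power2_eq_square mult.assoc)
  also have "\<dots> = (LBINT s. \<Phi> s * (LBINT x. (indicator {0<..} x * exp (- (\<mu> * x)) * K x) * sin (s * x)))"
    by (intro integral_mult_K integrable_exp_weight[OF assms _ K_bound]) auto
  also have "\<dots> = (LBINT s. \<Phi> s * (LBINT x. (indicator {0<..} x * exp (- (\<mu> * x)) * sin (s * x)) * K x))"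
    by (simp add: mult_ac)
  also have "\<dots> = (LBINT s. \<Phi> s * (LBINT t. \<Phi> t * (LBINT x. (indicator {0<..} x * exp (- (\<mu> * x)) * sin (s * x)) * sin (t * x))))"
    by (subst integral_mult_K[OF integrable_exp_weight[OF assms _ abs_sin_le_one]]) auto
  also have "\<dots> = poisson_form \<mu>"
    by (simp add: poisson_form_def exp_sin_sin_integral[OF assms])
  finally show ?thesis .
qed

text \<open>Schur's test: the weights \<open>\<Phi>\<^sup>2 / 2\<close> in both variables dominate \<open>\<Phi> s \<Phi> t\<close>.\<close>

lemma poisson_form_le:
  assumes "\<mu> > 0"
  shows "poisson_form \<mu> \<le> pi / 2 * (LBINT t. (\<Phi> t)\<^sup>2)"
proof -
  define k where "k = (\<lambda>s t. poisson_diff \<mu> s t * indicator {0..} s * indicator {0..} t :: real)"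
  have k0: "k s t \<ge> 0" for s t by (auto simp: k_def poisson_diff_nonneg assms less_imp_le split: split_indicator)
  have [measurable]: "(\<lambda>(s, t). k s t) \<in> borel_measurable (borel \<Otimes>\<^sub>M borel)" "k s \<in> borel_measurable borel" for s
    unfolding k_def[abs_def] by measurable
  have kle: "(\<integral>\<^sup>+t. ennreal (k s t) \<partial>lborel) \<le> ennreal (pi / 2)" for s
  proof (cases "s \<ge> 0")
    case True
    then have "(\<integral>\<^sup>+t. ennreal (k s t) \<partial>lborel) = (\<integral>\<^sup>+t. ennreal (poisson_diff \<mu> s t) * indicator {0..} t \<partial>lborel)"
      by (intro nn_integral_cong) (auto simp: k_def split: split_indicator)
    then show ?thesis using nn_integral_poisson_diff_le[OF assms True] by simp
  qed (simp add: k_def)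
  have Int: "(\<integral>\<^sup>+t. ennreal ((\<Phi> t)\<^sup>2) \<partial>lborel) = ennreal (LBINT t. (\<Phi> t)\<^sup>2)"
    by (intro nn_integral_eq_integral integrable_\<Phi>_sq) auto
  have le1: "(\<integral>\<^sup>+s. \<integral>\<^sup>+t. ennreal ((\<Phi> s)\<^sup>2 * k s t) \<partial>lborel \<partial>lborel) \<le> ennreal (pi / 2 * (LBINT t. (\<Phi> t)\<^sup>2))"
  proof -
    have "(\<integral>\<^sup>+s. \<integral>\<^sup>+t. ennreal ((\<Phi> s)\<^sup>2 * k s t) \<partial>lborel \<partial>lborel) = (\<integral>\<^sup>+s. ennreal ((\<Phi> s)\<^sup>2) * (\<integral>\<^sup>+t. ennreal (k s t) \<partial>lborel) \<partial>lborel)"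
      by (simp add: ennreal_mult' k0 nn_integral_cmult)
    also have "\<dots> \<le> (\<integral>\<^sup>+s. ennreal ((\<Phi> s)\<^sup>2) * ennreal (pi / 2) \<partial>lborel)"
      by (intro nn_integral_mono mult_left_mono kle) auto
    also have "\<dots> = ennreal (pi / 2 * (LBINT t. (\<Phi> t)\<^sup>2))"
      by (subst nn_integral_multc) (auto simp: Int ennreal_mult'[symmetric] mult.commute)
    finally show ?thesis .
  qed
  have le2: "(\<integral>\<^sup>+s. \<integral>\<^sup>+t. ennreal ((\<Phi> t)\<^sup>2 * k s t) \<partial>lborel \<partial>lborel) \<le> ennreal (pi / 2 * (LBINT t. (\<Phi> t)\<^sup>2))"
  proof -
    have "(\<integral>\<^sup>+s. \<integral>\<^sup>+t. ennreal ((\<Phi> t)\<^sup>2 * k s t) \<partial>lborel \<partial>lborel) = (\<integral>\<^sup>+t. \<integral>\<^sup>+s. ennreal ((\<Phi> t)\<^sup>2 * k s t) \<partial>lborel \<partial>lborel)"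
      by (rule lborel_pair.Fubini') measurable
    also have "\<dots> = (\<integral>\<^sup>+s. \<integral>\<^sup>+t. ennreal ((\<Phi> s)\<^sup>2 * k s t) \<partial>lborel \<partial>lborel)"
      by (simp add: k_def poisson_diff_commute mult_ac)
    finally show ?thesis using le1 by simp
  qed
  have "ennreal (poisson_form \<mu>) \<le> ennreal \<bar>poisson_form \<mu>\<bar>" by (intro ennreal_leI) simp
  also have "\<dots> \<le> (\<integral>\<^sup>+s. ennreal \<bar>LBINT t. \<Phi> s * (\<Phi> t * poisson_diff \<mu> s t)\<bar> \<partial>lborel)"
    unfolding poisson_form_def by (rule order_trans[OF ennreal_integral_le]) simp
  also have "\<dots> \<le> (\<integral>\<^sup>+s. \<integral>\<^sup>+t. ennreal \<bar>\<Phi> s * (\<Phi> t * poisson_diff \<mu> s t)\<bar> \<partial>lborel \<partial>lborel)"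
    by (intro nn_integral_mono ennreal_integral_le)
  also have "\<dots> \<le> (\<integral>\<^sup>+s. \<integral>\<^sup>+t. (ennreal ((\<Phi> s)\<^sup>2 * k s t) + ennreal ((\<Phi> t)\<^sup>2 * k s t)) / 2 \<partial>lborel \<partial>lborel)"
  proof (intro nn_integral_mono)
    fix s t
    have eq: "\<Phi> s * (\<Phi> t * poisson_diff \<mu> s t) = \<Phi> s * \<Phi> t * k s t"
      using \<Phi>_support[of s] \<Phi>_support[of t] by (auto simp: k_def split: split_indicator)
    have "2 * (\<bar>\<Phi> s\<bar> * \<bar>\<Phi> t\<bar>) \<le> (\<Phi> s)\<^sup>2 + (\<Phi> t)\<^sup>2"
      using sum_squares_bound[of "\<bar>\<Phi> s\<bar>" "\<bar>\<Phi> t\<bar>"] by simp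
    then have "(\<bar>\<Phi> s\<bar> * \<bar>\<Phi> t\<bar>) * k s t \<le> (((\<Phi> s)\<^sup>2 + (\<Phi> t)\<^sup>2) / 2) * k s t"
      by (intro mult_right_mono k0) simp
    then have "\<bar>\<Phi> s * \<Phi> t * k s t\<bar> \<le> ((\<Phi> s)\<^sup>2 * k s t + (\<Phi> t)\<^sup>2 * k s t) / 2"
      using k0[of s t] by (simp add: abs_mult algebra_simps add_divide_distrib)
    then have "ennreal \<bar>\<Phi> s * \<Phi> t * k s t\<bar> \<le> ennreal (((\<Phi> s)\<^sup>2 * k s t + (\<Phi> t)\<^sup>2 * k s t) / 2)"
      by (rule ennreal_leI)
    also have "\<dots> = (ennreal ((\<Phi> s)\<^sup>2 * k s t) + ennreal ((\<Phi> t)\<^sup>2 * k s t)) / 2"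
      using k0[of s t] divide_ennreal[of "(\<Phi> s)\<^sup>2 * k s t + (\<Phi> t)\<^sup>2 * k s t" 2] by simp
    finally show "ennreal \<bar>\<Phi> s * (\<Phi> t * poisson_diff \<mu> s t)\<bar> \<le> (ennreal ((\<Phi> s)\<^sup>2 * k s t) + ennreal ((\<Phi> t)\<^sup>2 * k s t)) / 2"
      unfolding eq .
  qed
  also have "\<dots> = ((\<integral>\<^sup>+s. \<integral>\<^sup>+t. ennreal ((\<Phi> s)\<^sup>2 * k s t) \<partial>lborel \<partial>lborel)
      + (\<integral>\<^sup>+s. \<integral>\<^sup>+t. ennreal ((\<Phi> t)\<^sup>2 * k s t) \<partial>lborel \<partial>lborel)) / 2"
    by (simp add: nn_integral_divide nn_integral_add)
  also have "\<dots> \<le> (ennreal (pi / 2 * (LBINT t. (\<Phi> t)\<^sup>2)) + ennreal (pi / 2 * (LBINT t. (\<Phi> t)\<^sup>2))) / 2"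
    by (intro divide_right_mono_ennreal add_mono le1 le2)
  also have "\<dots> = ennreal (pi / 2 * (LBINT t. (\<Phi> t)\<^sup>2))"
    by (intro ennreal_mean_self mult_nonneg_nonneg integral_nonneg_AE) auto
  finally show ?thesis by (simp add: ennreal_le_iff)
qed

lemma poisson_form_nonneg:
  assumes "\<mu> > 0" shows "poisson_form \<mu> \<ge> 0"
  unfolding integral_exp_K_sq[OF assms, symmetric] by (intro integral_nonneg_AE) auto

lemma K_sq_bound: "\<bar>(K x)\<^sup>2\<bar> \<le> B\<^sup>2"
  using power_mono[OF K_bound[of x], of 2] by simp

lemma nn_integral_exp_K_sq:
  assumes "\<mu> > 0"
  shows "(\<integral>\<^sup>+x. ennreal (indicator {0<..} x * exp (- (\<mu> * x)) * (K x)\<^sup>2) \<partial>lborel) = ennreal (poisson_form \<mu>)"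
  unfolding integral_exp_K_sq[OF assms, symmetric]
  by (intro nn_integral_eq_integral integrable_exp_weight[OF assms _ K_sq_bound]) auto

text \<open>One half of Plancherel's identity, from the damped integrals by Fatou's lemma as \<open>\<mu>\<close> tends to \<open>0\<close>.\<close>

lemma nn_integral_K_sq_le:
  "(\<integral>\<^sup>+x. ennreal (indicator {0<..} x * (K x)\<^sup>2) \<partial>lborel) \<le> ennreal (pi / 2 * (LBINT t. (\<Phi> t)\<^sup>2))"
proof -
  define f where "f = (\<lambda>n x. indicator {0<..} x * exp (- (inverse (real (Suc n)) * x)) * (K x)\<^sup>2)"
  have [measurable]: "f n \<in> borel_measurable borel" for n unfolding f_def by measurable
  have "ennreal (indicator {0<..} x * (K x)\<^sup>2) = liminf (\<lambda>n. ennreal (f n x))" for x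
  proof -
    have "(\<lambda>n. f n x) \<longlonglongrightarrow> indicator {0<..} x * exp (- (0 * x)) * (K x)\<^sup>2"
      unfolding f_def by (intro tendsto_intros LIMSEQ_inverse_real_of_nat)
    then show ?thesis
      using lim_imp_Liminf[OF sequentially_bot tendsto_ennrealI] by fastforce
  qed
  then have "(\<integral>\<^sup>+x. ennreal (indicator {0<..} x * (K x)\<^sup>2) \<partial>lborel) \<le> liminf (\<lambda>n. \<integral>\<^sup>+x. ennreal (f n x) \<partial>lborel)"
    by (simp add: nn_integral_liminf)
  also have "\<dots> \<le> liminf (\<lambda>n. ennreal (pi / 2 * (LBINT t. (\<Phi> t)\<^sup>2)))"
  proof (intro Liminf_mono always_eventually allI)
    fix n
    have n: "inverse (real (Suc n)) > 0" by simp
    show "(\<integral>\<^sup>+x. ennreal (f n x) \<partial>lborel) \<le> ennreal (pi / 2 * (LBINT t. (\<Phi> t)\<^sup>2))"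
      unfolding f_def nn_integral_exp_K_sq[OF n] by (intro ennreal_leI poisson_form_le n)
  qed
  finally show ?thesis by (simp add: Liminf_const)
qed

definition log_form :: real where
  "log_form = (LBINT s. \<Phi> s * (LBINT t. \<Phi> t * log_kernel s t))"

text \<open>Fubini, applied twice; the logarithmic kernel is integrable in each variable, with integral at
  most \<open>4\<close> over the unit interval.\<close>

lemma integral_poisson_form:
  "integrable lborel (\<lambda>\<mu>. indicator {0<..} \<mu> * poisson_form \<mu>)"
  "(LBINT \<mu>. indicator {0<..} \<mu> * poisson_form \<mu>) = log_form / 2"
proof -
  define P where "P = (\<lambda>\<mu> s t. indicator {0<..} \<mu> * poisson_diff \<mu> s t :: real)"
  have [measurable]: "(\<lambda>x. P (f x) (g x) (h x)) \<in> borel_measurable M"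
    if [measurable]: "f \<in> borel_measurable M" "g \<in> borel_measurable M" "h \<in> borel_measurable M" for f g h M
    unfolding P_def by measurable
  have P0: "P \<mu> s t \<ge> 0" if "0 \<le> s" "0 \<le> t" for \<mu> s t
    using that by (auto simp: P_def poisson_diff_nonneg split: split_indicator)
  have intP: "(\<integral>\<^sup>+\<mu>. ennreal (P \<mu> s t) \<partial>lborel) = ennreal (log_kernel s t / 2)"
    if "0 < s" "0 < t" "s \<noteq> t" for s t
  proof -
    have "(\<integral>\<^sup>+\<mu>. ennreal (P \<mu> s t) \<partial>lborel) = (\<integral>\<^sup>+\<mu>. ennreal (poisson_diff \<mu> s t) * indicator {0..} \<mu> \<partial>lborel)"
      by (intro nn_integral_cong) (auto simp: P_def poisson_diff_def split: split_indicator)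
    then show ?thesis using nn_integral_poisson_diff_eq_log_kernel[OF that] by simp
  qed
  have \<Phi>P: "\<bar>\<Phi> t * P \<mu> s t\<bar> \<le> B * (indicator {0..1} t * P \<mu> s t)" if "s \<ge> 0" for \<mu> s t
    using \<Phi>_bound[of t] \<Phi>_support[of t] P0[of s t \<mu>] that
    by (auto simp: abs_mult mult_right_mono split: split_indicator)
  have fin: "(\<integral>\<^sup>+t. \<integral>\<^sup>+\<mu>. ennreal \<bar>\<Phi> t * P \<mu> s t\<bar> \<partial>lborel \<partial>lborel) \<le> ennreal (B * 4)" if s: "s \<in> {0<..1}" for s
  proof -
    have "(\<integral>\<^sup>+t. \<integral>\<^sup>+\<mu>. ennreal \<bar>\<Phi> t * P \<mu> s t\<bar> \<partial>lborel \<partial>lborel)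
        \<le> (\<integral>\<^sup>+t. ennreal B * (ennreal (log_kernel s t) * indicator {0..1} t) \<partial>lborel)"
    proof (intro nn_integral_mono_AE)
      have "AE t in lborel. t \<noteq> 0 \<and> t \<noteq> s"
        using AE_lborel_singleton[of 0] AE_lborel_singleton[of s] by eventually_elim auto
      then show "AE t in lborel. (\<integral>\<^sup>+\<mu>. ennreal \<bar>\<Phi> t * P \<mu> s t\<bar> \<partial>lborel) \<le> ennreal B * (ennreal (log_kernel s t) * indicator {0..1} t)"
      proof eventually_elim
        case (elim t)
        show ?case
        proof (cases "t \<in> {0..1}")
          case True
          have "(\<integral>\<^sup>+\<mu>. ennreal \<bar>\<Phi> t * P \<mu> s t\<bar> \<partial>lborel) \<le> (\<integral>\<^sup>+\<mu>. ennreal B * ennreal (P \<mu> s t) \<partial>lborel)"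
            using \<Phi>P[of s t] s True B_nonneg
            by (intro nn_integral_mono) (auto simp: ennreal_mult'[symmetric] intro!: ennreal_leI)
          also have "\<dots> = ennreal B * ennreal (log_kernel s t / 2)"
            using intP[of s t] s True elim by (simp add: nn_integral_cmult)
          also have "\<dots> \<le> ennreal B * ennreal (log_kernel s t)"
            using log_kernel_nonneg[of s t] s True by (intro mult_left_mono ennreal_leI) auto
          finally show ?thesis using True by simp
        qed (simp add: \<Phi>_support)
      qed
    qed
    also have "\<dots> = ennreal B * (\<integral>\<^sup>+t. ennreal (log_kernel s t) * indicator {0..1} t \<partial>lborel)"
      by (rule nn_integral_cmult) measurable
    also have "\<dots> \<le> ennreal B * ennreal 4"
      using s by (intro mult_left_mono nn_integral_log_kernel_le) auto
    finally show ?thesis using B_nonneg by (simp add: ennreal_mult')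
  qed
  define R where "R = (\<lambda>\<mu> s. LBINT t. \<Phi> t * P \<mu> s t)"
  have [measurable]: "(\<lambda>(\<mu>, s). R \<mu> s) \<in> borel_measurable (borel \<Otimes>\<^sub>M borel)"
    unfolding R_def by measurable
  have R_int: "(LBINT \<mu>. R \<mu> s) = (LBINT t. \<Phi> t * (log_kernel s t / 2))" if s: "s \<in> {0<..1}" for s
  proof -
    have "(LBINT \<mu>. R \<mu> s) = (LBINT t. LBINT \<mu>. \<Phi> t * P \<mu> s t)"
      unfolding R_def
      by (rule lborel_Fubini_of_finite(2)[symmetric]) (use fin[OF s] in \<open>auto elim!: le_less_trans\<close>)
    also have "\<dots> = (LBINT t. \<Phi> t * (log_kernel s t / 2))"
    proof (rule integral_cong_AE)
      have "AE t in lborel. t \<noteq> 0 \<and> t \<noteq> s"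
        using AE_lborel_singleton[of 0] AE_lborel_singleton[of s] by eventually_elim auto
      then show "AE t in lborel. (LBINT \<mu>. \<Phi> t * P \<mu> s t) = \<Phi> t * (log_kernel s t / 2)"
      proof eventually_elim
        case (elim t)
        show ?case
        proof (cases "t \<in> {0..1}")
          case True
          with elim s have st: "0 < s" "0 < t" "s \<noteq> t" by auto
          have "(LBINT \<mu>. P \<mu> s t) = enn2real (\<integral>\<^sup>+\<mu>. ennreal (P \<mu> s t) \<partial>lborel)"
            using P0[of s t] st by (intro integral_eq_nn_integral) auto
          also have "\<dots> = log_kernel s t / 2"
            unfolding intP[OF st] using log_kernel_nonneg[of s t] st by simp
          finally show ?thesis by simp
        qed (simp add: \<Phi>_support)
      qed
    qed measurable
    finally show ?thesis .
  qed
  have pf: "indicator {0<..} \<mu> * poisson_form \<mu> = (LBINT s. \<Phi> s * R \<mu> s)" for \<mu>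
    by (auto simp: poisson_form_def R_def P_def split: split_indicator)
  have "(\<integral>\<^sup>+s. \<integral>\<^sup>+\<mu>. ennreal \<bar>\<Phi> s * R \<mu> s\<bar> \<partial>lborel \<partial>lborel) \<le> (\<integral>\<^sup>+s. ennreal (B * (B * 4)) * indicator {0..1::real} s \<partial>lborel)"
  proof (intro nn_integral_mono_AE)
    show "AE s in lborel. (\<integral>\<^sup>+\<mu>. ennreal \<bar>\<Phi> s * R \<mu> s\<bar> \<partial>lborel) \<le> ennreal (B * (B * 4)) * indicator {0..1} s"
      using AE_lborel_singleton[of 0]
    proof eventually_elim
      case (elim s)
      show ?case
      proof (cases "s \<in> {0..1}")
        case True
        with elim have s: "s \<in> {0<..1}" by auto
        have "(\<integral>\<^sup>+\<mu>. ennreal \<bar>\<Phi> s * R \<mu> s\<bar> \<partial>lborel) \<le> (\<integral>\<^sup>+\<mu>. ennreal B * (\<integral>\<^sup>+t. ennreal \<bar>\<Phi> t * P \<mu> s t\<bar> \<partial>lborel) \<partial>lborel)"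
        proof (intro nn_integral_mono)
          fix \<mu>
          have "ennreal \<bar>\<Phi> s * R \<mu> s\<bar> = ennreal \<bar>\<Phi> s\<bar> * ennreal \<bar>R \<mu> s\<bar>" by (simp add: abs_mult ennreal_mult')
          also have "\<dots> \<le> ennreal B * (\<integral>\<^sup>+t. ennreal \<bar>\<Phi> t * P \<mu> s t\<bar> \<partial>lborel)"
            unfolding R_def by (intro mult_mono ennreal_leI \<Phi>_bound ennreal_integral_le) auto
          finally show "ennreal \<bar>\<Phi> s * R \<mu> s\<bar> \<le> ennreal B * (\<integral>\<^sup>+t. ennreal \<bar>\<Phi> t * P \<mu> s t\<bar> \<partial>lborel)" .
        qed
        also have "\<dots> = ennreal B * (\<integral>\<^sup>+\<mu>. \<integral>\<^sup>+t. ennreal \<bar>\<Phi> t * P \<mu> s t\<bar> \<partial>lborel \<partial>lborel)"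
          by (rule nn_integral_cmult) measurable
        also have "(\<integral>\<^sup>+\<mu>. \<integral>\<^sup>+t. ennreal \<bar>\<Phi> t * P \<mu> s t\<bar> \<partial>lborel \<partial>lborel) = (\<integral>\<^sup>+t. \<integral>\<^sup>+\<mu>. ennreal \<bar>\<Phi> t * P \<mu> s t\<bar> \<partial>lborel \<partial>lborel)"
          by (rule lborel_pair.Fubini') measurable
        also have "ennreal B * \<dots> \<le> ennreal B * ennreal (B * 4)"
          by (intro mult_left_mono fin s) auto
        finally show ?thesis using True B_nonneg by (simp add: ennreal_mult')
      qed (simp add: \<Phi>_support)
    qed
  qed
  also have "\<dots> < \<infinity>" by (simp add: nn_integral_cmult ennreal_mult_less_top)
  finally have fin2: "(\<integral>\<^sup>+\<mu>. \<integral>\<^sup>+s. ennreal \<bar>\<Phi> s * R \<mu> s\<bar> \<partial>lborel \<partial>lborel) < \<infinity>"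
    by (subst lborel_pair.Fubini') auto
  show "integrable lborel (\<lambda>\<mu>. indicator {0<..} \<mu> * poisson_form \<mu>)"
    unfolding pf by (rule lborel_Fubini_of_finite(1)[OF _ fin2]) measurable
  have "(LBINT \<mu>. indicator {0<..} \<mu> * poisson_form \<mu>) = (LBINT s. LBINT \<mu>. \<Phi> s * R \<mu> s)"
    unfolding pf by (rule lborel_Fubini_of_finite(2)[OF _ fin2]) measurable
  also have "\<dots> = (LBINT s. \<Phi> s * (LBINT t. \<Phi> t * log_kernel s t) / 2)"
  proof (rule integral_cong_AE)
    show "AE s in lborel. (LBINT \<mu>. \<Phi> s * R \<mu> s) = \<Phi> s * (LBINT t. \<Phi> t * log_kernel s t) / 2"
      using AE_lborel_singleton[of 0]
    proof eventually_elim
      case (elim s)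
      show ?case
      proof (cases "s \<in> {0..1}")
        case True
        with elim have s: "s \<in> {0<..1}" by auto
        then show ?thesis using R_int[OF s] by simp
      qed (simp add: \<Phi>_support)
    qed
  qed measurable
  also have "\<dots> = log_form / 2" by (simp add: log_form_def)
  finally show "(LBINT \<mu>. indicator {0<..} \<mu> * poisson_form \<mu>) = log_form / 2" .
qed

text \<open>The identity that makes the logarithmic kernel appear: write \<open>1 / x\<close> as the integral of
  \<open>exp (- \<mu> x)\<close> over \<open>\<mu> > 0\<close> and exchange the integrations.\<close>

theorem nn_integral_K_sq_div:
  "(\<integral>\<^sup>+x. ennreal (indicator {0<..} x * ((K x)\<^sup>2 / x)) \<partial>lborel) = ennreal (log_form / 2)"
proof -
  have "ennreal (indicator {0<..} x * ((K x)\<^sup>2 / x))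
      = (\<integral>\<^sup>+\<mu>. ennreal (indicator {0<..} \<mu> * (indicator {0<..} x * exp (- (\<mu> * x)) * (K x)\<^sup>2)) \<partial>lborel)" for x
  proof (cases "x > 0")
    case True
    have "has_bochner_integral lborel (\<lambda>\<mu>. indicator {0<..} \<mu> * exp (- (x * \<mu>)) * cos (0 * \<mu>) * (K x)\<^sup>2) (x / (x\<^sup>2 + 0\<^sup>2) * (K x)\<^sup>2)"
      by (intro has_bochner_integral_mult_left exp_cos_integral True)
    then have "(\<integral>\<^sup>+\<mu>. ennreal (indicator {0<..} \<mu> * exp (- (x * \<mu>)) * cos (0 * \<mu>) * (K x)\<^sup>2) \<partial>lborel) = ennreal (x / (x\<^sup>2 + 0\<^sup>2) * (K x)\<^sup>2)"
      by (subst nn_integral_eq_integral) (auto simp: has_bochner_integral_iff)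
    then show ?thesis using True by (simp add: power2_eq_square mult_ac)
  qed simp
  then have "(\<integral>\<^sup>+x. ennreal (indicator {0<..} x * ((K x)\<^sup>2 / x)) \<partial>lborel)
     = (\<integral>\<^sup>+x. \<integral>\<^sup>+\<mu>. ennreal (indicator {0<..} \<mu> * (indicator {0<..} x * exp (- (\<mu> * x)) * (K x)\<^sup>2)) \<partial>lborel \<partial>lborel)"
    by simp
  also have "\<dots> = (\<integral>\<^sup>+\<mu>. \<integral>\<^sup>+x. ennreal (indicator {0<..} \<mu> * (indicator {0<..} x * exp (- (\<mu> * x)) * (K x)\<^sup>2)) \<partial>lborel \<partial>lborel)"
    by (rule lborel_pair.Fubini') measurable
  also have "\<dots> = (\<integral>\<^sup>+\<mu>. ennreal (indicator {0<..} \<mu> * poisson_form \<mu>) \<partial>lborel)"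
  proof (intro nn_integral_cong)
    fix \<mu> :: real
    show "(\<integral>\<^sup>+x. ennreal (indicator {0<..} \<mu> * (indicator {0<..} x * exp (- (\<mu> * x)) * (K x)\<^sup>2)) \<partial>lborel) = ennreal (indicator {0<..} \<mu> * poisson_form \<mu>)"
      using nn_integral_exp_K_sq[of \<mu>] by (cases "\<mu> > 0") simp_all
  qed
  also have "\<dots> = ennreal (log_form / 2)"
    unfolding integral_poisson_form(2)[symmetric]
    by (intro nn_integral_eq_integral integral_poisson_form(1)) (auto simp: poisson_form_nonneg split: split_indicator)
  finally show ?thesis .
qed

end

section \<open>Moments of the logarithmic kernel\<close>

text \<open>The closed form of the integral of \<open>t\<^bsup>2m+1\<^esup> log_kernel s t\<close> over \<open>t \<in> [0, 1]\<close>.\<close>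

definition log_moment :: "nat \<Rightarrow> real \<Rightarrow> real" where
  "log_moment m s = ((1 - s ^ (2 * m + 2)) * log_kernel s 1
     + 2 * (\<Sum>j\<le>m. s ^ (2 * (m - j) + 1) / real (2 * j + 1))) / real (2 * m + 2)"

text \<open>The factor \<open>t\<^bsup>n\<^esup> - s\<^bsup>n\<^esup>\<close> removes the singularity at \<open>t = s\<close>; this is what the primitive of
  \<open>t\<^bsup>n-1\<^esup> log_kernel s t\<close> contains.\<close>

lemma continuous_on_log_kernel_mult:
  assumes "s > 0"
  shows "continuous_on {0..1} (\<lambda>t. (t ^ n - s ^ n) * log_kernel s t)"
proof -
  have eq: "(t ^ n - s ^ n) * log_kernel s t
      = (t ^ n - s ^ n) * ln (s + t) - ((t - s) * ln \<bar>t - s\<bar>) * (\<Sum>i<n. s ^ (n - Suc i) * t ^ i)" if "t \<in> {0..1}" for t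
  proof (cases "t = s")
    case False
    then have "log_kernel s t = ln (s + t) - ln \<bar>t - s\<bar>"
      using assms that by (simp add: log_kernel_def ln_div abs_minus_commute)
    then have "(t ^ n - s ^ n) * log_kernel s t = (t ^ n - s ^ n) * ln (s + t) - (t ^ n - s ^ n) * ln \<bar>t - s\<bar>"
      by (simp only: right_diff_distrib)
    also have "(t ^ n - s ^ n) * ln \<bar>t - s\<bar> = ((t - s) * ln \<bar>t - s\<bar>) * (\<Sum>i<n. s ^ (n - Suc i) * t ^ i)"
      by (subst power_diff_sumr2) (simp only: mult_ac)
    finally show ?thesis .
  qed simp
  have "continuous_on {0..1} (\<lambda>t. (t ^ n - s ^ n) * ln (s + t) - ((t - s) * ln \<bar>t - s\<bar>) * (\<Sum>i<n. s ^ (n - Suc i) * t ^ i))"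
    using assms by (intro continuous_intros) auto
  then show ?thesis by (rule continuous_on_eq) (rule eq[symmetric])
qed

lemma nn_integral_log_moment:
  assumes s: "s \<in> {0<..1}"
  shows "(\<integral>\<^sup>+t. ennreal (t ^ (2 * m + 1) * log_kernel s t) * indicator {0..1} t \<partial>lborel) = ennreal (log_moment m s)"
proof -
  define S where "S = (\<lambda>t. \<Sum>j\<le>m. s ^ (2 * (m - j) + 1) / real (2 * j + 1) * t ^ (2 * j + 1))"
  define F where "F = (\<lambda>t. ((t ^ (2 * m + 2) - s ^ (2 * m + 2)) * log_kernel s t + 2 * S t) / real (2 * m + 2))"
  have "(\<integral>\<^sup>+t. ennreal (t ^ (2 * m + 1) * log_kernel s t) * indicator {0..1} t \<partial>lborel) = ennreal (F 1 - F 0)"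
  proof (rule nn_integral_FTC_interior[of _ _ "{s}"])
    show "continuous_on {0..1} F"
      unfolding F_def S_def using s
      by (intro continuous_on_divide continuous_on_add continuous_on_log_kernel_mult continuous_intros) auto
    show "(F has_real_derivative x ^ (2 * m + 1) * log_kernel s x) (at x)" if x: "x \<in> {0<..<1} - {s}" for x
    proof -
      define k where "k = (\<lambda>t. ln (s + t) - ln ((s - t)\<^sup>2) / 2)"
      have k_eq: "k t = log_kernel s t" if "t \<in> {0<..} - {s}" for t
      proof -
        have "ln ((s - t)\<^sup>2) = 2 * ln \<bar>s - t\<bar>"
          using that ln_realpow[of "\<bar>s - t\<bar>" 2] by simp
        then show ?thesis using that s by (simp add: k_def log_kernel_def ln_div)
      qed
      have dk: "(k has_real_derivative (1 / (s + x) - 1 / (x - s))) (at x)"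
      proof -
        have "(s - x)\<^sup>2 > 0" "s + x > 0" using x s by auto
        then have "(k has_real_derivative (1 / (s + x) * (0 + 1) - (1 / (s - x)\<^sup>2 * (2 * (s - x) * (0 - 1))) / 2)) (at x)"
          unfolding k_def by (auto intro!: derivative_eq_intros, simp add: frac_eq_eq algebra_simps)
        also have "(1 / (s - x)\<^sup>2 * (2 * (s - x) * (0 - 1))) / 2 = 1 / (x - s)"
          using x by (simp add: power2_eq_square divide_simps) (simp add: algebra_simps)
        finally show ?thesis by simp
      qed
      have dS: "(S has_real_derivative (\<Sum>j\<le>m. s ^ (2 * (m - j) + 1) * x ^ (2 * j))) (at x)"
        unfolding S_def
      proof (rule DERIV_sum)
        fix j
        show "((\<lambda>t. s ^ (2 * (m - j) + 1) / real (2 * j + 1) * t ^ (2 * j + 1)) has_real_derivative s ^ (2 * (m - j) + 1) * x ^ (2 * j)) (at x)"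
          using DERIV_cmult[OF DERIV_pow[of "2 * j + 1" x UNIV], of "s ^ (2 * (m - j) + 1) / real (2 * j + 1)"] by (simp add: mult.assoc)
      qed
      have geo: "(x ^ (2 * m + 2) - s ^ (2 * m + 2)) = (x\<^sup>2 - s\<^sup>2) * (\<Sum>j\<le>m. s ^ (2 * (m - j)) * x ^ (2 * j))"
      proof -
        have "(x\<^sup>2) ^ Suc m - (s\<^sup>2) ^ Suc m = (x\<^sup>2 - s\<^sup>2) * (\<Sum>j<Suc m. (s\<^sup>2) ^ (Suc m - Suc j) * (x\<^sup>2) ^ j)"
          by (rule power_diff_sumr2)
        moreover have "(x\<^sup>2) ^ Suc m = x ^ (2 * m + 2)" "(s\<^sup>2) ^ Suc m = s ^ (2 * m + 2)"
          by (simp_all only: power_mult[symmetric]) simp_all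
        moreover have "(\<Sum>j<Suc m. (s\<^sup>2) ^ (Suc m - Suc j) * (x\<^sup>2) ^ j) = (\<Sum>j\<le>m. s ^ (2 * (m - j)) * x ^ (2 * j))"
          unfolding lessThan_Suc_atMost by (simp only: power_mult[symmetric] diff_Suc_Suc)
        ultimately show ?thesis by (simp only:)
      qed
      have "((\<lambda>t. ((t ^ (2 * m + 2) - s ^ (2 * m + 2)) * k t + 2 * S t) / real (2 * m + 2)) has_real_derivative
         ((real (2 * m + 2) * x ^ (2 * m + 1)) * k x + (x ^ (2 * m + 2) - s ^ (2 * m + 2)) * (1 / (s + x) - 1 / (x - s))
           + 2 * (\<Sum>j\<le>m. s ^ (2 * (m - j) + 1) * x ^ (2 * j))) / real (2 * m + 2)) (at x)"
        by (rule derivative_eq_intros refl dk dS | simp)+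
      also have "(x ^ (2 * m + 2) - s ^ (2 * m + 2)) * (1 / (s + x) - 1 / (x - s)) = - 2 * s * (\<Sum>j\<le>m. s ^ (2 * (m - j)) * x ^ (2 * j))"
      proof -
        have "(x\<^sup>2 - s\<^sup>2) * (1 / (s + x) - 1 / (x - s)) = - 2 * s"
          using x s by (simp add: divide_simps power2_eq_square) (simp add: algebra_simps)
        moreover have "(A * S') * D = (A * D) * S'" for A S' D :: real by simp
        ultimately show ?thesis unfolding geo by metis
      qed
      also have "2 * (\<Sum>j\<le>m. s ^ (2 * (m - j) + 1) * x ^ (2 * j)) = 2 * s * (\<Sum>j\<le>m. s ^ (2 * (m - j)) * x ^ (2 * j))"
        by (simp add: sum_distrib_left mult_ac)
      also have "((real (2 * m + 2) * x ^ (2 * m + 1)) * k x + - 2 * s * Z + 2 * s * Z) / real (2 * m + 2) = x ^ (2 * m + 1) * k x" for Z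
        by (simp del: of_nat_add of_nat_mult)
      finally have "((\<lambda>t. ((t ^ (2 * m + 2) - s ^ (2 * m + 2)) * k t + 2 * S t) / real (2 * m + 2)) has_real_derivative
         (x ^ (2 * m + 1) * k x)) (at x)" .
      then have "(F has_real_derivative x ^ (2 * m + 1) * k x) (at x)"
        unfolding F_def
        by (rule has_field_derivative_transform_within_open[of _ _ _ "{0<..} - {s}"])
           (use x k_eq in \<open>auto simp: open_delete\<close>)
      then show ?thesis using k_eq[of x] x by simp
    qed
    show "0 \<le> x ^ (2 * m + 1) * log_kernel s x" if "x \<in> {0..1}" for x
      using that s by (auto intro!: mult_nonneg_nonneg log_kernel_nonneg)
  qed auto
  moreover have "F 0 = 0" using s by (simp add: F_def S_def log_kernel_def)
  moreover have "F 1 = log_moment m s" by (simp add: F_def S_def log_moment_def)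
  ultimately show ?thesis by simp
qed

lemma log_moment_nonneg:
  assumes "s \<in> {0<..1}" shows "log_moment m s \<ge> 0"
proof -
  have "(1 - s ^ (2 * m + 2)) * log_kernel s 1 \<ge> 0"
    using assms power_le_one[of s "2 * m + 2"] by (intro mult_nonneg_nonneg log_kernel_nonneg) auto
  moreover have "(\<Sum>j\<le>m. s ^ (2 * (m - j) + 1) / real (2 * j + 1)) \<ge> 0"
    using assms by (intro sum_nonneg) auto
  ultimately show ?thesis by (simp add: log_moment_def)
qed

lemma has_bochner_integral_log_moment:
  assumes s: "s \<in> {0<..1}"
  shows "has_bochner_integral lborel (\<lambda>t. indicator {0..1} t * t ^ (2 * m + 1) * log_kernel s t) (log_moment m s)"
proof (rule has_bochner_integral_nn_integral)
  show "AE t in lborel. 0 \<le> indicator {0..1} t * t ^ (2 * m + 1) * log_kernel s t"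
    using s by (auto intro!: mult_nonneg_nonneg log_kernel_nonneg split: split_indicator)
  have "(\<integral>\<^sup>+t. ennreal (indicator {0..1} t * t ^ (2 * m + 1) * log_kernel s t) \<partial>lborel)
      = (\<integral>\<^sup>+t. ennreal (t ^ (2 * m + 1) * log_kernel s t) * indicator {0..1} t \<partial>lborel)"
    by (intro nn_integral_cong) (auto split: split_indicator)
  then show "(\<integral>\<^sup>+t. ennreal (indicator {0..1} t * t ^ (2 * m + 1) * log_kernel s t) \<partial>lborel) = ennreal (log_moment m s)"
    using nn_integral_log_moment[OF s] by simp
qed (use log_moment_nonneg[OF s] in auto)

text \<open>The moment \<open>log_moment m 1\<close>, where the logarithm drops out.\<close>

definition moment_at_one :: "nat \<Rightarrow> real" where
  "moment_at_one m = (\<Sum>j\<le>m. 1 / real (2 * j + 1)) / real (m + 1)"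

lemma log_moment_one: "log_moment m 1 = moment_at_one m"
  by (simp add: log_moment_def moment_at_one_def field_simps)

text \<open>The closed form of the integral of \<open>s\<^bsup>2l+1\<^esup> log_moment m s\<close> over \<open>s \<in> [0, 1]\<close>, that is, the entries of
  the logarithmic form in the basis of odd powers.\<close>

definition log_moment2 :: "nat \<Rightarrow> nat \<Rightarrow> real" where
  "log_moment2 l m = (moment_at_one l - moment_at_one (l + m + 1)
     + 2 * (\<Sum>j\<le>m. 1 / (real (2 * j + 1) * real (2 * (l + m - j) + 3)))) / real (2 * m + 2)"

lemma has_bochner_integral_power_Icc01:
  "has_bochner_integral lborel (\<lambda>s::real. indicator {0..1} s * s ^ n) (1 / real (n + 1))"
proof -
  have "((\<lambda>s. s ^ Suc n / real (Suc n)) has_real_derivative x ^ n) (at x)" for x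
    by (auto intro!: derivative_eq_intros simp del: of_nat_Suc power_Suc)
  then have "has_bochner_integral lborel (\<lambda>s::real. s ^ n * indicator {0..1} s) (1 ^ Suc n / real (Suc n) - 0 ^ Suc n / real (Suc n))"
    by (intro has_bochner_integral_FTC_Icc_real) auto
  then show ?thesis by (simp add: mult.commute[of "indicator _ _"])
qed

lemma has_bochner_integral_log_moment2:
  "has_bochner_integral lborel (\<lambda>s. indicator {0..1} s * s ^ (2 * l + 1) * log_moment m s) (log_moment2 l m)"
proof -
  have 1: "has_bochner_integral lborel (\<lambda>s. indicator {0..1} s * s ^ (2 * i + 1) * log_kernel s 1) (moment_at_one i)" for i
    using has_bochner_integral_log_moment[of 1 i] by (simp add: log_moment_one log_kernel_commute[of 1])
  have 2: "has_bochner_integral lborel (\<lambda>s. \<Sum>j\<le>m. (indicator {0..1} s * s ^ (2 * (l + m - j) + 2)) * (1 / real (2 * j + 1)))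
      (\<Sum>j\<le>m. (1 / real (2 * (l + m - j) + 2 + 1)) * (1 / real (2 * j + 1)))"
    by (intro has_bochner_integral_sum has_bochner_integral_mult_left has_bochner_integral_power_Icc01)
  have "has_bochner_integral lborel (\<lambda>s. (indicator {0..1} s * s ^ (2 * l + 1) * log_kernel s 1
       - indicator {0..1} s * s ^ (2 * (l + m + 1) + 1) * log_kernel s 1
       + 2 * (\<Sum>j\<le>m. (indicator {0..1} s * s ^ (2 * (l + m - j) + 2)) * (1 / real (2 * j + 1)))) / real (2 * m + 2))
     ((moment_at_one l - moment_at_one (l + m + 1) + 2 * (\<Sum>j\<le>m. (1 / real (2 * (l + m - j) + 2 + 1)) * (1 / real (2 * j + 1)))) / real (2 * m + 2))"
    by (intro has_bochner_integral_divide_zero has_bochner_integral_add has_bochner_integral_diff has_bochner_integral_mult_right 1 2)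
  moreover have "(indicator {0..1} s * s ^ (2 * l + 1) * log_kernel s 1
       - indicator {0..1} s * s ^ (2 * (l + m + 1) + 1) * log_kernel s 1
       + 2 * (\<Sum>j\<le>m. (indicator {0..1} s * s ^ (2 * (l + m - j) + 2)) * (1 / real (2 * j + 1)))) / real (2 * m + 2)
     = indicator {0..1} s * s ^ (2 * l + 1) * log_moment m s" for s :: real
  proof -
    have sumeq: "(\<Sum>j\<le>m. (indicator {0..1} s * s ^ (2 * (l + m - j) + 2)) * (1 / real (2 * j + 1)))
        = indicator {0..1} s * s ^ (2 * l + 1) * (\<Sum>j\<le>m. s ^ (2 * (m - j) + 1) / real (2 * j + 1))"
      unfolding sum_distrib_left
    proof (intro sum.cong refl)
      fix j assume "j \<in> {..m}"
      then have "2 * (l + m - j) + 2 = (2 * l + 1) + (2 * (m - j) + 1)" by simp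
      then show "(indicator {0..1} s * s ^ (2 * (l + m - j) + 2)) * (1 / real (2 * j + 1)) = indicator {0..1} s * s ^ (2 * l + 1) * (s ^ (2 * (m - j) + 1) / real (2 * j + 1))"
        by (simp only: power_add) simp
    qed
    have poweq: "s ^ (2 * (l + m + 1) + 1) = s ^ (2 * l + 1) * s ^ (2 * m + 2)"
      by (simp add: power_add[symmetric])
    have gen: "(i * A * L - i * (A * C) * L + 2 * (i * A * S)) / d = i * A * (((1 - C) * L + 2 * S) / d)"
      for i A C L S d :: real by (simp add: algebra_simps)
    show ?thesis unfolding log_moment_def sumeq poweq by (rule gen)
  qed
  moreover have "(\<Sum>j\<le>m. (1 / real (2 * (l + m - j) + 2 + 1)) * (1 / real (2 * j + 1))) = (\<Sum>j\<le>m. 1 / (real (2 * j + 1) * real (2 * (l + m - j) + 3)))"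
    by (intro sum.cong) (auto simp: mult_ac eval_nat_numeral)
  ultimately show ?thesis unfolding log_moment2_def by simp
qed

definition odd_poly :: "real list \<Rightarrow> real \<Rightarrow> real" where
  "odd_poly cs s = (\<Sum>i<length cs. cs ! i * s ^ (2 * i + 1))"

lemma odd_poly_measurable [measurable]:
  assumes [measurable]: "f \<in> borel_measurable M" shows "(\<lambda>x. odd_poly cs (f x)) \<in> borel_measurable M"
  unfolding odd_poly_def by measurable

lemma integral_odd_poly_sq:
  "has_bochner_integral lborel (\<lambda>s. indicator {0..1} s * (odd_poly cs s)\<^sup>2)
     (\<Sum>i<length cs. \<Sum>j<length cs. cs ! i * cs ! j / real (2 * i + 2 * j + 3))"
proof -
  have "has_bochner_integral lborel (\<lambda>s. \<Sum>i<length cs. \<Sum>j<length cs. (cs ! i * cs ! j) * (indicator {0..1} s * s ^ (2 * i + 2 * j + 2)))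
    (\<Sum>i<length cs. \<Sum>j<length cs. (cs ! i * cs ! j) * (1 / real (2 * i + 2 * j + 2 + 1)))"
    by (intro has_bochner_integral_sum has_bochner_integral_mult_right has_bochner_integral_power_Icc01)
  moreover have "(\<Sum>i<length cs. \<Sum>j<length cs. (cs ! i * cs ! j) * (indicator {0..1} s * s ^ (2 * i + 2 * j + 2)))
     = indicator {0..1} s * (odd_poly cs s)\<^sup>2" for s :: real
  proof -
    have sq: "(odd_poly cs s)\<^sup>2 = (\<Sum>i<length cs. \<Sum>j<length cs. (cs ! i * s ^ (2 * i + 1)) * (cs ! j * s ^ (2 * j + 1)))"
      unfolding odd_poly_def power2_eq_square by (rule sum_product)
    show ?thesis
      unfolding sq sum_distrib_left by (simp add: power_add mult_ac power2_eq_square)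
  qed
  ultimately show ?thesis by (simp add: add.commute)
qed

lemma integral_odd_poly_log_kernel:
  assumes "s \<in> {0<..1}"
  shows "has_bochner_integral lborel (\<lambda>t. (indicator {0..1} t * odd_poly cs t) * log_kernel s t) (\<Sum>i<length cs. cs ! i * log_moment i s)"
proof -
  have "has_bochner_integral lborel (\<lambda>t. \<Sum>i<length cs. cs ! i * (indicator {0..1} t * t ^ (2 * i + 1) * log_kernel s t)) (\<Sum>i<length cs. cs ! i * log_moment i s)"
    by (intro has_bochner_integral_sum has_bochner_integral_mult_right has_bochner_integral_log_moment assms)
  moreover have "(\<Sum>i<length cs. cs ! i * (indicator {0..1} t * t ^ (2 * i + 1) * log_kernel s t)) = (indicator {0..1} t * odd_poly cs t) * log_kernel s t" for t :: real
    unfolding odd_poly_def sum_distrib_left sum_distrib_right by (simp add: mult_ac)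
  ultimately show ?thesis by simp
qed

lemma odd_poly_window:
  "sine_window (\<lambda>t. indicator {0..1} t * odd_poly cs t) (\<Sum>i<length cs. \<bar>cs ! i\<bar>)"
proof
  fix t :: real
  show "\<bar>indicator {0..1} t * odd_poly cs t\<bar> \<le> (\<Sum>i<length cs. \<bar>cs ! i\<bar>)"
  proof (cases "t \<in> {0..1}")
    case True
    have "\<bar>odd_poly cs t\<bar> \<le> (\<Sum>i<length cs. \<bar>cs ! i * t ^ (2 * i + 1)\<bar>)" unfolding odd_poly_def by (rule sum_abs)
    also have "\<dots> \<le> (\<Sum>i<length cs. \<bar>cs ! i\<bar>)"
    proof (rule sum_mono)
      fix i
      have "\<bar>t ^ (2 * i + 1)\<bar> \<le> 1" using True power_le_one[of t "2 * i + 1"] by (simp add: abs_mult)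
      then show "\<bar>cs ! i * t ^ (2 * i + 1)\<bar> \<le> \<bar>cs ! i\<bar>" unfolding abs_mult by (rule mult_left_le) simp
    qed
    finally show ?thesis using True by simp
  qed (simp add: sum_nonneg)
qed auto

lemma log_form_odd_poly:
  "sine_window.log_form (\<lambda>t. indicator {0..1} t * odd_poly cs t) = (\<Sum>i<length cs. \<Sum>j<length cs. cs ! i * cs ! j * log_moment2 i j)"
proof -
  have "sine_window.log_form (\<lambda>t. indicator {0..1} t * odd_poly cs t)
     = (LBINT s. (indicator {0..1} s * odd_poly cs s) * (LBINT t. (indicator {0..1} t * odd_poly cs t) * log_kernel s t))"
    by (rule sine_window.log_form_def[OF odd_poly_window])
  also have "\<dots> = (LBINT s. (indicator {0..1} s * odd_poly cs s) * (\<Sum>i<length cs. cs ! i * log_moment i s))"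
  proof (rule integral_cong_AE)
    show "AE s in lborel. (indicator {0..1} s * odd_poly cs s) * (LBINT t. (indicator {0..1} t * odd_poly cs t) * log_kernel s t)
       = (indicator {0..1} s * odd_poly cs s) * (\<Sum>i<length cs. cs ! i * log_moment i s)"
      using AE_lborel_singleton[of 0]
    proof eventually_elim
      case (elim s)
      then show ?case
        using has_bochner_integral_integral_eq[OF integral_odd_poly_log_kernel[of s cs]]
        by (cases "s \<in> {0..1}") auto
    qed
  qed (auto simp: log_moment_def)
  also have "\<dots> = (\<Sum>i<length cs. \<Sum>j<length cs. cs ! i * cs ! j * log_moment2 i j)"
  proof (rule has_bochner_integral_integral_eq)
    have "has_bochner_integral lborel (\<lambda>s. \<Sum>i<length cs. \<Sum>j<length cs. (cs ! i * cs ! j) * (indicator {0..1} s * s ^ (2 * i + 1) * log_moment j s))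
       (\<Sum>i<length cs. \<Sum>j<length cs. cs ! i * cs ! j * log_moment2 i j)"
      by (intro has_bochner_integral_sum has_bochner_integral_mult_right has_bochner_integral_log_moment2)
    moreover have "(\<Sum>i<length cs. \<Sum>j<length cs. (cs ! i * cs ! j) * (indicator {0..1} s * s ^ (2 * i + 1) * log_moment j s))
      = (indicator {0..1} s * odd_poly cs s) * (\<Sum>i<length cs. cs ! i * log_moment i s)" for s :: real
      unfolding odd_poly_def sum_distrib_left[of "indicator {0..1} s"] sum_product
      by (intro sum.cong refl) (simp add: mult_ac)
    ultimately show "has_bochner_integral lborel (\<lambda>s. (indicator {0..1} s * odd_poly cs s) * (\<Sum>i<length cs. cs ! i * log_moment i s))
       (\<Sum>i<length cs. \<Sum>j<length cs. cs ! i * cs ! j * log_moment2 i j)" by simp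
  qed
  finally show ?thesis .
qed

section \<open>An upper bound for the logarithmic form\<close>

lemma continuous_on_mult_ln_sq: "continuous_on {0..} (\<lambda>u::real. u * (ln u)\<^sup>2)"
  unfolding continuous_on_eq_continuous_within
proof
  fix u :: real assume "u \<in> {0..}"
  show "continuous (at u within {0..}) (\<lambda>u. u * (ln u)\<^sup>2)"
  proof (cases "u = 0")
    case True
    have "((\<lambda>u::real. u * (ln u)\<^sup>2) \<longlongrightarrow> 0) (at_right 0)" by real_asymp
    then show ?thesis using True by (simp add: continuous_within at_within_Ici_at_right)
  next
    case False
    have "isCont (\<lambda>u::real. u * (ln u)\<^sup>2) u"
      by (rule isCont_mult[OF continuous_ident isCont_power[OF isCont_ln[OF False]]])
    then show ?thesis by (rule continuous_at_imp_continuous_at_within)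
  qed
qed

text \<open>Replacing \<open>1 + r\<close> by \<open>2\<close> leaves an elementary integral, with value \<open>c\<^sup>2 + 2 c + 2\<close> for \<open>c = ln 2\<close>.\<close>

lemma nn_integral_log_kernel_one_sq_le:
  "(\<integral>\<^sup>+r. ennreal ((log_kernel 1 r)\<^sup>2) * indicator {0..1} r \<partial>lborel) \<le> ennreal 3.88"
proof -
  define c :: real where "c = ln 2"
  have c: "0 \<le> c" "c \<le> 25 / 36" using ln2_le_25_over_36 by (auto simp: c_def)
  have "(\<integral>\<^sup>+r. ennreal ((log_kernel 1 r)\<^sup>2) * indicator {0..1} r \<partial>lborel)
      \<le> (\<integral>\<^sup>+r. ennreal ((c - ln \<bar>1 - r\<bar>)\<^sup>2) * indicator {0..1} (1 - r) \<partial>lborel)"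
  proof (intro nn_integral_mono)
    fix r :: real
    show "ennreal ((log_kernel 1 r)\<^sup>2) * indicator {0..1} r \<le> ennreal ((c - ln \<bar>1 - r\<bar>)\<^sup>2) * indicator {0..1} (1 - r)"
    proof (cases "r \<in> {0..1}")
      case True
      then have "(log_kernel 1 r)\<^sup>2 \<le> (c - ln \<bar>1 - r\<bar>)\<^sup>2"
        using log_kernel_le[of 1 r] log_kernel_nonneg[of 1 r] by (intro power_mono) (auto simp: c_def)
      then show ?thesis using True by (simp add: ennreal_leI)
    qed simp
  qed
  also have "\<dots> = (\<integral>\<^sup>+u. ennreal ((c - ln \<bar>u\<bar>)\<^sup>2) * indicator {0..1} u \<partial>lborel)"
    using nn_integral_real_affine[of "\<lambda>u. ennreal ((c - ln \<bar>u\<bar>)\<^sup>2) * indicator {0..1} u" "-1" 1] by simp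
  also have "\<dots> = ennreal ((\<lambda>u. (c\<^sup>2 + 2 * c + 2) * u - 2 * (c + 1) * (u * ln \<bar>u\<bar>) + u * (ln u)\<^sup>2) 1
      - (\<lambda>u. (c\<^sup>2 + 2 * c + 2) * u - 2 * (c + 1) * (u * ln \<bar>u\<bar>) + u * (ln u)\<^sup>2) 0)"
  proof (rule nn_integral_FTC_interior[of _ _ "{}"])
    show "((\<lambda>u. (c\<^sup>2 + 2 * c + 2) * u - 2 * (c + 1) * (u * ln \<bar>u\<bar>) + u * (ln u)\<^sup>2) has_real_derivative (c - ln \<bar>x\<bar>)\<^sup>2) (at x)"
      if "x \<in> {0<..<1} - {}" for x :: real
    proof -
      have "((\<lambda>u. (c\<^sup>2 + 2 * c + 2) * u - 2 * (c + 1) * (u * ln u) + u * (ln u)\<^sup>2) has_real_derivative (c - ln \<bar>x\<bar>)\<^sup>2) (at x)"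
      proof -
        have "((\<lambda>u. (c\<^sup>2 + 2 * c + 2) * u - 2 * (c + 1) * (u * ln u) + u * (ln u)\<^sup>2) has_real_derivative
          (c\<^sup>2 + 2 * c + 2) - 2 * (c + 1) * (ln x + 1) + ((ln x)\<^sup>2 + 2 * ln x)) (at x)"
          using that by (auto intro!: derivative_eq_intros)
        then show ?thesis using that by (simp add: power2_diff algebra_simps)
      qed
      then show ?thesis
        by (rule has_field_derivative_transform_within_open[of _ _ _ "{0<..}"]) (use that in auto)
    qed
    show "continuous_on {0..1} (\<lambda>u::real. (c\<^sup>2 + 2 * c + 2) * u - 2 * (c + 1) * (u * ln \<bar>u\<bar>) + u * (ln u)\<^sup>2)"
      by (intro continuous_intros continuous_on_subset[OF continuous_on_mult_ln_sq]) auto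
  qed auto
  also have "\<dots> \<le> ennreal 3.88"
  proof (rule ennreal_leI)
    have "c\<^sup>2 \<le> (25 / 36)\<^sup>2" using c by (intro power_mono) auto
    then show "(\<lambda>u. (c\<^sup>2 + 2 * c + 2) * u - 2 * (c + 1) * (u * ln \<bar>u\<bar>) + u * (ln u)\<^sup>2) 1
      - (\<lambda>u. (c\<^sup>2 + 2 * c + 2) * u - 2 * (c + 1) * (u * ln \<bar>u\<bar>) + u * (ln u)\<^sup>2) 0 \<le> 3.88"
      using c by (simp add: power2_eq_square)
  qed
  finally show ?thesis .
qed

lemma log_kernel_scale:
  assumes "s > 0" shows "log_kernel s (s * r) = log_kernel 1 r"
proof -
  have "s + s * r = s * (1 + r)" "\<bar>s - s * r\<bar> = s * \<bar>1 - r\<bar>"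
    using assms abs_mult[of s "1 - r"] by (simp_all add: algebra_simps)
  then show ?thesis using assms by (simp add: log_kernel_def)
qed

text \<open>The kernel is symmetric and homogeneous of degree \<open>0\<close>: the substitution \<open>t = s r\<close> on the triangle
  \<open>t \<le> s\<close> reduces the Hilbert-Schmidt norm to a one-dimensional integral.\<close>

lemma nn_integral_log_kernel_sq_le:
  "(\<integral>\<^sup>+s. \<integral>\<^sup>+t. ennreal ((log_kernel s t)\<^sup>2) * indicator {0..1} s * indicator {0..1} t \<partial>lborel \<partial>lborel) \<le> ennreal 3.88"
proof -
  define f where "f = (\<lambda>s t. ennreal ((log_kernel s t)\<^sup>2) * indicator {0..1} s * indicator {0..1} t)"
  define lo where "lo = (\<lambda>s t::real. if t \<le> s then 1 else 0 :: ennreal)"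
  have [measurable]: "(\<lambda>(s, t). f s t * lo s t) \<in> borel_measurable (borel \<Otimes>\<^sub>M borel)"
    "(\<lambda>(s, t). f s t * lo t s) \<in> borel_measurable (borel \<Otimes>\<^sub>M borel)"
    "\<And>s. (\<lambda>t. f s t * lo s t) \<in> borel_measurable borel" "\<And>s. (\<lambda>t. f s t * lo t s) \<in> borel_measurable borel"
    "(\<lambda>s. \<integral>\<^sup>+t. f s t * lo s t \<partial>lborel) \<in> borel_measurable borel" "(\<lambda>s. \<integral>\<^sup>+t. f s t * lo t s \<partial>lborel) \<in> borel_measurable borel"
    unfolding f_def lo_def by measurable
  have sym: "f s t = f t s" for s t by (simp add: f_def log_kernel_commute mult_ac)
  define J where "J = (\<integral>\<^sup>+r. ennreal ((log_kernel 1 r)\<^sup>2) * indicator {0..1} r \<partial>lborel)"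
  have inner: "(\<integral>\<^sup>+t. f s t * lo s t \<partial>lborel) = ennreal (s * indicator {0..1} s) * J" if "s \<noteq> 0" for s
  proof (cases "s \<in> {0<..1}")
    case True
    have "(\<integral>\<^sup>+t. f s t * lo s t \<partial>lborel) = \<bar>s\<bar> * (\<integral>\<^sup>+r. f s (0 + s * r) * lo s (0 + s * r) \<partial>lborel)"
      using True by (intro nn_integral_real_affine) auto
    also have "(\<integral>\<^sup>+r. f s (0 + s * r) * lo s (0 + s * r) \<partial>lborel) = J"
      unfolding J_def
    proof (intro nn_integral_cong)
      fix r
      have "(s * r \<in> {0..1} \<and> s * r \<le> s) = (r \<in> {0..1})"
        using True by (auto simp: zero_le_mult_iff mult_le_cancel_left1 intro: order_trans mult_le_one)
      then show "f s (0 + s * r) * lo s (0 + s * r) = ennreal ((log_kernel 1 r)\<^sup>2) * indicator {0..1} r"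
        using True log_kernel_scale[of s r] by (auto simp: f_def lo_def split: split_indicator)
    qed
    finally show ?thesis using True by simp
  next
    case False
    then show ?thesis using that by (simp add: f_def)
  qed
  have "(\<integral>\<^sup>+s. \<integral>\<^sup>+t. f s t * lo s t \<partial>lborel \<partial>lborel) = (\<integral>\<^sup>+s. ennreal (s * indicator {0..1} s) * J \<partial>lborel)"
  proof (rule nn_integral_cong_AE)
    show "AE s in lborel. (\<integral>\<^sup>+t. f s t * lo s t \<partial>lborel) = ennreal (s * indicator {0..1} s) * J"
      using AE_lborel_singleton[of 0] by eventually_elim (rule inner)
  qed
  also have "\<dots> = (\<integral>\<^sup>+s. ennreal (s * indicator {0..1} s) \<partial>lborel) * J"
    by (rule nn_integral_multc) measurable
  also have "(\<integral>\<^sup>+s. ennreal (s * indicator {0..1} s) \<partial>lborel) = ennreal (1 / 2)"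
  proof -
    have h: "has_bochner_integral lborel (\<lambda>s::real. s * indicator {0..1} s) (1 / 2)"
      using has_bochner_integral_power_Icc01[of 1] by (simp add: mult.commute)
    have "(\<integral>\<^sup>+s. ennreal (s * indicator {0..1} s) \<partial>lborel) = ennreal (LBINT s. s * indicator {0..1} s)"
      using h by (intro nn_integral_eq_integral) (auto simp: has_bochner_integral_iff split: split_indicator)
    then show ?thesis unfolding has_bochner_integral_integral_eq[OF h] .
  qed
  finally have lower: "(\<integral>\<^sup>+s. \<integral>\<^sup>+t. f s t * lo s t \<partial>lborel \<partial>lborel) = ennreal (1 / 2) * J" .
  have upper: "(\<integral>\<^sup>+s. \<integral>\<^sup>+t. f s t * lo t s \<partial>lborel \<partial>lborel) = ennreal (1 / 2) * J"
  proof -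
    have "(\<integral>\<^sup>+s. \<integral>\<^sup>+t. f s t * lo t s \<partial>lborel \<partial>lborel) = (\<integral>\<^sup>+t. \<integral>\<^sup>+s. f s t * lo t s \<partial>lborel \<partial>lborel)"
      by (rule lborel_pair.Fubini') measurable
    also have "\<dots> = (\<integral>\<^sup>+t. \<integral>\<^sup>+s. f t s * lo t s \<partial>lborel \<partial>lborel)" by (simp add: sym)
    finally show ?thesis using lower by simp
  qed
  have "(\<integral>\<^sup>+s. \<integral>\<^sup>+t. f s t \<partial>lborel \<partial>lborel) \<le> (\<integral>\<^sup>+s. (\<integral>\<^sup>+t. f s t * lo s t \<partial>lborel) + (\<integral>\<^sup>+t. f s t * lo t s \<partial>lborel) \<partial>lborel)"
  proof (intro nn_integral_mono)
    fix s
    have "(\<integral>\<^sup>+t. f s t \<partial>lborel) \<le> (\<integral>\<^sup>+t. f s t * lo s t + f s t * lo t s \<partial>lborel)"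
      by (intro nn_integral_mono) (auto simp: lo_def)
    then show "(\<integral>\<^sup>+t. f s t \<partial>lborel) \<le> (\<integral>\<^sup>+t. f s t * lo s t \<partial>lborel) + (\<integral>\<^sup>+t. f s t * lo t s \<partial>lborel)"
      by (simp add: nn_integral_add)
  qed
  also have "\<dots> = ennreal (1 / 2) * J + ennreal (1 / 2) * J"
    by (simp add: nn_integral_add lower upper)
  also have "\<dots> = J"
  proof -
    have "ennreal (1 / 2) + ennreal (1 / 2) = 1"
      by (subst ennreal_plus[symmetric]) (auto simp del: ennreal_plus)
    then show ?thesis unfolding distrib_right[symmetric] by simp
  qed
  also have "\<dots> \<le> ennreal 3.88" unfolding J_def by (rule nn_integral_log_kernel_one_sq_le)
  finally show ?thesis unfolding f_def .
qed

text \<open>The power series of \<open>ln ((1 + s) / (1 - s))\<close> up to degree \<open>11\<close>. The factor \<open>1 - s\<^sup>2\<close> cancels the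
  denominator in the estimate of its tail, and \<open>s\<^bsup>13\<^esup> / 13\<close> centres the interval of possible values.\<close>

lemma log_kernel_one_bounds:
  fixes s :: real
  assumes s: "s \<in> {0<..<1}"
  defines "p \<equiv> \<Sum>j<6. 2 * s ^ (2 * j + 1) / real (2 * j + 1)"
  shows "\<bar>(1 - s\<^sup>2) * log_kernel s 1 - ((1 - s\<^sup>2) * p + s ^ 13 / 13)\<bar> \<le> s ^ 13 / 13"
proof -
  define x where "x = (1 + s) / (1 - s)"
  have x: "x > 1" "(x - 1) / (x + 1) = s" using s by (auto simp: x_def field_simps)
  have k: "log_kernel s 1 = ln x" using s by (simp add: log_kernel_def x_def add.commute)
  have s2: "1 - s\<^sup>2 > 0" using s by (simp add: power_less_one_iff abs_square_less_1)
  have d: "ln x \<in> {p .. p + 2 * (s ^ 13 / (1 - s\<^sup>2) / 13)}"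
    using ln_approx_bounds[OF x(1), of 6] unfolding x(2) p_def by simp
  have "(1 - s\<^sup>2) * p \<le> (1 - s\<^sup>2) * ln x" using d s2 by (intro mult_left_mono) auto
  moreover have "(1 - s\<^sup>2) * ln x \<le> (1 - s\<^sup>2) * (p + 2 * (s ^ 13 / (1 - s\<^sup>2) / 13))"
    using d s2 by (intro mult_left_mono) auto
  moreover have "(1 - s\<^sup>2) * (p + 2 * (s ^ 13 / (1 - s\<^sup>2) / 13)) = (1 - s\<^sup>2) * p + 2 * (s ^ 13 / 13)"
  proof -
    have "d * (p + 2 * (a / d / 13)) = d * p + 2 * (a / 13)" if "d > 0" for a d :: real
      using that by (simp add: field_simps)
    from this[OF s2] show ?thesis .
  qed
  ultimately show ?thesis unfolding k abs_le_iff by linarith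
qed

text \<open>The polynomial \<open>t - 31/50 t\<^sup>3\<close> is close to the leading eigenfunction of the integral operator with
  the logarithmic kernel on the unit interval, and \<open>783/500\<close> is close to its eigenvalue.\<close>

abbreviation trial_coeffs :: "real list" where "trial_coeffs \<equiv> [1, - (31 / 50)]"

definition trial :: "real \<Rightarrow> real" where
  "trial t = indicator {0..1} t * odd_poly trial_coeffs t"

definition trial_norm_sq :: real where
  "trial_norm_sq = (\<Sum>i<length trial_coeffs. \<Sum>j<length trial_coeffs. trial_coeffs ! i * trial_coeffs ! j / real (2 * i + 2 * j + 3))"

definition trial_form :: real where
  "trial_form = (\<Sum>i<length trial_coeffs. \<Sum>j<length trial_coeffs. trial_coeffs ! i * trial_coeffs ! j * log_moment2 i j)"

lemmas list_sum_simps = lessThan_nat_numeral lessThan_Suc atMost_Suc atMost_nat_numeral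

lemma trial_norm_sq_eq: "trial_norm_sq = 1 / 3 - 31 / 125 + 961 / 17500"
  by (simp add: trial_norm_sq_def list_sum_simps)

lemma trial_form_eq: "trial_form = 1 / 2 - 31 / 90 + 961 / 15000"
  by (simp add: trial_form_def log_moment2_def moment_at_one_def list_sum_simps)

text \<open>The image of the trial polynomial under the operator, minus \<open>783/500\<close> times the trial polynomial,
  with the logarithm \<open>log_kernel s 1\<close> replaced by its truncated power series.\<close>

definition residual_coeffs :: "real list" where
  "residual_coeffs = [31 / 1500, - 2727 / 25000, 43 / 375, 1 / 525, - 11 / 2625, - 71 / 17325, - 7703 / 257400, 93 / 5720]"

lemma residual_sq_le:
  assumes s: "s \<in> {0<..<1}"
  shows "((\<Sum>i<length trial_coeffs. trial_coeffs ! i * log_moment i s) - 783 / 500 * odd_poly trial_coeffs s)\<^sup>2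
     \<le> 2 * (odd_poly residual_coeffs s)\<^sup>2 + 2 * (69 / 2600 * s ^ 13)\<^sup>2"
proof -
  define p where "p = (\<Sum>j<6. 2 * s ^ (2 * j + 1) / real (2 * j + 1))"
  define m where "m = (1 - s\<^sup>2) * log_kernel s 1"
  define w where "w = (1 - s\<^sup>2) * p + s ^ 13 / 13"
  define c where "c = 69 / 200 - 31 / 200 * s\<^sup>2"
  define A where "A = 269 / 300 * s - 31 / 100 * s ^ 3 - 783 / 500 * (s - 31 / 50 * s ^ 3)"
  have mw: "\<bar>m - w\<bar> \<le> s ^ 13 / 13"
    using log_kernel_one_bounds[OF s] unfolding m_def w_def p_def .
  have "s\<^sup>2 \<le> 1" using s by (simp add: power_le_one)
  then have c: "0 \<le> c" "c \<le> 69 / 200" by (simp_all add: c_def)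
  have lhs: "(\<Sum>i<length trial_coeffs. trial_coeffs ! i * log_moment i s) - 783 / 500 * odd_poly trial_coeffs s = A + m * c"
  proof -
    have 0: "log_moment 0 s = ((1 - s\<^sup>2) * log_kernel s 1 + 2 * s) / 2"
      by (simp add: log_moment_def power2_eq_square)
    have 1: "log_moment 1 s = ((1 - s ^ 4) * log_kernel s 1 + 2 * (s ^ 3 + s / 3)) / 4"
      by (simp add: log_moment_def power2_eq_square power3_eq_cube power4_eq_xxxx)
    have sum: "(\<Sum>i<length trial_coeffs. trial_coeffs ! i * log_moment i s) = log_moment 0 s - 31 / 50 * log_moment 1 s"
      by (simp add: list_sum_simps)
    have odd: "odd_poly trial_coeffs s = s - 31 / 50 * s ^ 3"
      by (simp add: odd_poly_def list_sum_simps power2_eq_square power3_eq_cube)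
    have pow: "s ^ 4 = s\<^sup>2 * s\<^sup>2" "s ^ 3 = s * s\<^sup>2"
      by (simp_all add: power2_eq_square power3_eq_cube power4_eq_xxxx)
    have gen: "((1 - x) * L + 2 * s) / 2 - 31 / 50 * (((1 - x * x) * L + 2 * (s * x + s / 3)) / 4) - 783 / 500 * (s - 31 / 50 * (s * x))
      = 269 / 300 * s - 31 / 100 * (s * x) - 783 / 500 * (s - 31 / 50 * (s * x)) + (1 - x) * L * (69 / 200 - 31 / 200 * x)"
      for x L :: real by (simp add: field_simps)
    show ?thesis unfolding sum odd 0 1 A_def m_def c_def pow by (rule gen)
  qed
  have rhs: "odd_poly residual_coeffs s = A + w * c"
  proof -
    have 1: "p = 2 * s + 2 / 3 * s ^ 3 + 2 / 5 * s ^ 5 + 2 / 7 * s ^ 7 + 2 / 9 * s ^ 9 + 2 / 11 * s ^ 11"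
      by (simp add: p_def list_sum_simps del: power_Suc)
    have 2: "odd_poly residual_coeffs s = 31 / 1500 * s - 2727 / 25000 * s ^ 3 + 43 / 375 * s ^ 5 + 1 / 525 * s ^ 7
      - 11 / 2625 * s ^ 9 - 71 / 17325 * s ^ 11 - 7703 / 257400 * s ^ 13 + 93 / 5720 * s ^ 15"
      by (simp add: odd_poly_def residual_coeffs_def list_sum_simps del: power_Suc)
    define x where "x = s\<^sup>2"
    have pow: "s ^ 3 = s * x" "s ^ 5 = s * x ^ 2" "s ^ 7 = s * x ^ 3" "s ^ 9 = s * x ^ 4" "s ^ 11 = s * x ^ 5"
      "s ^ 13 = s * x ^ 6" "s ^ 15 = s * x ^ 7"
      unfolding x_def power_mult[symmetric] by (simp_all flip: power_Suc)
    show ?thesis unfolding 2 A_def w_def 1 c_def pow x_def[symmetric]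
      by (simp add: field_simps power_numeral_reduce)
  qed
  have "\<bar>(m - w) * c\<bar> \<le> s ^ 13 / 13 * (69 / 200)"
    unfolding abs_mult using mw c s by (intro mult_mono) auto
  then have "((m - w) * c)\<^sup>2 \<le> (69 / 2600 * s ^ 13)\<^sup>2"
    by (intro abs_le_square_iff[THEN iffD1]) simp
  moreover have "(A + m * c)\<^sup>2 \<le> 2 * (A + w * c)\<^sup>2 + 2 * ((m - w) * c)\<^sup>2"
    using zero_le_power2[of "(A + w * c) - (m - w) * c"] by (simp add: power2_eq_square algebra_simps)
  ultimately show ?thesis unfolding lhs rhs by simp
qed

lemma residual_numeric:
  "2 * (\<Sum>i<length residual_coeffs. \<Sum>j<length residual_coeffs. residual_coeffs ! i * residual_coeffs ! j / real (2 * i + 2 * j + 3))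
    + 2 * ((69 / 2600)\<^sup>2 * (1 / 27)) \<le> 1 / 10000"
  by (simp add: residual_coeffs_def list_sum_simps power2_eq_square)

context sine_window
begin

lemma nn_integral_\<Phi>_log_kernel_le:
  assumes s: "s \<in> {0..1}"
  shows "(\<integral>\<^sup>+t. ennreal \<bar>\<Phi> t * log_kernel s t\<bar> \<partial>lborel) \<le> ennreal (B * 4)"
proof -
  have "(\<integral>\<^sup>+t. ennreal \<bar>\<Phi> t * log_kernel s t\<bar> \<partial>lborel) \<le> (\<integral>\<^sup>+t. ennreal B * (ennreal (log_kernel s t) * indicator {0..1} t) \<partial>lborel)"
  proof (intro nn_integral_mono)
    fix t
    show "ennreal \<bar>\<Phi> t * log_kernel s t\<bar> \<le> ennreal B * (ennreal (log_kernel s t) * indicator {0..1} t)"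
    proof (cases "t \<in> {0..1}")
      case True
      then have "\<bar>\<Phi> t * log_kernel s t\<bar> \<le> B * log_kernel s t"
        using \<Phi>_bound[of t] log_kernel_nonneg[of s t] s by (simp add: abs_mult mult_right_mono)
      then show ?thesis using True B_nonneg by (simp add: ennreal_mult'[symmetric] ennreal_leI)
    qed (simp add: \<Phi>_support)
  qed
  also have "\<dots> = ennreal B * (\<integral>\<^sup>+t. ennreal (log_kernel s t) * indicator {0..1} t \<partial>lborel)"
    by (rule nn_integral_cmult) measurable
  also have "\<dots> \<le> ennreal B * ennreal 4" by (intro mult_left_mono nn_integral_log_kernel_le s) auto
  finally show ?thesis using B_nonneg by (simp add: ennreal_mult')
qed

lemma integrable_\<Phi>_log_kernel:
  assumes "s \<in> {0..1}" shows "integrable lborel (\<lambda>t. \<Phi> t * log_kernel s t)"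
  using nn_integral_\<Phi>_log_kernel_le[OF assms]
  by (intro integrableI_bounded) (auto intro: le_less_trans[OF _ ennreal_less_top])

lemma abs_integral_\<Phi>_log_kernel_le:
  assumes "s \<in> {0..1}" shows "\<bar>LBINT t. \<Phi> t * log_kernel s t\<bar> \<le> B * 4"
  using order_trans[OF ennreal_integral_le nn_integral_\<Phi>_log_kernel_le[OF assms]] B_nonneg
  by (simp add: ennreal_le_iff)

end

definition log_pairing :: "(real \<Rightarrow> real) \<Rightarrow> (real \<Rightarrow> real) \<Rightarrow> real" where
  "log_pairing f h = (LBINT s. f s * (LBINT t. h t * log_kernel s t))"

lemma sine_window_lincomb:
  assumes "sine_window f C" "sine_window h D"
  shows "sine_window (\<lambda>t. f t + c * h t) (C + \<bar>c\<bar> * D)"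
proof -
  interpret f: sine_window f C by fact
  interpret h: sine_window h D by fact
  show ?thesis
  proof
    fix t
    have "\<bar>f t + c * h t\<bar> \<le> \<bar>f t\<bar> + \<bar>c\<bar> * \<bar>h t\<bar>" by (metis abs_mult abs_triangle_ineq)
    also have "\<dots> \<le> C + \<bar>c\<bar> * D" by (intro add_mono mult_left_mono f.\<Phi>_bound h.\<Phi>_bound) auto
    finally show "\<bar>f t + c * h t\<bar> \<le> C + \<bar>c\<bar> * D" .
  qed (auto simp: f.\<Phi>_support h.\<Phi>_support)
qed

lemma integrable_log_pairing:
  assumes "sine_window f C" "sine_window h D"
  shows "integrable lborel (\<lambda>s. f s * (LBINT t. h t * log_kernel s t))"
proof -
  interpret f: sine_window f C by fact
  interpret h: sine_window h D by fact
  show ?thesis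
  proof (rule Bochner_Integration.integrable_bound)
    show "integrable lborel (\<lambda>s. C * (D * 4) * indicator {0..1::real} s)" by simp
    have "\<bar>f s * (LBINT t. h t * log_kernel s t)\<bar> \<le> C * (D * 4) * indicator {0..1} s" for s
    proof (cases "s \<in> {0..1}")
      case True
      then show ?thesis unfolding abs_mult
        using h.abs_integral_\<Phi>_log_kernel_le[OF True] f.\<Phi>_bound[of s] f.B_nonneg by (simp add: mult_mono)
    qed (simp add: f.\<Phi>_support)
    then show "AE s in lborel. norm (f s * (LBINT t. h t * log_kernel s t)) \<le> norm (C * (D * 4) * indicator {0..1::real} s)"
      using f.B_nonneg h.B_nonneg by (auto simp: abs_mult)
  qed measurable
qed

lemma log_pairing_commute:
  assumes "sine_window f C" "sine_window h D"
  shows "log_pairing f h = log_pairing h f"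
proof -
  interpret f: sine_window f C by fact
  interpret h: sine_window h D by fact
  have fin: "(\<integral>\<^sup>+s. \<integral>\<^sup>+t. ennreal \<bar>f s * (h t * log_kernel s t)\<bar> \<partial>lborel \<partial>lborel) < \<infinity>"
  proof -
    have "(\<integral>\<^sup>+s. \<integral>\<^sup>+t. ennreal \<bar>f s * (h t * log_kernel s t)\<bar> \<partial>lborel \<partial>lborel) \<le> (\<integral>\<^sup>+s. ennreal (C * (D * 4)) * indicator {0..1::real} s \<partial>lborel)"
    proof (intro nn_integral_mono)
      fix s
      show "(\<integral>\<^sup>+t. ennreal \<bar>f s * (h t * log_kernel s t)\<bar> \<partial>lborel) \<le> ennreal (C * (D * 4)) * indicator {0..1} s"
      proof (cases "s \<in> {0..1}")
        case True
        have "(\<integral>\<^sup>+t. ennreal \<bar>f s * (h t * log_kernel s t)\<bar> \<partial>lborel) = ennreal \<bar>f s\<bar> * (\<integral>\<^sup>+t. ennreal \<bar>h t * log_kernel s t\<bar> \<partial>lborel)"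
          by (simp add: abs_mult[of "f s"] ennreal_mult' nn_integral_cmult)
        also have "\<dots> \<le> ennreal C * ennreal (D * 4)"
          by (intro mult_mono ennreal_leI f.\<Phi>_bound h.nn_integral_\<Phi>_log_kernel_le True) auto
        finally show ?thesis using True f.B_nonneg by (simp add: ennreal_mult')
      qed (simp add: f.\<Phi>_support)
    qed
    also have "\<dots> < \<infinity>" by (simp add: nn_integral_cmult ennreal_mult_less_top)
    finally show ?thesis .
  qed
  have "log_pairing f h = (LBINT s. LBINT t. f s * (h t * log_kernel s t))"
    by (simp add: log_pairing_def)
  also have "\<dots> = (LBINT t. LBINT s. f s * (h t * log_kernel s t))"
    by (rule lborel_Fubini_of_finite(2)[OF _ fin]) measurable
  also have "\<dots> = (LBINT t. h t * (LBINT s. f s * log_kernel t s))"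
  proof -
    have eq: "f s * (h t * log_kernel s t) = h t * (f s * log_kernel t s)" for s t
      by (simp only: mult.left_commute log_kernel_commute[of s t])
    show ?thesis unfolding eq by simp
  qed
  finally show ?thesis by (simp add: log_pairing_def)
qed

lemma log_pairing_lincomb_right:
  assumes "sine_window f C" "sine_window h D" "sine_window k E"
  shows "log_pairing f (\<lambda>t. h t + c * k t) = log_pairing f h + c * log_pairing f k"
proof -
  interpret f: sine_window f C by fact
  interpret h: sine_window h D by fact
  interpret k: sine_window k E by fact
  have "f s * (LBINT t. (h t + c * k t) * log_kernel s t) = f s * (LBINT t. h t * log_kernel s t) + c * (f s * (LBINT t. k t * log_kernel s t))" for s
  proof (cases "s \<in> {0..1}")
    case True
    then show ?thesis
      using h.integrable_\<Phi>_log_kernel[OF True] k.integrable_\<Phi>_log_kernel[OF True]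
      by (simp add: algebra_simps)
  qed (simp add: f.\<Phi>_support)
  then show ?thesis
    unfolding log_pairing_def
    using integrable_log_pairing[OF assms(1,2)] integrable_log_pairing[OF assms(1,3)] by simp
qed

lemma trial_window: "sine_window trial 2"
proof -
  have "sine_window trial (\<Sum>i<length trial_coeffs. \<bar>trial_coeffs ! i\<bar>)"
    unfolding trial_def[abs_def] by (rule odd_poly_window)
  moreover have "(\<Sum>i<length trial_coeffs. \<bar>trial_coeffs ! i\<bar>) \<le> 2"
    by (simp add: list_sum_simps)
  ultimately show ?thesis unfolding sine_window_def by (meson order_trans)
qed

lemma trial_norm: "has_bochner_integral lborel (\<lambda>s. (trial s)\<^sup>2) trial_norm_sq"
proof -
  have "(trial s)\<^sup>2 = indicator {0..1} s * (odd_poly trial_coeffs s)\<^sup>2" for s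
    by (auto simp: trial_def split: split_indicator)
  then show ?thesis using integral_odd_poly_sq[of trial_coeffs] by (simp add: trial_norm_sq_def)
qed

lemma trial_log_pairing: "log_pairing trial trial = trial_form"
  using log_form_odd_poly[of trial_coeffs] sine_window.log_form_def[OF trial_window]
  unfolding trial_def[abs_def] log_pairing_def trial_form_def by simp

lemma trial_nonneg: "trial t \<ge> 0"
proof (cases "t \<in> {0..1}")
  case True
  have "odd_poly trial_coeffs t = t * (1 - 31 / 50 * t\<^sup>2)"
    by (simp add: odd_poly_def list_sum_simps power2_eq_square algebra_simps)
  moreover have "t\<^sup>2 \<le> 1" using True by (simp add: power_le_one)
  ultimately show ?thesis using True by (simp add: trial_def)
qed (simp add: trial_def)

text \<open>Against functions orthogonal to the trial function \<open>u\<close> the kernel may be replaced by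
  \<open>k(s, t) - (\<langle>u, K u\<rangle> / \<parallel>u\<parallel>\<^sup>4) u(s) u(t)\<close>, where \<open>K\<close> is the operator with kernel \<open>k\<close>. The rank-one
  correction lowers the squared Hilbert-Schmidt norm by \<open>(\<langle>u, K u\<rangle> / \<parallel>u\<parallel>\<^sup>2)\<^sup>2 \<ge> 2.44\<close>, from at most
  \<open>3.88\<close> to at most \<open>(6/5)\<^sup>2\<close>, and this norm bounds the form.\<close>

lemma log_pairing_orthogonal_le:
  assumes g: "sine_window g C" and orth: "(LBINT t. g t * trial t) = 0"
  shows "log_pairing g g \<le> 6 / 5 * (LBINT t. (g t)\<^sup>2)"
proof -
  interpret g: sine_window g C by fact
  interpret u: sine_window trial 2 by (rule trial_window)
  define n q where "n = trial_norm_sq" and "q = trial_form"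
  have nq: "n = 1 / 3 - 31 / 125 + 961 / 17500" "q = 1 / 2 - 31 / 90 + 961 / 15000"
    by (simp_all add: n_def q_def trial_norm_sq_eq trial_form_eq)
  have n0: "n > 0" "q > 0" by (simp_all add: nq)
  define \<beta> where "\<beta> = q / n\<^sup>2"
  define k where "k = (\<lambda>s t. indicator {0..1} s * indicator {0..1} t * log_kernel s t :: real)"
  define R where "R = (\<lambda>s t. k s t - \<beta> * (trial s * trial t))"
  have \<beta>0: "\<beta> \<ge> 0" using n0 by (simp add: \<beta>_def)
  have k0: "k s t \<ge> 0" for s t by (auto simp: k_def log_kernel_nonneg split: split_indicator)
  have [measurable]: "(\<lambda>x. k (f x) (h x)) \<in> borel_measurable M" "(\<lambda>x. R (f x) (h x)) \<in> borel_measurable M"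
    if [measurable]: "f \<in> borel_measurable M" "h \<in> borel_measurable M" for f h M
    unfolding R_def k_def by measurable
  have nn_trial: "(\<integral>\<^sup>+s. ennreal ((trial s)\<^sup>2) \<partial>lborel) = ennreal n"
    using trial_norm unfolding n_def
    by (subst nn_integral_eq_integral) (auto simp: has_bochner_integral_iff)
  have sq: "(\<integral>\<^sup>+s. \<integral>\<^sup>+t. ennreal ((k s t)\<^sup>2) \<partial>lborel \<partial>lborel) \<le> ennreal 3.88"
  proof -
    have "ennreal ((k s t)\<^sup>2) = ennreal ((log_kernel s t)\<^sup>2) * indicator {0..1} s * indicator {0..1} t" for s t
      by (auto simp: k_def split: split_indicator)
    then show ?thesis using nn_integral_log_kernel_sq_le by simp
  qed
  have cross: "(\<integral>\<^sup>+s. \<integral>\<^sup>+t. ennreal (trial s * trial t * k s t) \<partial>lborel \<partial>lborel) = ennreal q"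
  proof -
    have "(\<integral>\<^sup>+t. ennreal (trial s * trial t * k s t) \<partial>lborel) = ennreal (trial s * (LBINT t. trial t * log_kernel s t))" for s
    proof (cases "s \<in> {0..1}")
      case True
      have e1: "trial s * trial t * k s t = trial s * (trial t * log_kernel s t)" for t
        using True by (auto simp: k_def u.\<Phi>_support split: split_indicator)
      have "(\<integral>\<^sup>+t. ennreal (trial s * (trial t * log_kernel s t)) \<partial>lborel) = ennreal (LBINT t. trial s * (trial t * log_kernel s t))"
      proof (intro nn_integral_eq_integral AE_I2)
        show "0 \<le> trial s * (trial t * log_kernel s t)" for t
          using trial_nonneg log_kernel_nonneg[of s t] True u.\<Phi>_support[of t] by (cases "t \<in> {0..1}") auto
      qed (use u.integrable_\<Phi>_log_kernel[OF True] in simp)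
      then show ?thesis unfolding e1 by simp
    qed (simp add: u.\<Phi>_support)
    moreover have "(\<integral>\<^sup>+s. ennreal (trial s * (LBINT t. trial t * log_kernel s t)) \<partial>lborel) = ennreal (log_pairing trial trial)"
      unfolding log_pairing_def
    proof (intro nn_integral_eq_integral integrable_log_pairing[OF trial_window trial_window] AE_I2)
      fix s
      show "0 \<le> trial s * (LBINT t. trial t * log_kernel s t)"
      proof (cases "s \<in> {0..1}")
        case True
        have "0 \<le> trial t * log_kernel s t" for t
          using trial_nonneg log_kernel_nonneg[of s t] True u.\<Phi>_support[of t] by (cases "t \<in> {0..1}") auto
        then show ?thesis using trial_nonneg by (intro mult_nonneg_nonneg integral_nonneg_AE) auto
      qed (simp add: u.\<Phi>_support)
    qed
    ultimately show ?thesis by (simp add: trial_log_pairing q_def)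
  qed
  have quad: "(\<integral>\<^sup>+s. \<integral>\<^sup>+t. ennreal ((trial s)\<^sup>2 * (trial t)\<^sup>2) \<partial>lborel \<partial>lborel) = ennreal (n * n)"
    using n0 by (simp add: ennreal_mult' nn_integral_cmult nn_integral_multc nn_trial)
  have R_le: "(\<integral>\<^sup>+s. \<integral>\<^sup>+t. ennreal ((R s t)\<^sup>2) \<partial>lborel \<partial>lborel) \<le> ennreal (36 / 25)"
  proof -
    have pt: "ennreal ((R s t)\<^sup>2) + ennreal (2 * \<beta>) * ennreal (trial s * trial t * k s t) = ennreal ((k s t)\<^sup>2) + ennreal (\<beta>\<^sup>2) * ennreal ((trial s)\<^sup>2 * (trial t)\<^sup>2)" for s t
    proof -
      have "(R s t)\<^sup>2 + 2 * \<beta> * (trial s * trial t * k s t) = (k s t)\<^sup>2 + \<beta>\<^sup>2 * ((trial s)\<^sup>2 * (trial t)\<^sup>2)"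
        by (simp add: R_def power2_eq_square algebra_simps)
      then have "ennreal ((R s t)\<^sup>2 + 2 * \<beta> * (trial s * trial t * k s t)) = ennreal ((k s t)\<^sup>2 + \<beta>\<^sup>2 * ((trial s)\<^sup>2 * (trial t)\<^sup>2))"
        by simp
      then show ?thesis using \<beta>0 trial_nonneg k0 by (simp add: ennreal_mult')
    qed
    have "(\<integral>\<^sup>+s. \<integral>\<^sup>+t. ennreal ((R s t)\<^sup>2) \<partial>lborel \<partial>lborel) + ennreal (2 * \<beta>) * ennreal q
       = (\<integral>\<^sup>+s. \<integral>\<^sup>+t. ennreal ((R s t)\<^sup>2) + ennreal (2 * \<beta>) * ennreal (trial s * trial t * k s t) \<partial>lborel \<partial>lborel)"
      unfolding cross[symmetric] by (simp add: nn_integral_add nn_integral_cmult)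
    also have "\<dots> = (\<integral>\<^sup>+s. \<integral>\<^sup>+t. ennreal ((k s t)\<^sup>2) \<partial>lborel \<partial>lborel) + ennreal (\<beta>\<^sup>2) * ennreal (n * n)"
      unfolding pt quad[symmetric] by (simp add: nn_integral_add nn_integral_cmult)
    also have "\<dots> \<le> ennreal 3.88 + ennreal (\<beta>\<^sup>2) * ennreal (n * n)" using sq by (intro add_right_mono)
    also have "\<dots> = ennreal (3.88 + \<beta>\<^sup>2 * (n * n))" by (simp add: ennreal_mult'[symmetric] ennreal_plus[symmetric] del: ennreal_plus)
    also have "\<dots> \<le> ennreal (36 / 25 + 2 * \<beta> * q)"
    proof (rule ennreal_leI)
      have "\<beta>\<^sup>2 * (n * n) = q\<^sup>2 / n\<^sup>2" "2 * \<beta> * q = 2 * (q\<^sup>2 / n\<^sup>2)"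
        using n0 by (simp_all add: \<beta>_def power2_eq_square)
      moreover have "q\<^sup>2 / n\<^sup>2 \<ge> 2.44" by (simp add: nq power2_eq_square)
      ultimately show "3.88 + \<beta>\<^sup>2 * (n * n) \<le> 36 / 25 + 2 * \<beta> * q" by simp
    qed
    also have "\<dots> = ennreal (36 / 25) + ennreal (2 * \<beta>) * ennreal q"
      using \<beta>0 n0 by (simp add: ennreal_mult'[symmetric] ennreal_plus[symmetric] del: ennreal_plus)
    finally have le: "(\<integral>\<^sup>+s. \<integral>\<^sup>+t. ennreal ((R s t)\<^sup>2) \<partial>lborel \<partial>lborel) + ennreal (2 * \<beta>) * ennreal q
        \<le> ennreal (36 / 25) + ennreal (2 * \<beta>) * ennreal q" .
    have ne: "ennreal (2 * \<beta>) * ennreal q \<noteq> top" by (simp add: ennreal_mult_eq_top_iff)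
    show ?thesis
      using ennreal_minus_mono[OF le order_refl, of "ennreal (2 * \<beta>) * ennreal q"]
      unfolding ennreal_add_diff_cancel_right[OF ne] .
  qed
  define G where "G = (LBINT t. (g t)\<^sup>2)"
  have G0: "G \<ge> 0" unfolding G_def by (intro integral_nonneg_AE) auto
  have nnG: "(\<integral>\<^sup>+t. ennreal ((g t)\<^sup>2) \<partial>lborel) = ennreal G"
    unfolding G_def by (intro nn_integral_eq_integral g.integrable_\<Phi>_sq) auto
  \<comment> \<open>The Cauchy-Schwarz inequality with a free parameter, to be chosen as \<open>c = 5 G / 6\<close>.\<close>
  have main: "log_pairing g g \<le> (G\<^sup>2 / c + 36 / 25 * c) / 2" if "c > 0" for c
  proof -
    have eq: "g s * (LBINT t. g t * log_kernel s t) = (LBINT t. g s * (g t * R s t))" for s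
    proof (cases "s \<in> {0..1}")
      case True
      have gR: "g t * R s t = g t * log_kernel s t - \<beta> * trial s * (g t * trial t)" for t
        using True by (auto simp: R_def k_def g.\<Phi>_support algebra_simps split: split_indicator)
      have "(LBINT t. g t * R s t) = (LBINT t. g t * log_kernel s t) - \<beta> * trial s * (LBINT t. g t * trial t)"
        unfolding gR using g.integrable_\<Phi>_log_kernel[OF True] g.integrable_\<Phi>_mult[of trial 2] u.\<Phi>_bound by simp
      then show ?thesis using orth by simp
    qed (simp add: g.\<Phi>_support)
    have "ennreal (log_pairing g g) \<le> ennreal \<bar>log_pairing g g\<bar>" by (intro ennreal_leI) simp
    also have "\<dots> \<le> (\<integral>\<^sup>+s. ennreal \<bar>LBINT t. g s * (g t * R s t)\<bar> \<partial>lborel)"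
      unfolding log_pairing_def eq by (rule ennreal_integral_le)
    also have "\<dots> \<le> (\<integral>\<^sup>+s. \<integral>\<^sup>+t. ennreal \<bar>g s * (g t * R s t)\<bar> \<partial>lborel \<partial>lborel)"
      by (intro nn_integral_mono ennreal_integral_le)
    also have "\<dots> \<le> (\<integral>\<^sup>+s. \<integral>\<^sup>+t. ennreal (1 / (2 * c)) * ennreal ((g s)\<^sup>2 * (g t)\<^sup>2) + ennreal (c / 2) * ennreal ((R s t)\<^sup>2) \<partial>lborel \<partial>lborel)"
    proof (intro nn_integral_mono)
      fix s t
      have "\<bar>a * b\<bar> \<le> 1 / (2 * c) * a\<^sup>2 + c / 2 * b\<^sup>2" for a b :: real
      proof -
        have "0 \<le> (\<bar>a\<bar> - c * \<bar>b\<bar>)\<^sup>2 / (2 * c)" using \<open>c > 0\<close> by simp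
        also have "\<dots> = 1 / (2 * c) * a\<^sup>2 + c / 2 * b\<^sup>2 - \<bar>a * b\<bar>"
          using \<open>c > 0\<close> by (simp add: power2_diff power_mult_distrib abs_mult field_simps) (simp add: power2_eq_square)
        finally show ?thesis by simp
      qed
      from this[of "g s * g t" "R s t"]
      have "\<bar>g s * (g t * R s t)\<bar> \<le> 1 / (2 * c) * ((g s)\<^sup>2 * (g t)\<^sup>2) + c / 2 * (R s t)\<^sup>2"
        by (simp add: mult.assoc power_mult_distrib)
      from ennreal_leI[OF this]
      show "ennreal \<bar>g s * (g t * R s t)\<bar> \<le> ennreal (1 / (2 * c)) * ennreal ((g s)\<^sup>2 * (g t)\<^sup>2) + ennreal (c / 2) * ennreal ((R s t)\<^sup>2)"
        using \<open>c > 0\<close> by (simp add: ennreal_mult'[symmetric])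
    qed
    also have "\<dots> = ennreal (1 / (2 * c)) * (\<integral>\<^sup>+s. \<integral>\<^sup>+t. ennreal ((g s)\<^sup>2 * (g t)\<^sup>2) \<partial>lborel \<partial>lborel) + ennreal (c / 2) * (\<integral>\<^sup>+s. \<integral>\<^sup>+t. ennreal ((R s t)\<^sup>2) \<partial>lborel \<partial>lborel)"
      by (simp add: nn_integral_add nn_integral_cmult)
    also have "(\<integral>\<^sup>+s. \<integral>\<^sup>+t. ennreal ((g s)\<^sup>2 * (g t)\<^sup>2) \<partial>lborel \<partial>lborel) = ennreal (G * G)"
      using G0 by (simp add: ennreal_mult' nn_integral_cmult nn_integral_multc nnG)
    also have "ennreal (1 / (2 * c)) * ennreal (G * G) + ennreal (c / 2) * (\<integral>\<^sup>+s. \<integral>\<^sup>+t. ennreal ((R s t)\<^sup>2) \<partial>lborel \<partial>lborel)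
        \<le> ennreal (1 / (2 * c)) * ennreal (G * G) + ennreal (c / 2) * ennreal (36 / 25)"
      by (intro add_left_mono mult_left_mono R_le) auto
    also have "\<dots> = ennreal (1 / (2 * c) * (G * G) + c / 2 * (36 / 25))"
      using \<open>c > 0\<close> by (simp add: ennreal_mult'[symmetric] ennreal_plus[symmetric] del: ennreal_plus)
    finally have "log_pairing g g \<le> 1 / (2 * c) * (G * G) + c / 2 * (36 / 25)"
      using \<open>c > 0\<close> by (subst (asm) ennreal_le_iff) auto
    also have "1 / (2 * c) * (G * G) + c / 2 * (36 / 25) = (G\<^sup>2 / c + 36 / 25 * c) / 2"
      by (simp add: power2_eq_square add_divide_distrib)
    finally show ?thesis .
  qed
  show ?thesis
  proof (cases "G = 0")
    case True
    have "log_pairing g g \<le> 0 + e" if "e > 0" for e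
      using main[of e] that True by simp
    then have "log_pairing g g \<le> 0" by (rule field_le_epsilon)
    then show ?thesis using True by (simp add: G_def)
  next
    case False
    with G0 have "G > 0" by simp
    then have "log_pairing g g \<le> (G\<^sup>2 / (G / (6 / 5)) + 36 / 25 * (G / (6 / 5))) / 2" by (intro main) simp
    also have "(G\<^sup>2 / (G / (6 / 5)) + 36 / 25 * (G / (6 / 5))) / 2 = 6 / 5 * G"
      using \<open>G > 0\<close> by (simp add: power2_eq_square)
    finally show ?thesis unfolding G_def .
  qed
qed

text \<open>Split \<open>\<Phi> = g + a u\<close> with \<open>g\<close> orthogonal to the trial function \<open>u\<close>. The operator sends \<open>u\<close> to
  \<open>783/500 u + e\<close> with a small residual \<open>e\<close>, so the cross term is only \<open>2 a \<langle>g, e\<rangle>\<close>. The constant is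
  \<open>3137/2000 = 6/5 + 3685/10000\<close>: the first summand is the bound on the orthogonal complement, the
  second is the share of \<open>\<parallel>g\<parallel>\<^sup>2\<close> spent on the cross term.\<close>

theorem (in sine_window) log_form_le: "log_form \<le> 3137 / 2000 * (LBINT t. (\<Phi> t)\<^sup>2)"
proof -
  interpret u: sine_window trial 2 by (rule trial_window)
  note W = sine_window_axioms
  define n q where "n = trial_norm_sq" and "q = trial_form"
  have nq: "n = 1 / 3 - 31 / 125 + 961 / 17500" "q = 1 / 2 - 31 / 90 + 961 / 15000"
    by (simp_all add: n_def q_def trial_norm_sq_eq trial_form_eq)
  have n0: "n > 0" by (simp add: nq)
  define a where "a = (LBINT t. \<Phi> t * trial t) / n"
  define g where "g = (\<lambda>t. \<Phi> t + (- a) * trial t)"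
  have g: "sine_window g (B + \<bar>- a\<bar> * 2)" unfolding g_def by (rule sine_window_lincomb[OF W trial_window])
  interpret g: sine_window g "B + \<bar>- a\<bar> * 2" by (rule g)
  have \<Phi>_eq: "\<Phi> = (\<lambda>t. g t + a * trial t)" by (simp add: g_def)
  have int_n: "(LBINT t. (trial t)\<^sup>2) = n" "integrable lborel (\<lambda>t. (trial t)\<^sup>2)"
    using trial_norm by (auto simp: n_def has_bochner_integral_iff)
  have int1: "integrable lborel (\<lambda>t. \<Phi> t * trial t)" using integrable_\<Phi>_mult[of trial 2] u.\<Phi>_bound by simp
  have int2: "integrable lborel (\<lambda>t. g t * trial t)" using g.integrable_\<Phi>_mult[of trial 2] u.\<Phi>_bound by simp
  have orth: "(LBINT t. g t * trial t) = 0"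
  proof -
    have "g t * trial t = \<Phi> t * trial t - a * (trial t)\<^sup>2" for t by (simp add: g_def power2_eq_square algebra_simps)
    then have "(LBINT t. g t * trial t) = (LBINT t. \<Phi> t * trial t) - a * n" using int1 int_n by simp
    then show ?thesis using n0 by (simp add: a_def)
  qed
  define G where "G = (LBINT t. (g t)\<^sup>2)"
  have norm_eq: "(LBINT t. (\<Phi> t)\<^sup>2) = G + a\<^sup>2 * n"
  proof -
    have "(\<Phi> t)\<^sup>2 = (g t)\<^sup>2 + 2 * a * (g t * trial t) + a\<^sup>2 * (trial t)\<^sup>2" for t
      by (simp add: g_def power2_eq_square algebra_simps)
    then show ?thesis using g.integrable_\<Phi>_sq int2 int_n orth by (simp add: G_def)
  qed
  define e where "e = (\<lambda>s. indicator {0..1} s * (LBINT t. trial t * log_kernel s t) - 783 / 500 * trial s)"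
  have e: "sine_window e (8 + 783 / 500 * 2)"
  proof
    show "e \<in> borel_measurable borel" unfolding e_def by measurable
    fix t
    have "\<bar>indicator {0..1} t * (LBINT x. trial x * log_kernel t x)\<bar> \<le> 8"
      using u.abs_integral_\<Phi>_log_kernel_le[of t] by (auto split: split_indicator)
    then show "\<bar>e t\<bar> \<le> 8 + 783 / 500 * 2" unfolding e_def
      using abs_triangle_ineq4[of "indicator {0..1} t * (LBINT x. trial x * log_kernel t x)" "783 / 500 * trial t"] u.\<Phi>_bound[of t]
      by (simp add: abs_mult)
  qed (auto simp: e_def u.\<Phi>_support)
  interpret e: sine_window e "8 + 783 / 500 * 2" by (rule e)
  have e_sq: "(LBINT s. (e s)\<^sup>2) \<le> 1 / 10000"
  proof -
    have "(LBINT s. (e s)\<^sup>2) \<le> (LBINT s. 2 * (indicator {0..1} s * (odd_poly residual_coeffs s)\<^sup>2) + 2 * ((69 / 2600)\<^sup>2 * (indicator {0..1} s * s ^ 26)))"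
    proof (rule integral_mono_AE)
      show "integrable lborel (\<lambda>s. (e s)\<^sup>2)" by (rule e.integrable_\<Phi>_sq)
      show "integrable lborel (\<lambda>s. 2 * (indicator {0..1} s * (odd_poly residual_coeffs s)\<^sup>2) + 2 * ((69 / 2600)\<^sup>2 * (indicator {0..1} s * s ^ 26)))"
        using integral_odd_poly_sq[of residual_coeffs] has_bochner_integral_power_Icc01[of 26]
        by (auto simp: has_bochner_integral_iff)
      have "AE s in lborel. s \<noteq> 0 \<and> s \<noteq> (1::real)"
        using AE_lborel_singleton[of 0] AE_lborel_singleton[of 1] by eventually_elim auto
      then show "AE s in lborel. (e s)\<^sup>2 \<le> 2 * (indicator {0..1} s * (odd_poly residual_coeffs s)\<^sup>2) + 2 * ((69 / 2600)\<^sup>2 * (indicator {0..1} s * s ^ 26))"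
      proof eventually_elim
        case (elim s)
        show ?case
        proof (cases "s \<in> {0<..<1}")
          case True
          then have "(LBINT t. trial t * log_kernel s t) = (\<Sum>i<length trial_coeffs. trial_coeffs ! i * log_moment i s)"
            using has_bochner_integral_integral_eq[OF integral_odd_poly_log_kernel[of s trial_coeffs]]
            by (simp only: trial_def) auto
          then have "e s = (\<Sum>i<length trial_coeffs. trial_coeffs ! i * log_moment i s) - 783 / 500 * odd_poly trial_coeffs s"
            using True by (simp add: e_def trial_def)
          then have "(e s)\<^sup>2 \<le> 2 * (odd_poly residual_coeffs s)\<^sup>2 + 2 * (69 / 2600 * s ^ 13)\<^sup>2"
            using residual_sq_le[OF True] by simp
          also have "(69 / 2600 * s ^ 13)\<^sup>2 = (69 / 2600)\<^sup>2 * s ^ 26"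
            by (simp only: power_mult_distrib power_mult[symmetric]) simp
          finally show ?thesis using True by simp
        next
          case False
          then have "e s = 0" using elim e.\<Phi>_support[of s] by auto
          then show ?thesis by simp
        qed
      qed
    qed
    also have "\<dots> = 2 * (\<Sum>i<length residual_coeffs. \<Sum>j<length residual_coeffs. residual_coeffs ! i * residual_coeffs ! j / real (2 * i + 2 * j + 3))
        + 2 * ((69 / 2600)\<^sup>2 * (1 / 27))"
      by (intro has_bochner_integral_integral_eq has_bochner_integral_add has_bochner_integral_mult_right integral_odd_poly_sq)
         (use has_bochner_integral_power_Icc01[of 26] in simp)
    also have "\<dots> \<le> 1 / 10000" by (rule residual_numeric)
    finally show ?thesis .
  qed
  have cross: "2 * a * log_pairing g trial \<le> 3685 / 10000 * G + a\<^sup>2 * (10000 / 3685) * (1 / 10000)"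
  proof -
    have "g s * (LBINT t. trial t * log_kernel s t) = g s * e s + 783 / 500 * (g s * trial s)" for s
      by (cases "s \<in> {0..1}") (auto simp: e_def g.\<Phi>_support algebra_simps)
    then have "log_pairing g trial = (LBINT s. g s * e s)"
      unfolding log_pairing_def using int2 g.integrable_\<Phi>_mult[of e, OF _ e.\<Phi>_bound] orth by simp
    then have "2 * a * log_pairing g trial = (LBINT s. 2 * a * (g s * e s))" by simp
    also have "\<dots> \<le> (LBINT s. 3685 / 10000 * (g s)\<^sup>2 + a\<^sup>2 * (10000 / 3685) * (e s)\<^sup>2)"
    proof (rule integral_mono)
      show "integrable lborel (\<lambda>s. 2 * a * (g s * e s))" using g.integrable_\<Phi>_mult[of e, OF _ e.\<Phi>_bound] by simp
      show "integrable lborel (\<lambda>s. 3685 / 10000 * (g s)\<^sup>2 + a\<^sup>2 * (10000 / 3685) * (e s)\<^sup>2)"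
        using g.integrable_\<Phi>_sq e.integrable_\<Phi>_sq by simp
      fix s
      have "0 \<le> (3685 / 10000 * g s - a * e s)\<^sup>2 * (10000 / 3685)" by simp
      then show "2 * a * (g s * e s) \<le> 3685 / 10000 * (g s)\<^sup>2 + a\<^sup>2 * (10000 / 3685) * (e s)\<^sup>2"
        by (simp add: power2_eq_square algebra_simps)
    qed
    also have "\<dots> = 3685 / 10000 * G + a\<^sup>2 * (10000 / 3685) * (LBINT s. (e s)\<^sup>2)"
      using g.integrable_\<Phi>_sq e.integrable_\<Phi>_sq by (simp add: G_def)
    also have "\<dots> \<le> 3685 / 10000 * G + a\<^sup>2 * (10000 / 3685) * (1 / 10000)"
      using e_sq by (intro add_left_mono mult_left_mono) auto
    finally show ?thesis .
  qed
  have "log_form = log_pairing \<Phi> \<Phi>" by (simp add: log_form_def log_pairing_def)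
  also have "\<dots> = log_pairing \<Phi> g + a * log_pairing \<Phi> trial"
    by (subst (2) \<Phi>_eq) (rule log_pairing_lincomb_right[OF W g trial_window])
  also have "log_pairing \<Phi> g = log_pairing g g + a * log_pairing g trial"
    unfolding log_pairing_commute[OF W g] by (subst \<Phi>_eq) (rule log_pairing_lincomb_right[OF g g trial_window])
  also have "log_pairing \<Phi> trial = log_pairing g trial + a * q"
    unfolding log_pairing_commute[OF W trial_window] log_pairing_commute[OF g trial_window] q_def trial_log_pairing[symmetric]
    by (subst \<Phi>_eq) (rule log_pairing_lincomb_right[OF trial_window g trial_window])
  finally have "log_form = log_pairing g g + 2 * a * log_pairing g trial + a\<^sup>2 * q"
    by (simp add: power2_eq_square algebra_simps)
  also have "\<dots> \<le> 6 / 5 * G + (3685 / 10000 * G + a\<^sup>2 * (10000 / 3685) * (1 / 10000)) + a\<^sup>2 * q"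
    using log_pairing_orthogonal_le[OF g orth] cross by (simp add: G_def)
  also have "\<dots> = 3137 / 2000 * G + a\<^sup>2 * (1 / 3685 + q)" by (simp add: algebra_simps)
  also have "\<dots> \<le> 3137 / 2000 * G + a\<^sup>2 * (3137 / 2000 * n)"
    by (intro add_left_mono mult_left_mono) (simp_all add: nq)
  finally show ?thesis by (simp add: norm_eq algebra_simps)
qed

section \<open>A weighted inequality for trigonometric sums\<close>

lemma has_bochner_integral_eqI:
  assumes "has_bochner_integral M f x" "\<And>t. f t = g t" "x = y" shows "has_bochner_integral M g y"
proof -
  have "f = g" using assms(2) by (rule ext)
  with assms show ?thesis by simp
qed

lemma has_bochner_integral_nonneg:
  fixes f :: "'a \<Rightarrow> real"
  assumes "has_bochner_integral M f x" "\<And>t. 0 \<le> f t" shows "0 \<le> x"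
  using assms integral_nonneg_AE[of f M] by (auto simp: has_bochner_integral_iff)

lemma nn_integral_of_has_bochner:
  fixes f :: "'a \<Rightarrow> real"
  assumes "has_bochner_integral M f x" "\<And>t. 0 \<le> f t"
  shows "(\<integral>\<^sup>+t. ennreal (f t) \<partial>M) = ennreal x"
  using assms nn_integral_eq_integral[of M f] by (auto simp: has_bochner_integral_iff)

text \<open>The sine integral at infinity; by polarization it yields the inner products of step functions
  that stand behind Plancherel's identity for trigonometric sums.\<close>

lemma integral_one_minus_cos:
  "has_bochner_integral lborel (\<lambda>x. indicator {0<..} x * ((1 - cos (a * x)) / x\<^sup>2)) (pi / 2 * \<bar>a\<bar>)"
proof -
  define F where "F = (\<lambda>x::real. Si x - (1 - cos x) / x)"
  have lim0: "((F \<circ> real_of_ereal) \<longlongrightarrow> 0) (at_right 0)"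
  proof -
    have "((\<lambda>x::real. (1 - cos x) / x) \<longlongrightarrow> 0) (at_right 0)" by real_asymp
    moreover have "(Si \<longlongrightarrow> Si 0) (at_right 0)"
      using isCont_Si[of 0] unfolding isCont_def by (rule filterlim_at_split[THEN iffD1, THEN conjunct2])
    moreover have "Si 0 = 0" by (simp add: Si_def zero_ereal_def[symmetric])
    ultimately have "(F \<longlongrightarrow> 0 - 0) (at_right 0)" unfolding F_def by (intro tendsto_diff) auto
    then show ?thesis unfolding zero_ereal_def by (simp add: ereal_tendsto_simps)
  qed
  have limI: "((F \<circ> real_of_ereal) \<longlongrightarrow> pi / 2) (at_left \<infinity>)"
  proof -
    have "((\<lambda>x::real. (1 - cos x) / x) \<longlongrightarrow> 0) at_top"
    proof (rule Lim_null_comparison)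
      show "\<forall>\<^sub>F x in at_top. norm ((1 - cos x) / x) \<le> 2 / (x::real)"
        using eventually_gt_at_top[of 0]
      proof eventually_elim
        case (elim x)
        have "\<bar>1 - cos x\<bar> \<le> 2" using cos_ge_minus_one[of x] cos_le_one[of x] by linarith
        then show ?case using elim by (simp add: divide_right_mono)
      qed
      show "((\<lambda>x::real. 2 / x) \<longlongrightarrow> 0) at_top" by real_asymp
    qed
    then have "(F \<longlongrightarrow> pi / 2 - 0) at_top" unfolding F_def by (intro tendsto_diff Si_at_top) auto
    then show ?thesis by (simp add: ereal_tendsto_simps)
  qed
  have der: "(F has_real_derivative (1 - cos x) / x\<^sup>2) (at x)" if "0 < x" for x :: real
  proof -
    have "(F has_real_derivative sinc x - (sin x * x - (1 - cos x)) / x\<^sup>2) (at x)"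
      unfolding F_def using that by (auto intro!: derivative_eq_intros DERIV_Si simp: power2_eq_square)
    moreover have "sinc x - (sin x * x - (1 - cos x)) / x\<^sup>2 = (1 - cos x) / x\<^sup>2"
      using that by (simp add: power2_eq_square field_simps)
    ultimately show ?thesis by simp
  qed
  have 1: "set_integrable lborel (einterval 0 \<infinity>) (\<lambda>x. (1 - cos x) / x\<^sup>2)"
    "(LBINT x=0..\<infinity>. (1 - cos x) / x\<^sup>2) = pi / 2 - 0"
    by (rule interval_integral_FTC_nonneg[OF _ der _ _ lim0 limI];
        auto simp: zero_ereal_def intro!: continuous_intros)+
  have base: "has_bochner_integral lborel (\<lambda>x. indicator {0<..} x * ((1 - cos x) / x\<^sup>2)) (pi / 2)"
    using 1 by (simp add: has_bochner_integral_iff set_integrable_def zero_ereal_def interval_lebesgue_integral_0_infty[unfolded zero_ereal_def] set_lebesgue_integral_def)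
  have pos: "has_bochner_integral lborel (\<lambda>x. indicator {0<..} x * ((1 - cos (b * x)) / x\<^sup>2)) (pi / 2 * b)" if "b > 0" for b
  proof -
    have "has_bochner_integral lborel (\<lambda>x. indicator {0<..} (0 + b * x) * ((1 - cos (0 + b * x)) / (0 + b * x)\<^sup>2)) ((pi / 2) /\<^sub>R \<bar>b\<bar>)"
      using base that by (subst lborel_has_bochner_integral_real_affine_iff[symmetric]) auto
    from has_bochner_integral_mult_right[OF this, of "b\<^sup>2"]
    have "has_bochner_integral lborel (\<lambda>x. b\<^sup>2 * (indicator {0<..} (0 + b * x) * ((1 - cos (0 + b * x)) / (0 + b * x)\<^sup>2))) (b\<^sup>2 * ((pi / 2) /\<^sub>R \<bar>b\<bar>))" .
    then show ?thesis
    proof (rule has_bochner_integral_eqI)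
      show "b\<^sup>2 * (indicator {0<..} (0 + b * x) * ((1 - cos (0 + b * x)) / (0 + b * x)\<^sup>2)) = indicator {0<..} x * ((1 - cos (b * x)) / x\<^sup>2)" for x
        using that by (auto simp: power_mult_distrib zero_less_mult_iff split: split_indicator)
      show "b\<^sup>2 * ((pi / 2) /\<^sub>R \<bar>b\<bar>) = pi / 2 * b" using that by (simp add: power2_eq_square field_simps)
    qed
  qed
  consider "a = 0" | "a > 0" | "a < 0" by linarith
  then show ?thesis
  proof cases
    case 3
    then show ?thesis using pos[of "-a"] by simp
  qed (use pos[of a] in \<open>simp_all add: has_bochner_integral_zero\<close>)
qed

lemma integral_one_minus_cos_pair:
  assumes "0 \<le> a" "0 \<le> b"
  shows "has_bochner_integral lborel (\<lambda>x. indicator {0<..} x * ((1 - cos (a * x)) * (1 - cos (b * x)) / x\<^sup>2)) (pi / 2 * min a b)"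
proof -
  have eq: "indicator {0<..} x * ((1 - cos (a * x)) * (1 - cos (b * x)) / x\<^sup>2)
     = indicator {0<..} x * ((1 - cos (a * x)) / x\<^sup>2) + indicator {0<..} x * ((1 - cos (b * x)) / x\<^sup>2)
       - (1 / 2) * (indicator {0<..} x * ((1 - cos ((a + b) * x)) / x\<^sup>2)) - (1 / 2) * (indicator {0<..} x * ((1 - cos ((a - b) * x)) / x\<^sup>2))" for x :: real
  proof -
    have "cos (a * x) * cos (b * x) = (cos ((a - b) * x) + cos ((a + b) * x)) / 2"
      by (simp add: cos_times_cos left_diff_distrib distrib_right)
    then have "(1 - cos (a * x)) * (1 - cos (b * x)) = (1 - cos (a * x)) + (1 - cos (b * x)) - (1 / 2) * (1 - cos ((a + b) * x)) - (1 / 2) * (1 - cos ((a - b) * x))"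
      by (simp add: algebra_simps)
    then show ?thesis by (simp only: add_divide_distrib diff_divide_distrib distrib_left right_diff_distrib times_divide_eq_right mult.left_commute)
  qed
  have "has_bochner_integral lborel (\<lambda>x. indicator {0<..} x * ((1 - cos (a * x)) * (1 - cos (b * x)) / x\<^sup>2))
     (pi / 2 * \<bar>a\<bar> + pi / 2 * \<bar>b\<bar> - (1 / 2) * (pi / 2 * \<bar>a + b\<bar>) - (1 / 2) * (pi / 2 * \<bar>a - b\<bar>))"
    unfolding eq by (intro has_bochner_integral_add has_bochner_integral_diff has_bochner_integral_mult_right integral_one_minus_cos)
  also have "pi / 2 * \<bar>a\<bar> + pi / 2 * \<bar>b\<bar> - (1 / 2) * (pi / 2 * \<bar>a + b\<bar>) - (1 / 2) * (pi / 2 * \<bar>a - b\<bar>) = pi / 2 * min a b"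
    using assms by (auto simp: min_def abs_if field_simps)
  finally show ?thesis .
qed

lemma integral_sin_pair:
  assumes "0 \<le> a" "0 \<le> b"
  shows "has_bochner_integral lborel (\<lambda>x. indicator {0<..} x * (sin (a * x) * sin (b * x) / x\<^sup>2)) (pi / 2 * min a b)"
proof -
  have eq: "indicator {0<..} x * (sin (a * x) * sin (b * x) / x\<^sup>2)
     = (1 / 2) * (indicator {0<..} x * ((1 - cos ((a + b) * x)) / x\<^sup>2)) - (1 / 2) * (indicator {0<..} x * ((1 - cos ((a - b) * x)) / x\<^sup>2))" for x :: real
  proof -
    have "sin (a * x) * sin (b * x) = (cos ((a - b) * x) - cos ((a + b) * x)) / 2"
      by (simp add: sin_times_sin left_diff_distrib distrib_right)
    also have "(X - Y) / 2 = (1 / 2) * (1 - Y) - (1 / 2) * (1 - X)" for X Y :: real by (simp add: field_simps)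
    finally have "sin (a * x) * sin (b * x) = (1 / 2) * (1 - cos ((a + b) * x)) - (1 / 2) * (1 - cos ((a - b) * x))" .
    then show ?thesis by (simp only: add_divide_distrib diff_divide_distrib distrib_left right_diff_distrib times_divide_eq_right mult.left_commute)
  qed
  have "has_bochner_integral lborel (\<lambda>x. indicator {0<..} x * (sin (a * x) * sin (b * x) / x\<^sup>2))
     ((1 / 2) * (pi / 2 * \<bar>a + b\<bar>) - (1 / 2) * (pi / 2 * \<bar>a - b\<bar>))"
    unfolding eq by (intro has_bochner_integral_diff has_bochner_integral_mult_right integral_one_minus_cos)
  also have "(1 / 2) * (pi / 2 * \<bar>a + b\<bar>) - (1 / 2) * (pi / 2 * \<bar>a - b\<bar>) = pi / 2 * min a b"
    using assms by (auto simp: min_def abs_if field_simps)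
  finally show ?thesis .
qed

lemma integral_indicator_pair:
  fixes a b :: real
  assumes "0 \<le> a" "0 \<le> b"
  shows "has_bochner_integral lborel (\<lambda>t::real. indicator {0..<a} t * indicator {0..<b} t) (min a b)"
proof -
  have "(\<lambda>t::real. indicator {0..<a} t * indicator {0..<b} t) = (indicator {0..<min a b} :: real \<Rightarrow> real)"
    by (auto simp: fun_eq_iff split: split_indicator)
  moreover have "has_bochner_integral lborel (indicator {0..<min a b}) (measure lborel {0..<min a b})"
    using assms by (intro has_bochner_integral_real_indicator) auto
  ultimately show ?thesis using assms by simp
qed

lemma integral_bilinear_sum_sq:
  fixes f :: "'i \<Rightarrow> real \<Rightarrow> real"
  assumes "\<And>i j. i \<in> J \<Longrightarrow> j \<in> J \<Longrightarrow> has_bochner_integral lborel (\<lambda>x. w x * (f i x * f j x)) (m i j)"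
  shows "has_bochner_integral lborel (\<lambda>x. w x * (\<Sum>j\<in>J. e j * f j x)\<^sup>2) (\<Sum>i\<in>J. \<Sum>j\<in>J. e i * e j * m i j)"
proof -
  have "w x * (\<Sum>j\<in>J. e j * f j x)\<^sup>2 = (\<Sum>i\<in>J. \<Sum>j\<in>J. (e i * e j) * (w x * (f i x * f j x)))" for x
  proof -
    have "(\<Sum>j\<in>J. e j * f j x)\<^sup>2 = (\<Sum>i\<in>J. \<Sum>j\<in>J. (e i * f i x) * (e j * f j x))"
      unfolding power2_eq_square by (rule sum_product)
    then show ?thesis by (simp add: sum_distrib_left mult_ac)
  qed
  then show ?thesis
    using assms by (simp only:) (intro has_bochner_integral_sum has_bochner_integral_mult_right)
qed

lemma integral_step_sin:
  fixes x :: real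
  assumes "0 \<le> a" "a \<le> 1" "x \<noteq> 0"
  shows "has_bochner_integral lborel (\<lambda>t. indicator {0..<a} t * sin (t * x)) ((1 - cos (a * x)) / x)"
proof -
  have "has_bochner_integral lborel (\<lambda>t. sin (t * x) * indicator {0..a} t) ((- cos (a * x) / x) - (- cos (0 * x) / x))"
    using assms by (intro has_bochner_integral_FTC_Icc_real[where F = "\<lambda>t. - cos (t * x) / x"])
      (auto intro!: derivative_eq_intros continuous_intros)
  moreover have "AE t in lborel. sin (t * x) * indicator {0..a} t = indicator {0..<a} t * sin (t * x)"
    using AE_lborel_singleton[of a] by eventually_elim (auto split: split_indicator)
  ultimately have "has_bochner_integral lborel (\<lambda>t. indicator {0..<a} t * sin (t * x)) ((- cos (a * x) / x) - (- cos (0 * x) / x))"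
    by (subst has_bochner_integral_cong_AE[symmetric]) auto
  then show ?thesis by (simp add: diff_divide_distrib)
qed

text \<open>The sine transform of the step function \<open>\<Phi> = \<Sum> e\<^sub>j 1\<^bsub>[0, a\<^sub>j)\<^esub>\<close> is \<open>- E(x) / x\<close>, because \<open>\<Sum> e\<^sub>j = 0\<close>. So the
  left-hand side is, up to constants, the logarithmic form of \<open>\<Phi>\<close> and the right-hand side its norm.\<close>

lemma cos_sum_inequality_unit:
  fixes e a :: "'i \<Rightarrow> real"
  assumes "finite J" and a: "\<And>j. j \<in> J \<Longrightarrow> 0 \<le> a j \<and> a j \<le> 1" and e: "(\<Sum>j\<in>J. e j) = 0"
  defines "E \<equiv> \<lambda>x. \<Sum>j\<in>J. e j * cos (a j * x)"
  shows "(\<integral>\<^sup>+x. ennreal (indicator {0<..} x * ((E x)\<^sup>2 / x ^ 3)) \<partial>lborel)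
     \<le> ennreal (3137 / 2000 / pi) * (\<integral>\<^sup>+x. ennreal (indicator {0<..} x * ((E x)\<^sup>2 / x\<^sup>2)) \<partial>lborel)"
proof -
  define \<Phi> where "\<Phi> = (\<lambda>t. \<Sum>j\<in>J. e j * indicator {0..<a j} t :: real)"
  define Q where "Q = (\<Sum>i\<in>J. \<Sum>j\<in>J. e i * e j * min (a i) (a j))"
  interpret sine_window \<Phi> "\<Sum>j\<in>J. \<bar>e j\<bar>"
  proof
    show "\<Phi> \<in> borel_measurable borel" unfolding \<Phi>_def by measurable
    show "\<bar>\<Phi> t\<bar> \<le> (\<Sum>j\<in>J. \<bar>e j\<bar>)" for t
      unfolding \<Phi>_def by (rule order_trans[OF sum_abs]) (auto intro!: sum_mono simp: abs_mult mult_left_le split: split_indicator)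
    show "\<Phi> t = 0" if "t \<notin> {0..1}" for t
      unfolding \<Phi>_def using that a by (intro sum.neutral) (force split: split_indicator)
  qed
  have E_eq: "E x = - (\<Sum>j\<in>J. e j * (1 - cos (a j * x)))" for x
    using e by (simp add: E_def right_diff_distrib sum_subtractf)
  have K_eq: "K x = - E x / x" if "x \<noteq> 0" for x
  proof -
    have "has_bochner_integral lborel (\<lambda>t. \<Sum>j\<in>J. e j * (indicator {0..<a j} t * sin (t * x))) (\<Sum>j\<in>J. e j * ((1 - cos (a j * x)) / x))"
      using a that by (intro has_bochner_integral_sum has_bochner_integral_mult_right integral_step_sin) auto
    moreover have "(\<Sum>j\<in>J. e j * (indicator {0..<a j} t * sin (t * x))) = \<Phi> t * sin (t * x)" for t
      by (simp add: \<Phi>_def sum_distrib_right mult.assoc)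
    moreover have "(\<Sum>j\<in>J. e j * ((1 - cos (a j * x)) / x)) = - E x / x"
      by (simp add: E_eq sum_divide_distrib)
    ultimately show ?thesis unfolding K_def by (simp add: has_bochner_integral_iff)
  qed
  have int\<Phi>: "(LBINT t. (\<Phi> t)\<^sup>2) = Q"
  proof -
    have "has_bochner_integral lborel (\<lambda>t. 1 * (\<Phi> t)\<^sup>2) Q"
      unfolding \<Phi>_def Q_def using a
      by (intro integral_bilinear_sum_sq) (auto intro!: integral_indicator_pair)
    then show ?thesis by (simp add: has_bochner_integral_iff)
  qed
  have "has_bochner_integral lborel (\<lambda>x. (indicator {0<..} x / x\<^sup>2) * (\<Sum>j\<in>J. e j * (1 - cos (a j * x)))\<^sup>2) (\<Sum>i\<in>J. \<Sum>j\<in>J. e i * e j * (pi / 2 * min (a i) (a j)))"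
  proof (rule integral_bilinear_sum_sq)
    fix i j assume "i \<in> J" "j \<in> J"
    then show "has_bochner_integral lborel (\<lambda>x. (indicator {0<..} x / x\<^sup>2) * ((1 - cos (a i * x)) * (1 - cos (a j * x)))) (pi / 2 * min (a i) (a j))"
      using integral_one_minus_cos_pair[of "a i" "a j"] a by simp
  qed
  then have plancherel: "has_bochner_integral lborel (\<lambda>x. indicator {0<..} x * ((E x)\<^sup>2 / x\<^sup>2)) (pi / 2 * Q)"
    by (rule has_bochner_integral_eqI) (simp_all add: E_eq Q_def sum_distrib_left mult_ac)
  then have nn: "(\<integral>\<^sup>+x. ennreal (indicator {0<..} x * ((E x)\<^sup>2 / x\<^sup>2)) \<partial>lborel) = ennreal (pi / 2 * Q)"
    by (rule nn_integral_of_has_bochner) auto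
  have "ennreal (indicator {0<..} x * ((E x)\<^sup>2 / x ^ 3)) = ennreal (indicator {0<..} x * ((K x)\<^sup>2 / x))" for x
    using K_eq[of x] by (cases "x > 0") (auto simp: power_divide power2_eq_square power3_eq_cube)
  then have "(\<integral>\<^sup>+x. ennreal (indicator {0<..} x * ((E x)\<^sup>2 / x ^ 3)) \<partial>lborel) = ennreal (log_form / 2)"
    using nn_integral_K_sq_div by simp
  also have "\<dots> \<le> ennreal (3137 / 2000 / pi * (pi / 2 * Q))"
    using log_form_le by (intro ennreal_leI) (simp add: int\<Phi>)
  also have "\<dots> = ennreal (3137 / 2000 / pi) * ennreal (pi / 2 * Q)" by (rule ennreal_mult') simp
  finally show ?thesis unfolding nn .
qed

text \<open>Here \<open>\<Sum> e\<^sub>j a\<^sub>j = 0\<close> says that the step function \<open>\<Phi> = \<Sum> e\<^sub>j 1\<^bsub>[0, a\<^sub>j)\<^esub>\<close> has mean \<open>0\<close>; its primitive \<open>\<Psi>\<close> then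
  vanishes at both ends and has sine transform \<open>h = E(x) / x\<^sup>2\<close>. Cauchy-Schwarz on the mean-zero
  functions gives \<open>\<Psi>\<^sup>2 \<le> t (1 - t) \<parallel>\<Phi>\<parallel>\<^sup>2\<close>, so \<open>\<parallel>\<Psi>\<parallel>\<^sup>2 \<le> \<parallel>\<Phi>\<parallel>\<^sup>2 / 6\<close>. Together with
  \<open>x h\<^sup>2 \<le> h\<^sup>2 + x\<^sup>2 h\<^sup>2 / 4\<close> this proves the inequality with the smaller constant \<open>1/6 + 1/4 = 5/12\<close> in place
  of \<open>3137 / 2000 / \<pi>\<close>.\<close>

lemma sin_sum_inequality_unit:
  fixes e a :: "'i \<Rightarrow> real"
  assumes "finite J" and a: "\<And>j. j \<in> J \<Longrightarrow> 0 \<le> a j \<and> a j \<le> 1" and e: "(\<Sum>j\<in>J. e j * a j) = 0"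
  defines "E \<equiv> \<lambda>x. \<Sum>j\<in>J. e j * sin (a j * x)"
  shows "(\<integral>\<^sup>+x. ennreal (indicator {0<..} x * ((E x)\<^sup>2 / x ^ 3)) \<partial>lborel)
     \<le> ennreal (3137 / 2000 / pi) * (\<integral>\<^sup>+x. ennreal (indicator {0<..} x * ((E x)\<^sup>2 / x\<^sup>2)) \<partial>lborel)"
proof -
  define \<Phi> where "\<Phi> = (\<lambda>t. \<Sum>j\<in>J. e j * indicator {0..<a j} t :: real)"
  define \<Psi> where "\<Psi> = (\<lambda>t. indicator {0..1} t * (\<Sum>j\<in>J. e j * min t (a j)) :: real)"
  define Q where "Q = (\<Sum>i\<in>J. \<Sum>j\<in>J. e i * e j * min (a i) (a j))"
  have int\<Phi>: "has_bochner_integral lborel (\<lambda>t. (\<Phi> t)\<^sup>2) Q"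
  proof -
    have "has_bochner_integral lborel (\<lambda>t. 1 * (\<Phi> t)\<^sup>2) Q"
      unfolding \<Phi>_def Q_def using a
      by (intro integral_bilinear_sum_sq) (auto intro!: integral_indicator_pair)
    then show ?thesis by simp
  qed
  have int\<Phi>1: "has_bochner_integral lborel (\<lambda>s. \<Phi> s * indicator {0..<t} s) (\<Sum>j\<in>J. e j * min (a j) t)" if "0 \<le> t" for t
  proof -
    have "has_bochner_integral lborel (\<lambda>s. \<Sum>j\<in>J. e j * (indicator {0..<a j} s * indicator {0..<t} s)) (\<Sum>j\<in>J. e j * min (a j) t)"
      using a that by (intro has_bochner_integral_sum has_bochner_integral_mult_right integral_indicator_pair) auto
    then show ?thesis by (simp add: \<Phi>_def sum_distrib_right mult.assoc)
  qed
  have \<Psi>_sq: "(\<Psi> t)\<^sup>2 \<le> indicator {0..1} t * (t * (1 - t)) * Q" for t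
  proof (cases "t \<in> {0..1}")
    case True
    define P where "P = (\<Sum>j\<in>J. e j * min (a j) t)"
    have P1: "(\<Sum>j\<in>J. e j * min (a j) 1) = 0" using e a by (simp add: min_absorb1 cong: sum.cong)
    have h0: "has_bochner_integral lborel (\<lambda>s. \<Phi> s * indicator {0..<1} s) 0"
      using int\<Phi>1[of 1] P1 by simp
    have quad: "0 \<le> Q - 2 * c * P + c\<^sup>2 * (t * (1 - t))" for c
    proof -
      have i: "has_bochner_integral lborel (\<lambda>s. (\<Phi> s)\<^sup>2 - 2 * c * (\<Phi> s * indicator {0..<t} s) + 2 * c * t * (\<Phi> s * indicator {0..<1} s)
          + c\<^sup>2 * (indicator {0..<t} s * indicator {0..<t} s) - 2 * c\<^sup>2 * t * (indicator {0..<t} s * indicator {0..<1} s)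
          + c\<^sup>2 * t\<^sup>2 * (indicator {0..<1} s * indicator {0..<1} s))
         (Q - 2 * c * P + 2 * c * t * 0 + c\<^sup>2 * min t t - 2 * c\<^sup>2 * t * min t 1 + c\<^sup>2 * t\<^sup>2 * min 1 1)"
        unfolding P_def using True
        by (intro has_bochner_integral_add has_bochner_integral_diff has_bochner_integral_mult_right int\<Phi> h0 int\<Phi>1 integral_indicator_pair) auto
      have "0 \<le> Q - 2 * c * P + 2 * c * t * 0 + c\<^sup>2 * min t t - 2 * c\<^sup>2 * t * min t 1 + c\<^sup>2 * t\<^sup>2 * min 1 1"
      proof (rule has_bochner_integral_nonneg[OF i])
        fix s
        have "0 \<le> (\<Phi> s - c * indicator {0..<t} s + c * t * indicator {0..<1} s)\<^sup>2" by simp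
        then show "0 \<le> (\<Phi> s)\<^sup>2 - 2 * c * (\<Phi> s * indicator {0..<t} s) + 2 * c * t * (\<Phi> s * indicator {0..<1} s)
          + c\<^sup>2 * (indicator {0..<t} s * indicator {0..<t} s) - 2 * c\<^sup>2 * t * (indicator {0..<t} s * indicator {0..<1} s)
          + c\<^sup>2 * t\<^sup>2 * (indicator {0..<1} s * indicator {0..<1} s)"
          by (simp add: power2_eq_square algebra_simps)
      qed
      then show ?thesis using True by (simp add: min_def power2_eq_square algebra_simps)
    qed
    have "P\<^sup>2 \<le> t * (1 - t) * Q"
    proof (cases "t * (1 - t) = 0")
      case True
      have "P = 0"
      proof (rule ccontr)
        assume "P \<noteq> 0"
        then show False using quad[of "(Q + 1) / (2 * P)"] True by (simp add: field_simps)
      qed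
      show ?thesis unfolding \<open>P = 0\<close> True by simp
    next
      case False
      with \<open>t \<in> {0..1}\<close> have p: "t * (1 - t) > 0" by (simp add: zero_less_mult_iff)
      define u where "u = t * (1 - t)"
      have q: "0 \<le> Q - 2 * (P / u) * P + (P / u)\<^sup>2 * u" using quad[of "P / u"] unfolding u_def .
      have "0 \<le> (Q - 2 * (P / u) * P + (P / u)\<^sup>2 * u) * u"
        using p unfolding u_def[symmetric] by (intro mult_nonneg_nonneg[OF q] less_imp_le)
      also have "\<dots> = u * Q - P\<^sup>2" using p unfolding u_def[symmetric] by (simp add: power2_eq_square field_simps)
      finally show ?thesis by (simp add: u_def)
    qed
    then show ?thesis using True by (simp add: \<Psi>_def P_def min.commute)
  qed (simp add: \<Psi>_def)
  interpret \<Psi>: sine_window \<Psi> "\<Sum>j\<in>J. \<bar>e j\<bar>"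
  proof
    show "\<Psi> \<in> borel_measurable borel" unfolding \<Psi>_def by measurable
    show "\<bar>\<Psi> t\<bar> \<le> (\<Sum>j\<in>J. \<bar>e j\<bar>)" for t
    proof (cases "t \<in> {0..1}")
      case True
      have "\<bar>e j * min t (a j)\<bar> \<le> \<bar>e j\<bar>" if "j \<in> J" for j
        unfolding abs_mult using True a[OF that] by (intro mult_left_le) (auto simp: min_def)
      then show ?thesis using True unfolding \<Psi>_def by (auto intro!: order_trans[OF sum_abs] sum_mono)
    qed (simp add: \<Psi>_def sum_nonneg)
  qed (simp add: \<Psi>_def)
  have int\<Psi>: "(LBINT t. (\<Psi> t)\<^sup>2) \<le> Q / 6"
  proof -
    have h: "has_bochner_integral lborel (\<lambda>t. (indicator {0..1::real} t * t ^ 1 - indicator {0..1} t * t ^ 2) * Q) ((1 / real (1 + 1) - 1 / real (2 + 1)) * Q)"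
      by (intro has_bochner_integral_mult_left has_bochner_integral_diff has_bochner_integral_power_Icc01)
    have le: "(LBINT t. (\<Psi> t)\<^sup>2) \<le> (LBINT t. (indicator {0..1::real} t * t ^ 1 - indicator {0..1} t * t ^ 2) * Q)"
      using \<Psi>_sq \<Psi>.integrable_\<Phi>_sq h
      by (intro integral_mono) (auto simp: has_bochner_integral_iff power2_eq_square algebra_simps)
    show ?thesis using le unfolding has_bochner_integral_integral_eq[OF h] by simp
  qed
  have K_eq: "\<Psi>.K x = E x / x\<^sup>2" if "x \<noteq> 0" for x
  proof -
    have piece: "has_bochner_integral lborel (\<lambda>t. indicator {0..1} t * min t b * sin (t * x)) (sin (b * x) / x\<^sup>2 - b * cos x / x)"
      if b: "0 \<le> b" "b \<le> 1" for b
    proof -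
      have "has_bochner_integral lborel (\<lambda>t. t * sin (t * x) * indicator {0..b} t)
         ((sin (b * x) / x\<^sup>2 - b * cos (b * x) / x) - (sin (0 * x) / x\<^sup>2 - 0 * cos (0 * x) / x))"
        using \<open>x \<noteq> 0\<close> b
        by (intro has_bochner_integral_FTC_Icc_real[where F = "\<lambda>t. sin (t * x) / x\<^sup>2 - t * cos (t * x) / x"])
           (auto intro!: derivative_eq_intros continuous_intros simp: power2_eq_square diff_divide_distrib)
      moreover have "has_bochner_integral lborel (\<lambda>t. b * sin (t * x) * indicator {b..1} t) ((- b * cos (1 * x) / x) - (- b * cos (b * x) / x))"
        using \<open>x \<noteq> 0\<close> b
        by (intro has_bochner_integral_FTC_Icc_real[where F = "\<lambda>t. - b * cos (t * x) / x"])
           (auto intro!: derivative_eq_intros continuous_intros)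
      ultimately have "has_bochner_integral lborel (\<lambda>t. t * sin (t * x) * indicator {0..b} t + b * sin (t * x) * indicator {b..1} t)
        ((sin (b * x) / x\<^sup>2 - b * cos (b * x) / x) - (sin (0 * x) / x\<^sup>2 - 0 * cos (0 * x) / x) + ((- b * cos (1 * x) / x) - (- b * cos (b * x) / x)))"
        by (rule has_bochner_integral_add)
      moreover have "AE t in lborel. t * sin (t * x) * indicator {0..b} t + b * sin (t * x) * indicator {b..1} t = indicator {0..1} t * min t b * sin (t * x)"
        using AE_lborel_singleton[of b] by eventually_elim (use b in \<open>auto simp: min_def split: split_indicator\<close>)
      ultimately have "has_bochner_integral lborel (\<lambda>t. indicator {0..1} t * min t b * sin (t * x))
        ((sin (b * x) / x\<^sup>2 - b * cos (b * x) / x) - (sin (0 * x) / x\<^sup>2 - 0 * cos (0 * x) / x) + ((- b * cos (1 * x) / x) - (- b * cos (b * x) / x)))"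
        by (subst has_bochner_integral_cong_AE[symmetric]) auto
      then show ?thesis by simp
    qed
    have "has_bochner_integral lborel (\<lambda>t. \<Sum>j\<in>J. e j * (indicator {0..1} t * min t (a j) * sin (t * x))) (\<Sum>j\<in>J. e j * (sin (a j * x) / x\<^sup>2 - a j * cos x / x))"
      using a by (intro has_bochner_integral_sum has_bochner_integral_mult_right piece) auto
    moreover have "(\<Sum>j\<in>J. e j * (indicator {0..1} t * min t (a j) * sin (t * x))) = \<Psi> t * sin (t * x)" for t
      by (simp add: \<Psi>_def sum_distrib_left sum_distrib_right mult_ac)
    moreover have "(\<Sum>j\<in>J. e j * (sin (a j * x) / x\<^sup>2 - a j * cos x / x)) = E x / x\<^sup>2"
    proof -
      have "(\<Sum>j\<in>J. e j * (sin (a j * x) / x\<^sup>2 - a j * cos x / x)) = E x / x\<^sup>2 - (\<Sum>j\<in>J. e j * a j) * (cos x / x)"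
      proof -
        have "(\<Sum>j\<in>J. e j * (sin (a j * x) / x\<^sup>2 - a j * cos x / x)) = (\<Sum>j\<in>J. e j * sin (a j * x) / x\<^sup>2 - e j * a j * (cos x / x))"
          by (intro sum.cong refl) (simp add: right_diff_distrib)
        then show ?thesis by (simp only: E_def sum_subtractf sum_divide_distrib sum_distrib_right)
      qed
      then show ?thesis using e by simp
    qed
    ultimately show ?thesis unfolding \<Psi>.K_def by (simp add: has_bochner_integral_iff)
  qed
  have "has_bochner_integral lborel (\<lambda>x. (indicator {0<..} x / x\<^sup>2) * (\<Sum>j\<in>J. e j * sin (a j * x))\<^sup>2) (\<Sum>i\<in>J. \<Sum>j\<in>J. e i * e j * (pi / 2 * min (a i) (a j)))"
  proof (rule integral_bilinear_sum_sq)
    fix i j assume "i \<in> J" "j \<in> J"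
    then show "has_bochner_integral lborel (\<lambda>x. (indicator {0<..} x / x\<^sup>2) * (sin (a i * x) * sin (a j * x))) (pi / 2 * min (a i) (a j))"
      using integral_sin_pair[of "a i" "a j"] a by simp
  qed
  then have plancherel: "has_bochner_integral lborel (\<lambda>x. indicator {0<..} x * ((E x)\<^sup>2 / x\<^sup>2)) (pi / 2 * Q)"
    by (rule has_bochner_integral_eqI) (simp_all add: E_def Q_def sum_distrib_left mult_ac)
  then have nn: "(\<integral>\<^sup>+x. ennreal (indicator {0<..} x * ((E x)\<^sup>2 / x\<^sup>2)) \<partial>lborel) = ennreal (pi / 2 * Q)"
    by (rule nn_integral_of_has_bochner) auto
  have Q0: "Q \<ge> 0" using int\<Phi> by (rule has_bochner_integral_nonneg) simp
  have [measurable]: "E \<in> borel_measurable borel" unfolding E_def by measurable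
  have "(\<integral>\<^sup>+x. ennreal (indicator {0<..} x * ((E x)\<^sup>2 / x ^ 3)) \<partial>lborel)
      \<le> (\<integral>\<^sup>+x. ennreal (indicator {0<..} x * (\<Psi>.K x)\<^sup>2) + ennreal (1 / 4) * ennreal (indicator {0<..} x * ((E x)\<^sup>2 / x\<^sup>2)) \<partial>lborel)"
  proof (intro nn_integral_mono)
    fix x :: real
    have "indicator {0<..} x * ((E x)\<^sup>2 / x ^ 3) \<le> indicator {0<..} x * (\<Psi>.K x)\<^sup>2 + 1 / 4 * (indicator {0<..} x * ((E x)\<^sup>2 / x\<^sup>2))"
    proof (cases "x > 0")
      case True
      define h where "h = E x / x\<^sup>2"
      have "(E x)\<^sup>2 / x ^ 3 = x * h\<^sup>2" "(E x)\<^sup>2 / x\<^sup>2 = x\<^sup>2 * h\<^sup>2" "\<Psi>.K x = h"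
        using True K_eq[of x] by (simp_all add: h_def power2_eq_square power3_eq_cube)
      moreover have "x * h\<^sup>2 \<le> h\<^sup>2 + 1 / 4 * (x\<^sup>2 * h\<^sup>2)"
        using zero_le_power2[of "h - x * h / 2"] by (simp add: power2_eq_square algebra_simps)
      ultimately show ?thesis using True by simp
    qed simp
    then show "ennreal (indicator {0<..} x * ((E x)\<^sup>2 / x ^ 3)) \<le> ennreal (indicator {0<..} x * (\<Psi>.K x)\<^sup>2) + ennreal (1 / 4) * ennreal (indicator {0<..} x * ((E x)\<^sup>2 / x\<^sup>2))"
      by (simp add: ennreal_mult'[symmetric] ennreal_plus[symmetric] ennreal_leI del: ennreal_plus)
  qed
  also have "\<dots> = (\<integral>\<^sup>+x. ennreal (indicator {0<..} x * (\<Psi>.K x)\<^sup>2) \<partial>lborel) + ennreal (1 / 4) * ennreal (pi / 2 * Q)"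
    unfolding nn[symmetric] by (simp add: nn_integral_add nn_integral_cmult)
  also have "\<dots> \<le> ennreal (pi / 2 * (Q / 6)) + ennreal (1 / 4) * ennreal (pi / 2 * Q)"
    using int\<Psi> by (intro add_right_mono order_trans[OF \<Psi>.nn_integral_K_sq_le] ennreal_leI mult_left_mono) auto
  also have "\<dots> = ennreal (pi / 2 * (Q / 6) + 1 / 4 * (pi / 2 * Q))"
    using Q0 by (simp add: ennreal_mult'[symmetric] ennreal_plus[symmetric] del: ennreal_plus)
  also have "\<dots> \<le> ennreal (3137 / 2000 / pi * (pi / 2 * Q))"
  proof (intro ennreal_leI)
    have "pi \<le> 3.2" using pi_approx by simp
    then have "5 / 12 * pi \<le> 3137 / 2000" by simp
    then have "5 / 12 * pi * (Q / 2) \<le> 3137 / 2000 * (Q / 2)" using Q0 by (intro mult_right_mono) auto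
    then show "pi / 2 * (Q / 6) + 1 / 4 * (pi / 2 * Q) \<le> 3137 / 2000 / pi * (pi / 2 * Q)" by (simp add: field_simps)
  qed
  also have "\<dots> = ennreal (3137 / 2000 / pi) * ennreal (pi / 2 * Q)" by (rule ennreal_mult') simp
  finally show ?thesis unfolding nn .
qed

lemma nn_integral_power_weight_scale:
  fixes f :: "real \<Rightarrow> real"
  assumes [measurable]: "f \<in> borel_measurable borel" and T: "T > 0" and m: "m = Suc n"
  shows "(\<integral>\<^sup>+x. ennreal (indicator {0<..} x * ((f (T * x))\<^sup>2 / x ^ m)) \<partial>lborel)
    = ennreal (T ^ n) * (\<integral>\<^sup>+x. ennreal (indicator {0<..} x * ((f x)\<^sup>2 / x ^ m)) \<partial>lborel)"
proof -
  have "ennreal (T ^ n) * (\<integral>\<^sup>+x. ennreal (indicator {0<..} x * ((f x)\<^sup>2 / x ^ Suc n)) \<partial>lborel)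
      = ennreal (T ^ n) * (ennreal \<bar>T\<bar> * (\<integral>\<^sup>+x. ennreal (indicator {0<..} (0 + T * x) * ((f (0 + T * x))\<^sup>2 / (0 + T * x) ^ Suc n)) \<partial>lborel))"
    using T by (subst nn_integral_real_affine[of _ T 0]) auto
  also have "\<dots> = ennreal (T ^ Suc n) * (\<integral>\<^sup>+x. ennreal (indicator {0<..} (0 + T * x) * ((f (0 + T * x))\<^sup>2 / (0 + T * x) ^ Suc n)) \<partial>lborel)"
    using T by (simp add: mult.assoc[symmetric] ennreal_mult'[symmetric] mult.commute)
  also have "\<dots> = (\<integral>\<^sup>+x. ennreal (T ^ Suc n * (indicator {0<..} (0 + T * x) * ((f (0 + T * x))\<^sup>2 / (0 + T * x) ^ Suc n))) \<partial>lborel)"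
  proof -
    have "0 \<le> T ^ Suc n" using T by simp
    then show ?thesis unfolding ennreal_mult'[OF \<open>0 \<le> T ^ Suc n\<close>] by (intro nn_integral_cmult[symmetric]) measurable
  qed
  also have "\<dots> = (\<integral>\<^sup>+x. ennreal (indicator {0<..} x * ((f (T * x))\<^sup>2 / x ^ Suc n)) \<partial>lborel)"
  proof (intro nn_integral_cong arg_cong[where f = ennreal])
    fix x :: real
    show "T ^ Suc n * (indicator {0<..} (0 + T * x) * ((f (0 + T * x))\<^sup>2 / (0 + T * x) ^ Suc n)) = indicator {0<..} x * ((f (T * x))\<^sup>2 / x ^ Suc n)"
      using T by (auto simp: zero_less_mult_iff power_mult_distrib simp del: power_Suc split: split_indicator)
  qed
  finally show ?thesis unfolding m by (rule sym)
qed

text \<open>Rescaling \<open>x\<close> by \<open>T\<close> moves the frequencies into the unit interval; the signs of the frequencies are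
  absorbed by the coefficients.\<close>

lemma trig_sum_inequality:
  fixes e a :: "'i \<Rightarrow> real" and E :: "real \<Rightarrow> real"
  assumes "finite J" and T: "T > 0" and a: "\<And>j. j \<in> J \<Longrightarrow> \<bar>a j\<bar> \<le> T"
    and E: "(E = (\<lambda>x. \<Sum>j\<in>J. e j * cos (a j * x)) \<and> (\<Sum>j\<in>J. e j) = 0)
      \<or> (E = (\<lambda>x. \<Sum>j\<in>J. e j * sin (a j * x)) \<and> (\<Sum>j\<in>J. e j * a j) = 0)"
  shows "(\<integral>\<^sup>+x. ennreal (indicator {0<..} x * ((E x)\<^sup>2 / x ^ 3)) \<partial>lborel)
     \<le> ennreal (3137 / 2000 / pi * T) * (\<integral>\<^sup>+x. ennreal (indicator {0<..} x * ((E x)\<^sup>2 / x\<^sup>2)) \<partial>lborel)"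
proof -
  define f where "f = (\<lambda>x. E (x / T))"
  have Ef: "E x = f (T * x)" for x using T by (simp add: f_def)
  define b where "b = (\<lambda>j. \<bar>a j\<bar> / T)"
  have b: "0 \<le> b j \<and> b j \<le> 1" if "j \<in> J" for j using a[OF that] T by (simp add: b_def)
  have main: "(\<integral>\<^sup>+x. ennreal (indicator {0<..} x * ((f x)\<^sup>2 / x ^ 3)) \<partial>lborel)
     \<le> ennreal (3137 / 2000 / pi) * (\<integral>\<^sup>+x. ennreal (indicator {0<..} x * ((f x)\<^sup>2 / x\<^sup>2)) \<partial>lborel)"
    using E
  proof (elim disjE conjE)
    assume 1: "E = (\<lambda>x. \<Sum>j\<in>J. e j * cos (a j * x))" "(\<Sum>j\<in>J. e j) = 0"
    have "cos (a j * (x / T)) = cos (b j * x)" for j x by (simp add: b_def abs_if)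
    then have "f = (\<lambda>x. \<Sum>j\<in>J. e j * cos (b j * x))" by (simp add: f_def 1)
    then show ?thesis using cos_sum_inequality_unit[OF \<open>finite J\<close> b 1(2)] by simp
  next
    assume 1: "E = (\<lambda>x. \<Sum>j\<in>J. e j * sin (a j * x))" "(\<Sum>j\<in>J. e j * a j) = 0"
    define d where "d = (\<lambda>j. if a j < 0 then - e j else e j)"
    have "e j * sin (a j * (x / T)) = d j * sin (b j * x)" for j x by (simp add: b_def d_def)
    then have "f = (\<lambda>x. \<Sum>j\<in>J. d j * sin (b j * x))" by (simp add: f_def 1)
    moreover have "(\<Sum>j\<in>J. d j * b j) = (\<Sum>j\<in>J. e j * a j) / T"
      unfolding sum_divide_distrib by (intro sum.cong) (auto simp: d_def b_def)
    ultimately show ?thesis using sin_sum_inequality_unit[where e = d and a = b, OF \<open>finite J\<close> b] 1(2) by simp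
  qed
  have [measurable]: "f \<in> borel_measurable borel" using E unfolding f_def by auto
  define c where "c = 3137 / 2000 / pi"
  have "(\<integral>\<^sup>+x. ennreal (indicator {0<..} x * ((f (T * x))\<^sup>2 / x ^ 3)) \<partial>lborel)
      = ennreal (T ^ 2) * (\<integral>\<^sup>+x. ennreal (indicator {0<..} x * ((f x)\<^sup>2 / x ^ 3)) \<partial>lborel)"
    using T by (intro nn_integral_power_weight_scale) auto
  also have "\<dots> \<le> ennreal (T ^ 2) * (ennreal c * (\<integral>\<^sup>+x. ennreal (indicator {0<..} x * ((f x)\<^sup>2 / x\<^sup>2)) \<partial>lborel))"
    unfolding c_def by (intro mult_left_mono main) auto
  also have "\<dots> = ennreal (c * T) * (ennreal (T ^ 1) * (\<integral>\<^sup>+x. ennreal (indicator {0<..} x * ((f x)\<^sup>2 / x\<^sup>2)) \<partial>lborel))"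
  proof -
    have "ennreal (T ^ 2) * ennreal c = ennreal (c * T) * ennreal (T ^ 1)"
      using T by (simp add: ennreal_mult'[symmetric] power2_eq_square c_def mult_ac)
    then show ?thesis by (simp only: mult.assoc[symmetric])
  qed
  also have "ennreal (T ^ 1) * (\<integral>\<^sup>+x. ennreal (indicator {0<..} x * ((f x)\<^sup>2 / x\<^sup>2)) \<partial>lborel)
      = (\<integral>\<^sup>+x. ennreal (indicator {0<..} x * ((f (T * x))\<^sup>2 / x\<^sup>2)) \<partial>lborel)"
    using T by (intro nn_integral_power_weight_scale[symmetric]) auto
  finally show ?thesis unfolding Ef c_def .
qed

section \<open>The upper bound: a polynomial test function\<close>

text \<open>Fubini on the triangle \<open>0 < x < y\<close>. For a decreasing function with derivative \<open>- k\<close> and limit \<open>0\<close> it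
  expresses the integral by the derivative.\<close>

lemma nn_integral_tail_eq:
  fixes k :: "real \<Rightarrow> real"
  assumes [measurable]: "k \<in> borel_measurable borel" and nonneg: "\<And>x. x > 0 \<Longrightarrow> 0 \<le> k x"
  shows "(\<integral>\<^sup>+x. indicator {0<..} x * (\<integral>\<^sup>+y. ennreal (k y) * indicator {x<..} y \<partial>lborel) \<partial>lborel)
    = (\<integral>\<^sup>+y. ennreal (indicator {0<..} y * (y * k y)) \<partial>lborel)"
proof -
  have ind: "indicator {x<..} y = (if x < y then 1 else 0 :: ennreal)" for x y :: real
    by (simp add: indicator_def)
  have "(\<integral>\<^sup>+x. indicator {0<..} x * (\<integral>\<^sup>+y. ennreal (k y) * indicator {x<..} y \<partial>lborel) \<partial>lborel)
     = (\<integral>\<^sup>+x. \<integral>\<^sup>+y. indicator {0<..} x * (ennreal (k y) * indicator {x<..} y) \<partial>lborel \<partial>lborel)"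
    by (simp add: nn_integral_cmult)
  also have "\<dots> = (\<integral>\<^sup>+y. \<integral>\<^sup>+x. indicator {0<..} x * (ennreal (k y) * indicator {x<..} y) \<partial>lborel \<partial>lborel)"
    unfolding ind by (rule lborel_pair.Fubini') measurable
  also have "\<dots> = (\<integral>\<^sup>+y. ennreal (indicator {0<..} y * (y * k y)) \<partial>lborel)"
  proof (intro nn_integral_cong)
    fix y :: real
    have "(\<integral>\<^sup>+x. indicator {0<..} x * (ennreal (k y) * indicator {x<..} y) \<partial>lborel) = (\<integral>\<^sup>+x. ennreal (k y) * indicator {0<..<y} x \<partial>lborel)"
      by (intro nn_integral_cong) (auto split: split_indicator)
    also have "\<dots> = ennreal (indicator {0<..} y * (y * k y))"
      using nonneg[of y] by (cases "y > 0") (simp_all add: nn_integral_cmult ennreal_mult' mult.commute)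
    finally show "(\<integral>\<^sup>+x. indicator {0<..} x * (ennreal (k y) * indicator {x<..} y) \<partial>lborel) = ennreal (indicator {0<..} y * (y * k y))" .
  qed
  finally show ?thesis .
qed

lemma cmod_sin_le: "cmod (sin z) \<le> exp \<bar>Im z\<bar>"
proof -
  have "cmod (sin z) \<le> (cmod (exp (\<i> * z)) + cmod (exp (- (\<i> * z)))) / 2"
    using norm_triangle_ineq4[of "exp (\<i> * z)" "exp (- (\<i> * z))"]
    by (simp add: sin_exp_eq norm_divide norm_mult)
  also have "\<dots> \<le> (exp \<bar>Im z\<bar> + exp \<bar>Im z\<bar>) / 2"
    by (intro divide_right_mono add_mono) auto
  finally show ?thesis by simp
qed

definition entire_sine_transform :: "real list \<Rightarrow> complex \<Rightarrow> complex" where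
  "entire_sine_transform cs z = integral {0..1} (\<lambda>t. of_real (odd_poly cs t) * sin (of_real t * z))"

lemma continuous_on_odd_poly [continuous_intros]:
  "continuous_on A f \<Longrightarrow> continuous_on A (\<lambda>x. odd_poly cs (f x))"
  unfolding odd_poly_def by (intro continuous_intros)

lemma entire_sine_transform_holomorphic: "entire_sine_transform cs holomorphic_on UNIV"
proof -
  have "(\<lambda>z. integral (cbox 0 1) ((\<lambda>z t. of_real (odd_poly cs t) * sin (of_real t * z)) z)) holomorphic_on UNIV"
  proof (rule leibniz_rule_holomorphic[where fx = "\<lambda>z t. of_real (odd_poly cs t) * (cos (of_real t * z) * of_real t)"])
    show "((\<lambda>z. complex_of_real (odd_poly cs t) * sin (of_real t * z)) has_field_derivative of_real (odd_poly cs t) * (cos (of_real t * x) * of_real t)) (at x within UNIV)" for x t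
      by (auto intro!: derivative_eq_intros)
    show "(\<lambda>t. complex_of_real (odd_poly cs t) * sin (of_real t * x)) integrable_on cbox 0 1" for x
      by (intro integrable_continuous continuous_intros)
    show "continuous_on (UNIV \<times> cbox 0 1) (\<lambda>(x, t). complex_of_real (odd_poly cs t) * (cos (of_real t * x) * of_real t))"
      unfolding case_prod_beta by (intro continuous_intros)
  qed auto
  then show ?thesis by (simp add: entire_sine_transform_def[abs_def])
qed

lemma entire_sine_transform_bound:
  "cmod (entire_sine_transform cs z) \<le> (\<Sum>i<length cs. \<bar>cs ! i\<bar>) * exp \<bar>Im z\<bar>"
proof -
  define B where "B = (\<Sum>i<length cs. \<bar>cs ! i\<bar>)"
  interpret sine_window "\<lambda>t. indicator {0..1} t * odd_poly cs t" B
    unfolding B_def by (rule odd_poly_window)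
  have "cmod (integral {0..1} (\<lambda>t. of_real (odd_poly cs t) * sin (of_real t * z))) \<le> (B * exp \<bar>Im z\<bar>) * (1 - 0)"
  proof (rule integral_bound)
    show "continuous_on {0..1} (\<lambda>t. complex_of_real (odd_poly cs t) * sin (of_real t * z))"
      by (intro continuous_intros)
    show "cmod (of_real (odd_poly cs t) * sin (of_real t * z)) \<le> B * exp \<bar>Im z\<bar>" if "t \<in> {0..1}" for t
    proof -
      have t: "t \<in> {0..1}" using that by simp
      have "\<bar>odd_poly cs t\<bar> \<le> B" using \<Phi>_bound[of t] t by simp
      moreover have "cmod (sin (of_real t * z)) \<le> exp \<bar>Im z\<bar>"
      proof -
        have "\<bar>Im (of_real t * z)\<bar> \<le> \<bar>Im z\<bar>" using t by (simp add: abs_mult mult_left_le_one_le)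
        then show ?thesis using cmod_sin_le[of "of_real t * z"] by (meson exp_le_cancel_iff order_trans)
      qed
      ultimately show ?thesis unfolding norm_mult using B_nonneg by (intro mult_mono) auto
    qed
  qed simp
  then show ?thesis by (simp add: entire_sine_transform_def B_def)
qed

lemma entire_sine_transform_real:
  "entire_sine_transform cs (of_real x) = of_real (sine_window.K (\<lambda>t. indicator {0..1} t * odd_poly cs t) x)"
proof -
  interpret sine_window "\<lambda>t. indicator {0..1} t * odd_poly cs t" "\<Sum>i<length cs. \<bar>cs ! i\<bar>"
    by (rule odd_poly_window)
  have int: "set_integrable lborel {0..1} (\<lambda>t. odd_poly cs t * sin (t * x))"
    by (intro borel_integrable_atLeastAtMost' continuous_intros)
  have "((\<lambda>t. odd_poly cs t * sin (t * x)) has_integral K x) {0..1}"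
  proof -
    have "K x = (LINT t:{0..1}|lborel. odd_poly cs t * sin (t * x))"
      unfolding K_def set_lebesgue_integral_def by (simp add: mult.assoc)
    also have "\<dots> = integral {0..1} (\<lambda>t. odd_poly cs t * sin (t * x))"
      by (rule set_borel_integral_eq_integral(2)[OF int])
    finally show ?thesis
      using set_borel_integral_eq_integral(1)[OF int] by (simp add: has_integral_integral)
  qed
  from has_integral_linear[OF this bounded_linear_of_real[where 'a = complex]]
  have "((\<lambda>t. complex_of_real (odd_poly cs t) * sin (of_real t * of_real x)) has_integral of_real (K x)) {0..1}"
    by (simp add: o_def sin_of_real[symmetric])
  then show ?thesis unfolding entire_sine_transform_def by (rule integral_unique)
qed

lemma entire_sine_transform_minus: "entire_sine_transform cs (- z) = - entire_sine_transform cs z"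
  by (simp add: entire_sine_transform_def)

text \<open>Let \<open>T\<close> be the sine transform of \<open>\<Phi>\<close>, an odd entire function of type \<open>1\<close>. Then \<open>T(w)\<^sup>2 / w\<close> is an odd entire
  function that is nonnegative for \<open>w > 0\<close>, and \<open>F(z) = C - \<integral>\<^sub>0\<^bsup>\<pi> z\<^esup> T(w)\<^sup>2 / w dw\<close> is even, of type
  \<open>2 \<pi>\<close> and radially decreasing; \<open>C\<close> is half the logarithmic form, so that \<open>F\<close> tends to \<open>0\<close>. Its norm is
  given by the integral of \<open>T\<^sup>2\<close>.\<close>

lemma F1_from_odd_poly:
  fixes cs :: "real list"
  defines "\<Phi> \<equiv> \<lambda>t. indicator {0..1} t * odd_poly cs t"
  assumes pos: "sine_window.log_form \<Phi> > 0"
  shows "\<exists>F\<in>F1. F 0 \<noteq> 0 \<and> norm_L1 F / Re (F 0) \<le> 2 * (LBINT t. (\<Phi> t)\<^sup>2) / sine_window.log_form \<Phi>"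
proof -
  define B where "B = (\<Sum>i<length cs. \<bar>cs ! i\<bar>)"
  interpret sine_window \<Phi> B unfolding \<Phi>_def B_def by (rule odd_poly_window)
  define T where "T = entire_sine_transform cs"
  have T_hol: "T holomorphic_on UNIV" unfolding T_def by (rule entire_sine_transform_holomorphic)
  have T_real: "T (of_real x) = of_real (K x)" for x
    unfolding T_def \<Phi>_def by (rule entire_sine_transform_real)
  have T_bound: "cmod (T z) \<le> B * exp (cmod z)" for z
  proof -
    have "cmod (T z) \<le> B * exp \<bar>Im z\<bar>" unfolding T_def B_def by (rule entire_sine_transform_bound)
    also have "\<dots> \<le> B * exp (cmod z)" using B_nonneg abs_Im_le_cmod[of z] by (intro mult_left_mono) auto
    finally show ?thesis .
  qed
  have T_minus: "T (- z) = - T z" for z unfolding T_def by (rule entire_sine_transform_minus)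
  have T0: "T 0 = 0" using T_minus[of 0] by (simp add: eq_neg_iff_add_eq_0)
  obtain G where G: "G holomorphic_on UNIV" "\<And>z. T z = z * G z"
    using entire_divide_zero[OF T_hol T0] by auto
  define p where "p = (\<lambda>z. z * (G z)\<^sup>2)"
  have p_hol: "p holomorphic_on UNIV" unfolding p_def using G by (intro holomorphic_intros)
  have p_eq: "z * p z = (T z)\<^sup>2" for z by (simp add: p_def G(2) power2_eq_square mult_ac)
  have p_minus: "p (- z) = - p z" for z
  proof (cases "z = 0")
    case False
    have "(- z) * p (- z) = z * p z" unfolding p_eq T_minus by simp
    then have "z * (p (- z) + p z) = 0" by algebra
    then show ?thesis using False by (simp add: eq_neg_iff_add_eq_0)
  qed (simp add: p_def)
  obtain P0 where P0: "\<And>z. (P0 has_field_derivative p z) (at z)"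
    using holomorphic_convex_primitive'[of UNIV p] p_hol by auto
  define P where "P = (\<lambda>z. P0 z - P0 0)"
  have P: "(P has_field_derivative p z) (at z)" for z
    unfolding P_def by (auto intro!: derivative_eq_intros P0)
  have P_zero: "P 0 = 0" by (simp add: P_def)
  have P_hol: "P holomorphic_on UNIV" using P by (auto simp: holomorphic_on_def field_differentiable_def intro: has_field_derivative_at_within)
  have P_minus: "P (- z) = P z" for z
  proof -
    have "((\<lambda>w. P (- w) - P w) has_field_derivative 0) (at w)" for w
    proof -
      have "((\<lambda>w. P (- w)) has_field_derivative p (- w) * (- 1)) (at w)"
        by (rule DERIV_chain2[OF P]) (auto intro!: derivative_eq_intros)
      from DERIV_diff[OF this P[of w]] show ?thesis by (simp add: p_minus)
    qed
    then obtain c where "\<And>w. P (- w) - P w = c"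
      using has_field_derivative_zero_constant[of UNIV "\<lambda>w. P (- w) - P w"] by auto
    from this[of 0] this[of z] show ?thesis by simp
  qed
  define k where "k = (\<lambda>x::real. (K x)\<^sup>2 / x)"
  have [measurable]: "k \<in> borel_measurable borel" unfolding k_def by measurable
  have p_real: "p (of_real x) = of_real (k x)" for x :: real
  proof (cases "x = 0")
    case False
    have "of_real x * p (of_real x) = (of_real x * of_real (k x) :: complex)"
      unfolding p_eq T_real k_def using False by (simp add: power2_eq_square)
    then show ?thesis using False by simp
  qed (simp add: p_def k_def)
  have k0: "k x \<ge> 0" if "x \<ge> 0" for x using that by (simp add: k_def)
  define r where "r = (\<lambda>x::real. Re (P (of_real x)))"
  have vec: "((\<lambda>x::real. P (of_real x)) has_vector_derivative of_real (k x)) (at x)" for x :: real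
    using has_vector_derivative_real_field[OF P[of "of_real x"]] unfolding p_real .
  have r_der: "(r has_real_derivative k x) (at x)" for x
    using bounded_linear.has_vector_derivative[OF bounded_linear_Re vec[of x]] unfolding r_def has_real_derivative_iff_has_vector_derivative by simp
  have P_real: "P (of_real x) = of_real (r x)" for x
  proof -
    have "((\<lambda>x::real. Im (P (of_real x))) has_real_derivative 0) (at x)" for x
      using bounded_linear.has_vector_derivative[OF bounded_linear_Im vec[of x]] unfolding has_real_derivative_iff_has_vector_derivative by simp
    then have "Im (P (of_real x)) = Im (P (of_real 0))"
      using DERIV_isconst_all[of "\<lambda>x. Im (P (of_real x))"] by metis
    then show ?thesis by (simp add: r_def complex_eq_iff P_zero)
  qed
  have r_mono: "r x \<le> r y" if "0 \<le> x" "x \<le> y" for x y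
    proof (rule DERIV_nonneg_imp_nondecreasing[OF that(2)])
    fix u assume "x \<le> u" "u \<le> y"
    then show "\<exists>d. (r has_real_derivative d) (at u) \<and> 0 \<le> d" using that(1) r_der[of u] k0[of u] by auto
  qed
  have r0: "r 0 = 0" by (simp add: r_def P_zero)
  define C where "C = log_form / 2"
  have C: "C > 0" using pos by (simp add: C_def)
  have tail: "r x \<le> C \<and> (\<integral>\<^sup>+y. ennreal (k y) * indicator {x<..} y \<partial>lborel) = ennreal (C - r x)" if "x \<ge> 0" for x
  proof -
    have "(\<integral>\<^sup>+y. ennreal (k y) * indicator {0..x} y \<partial>lborel) = ennreal (r x - r 0)"
      using that r_der k0 by (intro nn_integral_FTC_interior[of _ _ "{}"] DERIV_continuous_on) (auto intro: has_field_derivative_at_within)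
    moreover have "(\<integral>\<^sup>+y. ennreal (indicator {0<..} y * k y) \<partial>lborel) = ennreal C"
      using nn_integral_K_sq_div by (simp add: k_def C_def)
    moreover have "(\<integral>\<^sup>+y. ennreal (indicator {0<..} y * k y) \<partial>lborel)
       = (\<integral>\<^sup>+y. ennreal (k y) * indicator {0..x} y + ennreal (k y) * indicator {x<..} y \<partial>lborel)"
    proof (rule nn_integral_cong)
      fix y :: real
      have "k 0 = 0" by (simp add: k_def)
      then show "ennreal (indicator {0<..} y * k y) = ennreal (k y) * indicator {0..x} y + ennreal (k y) * indicator {x<..} y"
        using that by (cases "y = 0") (auto split: split_indicator)
    qed
    ultimately have eq: "ennreal C = ennreal (r x) + (\<integral>\<^sup>+y. ennreal (k y) * indicator {x<..} y \<partial>lborel)"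
      by (simp add: nn_integral_add r0)
    have "ennreal (r x) \<le> ennreal C" unfolding eq by simp
    then have le: "r x \<le> C" using C by (simp add: ennreal_le_iff)
    have "ennreal C = ennreal (r x) + ennreal (C - r x)" using le r_mono[of 0 x] that r0 by (simp add: ennreal_plus[symmetric] del: ennreal_plus)
    with eq show ?thesis using le by (metis ennreal_add_left_cancel ennreal_neq_top infinity_ennreal_def)
  qed
  define F where "F = (\<lambda>z. of_real C - P (of_real pi * z))"
  have F_real: "F (of_real x) = of_real (C - r (pi * x))" for x :: real
    by (simp add: F_def P_real[symmetric])
  have r_minus: "r (- x) = r x" for x using P_minus[of "of_real x"] by (simp add: r_def)
  have F_nn: "0 \<le> C - r x" for x
    using tail[of x] tail[of "- x"] r_minus[of x] by (cases "x \<ge> 0") auto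
  have half: "(\<integral>\<^sup>+x. ennreal (C - r x) * indicator {0<..} x \<partial>lborel) \<le> ennreal (pi / 2 * (LBINT t. (\<Phi> t)\<^sup>2))"
  proof -
    have "(\<integral>\<^sup>+x. ennreal (C - r x) * indicator {0<..} x \<partial>lborel) = (\<integral>\<^sup>+x. indicator {0<..} x * (\<integral>\<^sup>+y. ennreal (k y) * indicator {x<..} y \<partial>lborel) \<partial>lborel)"
      using tail by (intro nn_integral_cong) (auto split: split_indicator)
    also have "\<dots> = (\<integral>\<^sup>+y. ennreal (indicator {0<..} y * (y * k y)) \<partial>lborel)"
      using k0 by (intro nn_integral_tail_eq) auto
    also have "\<dots> = (\<integral>\<^sup>+y. ennreal (indicator {0<..} y * (K y)\<^sup>2) \<partial>lborel)"
      by (intro nn_integral_cong) (auto simp: k_def split: split_indicator)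
    also have "\<dots> \<le> ennreal (pi / 2 * (LBINT t. (\<Phi> t)\<^sup>2))" by (rule nn_integral_K_sq_le)
    finally show ?thesis .
  qed
  have r_cont: "continuous_on UNIV r" using r_der DERIV_continuous_on by blast
  have [measurable]: "r \<in> borel_measurable borel" by (rule borel_measurable_continuous_onI[OF r_cont])
  define n where "n = (LBINT t. (\<Phi> t)\<^sup>2)"
  have n0: "n \<ge> 0" unfolding n_def by (intro integral_nonneg_AE) auto
  have whole: "(\<integral>\<^sup>+x. ennreal (C - r (pi * x)) \<partial>lborel) \<le> ennreal n"
  proof -
    have "(\<integral>\<^sup>+x. ennreal (C - r x) \<partial>lborel) = (\<integral>\<^sup>+x. ennreal (C - r x) * indicator {0<..} x + ennreal (C - r x) * indicator {..<0} x \<partial>lborel)"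
      by (intro nn_integral_cong_AE) (use AE_lborel_singleton[of 0] in \<open>eventually_elim, auto split: split_indicator\<close>)
    also have "\<dots> = (\<integral>\<^sup>+x. ennreal (C - r x) * indicator {0<..} x \<partial>lborel) + (\<integral>\<^sup>+x. ennreal (C - r x) * indicator {..<0} x \<partial>lborel)"
      by (simp add: nn_integral_add)
    also have "(\<integral>\<^sup>+x. ennreal (C - r x) * indicator {..<0} x \<partial>lborel) = (\<integral>\<^sup>+x. ennreal (C - r (- x)) * indicator {..<0} (- x) \<partial>lborel)"
      using nn_integral_real_affine[of "\<lambda>x. ennreal (C - r x) * indicator {..<0} x" "-1" 0] by simp
    also have "\<dots> = (\<integral>\<^sup>+x. ennreal (C - r x) * indicator {0<..} x \<partial>lborel)"
      unfolding r_minus by (intro nn_integral_cong) (auto split: split_indicator)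
    also have "(\<integral>\<^sup>+x. ennreal (C - r x) * indicator {0<..} x \<partial>lborel) + (\<integral>\<^sup>+x. ennreal (C - r x) * indicator {0<..} x \<partial>lborel)
       \<le> ennreal (pi / 2 * n) + ennreal (pi / 2 * n)"
      using half unfolding n_def by (intro add_mono)
    also have "\<dots> = ennreal (pi * n)" using n0 by (simp add: ennreal_plus[symmetric] del: ennreal_plus)
    finally have "(\<integral>\<^sup>+x. ennreal (C - r x) \<partial>lborel) \<le> ennreal (pi * n)" .
    moreover have "(\<integral>\<^sup>+x. ennreal (C - r x) \<partial>lborel) = ennreal pi * (\<integral>\<^sup>+x. ennreal (C - r (pi * x)) \<partial>lborel)"
      using nn_integral_real_affine[of "\<lambda>x. ennreal (C - r x)" pi 0] by simp
    ultimately have "ennreal pi * (\<integral>\<^sup>+x. ennreal (C - r (pi * x)) \<partial>lborel) \<le> ennreal pi * ennreal n"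
      using n0 by (simp add: ennreal_mult')
    then show ?thesis by (simp add: ennreal_mult_le_mult_iff)
  qed
  have int: "integrable lborel (\<lambda>x. C - r (pi * x))"
    using whole F_nn by (intro integrableI_nonneg) (auto intro: le_less_trans[OF _ ennreal_less_top])
  have mem: "F \<in> F1"
  proof (rule F1_I)
    have "(P \<circ> (*) (of_real pi)) holomorphic_on UNIV"
      by (rule holomorphic_on_compose_gen[OF _ P_hol]) (auto intro!: holomorphic_intros)
    then show "F holomorphic_on UNIV" unfolding F_def o_def by (intro holomorphic_intros)
    show "exponential_type_at_most (2 * pi) F" unfolding exponential_type_at_most_def
    proof (intro allI impI)
      fix \<epsilon> :: real assume "\<epsilon> > 0"
      have "bounded (p ` cball 0 1)"
        by (intro compact_imp_bounded compact_continuous_image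
          continuous_on_subset[OF holomorphic_on_imp_continuous_on[OF p_hol]]) auto
      then obtain D where D: "\<And>z. cmod z \<le> 1 \<Longrightarrow> cmod (p z) \<le> D"
        unfolding bounded_iff by (metis imageI mem_cball_0)
      define M where "M = max D (B\<^sup>2)"
      have M: "M \<ge> 0" "D \<le> M" "B\<^sup>2 \<le> M" by (auto simp: M_def le_max_iff_disj)
      have p_bound: "cmod (p z) \<le> M * exp (2 * cmod z)" for z
      proof (cases "cmod z \<le> 1")
        case True
        have "M * 1 \<le> M * exp (2 * cmod z)" using M by (intro mult_left_mono) auto
        then show ?thesis using D[OF True] M by simp
      next
        case False
        have "1 * cmod (p z) \<le> cmod z * cmod (p z)" using False by (intro mult_right_mono) auto
        also have "\<dots> = (cmod (T z))\<^sup>2" by (simp only: norm_mult[symmetric] p_eq norm_power)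
        also have "\<dots> \<le> (B * exp (cmod z))\<^sup>2" by (intro power_mono T_bound) auto
        also have "\<dots> = B\<^sup>2 * exp (2 * cmod z)" by (simp add: power_mult_distrib exp_double)
        also have "\<dots> \<le> M * exp (2 * cmod z)" using M by (intro mult_right_mono) auto
        finally show ?thesis by simp
      qed
      have P_bound: "cmod (P z) \<le> M * exp (2 * cmod z) * cmod z" for z
      proof -
        have "cmod (P z - P 0) \<le> (M * exp (2 * cmod z)) * cmod (z - 0)"
        proof (rule field_differentiable_bound[where S = "cball 0 (cmod z)"])
          show "(P has_field_derivative p w) (at w within cball 0 (cmod z))" for w
            using P has_field_derivative_at_within by blast
          show "cmod (p w) \<le> M * exp (2 * cmod z)" if "w \<in> cball 0 (cmod z)" for w
            using p_bound[of w] mult_left_mono[of "exp (2 * cmod w)" "exp (2 * cmod z)" M] that M by simp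
        qed auto
        then show ?thesis by (simp add: P_zero)
      qed
      show "\<exists>A>0. \<forall>z. cmod (F z) \<le> A * exp ((2 * pi + \<epsilon>) * cmod z)"
      proof (intro exI[of _ "C + M * pi / \<epsilon>"] conjI allI)
        show "C + M * pi / \<epsilon> > 0" using C M \<open>\<epsilon> > 0\<close> by (simp add: add_pos_nonneg)
        fix z
        have "\<epsilon> * cmod z \<le> exp (\<epsilon> * cmod z)" using exp_ge_add_one_self[of "\<epsilon> * cmod z"] by linarith
        then have "cmod z \<le> exp (\<epsilon> * cmod z) / \<epsilon>" using \<open>\<epsilon> > 0\<close> by (simp add: field_simps)
        then have "M * pi * exp (2 * pi * cmod z) * cmod z \<le> M * pi * exp (2 * pi * cmod z) * (exp (\<epsilon> * cmod z) / \<epsilon>)"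
          using M by (intro mult_left_mono) auto
        also have "\<dots> = M * pi / \<epsilon> * exp ((2 * pi + \<epsilon>) * cmod z)"
          by (simp add: exp_add distrib_right)
        finally have 1: "cmod (P (of_real pi * z)) \<le> M * pi / \<epsilon> * exp ((2 * pi + \<epsilon>) * cmod z)"
          using P_bound[of "of_real pi * z"] by (simp add: norm_mult mult_ac)
        have "C * 1 \<le> C * exp ((2 * pi + \<epsilon>) * cmod z)" using C \<open>\<epsilon> > 0\<close> by (intro mult_left_mono) auto
        moreover have "cmod (F z) \<le> C + cmod (P (of_real pi * z))"
          unfolding F_def using norm_triangle_ineq4[of "of_real C" "P (of_real pi * z)"] C by simp
        ultimately show "cmod (F z) \<le> (C + M * pi / \<epsilon>) * exp ((2 * pi + \<epsilon>) * cmod z)"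
          using 1 by (simp add: distrib_right)
      qed
    qed
    show "F (of_real x) \<in> \<real>" for x :: real unfolding F_real by (rule Reals_of_real)
    show "0 \<le> Re (F (of_real x))" for x :: real unfolding F_real using F_nn by simp
    show "integrable lborel (\<lambda>x::real. Re (F (of_real x)))" unfolding F_real using int by simp
    show "Re (F (of_real y)) \<le> Re (F (of_real x))" if "0 < x" "x \<le> y" for x y :: real
      unfolding F_real using r_mono[of "pi * x" "pi * y"] that by simp
    show "Re (F (of_real (- y))) \<le> Re (F (of_real (- x)))" if "0 < x" "x \<le> y" for x y :: real
      unfolding F_real using r_mono[of "pi * x" "pi * y"] r_minus[of "pi * x"] r_minus[of "pi * y"] that by simp
  qed
  have F0: "F 0 = of_real C" by (simp add: F_def P_zero)
  have "norm_L1 F = (LBINT x. C - r (pi * x))" unfolding F1_norm_L1[OF mem] F_real by simp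
  also have "\<dots> \<le> n"
    using whole nn_integral_eq_integral[OF int] F_nn n0 by (simp add: ennreal_le_iff)
  finally have "norm_L1 F / Re (F 0) \<le> n / C" unfolding F0 using C by (simp add: divide_right_mono)
  then have "norm_L1 F / Re (F 0) \<le> 2 * n / log_form" by (simp add: C_def mult.commute)
  moreover have "F 0 \<noteq> 0" using F0 C by simp
  ultimately show ?thesis using mem unfolding n_def by blast
qed

text \<open>A near-optimal polynomial of degree \<open>7\<close>, found numerically.\<close>

definition test_coeffs :: "real list" where
  "test_coeffs = [1, - (7511 / 10000), 2422 / 10000, - (1193 / 10000)]"

lemma test_quotient:
  "2 * (\<Sum>i<length test_coeffs. \<Sum>j<length test_coeffs. test_coeffs ! i * test_coeffs ! j / real (2 * i + 2 * j + 3))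
    < 1.27714 * (\<Sum>i<length test_coeffs. \<Sum>j<length test_coeffs. test_coeffs ! i * test_coeffs ! j * log_moment2 i j)"
  "(\<Sum>i<length test_coeffs. \<Sum>j<length test_coeffs. test_coeffs ! i * test_coeffs ! j * log_moment2 i j) > 0"
  by (simp_all add: test_coeffs_def list_sum_simps log_moment2_def moment_at_one_def)

theorem A1_upper: "\<exists>F\<in>F1. F 0 \<noteq> 0 \<and> norm_L1 F / Re (F 0) < 1.27714"
proof -
  define b where "b = sine_window.log_form (\<lambda>t. indicator {0..1} t * odd_poly test_coeffs t)"
  have b: "b = (\<Sum>i<length test_coeffs. \<Sum>j<length test_coeffs. test_coeffs ! i * test_coeffs ! j * log_moment2 i j)"
    unfolding b_def by (rule log_form_odd_poly)
  have "has_bochner_integral lborel (\<lambda>t. (indicator {0..1} t * odd_poly test_coeffs t)\<^sup>2)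
     (\<Sum>i<length test_coeffs. \<Sum>j<length test_coeffs. test_coeffs ! i * test_coeffs ! j / real (2 * i + 2 * j + 3))"
    using integral_odd_poly_sq by (rule has_bochner_integral_eqI) (auto split: split_indicator)
  then have n: "(LBINT t. (indicator {0..1} t * odd_poly test_coeffs t)\<^sup>2)
     = (\<Sum>i<length test_coeffs. \<Sum>j<length test_coeffs. test_coeffs ! i * test_coeffs ! j / real (2 * i + 2 * j + 3))"
    by (rule has_bochner_integral_integral_eq)
  have "b > 0" using test_quotient(2) b by simp
  then obtain F where F: "F \<in> F1" "F 0 \<noteq> 0"
    "norm_L1 F / Re (F 0) \<le> 2 * (LBINT t. (indicator {0..1} t * odd_poly test_coeffs t)\<^sup>2) / b"
    using F1_from_odd_poly[of test_coeffs] unfolding b_def by blast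
  have "2 * (LBINT t. (indicator {0..1} t * odd_poly test_coeffs t)\<^sup>2) / b < 1.27714"
    using test_quotient(1) \<open>b > 0\<close> unfolding n b by (subst divide_less_eq) simp
  with F show ?thesis by (meson le_less_trans)
qed

section \<open>The Fejer-Riesz theorem\<close>

lemma poly_sum_upto:
  fixes p :: "complex poly"
  assumes "degree p \<le> n" shows "poly p x = (\<Sum>i\<le>n. coeff p i * x ^ i)"
  unfolding poly_altdef using assms by (intro sum.mono_neutral_left) (auto simp: coeff_eq_0)

lemma poly_eq_on_circle:
  fixes p q :: "complex poly"
  assumes "\<And>w. cmod w = 1 \<Longrightarrow> poly p w = poly q w" shows "p = q"
proof (rule ccontr)
  assume "p \<noteq> q"
  then have "finite {w. poly (p - q) w = 0}" by (intro poly_roots_finite) simp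
  moreover have "sphere (0::complex) 1 \<subseteq> {w. poly (p - q) w = 0}" using assms by auto
  ultimately have "finite (sphere (0::complex) 1)" by (rule finite_subset[rotated])
  moreover have "infinite (sphere (0::complex) 1)"
  proof
    assume "finite (sphere (0::complex) 1)"
    then obtain c where "sphere (0::complex) 1 \<subseteq> {c}"
      using connected_finite_iff_sing[of "sphere (0::complex) 1"] connected_sphere[of "0::complex" 1] by auto
    moreover have "(1::complex) \<in> sphere 0 1" "(-1::complex) \<in> sphere 0 1" by simp_all
    ultimately have "(1::complex) = c" "(-1::complex) = c" by blast+
    then show False by simp
  qed
  ultimately show False by simp
qed

text \<open>A polynomial of formal degree \<open>2 n\<close> for which \<open>W(w) / w\<^sup>n\<close> is real on the unit circle is
  self-inversive; therefore its zeros off the circle come in pairs \<open>a, 1 / cnj a\<close>.\<close>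

lemma self_inversive_coeffs:
  assumes deg: "degree W \<le> 2 * n"
    and real: "\<And>w. cmod w = 1 \<Longrightarrow> poly W w / w ^ n \<in> \<real>"
    and "k \<le> 2 * n"
  shows "coeff W k = cnj (coeff W (2 * n - k))"
proof -
  define V where "V = (\<Sum>k\<le>2 * n. monom (cnj (coeff W (2 * n - k))) k)"
  have coeffV: "coeff V k = (if k \<le> 2 * n then cnj (coeff W (2 * n - k)) else 0)" for k
    by (simp add: V_def coeff_sum)
  have "W = V"
  proof (rule poly_eq_on_circle)
    fix w assume w: "cmod w = 1"
    then have w0: "w \<noteq> 0" by auto
    have inv: "cnj w = 1 / w" using w w0 complex_norm_square[of w] by (simp add: field_simps)
    have "poly V w = (\<Sum>k\<le>2 * n. cnj (coeff W (2 * n - k)) * w ^ k)"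
      by (simp add: V_def poly_sum poly_monom)
    also have "\<dots> = (\<Sum>k\<le>2 * n. cnj (coeff W k) * w ^ (2 * n - k))"
      by (rule sum.reindex_bij_witness[of _ "\<lambda>k. 2 * n - k" "\<lambda>k. 2 * n - k"]) auto
    also have "\<dots> = (\<Sum>k\<le>2 * n. w ^ (2 * n) * (cnj (coeff W k) * (cnj w) ^ k))"
    proof (intro sum.cong refl)
      fix k assume "k \<in> {..2 * n}"
      then have "w ^ (2 * n) = w ^ (2 * n - k) * w ^ k" by (simp add: power_add[symmetric])
      then show "cnj (coeff W k) * w ^ (2 * n - k) = w ^ (2 * n) * (cnj (coeff W k) * (cnj w) ^ k)"
        unfolding inv using w0 by (simp add: power_divide)
    qed
    also have "\<dots> = w ^ (2 * n) * cnj (poly W w)"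
      by (simp add: poly_sum_upto[OF deg] sum_distrib_left)
    also have "\<dots> = poly W w"
    proof -
      have "cnj (poly W w / w ^ n) = poly W w / w ^ n" using real[OF w] by (simp add: Reals_cnj_iff)
      then have "cnj (poly W w) * w ^ n = poly W w / w ^ n" by (simp add: inv power_divide)
      then show ?thesis using w0 by (simp add: field_simps power_mult power2_eq_square mult_2 power_add)
    qed
    finally show "poly W w = poly V w" by simp
  qed
  then show ?thesis using coeffV[of k] assms(3) by simp
qed

lemma self_inversive_root:
  assumes deg: "degree W \<le> 2 * n"
    and real: "\<And>w. cmod w = 1 \<Longrightarrow> poly W w / w ^ n \<in> \<real>"
    and a: "poly W a = 0" "a \<noteq> 0"
  shows "poly W (1 / cnj a) = 0"
proof -
  have "poly W (1 / cnj a) = (\<Sum>k\<le>2 * n. coeff W k * (1 / cnj a) ^ k)"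
    by (rule poly_sum_upto[OF deg])
  also have "\<dots> = (\<Sum>k\<le>2 * n. cnj (coeff W (2 * n - k)) * (1 / cnj a) ^ k)"
  proof (intro sum.cong refl)
    fix k assume "k \<in> {..2 * n}"
    then have "coeff W k = cnj (coeff W (2 * n - k))" by (intro self_inversive_coeffs[OF deg real]) auto
    then show "coeff W k * (1 / cnj a) ^ k = cnj (coeff W (2 * n - k)) * (1 / cnj a) ^ k" by (simp only:)
  qed
  also have "\<dots> = (\<Sum>k\<le>2 * n. cnj (coeff W k) * (1 / cnj a) ^ (2 * n - k))"
    by (rule sum.reindex_bij_witness[of _ "\<lambda>k. 2 * n - k" "\<lambda>k. 2 * n - k"]) auto
  also have "\<dots> = (\<Sum>k\<le>2 * n. (1 / cnj a) ^ (2 * n) * (cnj (coeff W k) * cnj a ^ k))"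
  proof (intro sum.cong refl)
    fix k assume "k \<in> {..2 * n}"
    then have "(1 / cnj a) ^ (2 * n) = (1 / cnj a) ^ (2 * n - k) * (1 / cnj a) ^ k" by (simp only: power_add[symmetric]) simp
    then show "cnj (coeff W k) * (1 / cnj a) ^ (2 * n - k) = (1 / cnj a) ^ (2 * n) * (cnj (coeff W k) * cnj a ^ k)"
      using a by (simp add: power_divide)
  qed
  also have "\<dots> = (1 / cnj a) ^ (2 * n) * cnj (poly W a)"
    by (simp add: poly_sum_upto[OF deg] sum_distrib_left)
  finally show ?thesis using a by simp
qed

text \<open>On the circle \<open>(w - a) (w - 1 / cnj a) = - (w / cnj a) \<bar>w - a\<bar>\<^sup>2\<close>, so each pair of zeros splits off as
  the square of one factor \<open>\<bar>w - a\<bar>\<close>, and \<open>n\<close> drops by one. Strict positivity keeps the zeros off the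
  circle.\<close>

theorem fejer_riesz:
  assumes "degree W \<le> 2 * n" and "\<And>w. cmod w = 1 \<Longrightarrow> \<exists>r>0. poly W w / w ^ n = of_real r"
  shows "\<exists>H. degree H \<le> n \<and> (\<forall>w. cmod w = 1 \<longrightarrow> poly W w / w ^ n = of_real ((cmod (poly H w))\<^sup>2))"
  using assms
proof (induction n arbitrary: W)
  case 0
  then have "degree W = 0" by simp
  then obtain c where W: "W = [:c:]" by (rule degree_eq_zeroE)
  obtain r where r: "r > 0" "c = of_real r" using "0.prems"(2)[of 1] W by auto
  have "poly W w / w ^ 0 = of_real ((cmod (poly [:of_real (sqrt r):] w))\<^sup>2)" for w
    using r W by simp
  then show ?case by (intro exI[of _ "[:of_real (sqrt r):]"]) simp
next
  case (Suc n)
  have nz: "poly W w \<noteq> 0" if "cmod w = 1" for w using Suc.prems(2)[OF that] that by auto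
  have real: "poly W w / w ^ Suc n \<in> \<real>" if "cmod w = 1" for w
    using Suc.prems(2)[OF that] by (metis Reals_of_real)
  show ?case
  proof (cases "poly W 0 = 0")
    case True
    then obtain V where V: "W = [:0, 1:] * V" by (metis dvd_def minus_zero poly_eq_0_iff_dvd)
    have "coeff W 0 = 0" using True by (simp add: poly_0_coeff_0)
    then have "coeff W (2 * Suc n) = 0"
      using self_inversive_coeffs[OF Suc.prems(1) real, of "2 * Suc n"] by simp
    then have "degree W < 2 * Suc n"
      using Suc.prems(1) nz[of 1] leading_coeff_0_iff[of W] by (metis le_neq_implies_less norm_one poly_0)
    moreover have "V \<noteq> 0" using V nz[of 1] by auto
    ultimately have degV: "degree V \<le> 2 * n" unfolding V by (simp add: degree_mult_eq)
    have eqV: "poly V w / w ^ n = poly W w / w ^ Suc n" if "cmod w = 1" for w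
      using that by (auto simp: V)
    obtain H where H: "degree H \<le> n" "\<And>w. cmod w = 1 \<Longrightarrow> poly V w / w ^ n = of_real ((cmod (poly H w))\<^sup>2)"
      using Suc.IH[OF degV] Suc.prems(2) eqV by metis
    then show ?thesis using eqV by (intro exI[of _ H]) auto
  next
    case False
    have "degree W \<noteq> 0"
    proof
      assume "degree W = 0"
      moreover have "coeff W 0 \<noteq> 0" using False by (simp add: poly_0_coeff_0)
      then have "coeff W (2 * Suc n) \<noteq> 0"
        using self_inversive_coeffs[OF Suc.prems(1) real, of 0] by auto
      ultimately show False using le_degree[of W "2 * Suc n"] by simp
    qed
    then obtain a where a: "poly W a = 0"
      using fundamental_theorem_of_algebra[of W] by (auto simp: constant_degree)
    have a0: "a \<noteq> 0" "cmod a \<noteq> 1" using a False nz by auto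
    define b where "b = 1 / cnj a"
    have b: "poly W b = 0" unfolding b_def using self_inversive_root[OF Suc.prems(1) real a a0(1)] .
    have ab: "a \<noteq> b"
    proof
      assume "a = b"
      then have "a * cnj a = b * cnj a" by simp
      then have "a * cnj a = 1" using a0 by (simp add: b_def)
      then have "(cmod a)\<^sup>2 = 1" by (metis complex_norm_square of_real_eq_1_iff)
      then show False using a0(2) by (simp add: power2_eq_1_iff) (use norm_ge_zero[of a] in linarith)
    qed
    obtain W1 where W1: "W = [:- a, 1:] * W1" using a by (metis dvd_def poly_eq_0_iff_dvd)
    then have "poly W1 b = 0" using b ab by auto
    then obtain V0 where V0: "W1 = [:- b, 1:] * V0" by (metis dvd_def poly_eq_0_iff_dvd)
    define V where "V = smult (- (1 / cnj a)) V0"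
    have "V0 \<noteq> 0" using W1 V0 nz[of 1] by auto
    then have "degree W1 = 1 + degree V0" unfolding V0 by (subst degree_mult_eq) auto
    moreover have "W1 \<noteq> 0" using W1 nz[of 1] by auto
    then have "degree W = 1 + degree W1" unfolding W1 by (subst degree_mult_eq) auto
    ultimately have "degree V0 + 2 \<le> 2 * Suc n" using Suc.prems(1) by simp
    then have degV: "degree V \<le> 2 * n" by (simp add: V_def)
    have factor: "poly W w / w ^ Suc n = of_real ((cmod (w - a))\<^sup>2) * (poly V w / w ^ n)" if w: "cmod w = 1" for w
    proof -
      have w0: "w \<noteq> 0" using w by auto
      have inv: "cnj w = 1 / w" using w w0 complex_norm_square[of w] by (simp add: field_simps)
      have "of_real ((cmod (w - a))\<^sup>2) = (w - a) * (1 / w - cnj a)"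
        unfolding complex_norm_square complex_cnj_diff inv ..
      then have pair: "of_real ((cmod (w - a))\<^sup>2) * (- (1 / cnj a)) * w = (w - a) * (w - b)"
        using w0 a0 by (simp add: b_def field_simps)
      have "poly W w = ((w - a) * (w - b)) * poly V0 w"
        unfolding W1 V0 by (simp add: algebra_simps)
      then have "poly W w = of_real ((cmod (w - a))\<^sup>2) * (- (1 / cnj a)) * w * poly V0 w"
        unfolding pair .
      then show ?thesis using w0 by (simp add: V_def)
    qed
    have posV: "\<exists>r>0. poly V w / w ^ n = of_real r" if w: "cmod w = 1" for w
    proof -
      obtain r where r: "r > 0" "poly W w / w ^ Suc n = of_real r" using Suc.prems(2)[OF w] by auto
      have "w \<noteq> a" using w a0 by auto
      then have m: "(cmod (w - a))\<^sup>2 > 0" by simp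
      have "poly V w / w ^ n = of_real (r / (cmod (w - a))\<^sup>2)"
        using factor[OF w] r(2) m by (simp add: field_simps)
      then show ?thesis using r m by (intro exI[of _ "r / (cmod (w - a))\<^sup>2"]) simp
    qed
    obtain H where H: "degree H \<le> n" "\<And>w. cmod w = 1 \<Longrightarrow> poly V w / w ^ n = of_real ((cmod (poly H w))\<^sup>2)"
      using Suc.IH[OF degV posV] by auto
    show ?thesis
    proof (intro exI[of _ "[:- a, 1:] * H"] conjI allI impI)
      show "degree ([:- a, 1:] * H) \<le> Suc n"
        using degree_mult_le[of "[:- a, 1:]" H] H(1) by simp
      fix w :: complex assume w: "cmod w = 1"
      have "poly ([:- a, 1:] * H) w = (w - a) * poly H w" by (simp add: algebra_simps)
      then show "poly W w / w ^ Suc n = of_real ((cmod (poly ([:- a, 1:] * H) w))\<^sup>2)"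
        unfolding factor[OF w] H(2)[OF w] by (simp only: norm_mult power_mult_distrib of_real_mult)
    qed
  qed
qed

section \<open>Partial fractions and periodic entire functions\<close>

lemma sum_lessThan_add:
  fixes h :: "nat \<Rightarrow> 'a::comm_monoid_add"
  shows "(\<Sum>k<m + n. h k) = (\<Sum>k<m. h k) + (\<Sum>k<n. h (m + k))"
  by (induction n) (simp_all add: add.assoc)

text \<open>Iterating \<open>1 / sin\<^sup>2 x = (1 / sin\<^sup>2 (x / 2) + 1 / sin\<^sup>2 ((x + \<pi>) / 2)) / 4\<close> and using
  \<open>sin\<^sup>2 y \<le> y\<^sup>2\<close> bounds the partial sums of the partial fraction series of \<open>1 / sin\<^sup>2\<close>.\<close>

lemma inverse_sin_sq_double:
  fixes x :: real
  assumes "sin x \<noteq> 0"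
  shows "1 / (sin x)\<^sup>2 = (1 / (sin (x / 2))\<^sup>2 + 1 / (sin ((x + pi) / 2))\<^sup>2) / 4"
    and "sin (x / 2) \<noteq> 0" "sin ((x + pi) / 2) \<noteq> 0"
proof -
  have s: "sin x = 2 * sin (x / 2) * cos (x / 2)" using sin_double[of "x / 2"] by simp
  have c: "sin ((x + pi) / 2) = cos (x / 2)" by (simp add: add_divide_distrib sin_add)
  show nz: "sin (x / 2) \<noteq> 0" "sin ((x + pi) / 2) \<noteq> 0" using assms s c by auto
  define a b where "a = sin (x / 2)" and "b = cos (x / 2)"
  have ab: "a \<noteq> 0" "b \<noteq> 0" "a\<^sup>2 + b\<^sup>2 = 1" using nz c by (auto simp: a_def b_def)
  have "(1 / a\<^sup>2 + 1 / b\<^sup>2) / 4 = (a\<^sup>2 + b\<^sup>2) / (4 * (a\<^sup>2 * b\<^sup>2))" using ab(1,2) by (simp add: field_simps)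
  also have "\<dots> = 1 / (2 * a * b)\<^sup>2" unfolding ab(3) by (simp add: power_mult_distrib)
  finally show "1 / (sin x)\<^sup>2 = (1 / (sin (x / 2))\<^sup>2 + 1 / (sin ((x + pi) / 2))\<^sup>2) / 4"
    unfolding s c a_def b_def by simp
qed

lemma inverse_sin_sq_iterate:
  fixes x :: real
  assumes "sin x \<noteq> 0"
  shows "(\<Sum>k<2 ^ m. 1 / (sin ((x + real k * pi) / 2 ^ m))\<^sup>2) / 4 ^ m = 1 / (sin x)\<^sup>2 \<and> (\<forall>k<2 ^ m. sin ((x + real k * pi) / 2 ^ m) \<noteq> 0)"
proof (induction m)
  case 0
  then show ?case using assms by simp
next
  case (Suc m)
  define t where "t = (\<lambda>k::nat. (x + real k * pi) / 2 ^ m)"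
  have half: "t k / 2 = (x + real k * pi) / 2 ^ Suc m" "(t k + pi) / 2 = (x + real (2 ^ m + k) * pi) / 2 ^ Suc m" for k
    by (simp_all add: t_def field_simps)
  have nz: "sin (t k) \<noteq> 0" if "k < 2 ^ m" for k using Suc that by (simp add: t_def)
  have split: "(\<Sum>k<2 ^ Suc m. h k) = (\<Sum>k<2 ^ m. h k + h (2 ^ m + k))" for h :: "nat \<Rightarrow> real"
    unfolding sum.distrib power_Suc mult_2 by (rule sum_lessThan_add)
  have "(\<Sum>k<2 ^ Suc m. 1 / (sin ((x + real k * pi) / 2 ^ Suc m))\<^sup>2) = (\<Sum>k<2 ^ m. 4 * (1 / (sin (t k))\<^sup>2))"
    unfolding split
  proof (intro sum.cong refl)
    fix k assume "k \<in> {..<2 ^ m :: nat}"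
    then show "1 / (sin ((x + real k * pi) / 2 ^ Suc m))\<^sup>2 + 1 / (sin ((x + real (2 ^ m + k) * pi) / 2 ^ Suc m))\<^sup>2 = 4 * (1 / (sin (t k))\<^sup>2)"
      using inverse_sin_sq_double(1)[OF nz[of k]] unfolding half by simp
  qed
  also have "\<dots> / 4 ^ Suc m = 1 / (sin x)\<^sup>2"
    using conjunct1[OF Suc.IH] unfolding sum_distrib_left[symmetric] by (simp add: t_def)
  moreover have "sin ((x + real k * pi) / 2 ^ Suc m) \<noteq> 0" if "k < 2 ^ Suc m" for k
  proof (cases "k < 2 ^ m")
    case True
    then show ?thesis using inverse_sin_sq_double(2)[OF nz[of k]] unfolding half by simp
  next
    case False
    then have "k - 2 ^ m < 2 ^ m" "2 ^ m + (k - 2 ^ m) = k" using that by auto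
    then show ?thesis using inverse_sin_sq_double(3)[OF nz[of "k - 2 ^ m"]] unfolding half by simp
  qed
  ultimately show ?case by simp
qed

lemma sum_inverse_sq_le:
  fixes x :: real
  assumes "sin x \<noteq> 0"
  shows "(\<Sum>n<M. 1 / (x - real n * pi)\<^sup>2 + 1 / (x + real (n + 1) * pi)\<^sup>2) \<le> 1 / (sin x)\<^sup>2"
proof -
  \<comment> \<open>From \<open>y\<close> the two-sided partial sum becomes a one-sided one: the indices \<open>M + n\<close> and \<open>M - 1 - n\<close> give the two summands for \<open>n\<close>, up to sign.\<close>
  define y where "y = - x - real M * pi"
  have sy: "(sin y)\<^sup>2 = (sin x)\<^sup>2"
    by (simp add: y_def sin_diff power_mult_distrib sin_npi2 mult.commute[of "real M"] cos_npi flip: power_mult)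
  have y0: "sin y \<noteq> 0" using sy assms by auto
  have summand_le: "1 / (y + real k * pi)\<^sup>2 \<le> 1 / (sin ((y + real k * pi) / 2 ^ m))\<^sup>2 / 4 ^ m" if "k < 2 ^ m" for k m
  proof -
    define u where "u = (y + real k * pi) / 2 ^ m"
    have u: "sin u \<noteq> 0" using inverse_sin_sq_iterate[OF y0, of m] that by (simp add: u_def)
    have "(sin u)\<^sup>2 \<le> u\<^sup>2" using abs_sin_x_le_abs_x[of u] by (simp add: abs_le_square_iff)
    then have "1 / u\<^sup>2 \<le> 1 / (sin u)\<^sup>2" using u by (intro divide_left_mono mult_pos_pos) auto
    moreover have "1 / (y + real k * pi)\<^sup>2 = 1 / u\<^sup>2 / 4 ^ m"
      by (simp add: u_def power_divide power_mult[symmetric] mult.commute[of m] power_mult)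
    ultimately show ?thesis unfolding u_def[symmetric] by (simp add: divide_right_mono del: divide_divide_eq_left)
  qed
  have "(\<Sum>n<M. 1 / (x - real n * pi)\<^sup>2 + 1 / (x + real (n + 1) * pi)\<^sup>2) = (\<Sum>k<2 * M. 1 / (y + real k * pi)\<^sup>2)"
  proof -
    have "(\<Sum>k<M + M. 1 / (y + real k * pi)\<^sup>2) = (\<Sum>k<M. 1 / (y + real k * pi)\<^sup>2) + (\<Sum>k<M. 1 / (y + real (M + k) * pi)\<^sup>2)"
      by (simp add: sum_lessThan_add)
    also have "(\<Sum>k<M. 1 / (y + real k * pi)\<^sup>2) = (\<Sum>n<M. 1 / (y + real (M - Suc n) * pi)\<^sup>2)"
      by (rule sum.nat_diff_reindex[symmetric])
    also have "\<dots> = (\<Sum>n<M. 1 / (x + real (n + 1) * pi)\<^sup>2)"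
    proof (intro sum.cong refl)
      fix n assume "n \<in> {..<M}"
      then have "y + real (M - Suc n) * pi = - (x + real (n + 1) * pi)" by (simp add: y_def of_nat_diff algebra_simps)
      then show "1 / (y + real (M - Suc n) * pi)\<^sup>2 = 1 / (x + real (n + 1) * pi)\<^sup>2" by (simp only: power2_minus)
    qed
    also have "(\<Sum>k<M. 1 / (y + real (M + k) * pi)\<^sup>2) = (\<Sum>n<M. 1 / (x - real n * pi)\<^sup>2)"
    proof (intro sum.cong refl)
      fix n
      have "y + real (M + n) * pi = - (x - real n * pi)" by (simp add: y_def algebra_simps)
      then show "1 / (y + real (M + n) * pi)\<^sup>2 = 1 / (x - real n * pi)\<^sup>2" by (simp only: power2_minus)
    qed
    finally show ?thesis by (simp add: sum.distrib mult_2 add.commute)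
  qed
  also have "\<dots> \<le> (\<Sum>k<2 * M. 1 / (sin ((y + real k * pi) / 2 ^ (2 * M)))\<^sup>2 / 4 ^ (2 * M))"
  proof (intro sum_mono summand_le)
    fix k assume "k \<in> {..<2 * M}"
    then show "k < 2 ^ (2 * M)" using less_exp[of "2 * M"] by (auto intro: less_trans)
  qed
  also have "\<dots> \<le> (\<Sum>k<2 ^ (2 * M). 1 / (sin ((y + real k * pi) / 2 ^ (2 * M)))\<^sup>2 / 4 ^ (2 * M))"
    using less_exp[of "2 * M"] by (intro sum_mono2) auto
  also have "\<dots> = 1 / (sin x)\<^sup>2"
    using inverse_sin_sq_iterate[OF y0, of "2 * M"] by (simp add: sum_divide_distrib sy)
  finally show ?thesis .
qed

lemma periodic_of_int:
  assumes per: "\<And>z::complex. G (z + 1) = G z"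
  shows "G (z + of_int k) = G z"
proof -
  have per_nat: "G (z + of_nat n) = G z" for z n
  proof (induction n)
    case (Suc n)
    then show ?case using per[of "z + of_nat n"] by (simp add: add.assoc add.commute[of 1])
  qed simp
  show ?thesis
  proof (cases "k \<ge> 0")
    case True
    then show ?thesis using per_nat[of z "nat k"] by simp
  next
    case False
    then show ?thesis using per_nat[of "z + of_int k" "nat (- k)"] by simp
  qed
qed

text \<open>The function \<open>Q\<close> is \<open>G\<close> composed with a logarithm. Any two logarithms of the same point differ by a
  period of \<open>G\<close>, so near each point the principal branch may be exchanged for one that is holomorphic
  there.\<close>

lemma periodic_entire_exp:
  assumes hol: "G holomorphic_on UNIV" and per: "\<And>z. G (z + 1) = G z"
  obtains Q where "Q holomorphic_on - {0}" "\<And>z. G z = Q (exp (2 * of_real pi * \<i> * z))"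
proof -
  define c where "c = 2 * of_real pi * \<i>"
  have c0: "c \<noteq> 0" by (simp add: c_def)
  have per_int: "G (z + of_int k) = G z" for z k using periodic_of_int[of G, OF per] .
  have G_eq: "G z = G w" if exps: "exp (c * z) = exp (c * w)" for z w
  proof -
    obtain n :: int where "c * z = c * w + of_real (of_int (2 * n) * pi) * \<i>" using exps unfolding exp_eq by blast
    then have "c * z = c * (w + of_int n)" by (simp add: c_def algebra_simps)
    then show ?thesis using c0 per_int[of w n] by simp
  qed
  define Q where "Q = (\<lambda>w. G (Ln w / c))"
  have Q_exp: "G z = Q (exp (c * z))" for z
    unfolding Q_def by (rule G_eq) (use c0 in simp)
  have "Q field_differentiable (at w)" if w0: "w \<noteq> 0" for w
  proof -
    have G_at: "G field_differentiable (at z)" for z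
      using hol by (simp add: holomorphic_on_def)
    obtain u r where u: "u \<noteq> 0" "r > 0" "\<And>v. v \<in> ball w r \<Longrightarrow> v / u \<notin> \<real>\<^sub>\<le>\<^sub>0"
    proof -
      have "open {v. v / w \<notin> \<real>\<^sub>\<le>\<^sub>0}"
      proof -
        have "open ((\<lambda>v. v / w) -` (- \<real>\<^sub>\<le>\<^sub>0))"
          by (intro open_vimage continuous_intros) (use w0 in auto)
        then show ?thesis by (simp add: vimage_def)
      qed
      moreover have "w \<in> {v. v / w \<notin> \<real>\<^sub>\<le>\<^sub>0}" using w0 by simp
      ultimately obtain r where "r > 0" "ball w r \<subseteq> {v. v / w \<notin> \<real>\<^sub>\<le>\<^sub>0}"
        using open_contains_ball by blast
      then show ?thesis using w0 by (intro that[of w r]) auto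
    qed
    have Q_loc: "G ((Ln (v / u) + Ln u) / c) = Q v" if v: "v \<in> ball w r" for v
    proof -
      have v0: "v \<noteq> 0" using u(3)[OF v] by auto
      have "exp (Ln (v / u) + Ln u) = v" using v0 u(1) by (simp add: exp_add)
      then show ?thesis unfolding Q_def using v0 c0 by (intro G_eq) simp
    qed
    have "(\<lambda>v. G ((Ln (v / u) + Ln u) / c)) field_differentiable (at w)"
    proof (rule field_differentiable_compose[of "\<lambda>v. (Ln (v / u) + Ln u) / c" w G, unfolded o_def])
      show "(\<lambda>v. (Ln (v / u) + Ln u) / c) field_differentiable (at w)"
      proof -
        have "(\<lambda>v. Ln (v / u)) field_differentiable (at w)"
          by (rule field_differentiable_compose[of "\<lambda>v. v / u" w Ln, unfolded o_def])
             (use u(2) u(3)[of w] u(1) in \<open>auto intro!: field_differentiable_at_Ln derivative_intros field_differentiable_divide\<close>)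
        then show ?thesis using c0 by (intro field_differentiable_divide field_differentiable_add field_differentiable_const)
      qed
    qed (rule G_at)
    then show ?thesis
      by (rule field_differentiable_transform_within[OF u(2), rotated 2]) (use Q_loc in \<open>auto simp: dist_commute\<close>)
  qed
  then have "Q holomorphic_on - {0}" by (auto simp: holomorphic_on_def field_differentiable_at_within)
  then show thesis using that Q_exp by (simp add: c_def)
qed

text \<open>Write \<open>G\<close> as a function \<open>Q\<close> of \<open>w = exp (2 \<pi> \<i> z)\<close>. The growth bound makes \<open>w\<^sup>n Q w\<close> bounded near \<open>0\<close> and
  \<open>O(\<bar>w\<bar>\<^bsup>2n\<^esup>)\<close> at infinity, so it is a polynomial by Riemann's and Liouville's theorems.\<close>

lemma periodic_exponential_type_trig_poly:
  assumes hol: "G holomorphic_on UNIV" and per: "\<And>z. G (z + 1) = G z"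
    and bd: "\<And>z. cmod (G z) \<le> C * exp (2 * pi * real n * \<bar>Im z\<bar>)"
  obtains W where "degree W \<le> 2 * n" "\<And>z. G z = poly W (exp (2 * of_real pi * \<i> * z)) / exp (2 * of_real pi * \<i> * z) ^ n"
proof -
  obtain Q where Q: "Q holomorphic_on - {0}" "\<And>z. G z = Q (exp (2 * of_real pi * \<i> * z))"
    using periodic_entire_exp[OF hol per] by blast
  have C0: "C \<ge> 0" using order_trans[OF norm_ge_zero bd[of 0]] by simp
  define R where "R = (\<lambda>w. w ^ n * Q w)"
  have R_bound: "cmod (R w) \<le> C * max 1 (cmod w ^ (2 * n))" if "w \<noteq> 0" for w
  proof -
    define z where "z = Ln w / (2 * of_real pi * \<i>)"
    have wz: "exp (2 * of_real pi * \<i> * z) = w" using that by (simp add: z_def)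
    have "cmod w = exp (- 2 * pi * Im z)" unfolding wz[symmetric] by (simp add: mult.assoc)
    then have lnw: "exp (2 * pi * real n * \<bar>Im z\<bar>) * cmod w ^ n \<le> max 1 (cmod w ^ (2 * n))"
    proof -
      assume e: "cmod w = exp (- 2 * pi * Im z)"
      have p: "cmod w ^ k = exp (real k * (- 2 * pi * Im z))" for k unfolding e by (rule exp_of_nat_mult[symmetric])
      show ?thesis
      proof (cases "Im z \<ge> 0")
        case True
        then show ?thesis unfolding p by (simp add: exp_add[symmetric] algebra_simps)
      next
        case False
        then show ?thesis unfolding p by (simp add: exp_add[symmetric] algebra_simps)
      qed
    qed
    have "cmod (R w) = cmod w ^ n * cmod (G z)" by (simp add: R_def Q(2) wz norm_mult norm_power)
    also have "\<dots> \<le> cmod w ^ n * (C * exp (2 * pi * real n * \<bar>Im z\<bar>))" by (intro mult_left_mono bd) auto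
    also have "\<dots> = C * (exp (2 * pi * real n * \<bar>Im z\<bar>) * cmod w ^ n)" by simp
    also have "\<dots> \<le> C * max 1 (cmod w ^ (2 * n))" using lnw C0 by (intro mult_left_mono)
    finally show ?thesis .
  qed
  have R_hol: "R holomorphic_on UNIV - {0}" unfolding R_def using Q(1) by (auto intro!: holomorphic_intros simp: Compl_eq_Diff_UNIV)
  have "\<exists>B. \<forall>\<^sub>F w in at 0. cmod (R w) \<le> B"
  proof (intro exI)
    show "\<forall>\<^sub>F w in at 0. cmod (R w) \<le> C"
      unfolding eventually_at
    proof (intro exI[of _ 1] conjI ballI impI)
      fix w :: complex assume "w \<noteq> 0 \<and> dist w 0 < 1"
      then show "cmod (R w) \<le> C" using R_bound[of w] power_le_one[of "cmod w" "2 * n"] by (simp add: max_absorb1)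
    qed simp
  qed
  then obtain S where S: "S holomorphic_on UNIV" "\<And>w. w \<noteq> 0 \<Longrightarrow> S w = R w"
    using holomorphic_on_extend_bounded[OF R_hol] by auto
  have S_poly: "S w = (\<Sum>k\<le>2 * n. (deriv ^^ k) S 0 / fact k * w ^ k)" for w
  proof (rule Liouville_polynomial[OF S(1)])
    fix z :: complex assume z: "1 \<le> cmod z"
    then have "z \<noteq> 0" by auto
    then show "cmod (S z) \<le> C * cmod z ^ (2 * n)"
      using R_bound[of z] S(2)[of z] z one_le_power[OF z, of "2 * n"] by (simp add: max_absorb2)
  qed
  define W where "W = (\<Sum>k\<le>2 * n. monom ((deriv ^^ k) S 0 / fact k) k)"
  have "poly W w = S w" for w unfolding W_def by (subst S_poly) (simp add: poly_sum poly_monom)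
  moreover have "degree W \<le> 2 * n" unfolding W_def by (intro degree_sum_le) (auto intro: order_trans[OF degree_monom_le])
  ultimately show thesis using that[of W] S(2) Q(2) by (simp add: R_def)
qed

section \<open>Decay and derivative of an even radially decreasing function\<close>

text \<open>Monotonicity and integrability give \<open>\<bar>x\<bar> F x \<le> \<parallel>F\<parallel>\<^sub>1\<close> on the real line; the Phragmen-Lindelof
  principle for \<open>F(z) (z + \<i>)\<close> carries the decay into the upper half-plane, and evenness into the lower.\<close>

lemma F1_even_decay:
  assumes F: "F \<in> F1" "even_fun F"
  obtains M where "\<And>z. cmod (F z) * (1 + cmod z) \<le> M * exp (2 * pi * \<bar>Im z\<bar>)"
proof -
  define h where "h = (\<lambda>x::real. Re (F (of_real x)))"
  define A where "A = norm_L1 F"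
  have A0: "A \<ge> 0" by (simp add: A_def norm_L1_nonneg)
  have F00: "Re (F 0) \<ge> 0" using F1_nonneg[OF F(1), of 0] by simp
  have pos: "x * h x \<le> A" if "x \<ge> 0" for x
  proof -
    have "(LBINT y. indicator {0..x} y * h x) \<le> (LBINT y. h y)"
    proof (rule integral_mono)
      show "integrable lborel (\<lambda>y. indicator {0..x} y * h x)"
        by (intro integrable_mult_left integrable_real_indicator) (auto simp: emeasure_lborel_Icc_eq)
      show "integrable lborel h" unfolding h_def by (rule F1_integrable[OF F(1)])
      show "indicator {0..x} y * h x \<le> h y" for y
        using F1_antimono[OF F(1), of y x] F1_nonneg[OF F(1), of y] by (auto simp: h_def split: split_indicator)
    qed
    then show ?thesis using that by (simp add: A_def F1_norm_L1[OF F(1)] h_def)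
  qed
  have hm: "h (- x) = h x" for x using F(2) by (simp add: h_def even_fun_def)
  have abs_pos: "\<bar>x\<bar> * h x \<le> A" for x using pos[of x] pos[of "- x"] hm[of x] by (cases "x \<ge> 0") auto
  define M where "M = A + Re (F 0)"
  have up: "cmod (F z * (z + \<i>)) \<le> M * exp (2 * pi * Im z)" if "Im z \<ge> 0" for z
  proof (rule phragmen_lindelof_upper_halfplane[where f = "\<lambda>z. F z * (z + \<i>)"])
    show "(\<lambda>z. F z * (z + \<i>)) holomorphic_on UNIV" using F1_holomorphic[OF F(1)] by (intro holomorphic_intros)
    show "exponential_type_at_most (2 * pi) (\<lambda>z. F z * (z + \<i>))"
      unfolding exponential_type_at_most_def
    proof (intro allI impI)
      fix \<epsilon> :: real assume e: "\<epsilon> > 0"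
      define C where "C = (Re (F 0) + 1) * (1 + 1 / \<epsilon>)"
      have "cmod (F z * (z + \<i>)) \<le> C * exp ((2 * pi + \<epsilon>) * cmod z)" for z
      proof -
        have "cmod (F z) \<le> Re (F 0) * exp (2 * pi * \<bar>Im z\<bar>)" by (rule F1_bound[OF F(1)])
        also have "\<dots> \<le> (Re (F 0) + 1) * exp (2 * pi * cmod z)"
          using F00 abs_Im_le_cmod[of z] by (intro mult_mono) auto
        finally have 1: "cmod (F z) \<le> (Re (F 0) + 1) * exp (2 * pi * cmod z)" .
        have "\<epsilon> * cmod z \<le> exp (\<epsilon> * cmod z)" using exp_ge_add_one_self[of "\<epsilon> * cmod z"] by linarith
        then have "cmod z \<le> 1 / \<epsilon> * exp (\<epsilon> * cmod z)" using e by (simp add: field_simps)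
        moreover have "1 \<le> exp (\<epsilon> * cmod z)" using e by simp
        moreover have "cmod (z + \<i>) \<le> cmod z + 1" using norm_triangle_ineq[of z \<i>] by simp
        ultimately have 2: "cmod (z + \<i>) \<le> (1 + 1 / \<epsilon>) * exp (\<epsilon> * cmod z)" by (simp only: distrib_right)
        have "cmod (F z) * cmod (z + \<i>) \<le> ((Re (F 0) + 1) * exp (2 * pi * cmod z)) * ((1 + 1 / \<epsilon>) * exp (\<epsilon> * cmod z))"
          using F00 by (intro mult_mono 1 2) auto
        also have "\<dots> = C * exp ((2 * pi + \<epsilon>) * cmod z)" unfolding C_def distrib_right[of "2 * pi"] exp_add by (simp only: mult_ac)
        finally show ?thesis by (simp add: norm_mult)
      qed
      moreover have "C > 0" using e F00 by (simp add: C_def add_pos_pos)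
      ultimately show "\<exists>C>0. \<forall>z. cmod (F z * (z + \<i>)) \<le> C * exp ((2 * pi + \<epsilon>) * cmod z)" by blast
    qed
    fix x :: real
    show "cmod (F (of_real x) * (of_real x + \<i>)) \<le> M"
    proof -
      have "cmod (F (of_real x) * (of_real x + \<i>)) = h x * cmod (of_real x + \<i>)"
        by (simp add: norm_mult F1_cmod[OF F(1)] h_def)
      also have "\<dots> \<le> h x * (\<bar>x\<bar> + 1)"
        using norm_triangle_ineq[of "of_real x" \<i>] F1_nonneg[OF F(1), of x] by (intro mult_left_mono) (auto simp: h_def)
      also have "\<dots> \<le> M"
        using abs_pos[of x] F1_le_center[OF F(1), of x] by (simp add: M_def distrib_left h_def mult.commute)
      finally show ?thesis .
    qed
  qed (use that in simp_all)
  have upper: "cmod (F z) * (1 + cmod z) \<le> 2 * M * exp (2 * pi * Im z)" if "Im z \<ge> 0" for z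
  proof -
    have "(1 + cmod z)\<^sup>2 \<le> (2 * cmod (z + \<i>))\<^sup>2"
    proof -
      have "0 \<le> (cmod z - 1)\<^sup>2" by simp
      then have "(1 + cmod z)\<^sup>2 \<le> 2 * ((cmod z)\<^sup>2 + 1)" by (simp add: power2_eq_square algebra_simps)
      also have "\<dots> \<le> 4 * (cmod (z + \<i>))\<^sup>2"
      proof -
        have "(cmod (z + \<i>))\<^sup>2 = (cmod z)\<^sup>2 + 2 * Im z + 1" unfolding cmod_power2 by (simp add: power2_sum)
        moreover have "2 * (p + 1) \<le> 4 * q" if "q = p + 2 * y + 1" "0 \<le> y" "0 \<le> p" for p q y :: real using that by simp
        ultimately show ?thesis using that by simp
      qed
      finally show ?thesis by (simp add: power_mult_distrib)
    qed
    then have "1 + cmod z \<le> 2 * cmod (z + \<i>)" by (rule power2_le_imp_le) simp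
    then have "cmod (F z) * (1 + cmod z) \<le> cmod (F z) * (2 * cmod (z + \<i>))" by (intro mult_left_mono) auto
    with up[OF that] show ?thesis by (simp add: norm_mult)
  qed
  show thesis
  proof (rule that)
    fix z show "cmod (F z) * (1 + cmod z) \<le> (2 * M) * exp (2 * pi * \<bar>Im z\<bar>)"
      using upper[of z] upper[of "- z"] F(2) by (cases "Im z \<ge> 0") (auto simp: even_fun_def)
  qed
qed

text \<open>The derivative of an even function is odd, hence divisible by \<open>z\<close>. Cauchy's estimate on unit circles
  passes the decay of \<open>F\<close> on to \<open>F'\<close>, and the division by \<open>z\<close> improves it to the order \<open>\<bar>z\<bar>\<^bsup>-2\<^esup>\<close>.\<close>

lemma F1_even_derivative:
  assumes F: "F \<in> F1" "even_fun F"
  obtains g D where "g holomorphic_on UNIV" "\<And>z. deriv F z = - (z * g z)"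
    "\<And>z. cmod (g z) \<le> D * exp (2 * pi * \<bar>Im z\<bar>) / (1 + (cmod z)\<^sup>2)"
    "\<And>x::real. g (of_real x) \<in> \<real>\<^sub>\<ge>\<^sub>0" "\<And>z. g (- z) = g z"
proof -
  obtain M where M: "\<And>z. cmod (F z) * (1 + cmod z) \<le> M * exp (2 * pi * \<bar>Im z\<bar>)"
    using F1_even_decay[OF F] by blast
  have M0: "M \<ge> 0" using order_trans[OF _ M[of 0]] by simp
  have hol: "F holomorphic_on UNIV" by (rule F1_holomorphic[OF F(1)])
  have der: "(F has_field_derivative deriv F z) (at z)" for z
    using hol by (simp add: holomorphic_derivI)
  define D0 where "D0 = 2 * M * exp (2 * pi)"
  have D0: "D0 \<ge> 0" using M0 by (simp add: D0_def)
  have d_bound: "cmod (deriv F z) * (1 + cmod z) \<le> D0 * exp (2 * pi * \<bar>Im z\<bar>)" for z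
  proof -
    have "cmod ((deriv ^^ 1) F z) \<le> fact 1 * (D0 * exp (2 * pi * \<bar>Im z\<bar>) / (1 + cmod z)) / 1 ^ 1"
    proof (rule Cauchy_inequality)
      show "F holomorphic_on ball z 1" using hol by (rule holomorphic_on_subset) auto
      show "continuous_on (cball z 1) F" using hol by (meson holomorphic_on_imp_continuous_on continuous_on_subset top_greatest)
      fix w assume w: "cmod (z - w) = 1"
      have n1: "cmod z \<le> cmod w + 1" using norm_triangle_ineq2[of z w] w by simp
      have n3: "1 + cmod z \<le> 2 * (1 + cmod w)" using add_mono[OF n1 norm_ge_zero[of w]] by (simp add: algebra_simps)
      have "\<bar>Im z - Im w\<bar> \<le> 1" using abs_Im_le_cmod[of "z - w"] w by simp
      then have n2: "2 * pi * \<bar>Im w\<bar> \<le> 2 * pi * \<bar>Im z\<bar> + 2 * pi"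
        using mult_left_mono[of "\<bar>Im w\<bar>" "\<bar>Im z\<bar> + 1" "2 * pi"] by (simp add: distrib_left)
      have "cmod (F w) * (1 + cmod z) \<le> cmod (F w) * (2 * (1 + cmod w))"
        using n3 by (intro mult_left_mono) auto
      also have "\<dots> \<le> 2 * (M * exp (2 * pi * \<bar>Im w\<bar>))" using M[of w] by (simp only: mult.left_commute[of _ 2])
      also have "\<dots> \<le> 2 * (M * exp (2 * pi * \<bar>Im z\<bar> + 2 * pi))" using n2 M0 by (intro mult_left_mono) auto
      also have "\<dots> = D0 * exp (2 * pi * \<bar>Im z\<bar>)" by (simp add: D0_def exp_add)
      finally show "cmod (F w) \<le> D0 * exp (2 * pi * \<bar>Im z\<bar>) / (1 + cmod z)"
        by (simp add: pos_le_divide_eq add_pos_nonneg)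
    qed simp
    then show ?thesis by (simp add: pos_le_divide_eq add_pos_nonneg)
  qed
  have d_minus: "deriv F (- z) = - deriv F z" for z
  proof -
    have "((\<lambda>w. F (- w)) has_field_derivative deriv F (- z) * (- 1)) (at z)"
      by (rule DERIV_chain2[OF der]) (auto intro!: derivative_eq_intros)
    then have "(F has_field_derivative - deriv F (- z)) (at z)" using F(2) by (simp add: even_fun_def)
    from DERIV_unique[OF this der] show ?thesis by (metis minus_minus)
  qed
  have "deriv F 0 = 0" using d_minus[of 0] by (simp add: eq_neg_iff_add_eq_0)
  moreover have "deriv F holomorphic_on UNIV" using hol by (simp add: holomorphic_deriv)
  ultimately obtain G where G: "G holomorphic_on UNIV" "\<And>z. deriv F z = z * G z"
    using entire_divide_zero[of "deriv F" 0] by auto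
  define g where "g = (\<lambda>z. - G z)"
  have g_hol: "g holomorphic_on UNIV" unfolding g_def using G(1) by (intro holomorphic_intros)
  have g_eq: "deriv F z = - (z * g z)" for z by (simp add: g_def G(2))
  have g_minus: "g (- z) = g z" for z
  proof (cases "z = 0")
    case False
    have "z * g (- z) = z * g z" using d_minus[of z] unfolding g_eq by simp
    then show ?thesis using False by simp
  qed simp
  have g_cont: "continuous_on UNIV g" using g_hol by (rule holomorphic_on_imp_continuous_on)
  have "bounded (g ` cball 0 1)"
    by (intro compact_imp_bounded compact_continuous_image continuous_on_subset[OF g_cont]) auto
  then obtain K where K: "\<And>z. cmod z \<le> 1 \<Longrightarrow> cmod (g z) \<le> K"
    unfolding bounded_iff by (metis imageI mem_cball_0)
  define D where "D = max (2 * K) D0"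
  have D: "D \<ge> 0" "2 * K \<le> D" "D0 \<le> D" using D0 by (auto simp: D_def le_max_iff_disj)
  have g_bound: "cmod (g z) \<le> D * exp (2 * pi * \<bar>Im z\<bar>) / (1 + (cmod z)\<^sup>2)" for z
  proof -
    have "cmod (g z) * (1 + (cmod z)\<^sup>2) \<le> D * exp (2 * pi * \<bar>Im z\<bar>)"
    proof (cases "cmod z \<le> 1")
      case True
      then have "(cmod z)\<^sup>2 \<le> 1" by (simp add: power_le_one)
      then have "cmod (g z) * (1 + (cmod z)\<^sup>2) \<le> K * 2" using K[OF True] order_trans[OF norm_ge_zero K[OF True]] by (intro mult_mono) auto
      also have "\<dots> \<le> D * 1" using D by simp
      also have "\<dots> \<le> D * exp (2 * pi * \<bar>Im z\<bar>)" using D(1) by (intro mult_left_mono) auto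
      finally show ?thesis .
    next
      case False
      have "cmod (g z) * (1 + (cmod z)\<^sup>2) \<le> cmod (g z) * (cmod z * (1 + cmod z))"
        using False by (intro mult_left_mono) (auto simp: power2_eq_square distrib_left)
      also have "\<dots> = cmod (deriv F z) * (1 + cmod z)" unfolding g_eq by (simp add: norm_mult)
      also have "\<dots> \<le> D0 * exp (2 * pi * \<bar>Im z\<bar>)" by (rule d_bound)
      also have "\<dots> \<le> D * exp (2 * pi * \<bar>Im z\<bar>)" using D by (intro mult_right_mono) auto
      finally show ?thesis .
    qed
    then show ?thesis by (simp add: pos_le_divide_eq add_pos_nonneg)
  qed
  have vec: "((\<lambda>x::real. F (of_real x)) has_vector_derivative deriv F (of_real x)) (at x)" for x :: real
    by (rule has_vector_derivative_real_field[OF der])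
  have g_pos: "g (of_real x) \<in> \<real>\<^sub>\<ge>\<^sub>0" if x: "x > 0" for x :: real
  proof -
    have "((\<lambda>x::real. Im (F (of_real x))) has_real_derivative Im (deriv F (of_real x))) (at x)"
      using bounded_linear.has_vector_derivative[OF bounded_linear_Im vec[of x]]
      unfolding has_real_derivative_iff_has_vector_derivative .
    moreover have "Im (F (of_real x)) = 0" for x :: real using F1_real[OF F(1), of x] by (metis Im_complex_of_real)
    ultimately have "((\<lambda>x::real. 0) has_real_derivative Im (deriv F (of_real x))) (at x)" by simp
    then have im: "Im (deriv F (of_real x)) = 0" using DERIV_unique[OF _ DERIV_const] by blast
    have "((\<lambda>x::real. - Re (F (of_real x))) has_real_derivative - Re (deriv F (of_real x))) (at x)"
      using bounded_linear.has_vector_derivative[OF bounded_linear_Re vec[of x]]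
      unfolding has_real_derivative_iff_has_vector_derivative by (rule has_vector_derivative_minus)
    moreover have "mono_on {0<..} (\<lambda>x::real. - Re (F (of_real x)))"
      using F1_antimono[OF F(1)] by (auto simp: monotone_on_def)
    ultimately have re: "0 \<le> - Re (deriv F (of_real x))"
      using x by (intro mono_on_imp_deriv_nonneg[of "{0<..}" "\<lambda>x. - Re (F (of_real x))" _ x]) (auto simp: interior_open)
    from im re x show ?thesis unfolding g_eq by (auto simp: complex_nonneg_Reals_iff zero_le_mult_iff)
  qed
  have g_nonneg: "g (of_real x) \<in> \<real>\<^sub>\<ge>\<^sub>0" for x :: real
  proof -
    have "closed ((\<lambda>x::real. g (of_real x)) -` \<real>\<^sub>\<ge>\<^sub>0)"
      by (intro continuous_closed_vimage closed_nonneg_Reals_complex isCont_o2[OF _ continuous_on_interior[OF g_cont]])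
         (auto intro!: continuous_intros)
    moreover have "- {0} \<subseteq> (\<lambda>x::real. g (of_real x)) -` \<real>\<^sub>\<ge>\<^sub>0"
    proof
      fix x :: real assume "x \<in> - {0}"
      then show "x \<in> (\<lambda>x::real. g (of_real x)) -` \<real>\<^sub>\<ge>\<^sub>0"
        using g_pos[of x] g_pos[of "- x"] g_minus[of "of_real x"] by (cases "x > 0") auto
    qed
    ultimately have "closure (- {0}) \<subseteq> (\<lambda>x::real. g (of_real x)) -` \<real>\<^sub>\<ge>\<^sub>0" by (intro closure_minimal)
    then show ?thesis by (auto simp: closure_complement)
  qed
  show thesis by (rule that[OF g_hol g_eq g_bound g_nonneg g_minus])
qed

text \<open>Both the value at the centre and the norm are moments of \<open>\<gamma> = - F' / x\<close>: integrate
  \<open>F' = - x \<gamma>\<close> once and twice from infinity.\<close>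

lemma F1_even_moments:
  assumes F: "F \<in> F1" "even_fun F" "F 0 = 1"
    and g: "continuous_on UNIV g" "\<And>z. deriv F z = - (z * g z)" "\<And>x::real. g (of_real x) = of_real (\<gamma> x)" "\<And>x. \<gamma> x \<ge> 0"
  shows "(\<integral>\<^sup>+y. ennreal (indicator {0<..} y * (y * \<gamma> y)) \<partial>lborel) = 1"
    and "(\<integral>\<^sup>+y. ennreal (indicator {0<..} y * (y\<^sup>2 * \<gamma> y)) \<partial>lborel) \<le> ennreal (norm_L1 F / 2)"
proof -
  define h where "h = (\<lambda>x::real. Re (F (of_real x)))"
  obtain M where M: "\<And>z. cmod (F z) * (1 + cmod z) \<le> M * exp (2 * pi * \<bar>Im z\<bar>)"
    using F1_even_decay[OF F(1,2)] by blast
  have h0: "h x \<ge> 0" for x using F1_nonneg[OF F(1), of x] by (simp add: h_def)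
  have h_bound: "h x \<le> M / x" if "x > 0" for x
  proof -
    have "h x * x \<le> h x * (1 + x)" using h0[of x] by (simp add: distrib_left)
    also have "\<dots> \<le> M" using M[of "of_real x"] that by (simp add: F1_cmod[OF F(1)] h_def)
    finally show ?thesis using that by (simp add: pos_le_divide_eq)
  qed
  have lim: "(h \<longlongrightarrow> 0) at_top"
  proof (rule tendsto_sandwich[of "\<lambda>_. 0" h _ "\<lambda>x. M / x"])
    show "\<forall>\<^sub>F x in at_top. h x \<le> M / x" using eventually_gt_at_top[of 0] by eventually_elim (rule h_bound)
    show "((\<lambda>x. M / x) \<longlongrightarrow> 0) at_top" by (intro tendsto_divide_0[OF tendsto_const] filterlim_at_top_imp_at_infinity filterlim_ident)
  qed (auto simp: h0)
  have hol: "F holomorphic_on UNIV" by (rule F1_holomorphic[OF F(1)])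
  have der: "(h has_real_derivative - (x * \<gamma> x)) (at x)" for x
  proof -
    have "((\<lambda>x::real. F (of_real x)) has_vector_derivative deriv F (of_real x)) (at x)"
      using hol by (intro has_vector_derivative_real_field) (simp add: holomorphic_derivI)
    from bounded_linear.has_vector_derivative[OF bounded_linear_Re this] show ?thesis
      unfolding h_def has_real_derivative_iff_has_vector_derivative g(2,3) by simp
  qed
  have "continuous_on UNIV (\<lambda>x. Re (g (of_real x)))"
    by (intro continuous_intros continuous_on_compose2[OF g(1)]) auto
  then have "continuous_on UNIV \<gamma>" by (simp add: g(3))
  then have [measurable]: "\<gamma> \<in> borel_measurable borel" by (rule borel_measurable_continuous_onI)
  have tail: "(\<integral>\<^sup>+y. ennreal (y * \<gamma> y) * indicator {x<..} y \<partial>lborel) = ennreal (h x)" if "x \<ge> 0" for x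
  proof -
    have "(\<integral>\<^sup>+y. ennreal (y * \<gamma> y) * indicator {x..} y \<partial>lborel) = 0 - (- h x)"
    proof (rule nn_integral_FTC_atLeast[where F = "\<lambda>x. - h x"])
      show "((\<lambda>x. - h x) has_real_derivative y * \<gamma> y) (at y)" for y using DERIV_minus[OF der[of y]] by simp
      show "((\<lambda>x. - h x) \<longlongrightarrow> 0) at_top" using tendsto_minus[OF lim] by simp
      show "0 \<le> y * \<gamma> y" if "x \<le> y" for y using that \<open>x \<ge> 0\<close> g(4)[of y] by simp
    qed measurable
    moreover have "(\<integral>\<^sup>+y. ennreal (y * \<gamma> y) * indicator {x<..} y \<partial>lborel) = (\<integral>\<^sup>+y. ennreal (y * \<gamma> y) * indicator {x..} y \<partial>lborel)"
      by (intro nn_integral_cong_AE) (use AE_lborel_singleton[of x] in \<open>eventually_elim, auto split: split_indicator\<close>)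
    ultimately show ?thesis by simp
  qed
  have "(\<integral>\<^sup>+y. ennreal (indicator {0<..} y * (y * \<gamma> y)) \<partial>lborel) = (\<integral>\<^sup>+y. ennreal (y * \<gamma> y) * indicator {0<..} y \<partial>lborel)"
    by (intro nn_integral_cong) (auto split: split_indicator)
  also have "\<dots> = 1" unfolding tail[OF order_refl] by (simp add: h_def F(3))
  finally show "(\<integral>\<^sup>+y. ennreal (indicator {0<..} y * (y * \<gamma> y)) \<partial>lborel) = 1" .
  have h_cont: "continuous_on UNIV h" by (rule DERIV_continuous_on) (rule has_field_derivative_at_within[OF der])
  have [measurable]: "h \<in> borel_measurable borel" by (rule borel_measurable_continuous_onI[OF h_cont])
  have hm: "h (- x) = h x" for x using F(2) by (simp add: h_def even_fun_def)
  define I where "I = (\<integral>\<^sup>+x. ennreal (h x) * indicator {0<..} x \<partial>lborel)"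
  have "(\<integral>\<^sup>+x. ennreal (h x) * indicator {..<0} x \<partial>lborel) = (\<integral>\<^sup>+x. ennreal (h (- x)) * indicator {..<0} (- x) \<partial>lborel)"
    using nn_integral_real_affine[of "\<lambda>x. ennreal (h x) * indicator {..<0} x" "-1" 0] by simp
  also have "\<dots> = I" unfolding hm I_def by (intro nn_integral_cong) (auto split: split_indicator)
  finally have "I + I = (\<integral>\<^sup>+x. ennreal (h x) * indicator {0<..} x + ennreal (h x) * indicator {..<0} x \<partial>lborel)"
    by (subst nn_integral_add) (auto simp: I_def)
  also have "\<dots> \<le> (\<integral>\<^sup>+x. ennreal (h x) \<partial>lborel)"
    by (intro nn_integral_mono) (auto split: split_indicator)
  also have "\<dots> = ennreal (norm_L1 F)"
    using nn_integral_eq_integral[OF F1_integrable[OF F(1)]] F1_nonneg[OF F(1)] by (simp add: F1_norm_L1[OF F(1)] h_def)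
  finally have II: "I + I \<le> ennreal (norm_L1 F)" .
  have "I \<le> ennreal (norm_L1 F / 2)"
  proof (cases I)
    case (real r)
    then show ?thesis using II norm_L1_nonneg[of F] by (simp add: ennreal_plus[symmetric] ennreal_le_iff del: ennreal_plus)
  qed (use II in \<open>simp add: top_unique\<close>)
  moreover have "I = (\<integral>\<^sup>+x. indicator {0<..} x * (\<integral>\<^sup>+y. ennreal (y * \<gamma> y) * indicator {x<..} y \<partial>lborel) \<partial>lborel)"
    unfolding I_def using tail by (intro nn_integral_cong) (auto split: split_indicator)
  moreover have "\<dots> = (\<integral>\<^sup>+y. ennreal (indicator {0<..} y * (y * (y * \<gamma> y))) \<partial>lborel)"
    using g(4) by (intro nn_integral_tail_eq) auto
  ultimately show "(\<integral>\<^sup>+y. ennreal (indicator {0<..} y * (y\<^sup>2 * \<gamma> y)) \<partial>lborel) \<le> ennreal (norm_L1 F / 2)"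
    by (simp add: power2_eq_square mult.assoc)
qed

section \<open>Periodizations as squares of trigonometric polynomials\<close>

lemma summable_inverse_one_plus_sq: "summable (\<lambda>n. 1 / (1 + (real n)\<^sup>2))"
proof (rule summable_comparison_test'[where N = 1])
  show "summable (\<lambda>n. inverse ((real n)\<^sup>2))" using inverse_power_summable[of 2, where 'a = real] by simp
  show "norm (1 / (1 + (real n)\<^sup>2)) \<le> inverse ((real n)\<^sup>2)" if "1 \<le> n" for n
    using that by (auto simp: inverse_eq_divide intro!: divide_left_mono mult_pos_pos add_pos_nonneg)
qed

lemma inverse_one_plus_sq_shift:
  fixes z :: complex and s :: real
  assumes "real n \<le> \<bar>s\<bar>"
  shows "1 / (1 + (cmod (z + of_real s))\<^sup>2) \<le> 2 * (1 + (Re z)\<^sup>2) / (1 + (real n)\<^sup>2)"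
proof -
  have "(real n)\<^sup>2 \<le> s\<^sup>2" using assms by (simp add: abs_le_square_iff[symmetric])
  also have "\<dots> \<le> 2 * (Re z + s)\<^sup>2 + 2 * (Re z)\<^sup>2"
    using zero_le_power2[of "s + 2 * Re z"] by (simp add: power2_eq_square algebra_simps)
  also have "(Re z + s)\<^sup>2 \<le> (cmod (z + of_real s))\<^sup>2" by (simp add: cmod_power2)
  finally have "1 + (real n)\<^sup>2 \<le> 2 * (1 + (cmod (z + of_real s))\<^sup>2) + 2 * (Re z)\<^sup>2" by simp
  also have "\<dots> \<le> 2 * (1 + (Re z)\<^sup>2) * (1 + (cmod (z + of_real s))\<^sup>2)"
    using mult_nonneg_nonneg[OF zero_le_power2[of "Re z"] zero_le_power2[of "cmod (z + of_real s)"]]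
    by (simp add: distrib_left distrib_right)
  finally show ?thesis
    by (simp add: pos_le_divide_eq pos_divide_le_eq add_pos_nonneg mult.commute)
qed

text \<open>The sum of all translates by multiples of \<open>N\<close>, grouped as \<open>n\<close> and \<open>- n - 1\<close>, converges locally uniformly
  by the quadratic decay, is \<open>N\<close>-periodic by telescoping, and inherits the exponential type.\<close>

lemma periodization_trig_poly:
  fixes g :: "complex \<Rightarrow> complex"
  assumes hol: "g holomorphic_on UNIV"
    and bd: "\<And>z. cmod (g z) \<le> D * exp (2 * pi * \<bar>Im z\<bar>) / (1 + (cmod z)\<^sup>2)"
    and N: "N \<ge> 1"
  obtains W where "degree W \<le> 2 * N"
    "\<And>z. (\<lambda>n. g (z + of_real (real n * real N)) + g (z - of_real (real (n + 1) * real N))) sums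
      (poly W (exp (2 * of_real pi * \<i> * (z / of_nat N))) / exp (2 * of_real pi * \<i> * (z / of_nat N)) ^ N)"
proof -
  have D0: "D \<ge> 0" using order_trans[OF norm_ge_zero bd[of 0]] by simp
  define f where "f = (\<lambda>n z. g (z + of_real (real n * real N)) + g (z - of_real (real (n + 1) * real N)))"
  have shift_bound: "cmod (g (z + of_real s)) \<le> 2 * D * (1 + (Re z)\<^sup>2) * exp (2 * pi * \<bar>Im z\<bar>) * (1 / (1 + (real n)\<^sup>2))"
    if "real n \<le> \<bar>s\<bar>" for n z s
  proof -
    have "cmod (g (z + of_real s)) \<le> D * exp (2 * pi * \<bar>Im z\<bar>) * (1 / (1 + (cmod (z + of_real s))\<^sup>2))"
      using bd[of "z + of_real s"] by simp
    also have "\<dots> \<le> D * exp (2 * pi * \<bar>Im z\<bar>) * (2 * (1 + (Re z)\<^sup>2) / (1 + (real n)\<^sup>2))"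
      using D0 by (intro mult_left_mono inverse_one_plus_sq_shift that) auto
    finally show ?thesis by (simp add: mult_ac)
  qed
  have nN: "real n \<le> \<bar>real n * real N\<bar>" "real n \<le> \<bar>- (real (n + 1) * real N)\<bar>" for n
  proof -
    have "real n * 1 \<le> real n * real N" "real n * 1 \<le> real (n + 1) * real N" using N by (intro mult_mono; simp)+
    then show "real n \<le> \<bar>real n * real N\<bar>" "real n \<le> \<bar>- (real (n + 1) * real N)\<bar>" by auto
  qed
  define c where "c = (\<lambda>x y. 4 * D * (1 + x\<^sup>2) * exp (2 * pi * y))"
  have f_bound: "cmod (f n z) \<le> c x y * (1 / (1 + (real n)\<^sup>2))" if "\<bar>Re z\<bar> \<le> x" "\<bar>Im z\<bar> \<le> y" for n z x y
  proof -
    have "cmod (f n z) \<le> cmod (g (z + of_real (real n * real N))) + cmod (g (z + of_real (- (real (n + 1) * real N))))"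
      unfolding f_def by (simp add: norm_triangle_ineq)
    also have "\<dots> \<le> c \<bar>Re z\<bar> \<bar>Im z\<bar> * (1 / (1 + (real n)\<^sup>2))"
      using add_mono[OF shift_bound[OF nN(1)] shift_bound[OF nN(2)], of z n z n] by (simp add: c_def)
    also have "\<dots> \<le> c x y * (1 / (1 + (real n)\<^sup>2))"
    proof (rule mult_right_mono)
      have "(Re z)\<^sup>2 \<le> x\<^sup>2" using that(1) by (simp add: abs_le_square_iff[symmetric])
      then show "c \<bar>Re z\<bar> \<bar>Im z\<bar> \<le> c x y"
        unfolding c_def using that(2) D0 by (intro mult_mono) (auto simp: add_nonneg_nonneg)
    qed (simp add: add_nonneg_nonneg)
    finally show ?thesis .
  qed
  have summ: "summable (\<lambda>n. c x y * (1 / (1 + (real n)\<^sup>2)))" for x y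
    by (intro summable_mult summable_inverse_one_plus_sq)
  define G where "G = (\<lambda>z. \<Sum>n. f n z)"
  have f_summable: "summable (\<lambda>n. f n z)" for z
    by (rule summable_comparison_test'[OF summ[of "\<bar>Re z\<bar>" "\<bar>Im z\<bar>"]]) (rule f_bound, auto)
  have G_sums: "(\<lambda>n. f n z) sums G z" for z unfolding G_def by (rule summable_sums[OF f_summable])
  have G_bound: "cmod (G z) \<le> (\<Sum>n. 1 / (1 + (real n)\<^sup>2)) * c x y" if "\<bar>Re z\<bar> \<le> x" "\<bar>Im z\<bar> \<le> y" for z x y
  proof -
    have "cmod (G z) \<le> (\<Sum>n. c x y * (1 / (1 + (real n)\<^sup>2)))"
      unfolding G_def by (rule norm_suminf_le[OF f_bound[OF that] summ])
    also have "\<dots> = c x y * (\<Sum>n. 1 / (1 + (real n)\<^sup>2))" by (rule suminf_mult[OF summable_inverse_one_plus_sq])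
    finally show ?thesis by (simp add: mult.commute)
  qed
  have shift_hol: "(\<lambda>z. g (z + a)) holomorphic_on UNIV" for a
  proof -
    have "(\<lambda>z. z + a) holomorphic_on UNIV" by (intro holomorphic_intros)
    then show ?thesis using holomorphic_on_compose_gen[OF _ hol, of "\<lambda>z. z + a" UNIV] by (simp add: o_def)
  qed
  have f_hol: "f n holomorphic_on UNIV" for n
    unfolding f_def diff_conv_add_uminus by (intro holomorphic_on_add shift_hol)
  have G_hol: "G holomorphic_on UNIV"
  proof (rule holomorphic_uniform_sequence[of UNIV "\<lambda>n z. \<Sum>i<n. f i z" G])
    show "(\<lambda>z. \<Sum>i<n. f i z) holomorphic_on UNIV" for n by (intro holomorphic_on_sum f_hol)
    fix z0 :: complex
    have "uniform_limit (cball z0 1) (\<lambda>n z. \<Sum>i<n. f i z) (\<lambda>z. \<Sum>i. f i z) sequentially"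
    proof (rule Weierstrass_m_test[OF f_bound summ])
      fix z assume "z \<in> cball z0 1"
      then have "cmod (z - z0) \<le> 1" by (simp add: dist_norm norm_minus_commute)
      then show "\<bar>Re z\<bar> \<le> \<bar>Re z0\<bar> + 1" "\<bar>Im z\<bar> \<le> \<bar>Im z0\<bar> + 1"
        using abs_Re_le_cmod[of "z - z0"] abs_Im_le_cmod[of "z - z0"] by auto
    qed
    then show "\<exists>d>0. cball z0 d \<subseteq> UNIV \<and> uniform_limit (cball z0 d) (\<lambda>n z. \<Sum>i<n. f i z) G sequentially"
      unfolding G_def by (intro exI[of _ 1]) auto
  qed auto
  have G_per: "G (z + of_nat N) = G z" for z
  proof -
    define u where "u = (\<lambda>n. g (z + of_real (real n * real N)) - g (z + of_real (- (real n * real N))))"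
    have "u \<longlonglongrightarrow> 0"
    proof (rule tendsto_norm_zero_cancel, rule tendsto_sandwich[of "\<lambda>_. 0" _ _ "\<lambda>n. c \<bar>Re z\<bar> \<bar>Im z\<bar> * (1 / (1 + (real n)\<^sup>2))"])
      show "\<forall>\<^sub>F n in sequentially. norm (u n) \<le> c \<bar>Re z\<bar> \<bar>Im z\<bar> * (1 / (1 + (real n)\<^sup>2))"
      proof (intro always_eventually allI)
        fix n
        have "norm (u n) \<le> cmod (g (z + of_real (real n * real N))) + cmod (g (z + of_real (- (real n * real N))))"
          unfolding u_def by (rule norm_triangle_ineq4)
        also have "\<dots> \<le> c \<bar>Re z\<bar> \<bar>Im z\<bar> * (1 / (1 + (real n)\<^sup>2))"
          using add_mono[OF shift_bound[OF nN(1)] shift_bound[of n "- (real n * real N)"], of z n z] nN(1)[of n] by (simp add: c_def)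
        finally show "norm (u n) \<le> c \<bar>Re z\<bar> \<bar>Im z\<bar> * (1 / (1 + (real n)\<^sup>2))" .
      qed
      show "(\<lambda>n. c \<bar>Re z\<bar> \<bar>Im z\<bar> * (1 / (1 + (real n)\<^sup>2))) \<longlonglongrightarrow> 0" by (rule summable_LIMSEQ_zero[OF summ])
    qed auto
    from telescope_sums[OF this] have "(\<lambda>n. u (Suc n) - u n) sums 0" by (simp add: u_def)
    moreover have "u (Suc n) - u n = f n (z + of_nat N) - f n z" for n
    proof -
      have eqs: "z + of_nat N + of_real (real n * real N) = z + of_real (real (Suc n) * real N)"
        "z + of_nat N - of_real (real (n + 1) * real N) = z + of_real (- (real n * real N))"
        "z - of_real (real (n + 1) * real N) = z + of_real (- (real (Suc n) * real N))"
        by (simp_all add: algebra_simps)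
      have "a - b - (c - d) = a + d - (c + b)" for a b c d :: complex by simp
      then show ?thesis unfolding u_def f_def eqs .
    qed
    ultimately have "(\<lambda>n. f n (z + of_nat N) - f n z) sums 0" by simp
    with sums_diff[OF G_sums[of "z + of_nat N"] G_sums[of z]] show ?thesis
      using sums_unique2 by fastforce
  qed
  define H where "H = (\<lambda>z. G (of_nat N * z))"
  have N0: "(of_nat N :: complex) \<noteq> 0" using N by simp
  have H_hol: "H holomorphic_on UNIV"
    unfolding H_def using holomorphic_on_compose_gen[OF _ G_hol, of "\<lambda>z. of_nat N * z" UNIV]
    by (auto simp: o_def intro!: holomorphic_intros)
  have H_per: "H (z + 1) = H z" for z using G_per[of "of_nat N * z"] by (simp add: H_def distrib_left)
  define C where "C = (\<Sum>n. 1 / (1 + (real n)\<^sup>2)) * (4 * D * (1 + (real N)\<^sup>2))"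
  have H_bound: "cmod (H z) \<le> C * exp (2 * pi * real N * \<bar>Im z\<bar>)" for z
  proof -
    define w where "w = z - of_int \<lfloor>Re z\<rfloor>"
    have "H z = H w" using periodic_of_int[of H w "\<lfloor>Re z\<rfloor>", OF H_per] by (simp add: w_def)
    moreover have "cmod (H w) \<le> (\<Sum>n. 1 / (1 + (real n)\<^sup>2)) * c (real N) (real N * \<bar>Im z\<bar>)"
      unfolding H_def
    proof (rule G_bound)
      have "0 \<le> Re w" by (simp add: w_def)
      moreover have "Re w = Re z - of_int \<lfloor>Re z\<rfloor>" by (simp add: w_def)
      then have "Re w \<le> 1" by linarith
      ultimately show "\<bar>Re (of_nat N * w)\<bar> \<le> real N" by (simp add: abs_mult mult_left_le)
      show "\<bar>Im (of_nat N * w)\<bar> \<le> real N * \<bar>Im z\<bar>" by (simp add: abs_mult w_def)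
    qed
    ultimately show ?thesis by (simp add: C_def c_def mult_ac)
  qed
  obtain W where W: "degree W \<le> 2 * N" "\<And>z. H z = poly W (exp (2 * of_real pi * \<i> * z)) / exp (2 * of_real pi * \<i> * z) ^ N"
    using periodic_exponential_type_trig_poly[OF H_hol H_per H_bound] by blast
  show thesis
  proof (rule that[OF W(1)])
    fix z
    have "H (z / of_nat N) = G z" using N0 by (simp add: H_def)
    then show "(\<lambda>n. g (z + of_real (real n * real N)) + g (z - of_real (real (n + 1) * real N))) sums
      (poly W (exp (2 * of_real pi * \<i> * (z / of_nat N))) / exp (2 * of_real pi * \<i> * (z / of_nat N)) ^ N)"
      using G_sums[of z] unfolding W(2) f_def by simp
  qed
qed

text \<open>The periodization is a nonnegative trigonometric polynomial. Adding \<open>\<epsilon>\<close> makes it positive, and the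
  Fejer-Riesz theorem turns it into a square. Shifting the \<open>N + 1\<close> frequencies \<open>2 \<pi> k / N\<close> by
  \<open>- \<pi>\<close> does not change the modulus and makes them symmetric: this is where type \<open>2 \<pi>\<close> of the
  function becomes type \<open>\<pi>\<close> of its square root.\<close>

lemma periodization_square:
  fixes g :: "complex \<Rightarrow> complex"
  assumes hol: "g holomorphic_on UNIV"
    and bd: "\<And>z. cmod (g z) \<le> D * exp (2 * pi * \<bar>Im z\<bar>) / (1 + (cmod z)\<^sup>2)"
    and g: "\<And>x::real. g (of_real x) = of_real (\<gamma> x)" "\<And>x. \<gamma> x \<ge> 0"
    and N: "N \<ge> 1" and "\<epsilon> > 0"
  obtains b a where "\<And>k. k \<le> N \<Longrightarrow> \<bar>a k\<bar> \<le> pi"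
    "\<And>x. (\<lambda>n. \<gamma> (x + real n * real N) + \<gamma> (x - real (n + 1) * real N)) sums
      ((cmod (\<Sum>k\<le>N. b k * cis (a k * x)))\<^sup>2 - \<epsilon>)"
proof -
  obtain W where W: "degree W \<le> 2 * N"
    "\<And>z. (\<lambda>n. g (z + of_real (real n * real N)) + g (z - of_real (real (n + 1) * real N))) sums
      (poly W (exp (2 * of_real pi * \<i> * (z / of_nat N))) / exp (2 * of_real pi * \<i> * (z / of_nat N)) ^ N)"
    using periodization_trig_poly[OF hol bd N] by blast
  define \<delta> where "\<delta> = 2 * pi / real N"
  have N0: "real N > 0" using N by simp
  have w_eq: "exp (2 * of_real pi * \<i> * (of_real x / of_nat N)) = cis (\<delta> * x)" for x :: real
    unfolding cis_conv_exp \<delta>_def by (simp add: mult_ac)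
  define \<Gamma> where "\<Gamma> = (\<lambda>x. \<Sum>n. \<gamma> (x + real n * real N) + \<gamma> (x - real (n + 1) * real N))"
  have sums: "(\<lambda>n. \<gamma> (x + real n * real N) + \<gamma> (x - real (n + 1) * real N)) sums \<Gamma> x
      \<and> poly W (cis (\<delta> * x)) / cis (\<delta> * x) ^ N = of_real (\<Gamma> x)" for x
  proof -
    have s: "(\<lambda>n. complex_of_real (\<gamma> (x + real n * real N) + \<gamma> (x - real (n + 1) * real N))) sums
       (poly W (cis (\<delta> * x)) / cis (\<delta> * x) ^ N)"
      using W(2)[of "of_real x"] unfolding w_eq of_real_add[symmetric] of_real_diff[symmetric] g(1) .
    have r: "(\<lambda>n. \<gamma> (x + real n * real N) + \<gamma> (x - real (n + 1) * real N)) sums Re (poly W (cis (\<delta> * x)) / cis (\<delta> * x) ^ N)"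
      using sums_Re[OF s] by (simp only: Re_complex_of_real)
    then have \<Gamma>: "\<Gamma> x = Re (poly W (cis (\<delta> * x)) / cis (\<delta> * x) ^ N)" unfolding \<Gamma>_def by (rule sums_unique[symmetric])
    have "poly W (cis (\<delta> * x)) / cis (\<delta> * x) ^ N = of_real (\<Gamma> x)"
      using s sums_of_real[OF r, where 'a = complex] unfolding \<Gamma> by (rule sums_unique2)
    with r show ?thesis unfolding \<Gamma>[symmetric] by (rule conjI)
  qed
  have \<Gamma>0: "\<Gamma> x \<ge> 0" for x unfolding \<Gamma>_def using sums[of x] g(2) by (intro suminf_nonneg) (auto simp: sums_iff)
  define W' where "W' = W + monom (of_real \<epsilon>) N"
  have W': "poly W' (cis (\<delta> * x)) / cis (\<delta> * x) ^ N = of_real (\<Gamma> x + \<epsilon>)" for x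
    using sums[of x] by (simp add: W'_def poly_monom add_divide_distrib)
  have "degree W' \<le> 2 * N" unfolding W'_def using W(1) by (intro degree_add_le order_trans[OF degree_monom_le]) auto
  moreover have "\<exists>r>0. poly W' w / w ^ N = of_real r" if "cmod w = 1" for w
  proof -
    have "w = cis (\<delta> * (Arg w / \<delta>))"
      using that N0 by (simp add: \<delta>_def complex_norm_eq_1_exp_eq cis_conv_exp)
    then show ?thesis using W'[of "Arg w / \<delta>"] \<Gamma>0[of "Arg w / \<delta>"] \<open>\<epsilon> > 0\<close> by (metis add_nonneg_pos)
  qed
  ultimately obtain H where H: "degree H \<le> N" "\<And>w. cmod w = 1 \<Longrightarrow> poly W' w / w ^ N = of_real ((cmod (poly H w))\<^sup>2)"
    using fejer_riesz[of W' N] by auto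
  define a where "a = (\<lambda>k. (real k - real N / 2) * \<delta>)"
  show thesis
  proof (rule that[of a "coeff H"])
    fix k assume "k \<le> N"
    then have "real k \<le> real N" by simp
    then have "\<bar>real k - real N / 2\<bar> \<le> real N / 2" by (simp only: abs_le_iff) linarith
    then have "\<bar>real k - real N / 2\<bar> * \<delta> \<le> real N / 2 * \<delta>" using N0 by (intro mult_right_mono) (auto simp: \<delta>_def)
    moreover have "\<delta> > 0" "real N / 2 * \<delta> = pi" using N0 by (auto simp: \<delta>_def)
    ultimately show "\<bar>a k\<bar> \<le> pi" by (simp only: a_def abs_mult abs_of_pos)
  next
    fix x
    have "poly H (cis (\<delta> * x)) = (\<Sum>k\<le>N. coeff H k * cis (\<delta> * x) ^ k)"
      unfolding poly_altdef using H(1) by (intro sum.mono_neutral_left) (auto simp: coeff_eq_0)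
    also have "\<dots> = cis (real N / 2 * \<delta> * x) * (\<Sum>k\<le>N. coeff H k * cis (a k * x))"
      unfolding sum_distrib_left
    proof (intro sum.cong refl)
      fix k
      have "cis (\<delta> * x) ^ k = cis (real N / 2 * \<delta> * x) * cis (a k * x)"
        by (simp add: Complex.DeMoivre cis_mult a_def algebra_simps)
      then show "coeff H k * cis (\<delta> * x) ^ k = cis (real N / 2 * \<delta> * x) * (coeff H k * cis (a k * x))" by simp
    qed
    finally have "cmod (poly H (cis (\<delta> * x))) = cmod (\<Sum>k\<le>N. coeff H k * cis (a k * x))" by (simp add: norm_mult)
    moreover have "of_real (\<Gamma> x + \<epsilon>) = complex_of_real ((cmod (poly H (cis (\<delta> * x))))\<^sup>2)"
      using W'[of x] H(2)[of "cis (\<delta> * x)"] by simp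
    ultimately have "\<Gamma> x = (cmod (\<Sum>k\<le>N. coeff H k * cis (a k * x)))\<^sup>2 - \<epsilon>" by (simp only: of_real_eq_iff)
    then show "(\<lambda>n. \<gamma> (x + real n * real N) + \<gamma> (x - real (n + 1) * real N)) sums
      ((cmod (\<Sum>k\<le>N. coeff H k * cis (a k * x)))\<^sup>2 - \<epsilon>)" using sums[of x] by simp
  qed
qed

section \<open>The moment inequality and the lower bound\<close>

text \<open>Multiplication by \<open>sin\<^sup>2 (\<delta> x / 2)\<close> splits each frequency \<open>a\<close> into \<open>a\<close> and \<open>a \<plusminus> \<delta>\<close>, with weights
  \<open>1/2\<close> and \<open>- 1/4\<close> twice. These weights enforce both moment conditions, whatever the coefficients are.\<close>

lemma windowed_trig_sum_inequality:
  fixes e a :: "nat \<Rightarrow> real" and f :: "real \<Rightarrow> real"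
  assumes a: "\<And>k. k \<le> N \<Longrightarrow> \<bar>a k\<bar> \<le> pi" and "\<delta> > 0"
    and f: "f = (\<lambda>x. \<Sum>k\<le>N. e k * cos (a k * x)) \<or> f = (\<lambda>x. \<Sum>k\<le>N. e k * sin (a k * x))"
  shows "(\<integral>\<^sup>+x. ennreal (indicator {0<..} x * ((f x * (sin (\<delta> / 2 * x))\<^sup>2)\<^sup>2 / x ^ 3)) \<partial>lborel)
     \<le> ennreal (3137 / 2000 / pi * (pi + \<delta>))
        * (\<integral>\<^sup>+x. ennreal (indicator {0<..} x * ((f x * (sin (\<delta> / 2 * x))\<^sup>2)\<^sup>2 / x\<^sup>2)) \<partial>lborel)"
proof (rule trig_sum_inequality)
  define J where "J = {..N} \<times> {0, 1, 2 :: nat}"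
  define c where "c = (\<lambda>m::nat. if m = 0 then 1 / 2 else - 1 / 4 :: real)"
  define s where "s = (\<lambda>m::nat. if m = 0 then 0 else if m = 1 then \<delta> else - \<delta>)"
  define e' where "e' = (\<lambda>(k, m). e k * c m)"
  define a' where "a' = (\<lambda>(k, m). a k + s m)"
  show "finite J" by (simp add: J_def)
  show "pi + \<delta> > 0" using \<open>\<delta> > 0\<close> by (simp add: add_pos_pos)
  show "\<bar>a' j\<bar> \<le> pi + \<delta>" if "j \<in> J" for j
    using that a \<open>\<delta> > 0\<close> by (fastforce simp: J_def a'_def s_def)
  have over_J: "(\<Sum>j\<in>J. h j) = (\<Sum>k\<le>N. h (k, 0) + h (k, 1) + h (k, 2))" for h :: "nat \<times> nat \<Rightarrow> real"
    unfolding J_def using sum.cartesian_product[of "\<lambda>k m. h (k, m)" "{0, 1, 2}" "{..N}"] by (simp add: add.assoc)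
  have sin_sq: "(sin (\<delta> / 2 * x))\<^sup>2 = (1 - cos (\<delta> * x)) / 2" for x
    using cos_double_sin[of "\<delta> / 2 * x"] by simp
  have zero: "(\<Sum>j\<in>J. e' j) = 0" "(\<Sum>j\<in>J. e' j * a' j) = 0"
    unfolding over_J by (auto intro!: sum.neutral simp: e'_def a'_def c_def s_def field_simps)
  have expand: "u * v * ((1 - d) / 2) = u * (1 / 2) * v + u * (- 1 / 4) * v1 + u * (- 1 / 4) * v2" if "v1 + v2 = 2 * v * d" for u v d v1 v2 :: real
  proof -
    have v2: "v2 = 2 * v * d - v1" using that by simp
    show ?thesis unfolding v2 by (simp add: field_simps)
  qed
  have cos_eq: "e k * cos (a k * x) * (sin (\<delta> / 2 * x))\<^sup>2 = e' (k, 0) * cos (a' (k, 0) * x) + e' (k, 1) * cos (a' (k, 1) * x) + e' (k, 2) * cos (a' (k, 2) * x)" for k x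
  proof -
    have "cos ((a k + \<delta>) * x) + cos ((a k - \<delta>) * x) = 2 * cos (a k * x) * cos (\<delta> * x)"
      by (simp add: distrib_right left_diff_distrib cos_add cos_diff)
    from expand[OF this, of "e k"] show ?thesis unfolding sin_sq by (simp add: e'_def a'_def c_def s_def)
  qed
  have sin_eq: "e k * sin (a k * x) * (sin (\<delta> / 2 * x))\<^sup>2 = e' (k, 0) * sin (a' (k, 0) * x) + e' (k, 1) * sin (a' (k, 1) * x) + e' (k, 2) * sin (a' (k, 2) * x)" for k x
  proof -
    have "sin ((a k + \<delta>) * x) + sin ((a k - \<delta>) * x) = 2 * sin (a k * x) * cos (\<delta> * x)"
      by (simp add: distrib_right left_diff_distrib sin_add sin_diff)
    from expand[OF this, of "e k"] show ?thesis unfolding sin_sq by (simp add: e'_def a'_def c_def s_def)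
  qed
  show "((\<lambda>x. f x * (sin (\<delta> / 2 * x))\<^sup>2) = (\<lambda>x. \<Sum>j\<in>J. e' j * cos (a' j * x)) \<and> (\<Sum>j\<in>J. e' j) = 0)
      \<or> ((\<lambda>x. f x * (sin (\<delta> / 2 * x))\<^sup>2) = (\<lambda>x. \<Sum>j\<in>J. e' j * sin (a' j * x)) \<and> (\<Sum>j\<in>J. e' j * a' j) = 0)"
    using f
  proof
    assume "f = (\<lambda>x. \<Sum>k\<le>N. e k * cos (a k * x))"
    then show ?thesis using zero(1) by (intro disjI1 conjI ext) (simp_all only: over_J sum_distrib_right cos_eq)
  next
    assume "f = (\<lambda>x. \<Sum>k\<le>N. e k * sin (a k * x))"
    then show ?thesis using zero(2) by (intro disjI2 conjI ext) (simp_all only: over_J sum_distrib_right sin_eq)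
  qed
qed

text \<open>With \<open>b\<^sub>k = \<alpha>\<^sub>k + \<i> \<beta>\<^sub>k\<close> the mixed products of even and odd sums cancel between \<open>x\<close> and \<open>- x\<close>, so that
  the real inequality for cosine or sine sums applies to each of the four squares.\<close>

lemma cmod_sq_trig_poly_even:
  fixes b :: "nat \<Rightarrow> complex"
  shows "(cmod (\<Sum>k\<le>N. b k * cis (a k * x)))\<^sup>2 + (cmod (\<Sum>k\<le>N. b k * cis (a k * (- x))))\<^sup>2
    = 2 * ((\<Sum>k\<le>N. Re (b k) * cos (a k * x))\<^sup>2 + (\<Sum>k\<le>N. Im (b k) * sin (a k * x))\<^sup>2
      + (\<Sum>k\<le>N. Re (b k) * sin (a k * x))\<^sup>2 + (\<Sum>k\<le>N. Im (b k) * cos (a k * x))\<^sup>2)"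
  unfolding cmod_power2
  by (simp add: sum.distrib sum_subtractf sum_negf power2_eq_square algebra_simps)

lemma nn_integral_add4:
  fixes f1 f2 f3 f4 :: "real \<Rightarrow> real"
  assumes [measurable]: "f1 \<in> borel_measurable borel" "f2 \<in> borel_measurable borel" "f3 \<in> borel_measurable borel" "f4 \<in> borel_measurable borel"
    and nn: "\<And>x. 0 \<le> f1 x" "\<And>x. 0 \<le> f2 x" "\<And>x. 0 \<le> f3 x" "\<And>x. 0 \<le> f4 x"
  shows "(\<integral>\<^sup>+x. ennreal (f1 x + f2 x + f3 x + f4 x) \<partial>lborel) =
    (\<integral>\<^sup>+x. ennreal (f1 x) \<partial>lborel) + (\<integral>\<^sup>+x. ennreal (f2 x) \<partial>lborel) + (\<integral>\<^sup>+x. ennreal (f3 x) \<partial>lborel) + (\<integral>\<^sup>+x. ennreal (f4 x) \<partial>lborel)"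
  using nn by (simp add: nn_integral_add[symmetric])

lemma square_trig_poly_inequality:
  fixes b :: "nat \<Rightarrow> complex" and a :: "nat \<Rightarrow> real"
  assumes a: "\<And>k. k \<le> N \<Longrightarrow> \<bar>a k\<bar> \<le> pi" and "\<delta> > 0"
  defines "Q \<equiv> \<lambda>x. (cmod (\<Sum>k\<le>N. b k * cis (a k * x)))\<^sup>2 + (cmod (\<Sum>k\<le>N. b k * cis (a k * (- x))))\<^sup>2"
  shows "(\<integral>\<^sup>+x. ennreal (indicator {0<..} x * (Q x * (sin (\<delta> / 2 * x)) ^ 4 / x ^ 3)) \<partial>lborel)
     \<le> ennreal (3137 / 2000 / pi * (pi + \<delta>))
        * (\<integral>\<^sup>+x. ennreal (indicator {0<..} x * (Q x * (sin (\<delta> / 2 * x)) ^ 4 / x\<^sup>2)) \<partial>lborel)"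
proof -
  define f1 where "f1 = (\<lambda>x. \<Sum>k\<le>N. Re (b k) * cos (a k * x))"
  define f2 where "f2 = (\<lambda>x. \<Sum>k\<le>N. Im (b k) * sin (a k * x))"
  define f3 where "f3 = (\<lambda>x. \<Sum>k\<le>N. Re (b k) * sin (a k * x))"
  define f4 where "f4 = (\<lambda>x. \<Sum>k\<le>N. Im (b k) * cos (a k * x))"
  define t where "t = (\<lambda>f x. (f x * (sin (\<delta> / 2 * x))\<^sup>2)\<^sup>2 :: real)"
  define w where "w = (\<lambda>(p::nat) f x. indicator {0<..} x * (t f x / x ^ p) :: real)"
  have [measurable]: "f1 \<in> borel_measurable borel" "f2 \<in> borel_measurable borel" "f3 \<in> borel_measurable borel" "f4 \<in> borel_measurable borel"
    unfolding f1_def f2_def f3_def f4_def by measurable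
  have [measurable]: "w p f \<in> borel_measurable borel" if [measurable]: "f \<in> borel_measurable borel" for f p
    unfolding w_def t_def by measurable
  have w0: "0 \<le> w p f x" for p f x by (auto simp: w_def t_def split: split_indicator)
  have split: "(\<integral>\<^sup>+x. ennreal (indicator {0<..} x * (Q x * (sin (\<delta> / 2 * x)) ^ 4 / x ^ p)) \<partial>lborel)
    = 2 * ((\<integral>\<^sup>+x. ennreal (w p f1 x) \<partial>lborel) + (\<integral>\<^sup>+x. ennreal (w p f2 x) \<partial>lborel)
       + (\<integral>\<^sup>+x. ennreal (w p f3 x) \<partial>lborel) + (\<integral>\<^sup>+x. ennreal (w p f4 x) \<partial>lborel))" for p
  proof -
    have Q: "Q x = 2 * ((f1 x)\<^sup>2 + (f2 x)\<^sup>2 + (f3 x)\<^sup>2 + (f4 x)\<^sup>2)" for x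
      unfolding Q_def f1_def f2_def f3_def f4_def by (rule cmod_sq_trig_poly_even)
    have "(\<integral>\<^sup>+x. ennreal (indicator {0<..} x * (Q x * (sin (\<delta> / 2 * x)) ^ 4 / x ^ p)) \<partial>lborel)
      = (\<integral>\<^sup>+x. 2 * ennreal (w p f1 x + w p f2 x + w p f3 x + w p f4 x) \<partial>lborel)"
    proof (rule nn_integral_cong)
      fix x
      have "indicator {0<..} x * (Q x * (sin (\<delta> / 2 * x)) ^ 4 / x ^ p) = 2 * (w p f1 x + w p f2 x + w p f3 x + w p f4 x)"
        unfolding Q w_def t_def power_mult_distrib power_mult[symmetric]
        by (auto simp: add_divide_distrib algebra_simps split: split_indicator)
      then show "ennreal (indicator {0<..} x * (Q x * (sin (\<delta> / 2 * x)) ^ 4 / x ^ p)) = 2 * ennreal (w p f1 x + w p f2 x + w p f3 x + w p f4 x)"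
        using w0 by (simp add: ennreal_mult')
    qed
    also have "\<dots> = 2 * (\<integral>\<^sup>+x. ennreal (w p f1 x + w p f2 x + w p f3 x + w p f4 x) \<partial>lborel)"
      by (intro nn_integral_cmult) measurable
    also have "(\<integral>\<^sup>+x. ennreal (w p f1 x + w p f2 x + w p f3 x + w p f4 x) \<partial>lborel) =
        (\<integral>\<^sup>+x. ennreal (w p f1 x) \<partial>lborel) + (\<integral>\<^sup>+x. ennreal (w p f2 x) \<partial>lborel)
       + (\<integral>\<^sup>+x. ennreal (w p f3 x) \<partial>lborel) + (\<integral>\<^sup>+x. ennreal (w p f4 x) \<partial>lborel)"
      by (intro nn_integral_add4 w0) measurable
    finally show ?thesis .
  qed
  have ineq: "(\<integral>\<^sup>+x. ennreal (w 3 f x) \<partial>lborel) \<le> ennreal (3137 / 2000 / pi * (pi + \<delta>)) * (\<integral>\<^sup>+x. ennreal (w 2 f x) \<partial>lborel)"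
    if "f = (\<lambda>x. \<Sum>k\<le>N. e k * cos (a k * x)) \<or> f = (\<lambda>x. \<Sum>k\<le>N. e k * sin (a k * x))" for f e
    using windowed_trig_sum_inequality[OF a \<open>\<delta> > 0\<close> that] unfolding w_def t_def .
  define c where "c = ennreal (3137 / 2000 / pi * (pi + \<delta>))"
  have "(\<integral>\<^sup>+x. ennreal (w 3 f x) \<partial>lborel) \<le> c * (\<integral>\<^sup>+x. ennreal (w 2 f x) \<partial>lborel)" if "f \<in> {f1, f2, f3, f4}" for f
    using that ineq[of f1 "\<lambda>k. Re (b k)"] ineq[of f2 "\<lambda>k. Im (b k)"] ineq[of f3 "\<lambda>k. Re (b k)"] ineq[of f4 "\<lambda>k. Im (b k)"]
    unfolding c_def[symmetric] f1_def[symmetric] f2_def[symmetric] f3_def[symmetric] f4_def[symmetric] by blast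
  then have le: "(\<integral>\<^sup>+x. ennreal (w 3 f1 x) \<partial>lborel) \<le> c * (\<integral>\<^sup>+x. ennreal (w 2 f1 x) \<partial>lborel)"
      "(\<integral>\<^sup>+x. ennreal (w 3 f2 x) \<partial>lborel) \<le> c * (\<integral>\<^sup>+x. ennreal (w 2 f2 x) \<partial>lborel)"
      "(\<integral>\<^sup>+x. ennreal (w 3 f3 x) \<partial>lborel) \<le> c * (\<integral>\<^sup>+x. ennreal (w 2 f3 x) \<partial>lborel)"
      "(\<integral>\<^sup>+x. ennreal (w 3 f4 x) \<partial>lborel) \<le> c * (\<integral>\<^sup>+x. ennreal (w 2 f4 x) \<partial>lborel)"
    by blast+
  have "2 * (i1 + i2 + i3 + i4) \<le> c * (2 * (j1 + j2 + j3 + j4))"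
    if "i1 \<le> c * j1" "i2 \<le> c * j2" "i3 \<le> c * j3" "i4 \<le> c * j4" for i1 i2 i3 i4 j1 j2 j3 j4 :: ennreal
  proof -
    have "i1 + i2 + i3 + i4 \<le> c * j1 + c * j2 + c * j3 + c * j4" by (intro add_mono that)
    then have "2 * (i1 + i2 + i3 + i4) \<le> 2 * (c * j1 + c * j2 + c * j3 + c * j4)" by (rule mult_left_mono) simp
    also have "\<dots> = c * (2 * (j1 + j2 + j3 + j4))" by (simp only: distrib_left mult.left_commute[of c 2])
    finally show ?thesis .
  qed
  from this[OF le] show ?thesis unfolding split c_def .
qed

lemma nn_integral_two_sided:
  fixes f :: "real \<Rightarrow> real"
  assumes [measurable]: "f \<in> borel_measurable borel" and nn: "\<And>x. 0 \<le> f x"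
  shows "(\<integral>\<^sup>+x. ennreal (indicator {0<..} x * (f x + f (- x))) \<partial>lborel) = (\<integral>\<^sup>+x. ennreal (f x) \<partial>lborel)"
proof -
  have "(\<integral>\<^sup>+x. ennreal (f x) * indicator {..<0} x \<partial>lborel) = (\<integral>\<^sup>+x. ennreal (f (- x)) * indicator {..<0} (- x) \<partial>lborel)"
    using nn_integral_real_affine[of "\<lambda>x. ennreal (f x) * indicator {..<0} x" "-1" 0] by simp
  also have "\<dots> = (\<integral>\<^sup>+x. ennreal (f (- x)) * indicator {0<..} x \<partial>lborel)"
    by (intro nn_integral_cong) (auto split: split_indicator)
  finally have refl: "(\<integral>\<^sup>+x. ennreal (f x) * indicator {..<0} x \<partial>lborel) = (\<integral>\<^sup>+x. ennreal (f (- x)) * indicator {0<..} x \<partial>lborel)" .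
  have "(\<integral>\<^sup>+x. ennreal (indicator {0<..} x * (f x + f (- x))) \<partial>lborel)
    = (\<integral>\<^sup>+x. ennreal (f x) * indicator {0<..} x + ennreal (f (- x)) * indicator {0<..} x \<partial>lborel)"
    using nn by (intro nn_integral_cong) (auto split: split_indicator)
  also have "\<dots> = (\<integral>\<^sup>+x. ennreal (f x) * indicator {0<..} x \<partial>lborel) + (\<integral>\<^sup>+x. ennreal (f x) * indicator {..<0} x \<partial>lborel)"
    unfolding refl by (intro nn_integral_add) measurable
  also have "\<dots> = (\<integral>\<^sup>+x. ennreal (f x) * indicator {0<..} x + ennreal (f x) * indicator {..<0} x \<partial>lborel)"
    by (intro nn_integral_add[symmetric]) measurable
  also have "\<dots> = (\<integral>\<^sup>+x. ennreal (f x) \<partial>lborel)"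
    by (intro nn_integral_cong_AE) (use AE_lborel_singleton[of 0] in \<open>eventually_elim, auto split: split_indicator\<close>)
  finally show ?thesis .
qed

text \<open>The window \<open>sin\<^sup>4\<close> has period \<open>N\<close>, so the sum over the translates can be moved onto \<open>1 / x\<^sup>2\<close>. There it is at most
  \<open>(\<pi> / N)\<^sup>2 / sin\<^sup>2 (\<pi> x / N)\<close>, and two of the four sines remain, each at most its argument.\<close>

lemma nn_integral_periodization_le:
  fixes \<gamma> \<Gamma> :: "real \<Rightarrow> real"
  assumes [measurable]: "\<gamma> \<in> borel_measurable borel" and nn: "\<And>x. 0 \<le> \<gamma> x"
    and N: "N \<ge> (1::nat)"
    and \<Gamma>: "\<And>x. (\<lambda>n. \<gamma> (x + real n * real N) + \<gamma> (x - real (n + 1) * real N)) sums \<Gamma> x"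
  shows "(\<integral>\<^sup>+x. ennreal (\<Gamma> x * sin (pi / N * x) ^ 4 / x\<^sup>2) \<partial>lborel) \<le> ennreal ((pi / N) ^ 4) * (\<integral>\<^sup>+x. ennreal (x\<^sup>2 * \<gamma> x) \<partial>lborel)"
proof -
  define p where "p = pi / real N"
  have p0: "p > 0" using N by (simp add: p_def)
  have pN: "p * real N = pi" using N by (simp add: p_def)
  define \<phi> where "\<phi> = (\<lambda>x. sin (p * x) ^ 4)"
  have \<phi>0: "\<phi> x \<ge> 0" for x by (simp add: \<phi>_def)
  have [measurable]: "\<phi> \<in> borel_measurable borel" unfolding \<phi>_def by measurable
  have per: "\<phi> (x + real n * real N) = \<phi> x" for x n
  proof -
    have "p * (x + real n * real N) = p * x + real n * pi" using pN by (simp add: distrib_left mult.left_commute)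
    then have "sin (p * (x + real n * real N)) = sin (p * x) * cos (real n * pi)" by (simp add: sin_add sin_npi)
    moreover have "cos (real n * pi) ^ 4 = 1" using cos_npi[of n] by (simp flip: power_mult)
    ultimately show ?thesis by (simp add: \<phi>_def power_mult_distrib)
  qed
  have per': "\<phi> (x - real n * real N) = \<phi> x" for x n using per[of "x - real n * real N" n] by simp
  define q where "q = (\<lambda>n x. \<gamma> x * \<phi> x * (1 / (x - real n * real N)\<^sup>2 + 1 / (x + real (n + 1) * real N)\<^sup>2))"
  have q0: "q n x \<ge> 0" for n x using nn \<phi>0 by (simp add: q_def)
  have [measurable]: "q n \<in> borel_measurable borel" for n unfolding q_def by measurable
  have shift: "(\<integral>\<^sup>+x. ennreal (\<gamma> (x + s) * \<phi> x / x\<^sup>2) \<partial>lborel) = (\<integral>\<^sup>+x. ennreal (\<gamma> x * \<phi> (x - s) / (x - s)\<^sup>2) \<partial>lborel)" for s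
    using nn_integral_real_affine[of "\<lambda>x. ennreal (\<gamma> (x + s) * \<phi> x / x\<^sup>2)" 1 "- s"] by simp
  have "(\<integral>\<^sup>+x. ennreal (\<Gamma> x * \<phi> x / x\<^sup>2) \<partial>lborel)
    = (\<integral>\<^sup>+x. (\<Sum>n. ennreal (\<gamma> (x + real n * real N) * \<phi> x / x\<^sup>2) + ennreal (\<gamma> (x - real (n + 1) * real N) * \<phi> x / x\<^sup>2)) \<partial>lborel)"
  proof (rule nn_integral_cong)
    fix x
    have "(\<lambda>n. (\<gamma> (x + real n * real N) + \<gamma> (x - real (n + 1) * real N)) * (\<phi> x / x\<^sup>2)) sums (\<Gamma> x * (\<phi> x / x\<^sup>2))"
      by (rule sums_mult2[OF \<Gamma>])
    then have "(\<Sum>n. ennreal ((\<gamma> (x + real n * real N) + \<gamma> (x - real (n + 1) * real N)) * (\<phi> x / x\<^sup>2))) = ennreal (\<Gamma> x * (\<phi> x / x\<^sup>2))"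
      using nn \<phi>0 by (intro suminf_ennreal_eq) auto
    moreover have "ennreal ((\<gamma> (x + real n * real N) + \<gamma> (x - real (n + 1) * real N)) * (\<phi> x / x\<^sup>2))
      = ennreal (\<gamma> (x + real n * real N) * \<phi> x / x\<^sup>2) + ennreal (\<gamma> (x - real (n + 1) * real N) * \<phi> x / x\<^sup>2)" for n
      using nn \<phi>0 by (simp add: ennreal_plus[symmetric] distrib_right add_divide_distrib del: ennreal_plus)
    ultimately show "ennreal (\<Gamma> x * \<phi> x / x\<^sup>2) = (\<Sum>n. ennreal (\<gamma> (x + real n * real N) * \<phi> x / x\<^sup>2) + ennreal (\<gamma> (x - real (n + 1) * real N) * \<phi> x / x\<^sup>2))"
      by simp
  qed
  also have "\<dots> = (\<Sum>n. \<integral>\<^sup>+x. ennreal (\<gamma> (x + real n * real N) * \<phi> x / x\<^sup>2) + ennreal (\<gamma> (x - real (n + 1) * real N) * \<phi> x / x\<^sup>2) \<partial>lborel)"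
    by (intro nn_integral_suminf) measurable
  also have "\<dots> = (\<Sum>n. \<integral>\<^sup>+x. ennreal (q n x) \<partial>lborel)"
  proof (rule suminf_cong)
    fix n
    have "(\<integral>\<^sup>+x. ennreal (\<gamma> (x + real n * real N) * \<phi> x / x\<^sup>2) + ennreal (\<gamma> (x - real (n + 1) * real N) * \<phi> x / x\<^sup>2) \<partial>lborel)
      = (\<integral>\<^sup>+x. ennreal (\<gamma> (x + real n * real N) * \<phi> x / x\<^sup>2) \<partial>lborel) + (\<integral>\<^sup>+x. ennreal (\<gamma> (x + (- (real (n + 1) * real N))) * \<phi> x / x\<^sup>2) \<partial>lborel)"
      by (subst nn_integral_add) simp_all
    also have "\<dots> = (\<integral>\<^sup>+x. ennreal (\<gamma> x * \<phi> x / (x - real n * real N)\<^sup>2) \<partial>lborel) + (\<integral>\<^sup>+x. ennreal (\<gamma> x * \<phi> x / (x + real (n + 1) * real N)\<^sup>2) \<partial>lborel)"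
      unfolding shift using per' per[of _ "n + 1"] by simp
    also have "\<dots> = (\<integral>\<^sup>+x. ennreal (\<gamma> x * \<phi> x / (x - real n * real N)\<^sup>2) + ennreal (\<gamma> x * \<phi> x / (x + real (n + 1) * real N)\<^sup>2) \<partial>lborel)"
      by (intro nn_integral_add[symmetric]) measurable
    also have "\<dots> = (\<integral>\<^sup>+x. ennreal (q n x) \<partial>lborel)"
      using nn \<phi>0 by (intro nn_integral_cong) (simp add: ennreal_plus[symmetric] q_def distrib_left del: ennreal_plus)
    finally show "(\<integral>\<^sup>+x. ennreal (\<gamma> (x + real n * real N) * \<phi> x / x\<^sup>2) + ennreal (\<gamma> (x - real (n + 1) * real N) * \<phi> x / x\<^sup>2) \<partial>lborel)
      = (\<integral>\<^sup>+x. ennreal (q n x) \<partial>lborel)" .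
  qed
  also have "\<dots> = (\<integral>\<^sup>+x. (\<Sum>n. ennreal (q n x)) \<partial>lborel)"
    by (intro nn_integral_suminf[symmetric]) measurable
  also have "\<dots> \<le> (\<integral>\<^sup>+x. ennreal (p ^ 4) * ennreal (x\<^sup>2 * \<gamma> x) \<partial>lborel)"
  proof (rule nn_integral_mono)
    fix x
    have "(\<Sum>n<M. q n x) \<le> p ^ 4 * (x\<^sup>2 * \<gamma> x)" for M
    proof (cases "sin (p * x) = 0")
      case True
      then show ?thesis using nn[of x] p0 by (simp add: q_def \<phi>_def)
    next
      case False
      have scale: "1 / (x - real n * real N)\<^sup>2 = p\<^sup>2 * (1 / (p * x - real n * pi)\<^sup>2)"
        "1 / (x + real (n + 1) * real N)\<^sup>2 = p\<^sup>2 * (1 / (p * x + real (n + 1) * pi)\<^sup>2)" for n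
      proof -
        have "p * x - real n * pi = p * (x - real n * real N)" "p * x + real (n + 1) * pi = p * (x + real (n + 1) * real N)"
          unfolding pN[symmetric] by (simp_all add: algebra_simps)
        then show "1 / (x - real n * real N)\<^sup>2 = p\<^sup>2 * (1 / (p * x - real n * pi)\<^sup>2)"
          "1 / (x + real (n + 1) * real N)\<^sup>2 = p\<^sup>2 * (1 / (p * x + real (n + 1) * pi)\<^sup>2)"
          using p0 by (simp_all add: power_mult_distrib)
      qed
      have "(\<Sum>n<M. q n x) = \<gamma> x * \<phi> x * p\<^sup>2 * (\<Sum>n<M. 1 / (p * x - real n * pi)\<^sup>2 + 1 / (p * x + real (n + 1) * pi)\<^sup>2)"
        unfolding q_def scale sum_distrib_left by (intro sum.cong refl) (simp only: distrib_left mult_ac)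
      also have "\<dots> \<le> \<gamma> x * \<phi> x * p\<^sup>2 * (1 / (sin (p * x))\<^sup>2)"
        using nn[of x] \<phi>0[of x] by (intro mult_left_mono sum_inverse_sq_le False) auto
      also have "\<dots> = \<gamma> x * p\<^sup>2 * (sin (p * x))\<^sup>2" using False by (simp add: \<phi>_def field_simps power4_eq_xxxx power2_eq_square)
      also have "\<dots> \<le> \<gamma> x * p\<^sup>2 * (p * x)\<^sup>2"
        using nn[of x] abs_sin_x_le_abs_x[of "p * x"] by (intro mult_left_mono) (simp_all add: abs_le_square_iff)
      also have "\<dots> = p ^ 4 * (x\<^sup>2 * \<gamma> x)" by (simp add: power_mult_distrib power4_eq_xxxx power2_eq_square)
      finally show ?thesis .
    qed
    then show "(\<Sum>n. ennreal (q n x)) \<le> ennreal (p ^ 4) * ennreal (x\<^sup>2 * \<gamma> x)"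
      using q0 nn[of x] p0 by (intro suminf_le_const) (auto simp: sum_ennreal ennreal_mult[symmetric] ennreal_le_iff)
  qed
  also have "\<dots> = ennreal (p ^ 4) * (\<integral>\<^sup>+x. ennreal (x\<^sup>2 * \<gamma> x) \<partial>lborel)"
    by (intro nn_integral_cmult) measurable
  finally show ?thesis unfolding \<phi>_def p_def .
qed

lemma nn_integral_sin4_div_sq_le:
  assumes "p > 0"
  shows "(\<integral>\<^sup>+x. ennreal (indicator {0<..} x * (sin (p * x) ^ 4 / x\<^sup>2)) \<partial>lborel) \<le> ennreal (pi / 2 * p)"
proof -
  have "has_bochner_integral lborel (\<lambda>x. indicator {0<..} x * ((1 - cos (2 * p * x)) / x\<^sup>2) / 2) (pi / 2 * \<bar>2 * p\<bar> / 2)"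
    by (intro has_bochner_integral_divide integral_one_minus_cos)
  from nn_integral_of_has_bochner[OF this]
  have eq: "(\<integral>\<^sup>+x. ennreal (indicator {0<..} x * ((1 - cos (2 * p * x)) / x\<^sup>2) / 2) \<partial>lborel) = ennreal (pi / 2 * p)"
    using assms by (simp add: split_indicator)
  show ?thesis
    unfolding eq[symmetric]
  proof (intro nn_integral_mono ennreal_leI)
    fix x
    have s: "(1 - cos (2 * p * x)) / 2 = (sin (p * x))\<^sup>2" using cos_double_sin[of "p * x"] by (simp add: mult.assoc)
    have "sin (p * x) ^ 4 \<le> (sin (p * x))\<^sup>2"
      using power_decreasing[of 1 2 "(sin (p * x))\<^sup>2"] by (simp add: abs_square_le_1 flip: power_mult)
    then show "indicator {0<..} x * (sin (p * x) ^ 4 / x\<^sup>2) \<le> indicator {0<..} x * ((1 - cos (2 * p * x)) / x\<^sup>2) / 2"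
      unfolding s[symmetric] by (auto simp: divide_right_mono field_simps split: split_indicator)
  qed
qed

text \<open>Let \<open>q\<close> be the square whose value is the periodization plus \<open>\<epsilon>\<close>. It dominates \<open>\<gamma>\<close>, the trigonometric
  inequality applies to it, and the right-hand side folds back to the second moment of \<open>\<gamma>\<close>.\<close>

lemma windowed_moment_inequality:
  fixes g :: "complex \<Rightarrow> complex"
  assumes hol: "g holomorphic_on UNIV"
    and bd: "\<And>z. cmod (g z) \<le> D * exp (2 * pi * \<bar>Im z\<bar>) / (1 + (cmod z)\<^sup>2)"
    and g: "\<And>x::real. g (of_real x) = of_real (\<gamma> x)" "\<And>x. \<gamma> x \<ge> 0" "\<And>x. \<gamma> (- x) = \<gamma> x"
    and N: "N \<ge> (1::nat)"
    and S: "(\<integral>\<^sup>+x. ennreal (indicator {0<..} x * (x\<^sup>2 * \<gamma> x)) \<partial>lborel) \<le> ennreal S" "S \<ge> 0"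
  shows "(\<integral>\<^sup>+x. ennreal (indicator {0<..} x * (x * \<gamma> x * (sin (pi / N * x) / (pi / N * x)) ^ 4)) \<partial>lborel)
    \<le> ennreal (3137 / 2000 * (1 + 2 / N) * (S + 1 / N))"
proof -
  define p where "p = pi / real N"
  have p0: "p > 0" using N by (simp add: p_def)
  have N0: "real N > 0" using N by simp
  \<comment> \<open>Chosen so that \<open>\<epsilon>\<close> contributes exactly \<open>1 / N\<close> next to \<open>S\<close> in the final bound.\<close>
  define \<epsilon> where "\<epsilon> = 2 * p ^ 3 / (pi * real N)"
  have \<epsilon>0: "\<epsilon> > 0" using p0 N0 by (simp add: \<epsilon>_def)
  obtain b a where a: "\<And>k. k \<le> N \<Longrightarrow> \<bar>a k\<bar> \<le> pi"
    and sums: "\<And>x. (\<lambda>n. \<gamma> (x + real n * real N) + \<gamma> (x - real (n + 1) * real N)) sums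
      ((cmod (\<Sum>k\<le>N. b k * cis (a k * x)))\<^sup>2 - \<epsilon>)"
  proof (rule periodization_square[OF hol bd g(1,2) N \<epsilon>0])
    fix b a
    assume "\<And>k. k \<le> N \<Longrightarrow> \<bar>a k\<bar> \<le> pi"
      and "\<And>x. (\<lambda>n. \<gamma> (x + real n * real N) + \<gamma> (x - real (n + 1) * real N)) sums
      ((cmod (\<Sum>k\<le>N. b k * cis (a k * x)))\<^sup>2 - \<epsilon>)"
    then show thesis by (rule that)
  qed
  define q where "q = (\<lambda>x. (cmod (\<Sum>k\<le>N. b k * cis (a k * x)))\<^sup>2)"
  define \<phi> where "\<phi> = (\<lambda>x. sin (p * x) ^ 4)"
  have \<phi>0: "\<phi> x \<ge> 0" and \<phi>m: "\<phi> (- x) = \<phi> x" for x by (simp_all add: \<phi>_def)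
  have "continuous_on UNIV (\<lambda>x. Re (g (of_real x)))"
    by (intro continuous_intros continuous_on_compose2[OF holomorphic_on_imp_continuous_on[OF hol]]) auto
  then have "continuous_on UNIV \<gamma>" by (simp add: g(1))
  then have [measurable]: "\<gamma> \<in> borel_measurable borel" by (rule borel_measurable_continuous_onI)
  have "continuous_on UNIV q" unfolding q_def cis_conv_exp by (intro continuous_intros)
  then have [measurable]: "q \<in> borel_measurable borel" by (rule borel_measurable_continuous_onI)
  have [measurable]: "\<phi> \<in> borel_measurable borel" unfolding \<phi>_def by measurable
  have q_ge: "\<gamma> x \<le> q x - \<epsilon>" for x
  proof -
    have "(\<Sum>n<1. \<gamma> (x + real n * real N) + \<gamma> (x - real (n + 1) * real N)) \<le> (\<Sum>n. \<gamma> (x + real n * real N) + \<gamma> (x - real (n + 1) * real N))"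
      using sums[of x] g(2) by (intro sum_le_suminf) (auto simp: sums_iff)
    also have "\<dots> = q x - \<epsilon>" using sums_unique[OF sums[of x]] by (simp add: q_def)
    finally show ?thesis using g(2)[of "x - real N"] by simp
  qed
  have q0: "q x - \<epsilon> \<ge> 0" for x using q_ge[of x] g(2)[of x] by linarith
  define c where "c = 3137 / 2000 * (1 + 2 / real N)"
  have c: "3137 / 2000 / pi * (pi + 2 * p) = c" using N0 by (simp add: c_def p_def field_simps)
  have c0: "c \<ge> 0" by (simp add: c_def)
  have two_S: "(\<integral>\<^sup>+x. ennreal (x\<^sup>2 * \<gamma> x) \<partial>lborel) \<le> ennreal (2 * S)"
  proof -
    have "(\<integral>\<^sup>+x. ennreal (x\<^sup>2 * \<gamma> x) \<partial>lborel) = (\<integral>\<^sup>+x. ennreal (indicator {0<..} x * (x\<^sup>2 * \<gamma> x + (- x)\<^sup>2 * \<gamma> (- x))) \<partial>lborel)"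
      using g(2) by (intro nn_integral_two_sided[symmetric]) auto
    also have "\<dots> = (\<integral>\<^sup>+x. ennreal (indicator {0<..} x * (x\<^sup>2 * \<gamma> x)) + ennreal (indicator {0<..} x * (x\<^sup>2 * \<gamma> x)) \<partial>lborel)"
      using g(2) by (intro nn_integral_cong) (auto simp: g(3) ennreal_plus[symmetric] simp del: ennreal_plus split: split_indicator)
    also have "\<dots> = (\<integral>\<^sup>+x. ennreal (indicator {0<..} x * (x\<^sup>2 * \<gamma> x)) \<partial>lborel) + (\<integral>\<^sup>+x. ennreal (indicator {0<..} x * (x\<^sup>2 * \<gamma> x)) \<partial>lborel)"
      by (intro nn_integral_add) measurable
    also have "\<dots> \<le> ennreal S + ennreal S" by (intro add_mono S(1))
    also have "\<dots> = ennreal (2 * S)" using S(2) by (simp add: ennreal_plus[symmetric] del: ennreal_plus)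
    finally show ?thesis .
  qed
  have "(\<integral>\<^sup>+x. ennreal (indicator {0<..} x * ((q x + q (- x)) * \<phi> x / x\<^sup>2)) \<partial>lborel)
      = (\<integral>\<^sup>+x. ennreal (indicator {0<..} x * ((q x - \<epsilon>) * \<phi> x / x\<^sup>2 + (q (- x) - \<epsilon>) * \<phi> (- x) / (- x)\<^sup>2))
           + ennreal (2 * \<epsilon>) * ennreal (indicator {0<..} x * (\<phi> x / x\<^sup>2)) \<partial>lborel)"
  proof (rule nn_integral_cong)
    fix x
    have "(q x + q (- x)) * \<phi> x / x\<^sup>2 = ((q x - \<epsilon>) * \<phi> x / x\<^sup>2 + (q (- x) - \<epsilon>) * \<phi> (- x) / (- x)\<^sup>2) + 2 * \<epsilon> * (\<phi> x / x\<^sup>2)"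
      unfolding \<phi>m power2_minus by (simp add: add_divide_distrib diff_divide_distrib algebra_simps)
    moreover have "0 \<le> (q x - \<epsilon>) * \<phi> x / x\<^sup>2 + (q (- x) - \<epsilon>) * \<phi> (- x) / (- x)\<^sup>2"
      using q0[of x] q0[of "- x"] \<phi>0 by (intro add_nonneg_nonneg divide_nonneg_nonneg mult_nonneg_nonneg) auto
    moreover have "0 \<le> 2 * \<epsilon> * (\<phi> x / x\<^sup>2)" using \<epsilon>0 \<phi>0 by simp
    ultimately have "ennreal ((q x + q (- x)) * \<phi> x / x\<^sup>2)
      = ennreal ((q x - \<epsilon>) * \<phi> x / x\<^sup>2 + (q (- x) - \<epsilon>) * \<phi> (- x) / (- x)\<^sup>2) + ennreal (2 * \<epsilon>) * ennreal (\<phi> x / x\<^sup>2)"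
      using \<epsilon>0 by (simp only: ennreal_plus ennreal_mult'[symmetric])
    then show "ennreal (indicator {0<..} x * ((q x + q (- x)) * \<phi> x / x\<^sup>2))
      = ennreal (indicator {0<..} x * ((q x - \<epsilon>) * \<phi> x / x\<^sup>2 + (q (- x) - \<epsilon>) * \<phi> (- x) / (- x)\<^sup>2))
           + ennreal (2 * \<epsilon>) * ennreal (indicator {0<..} x * (\<phi> x / x\<^sup>2))"
      by (cases "x > 0") simp_all
  qed
  also have "\<dots> = (\<integral>\<^sup>+x. ennreal (indicator {0<..} x * ((q x - \<epsilon>) * \<phi> x / x\<^sup>2 + (q (- x) - \<epsilon>) * \<phi> (- x) / (- x)\<^sup>2)) \<partial>lborel)
      + ennreal (2 * \<epsilon>) * (\<integral>\<^sup>+x. ennreal (indicator {0<..} x * (\<phi> x / x\<^sup>2)) \<partial>lborel)"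
    by (subst nn_integral_add, measurable, subst nn_integral_cmult, measurable)
  also have "(\<integral>\<^sup>+x. ennreal (indicator {0<..} x * ((q x - \<epsilon>) * \<phi> x / x\<^sup>2 + (q (- x) - \<epsilon>) * \<phi> (- x) / (- x)\<^sup>2)) \<partial>lborel)
      = (\<integral>\<^sup>+x. ennreal ((q x - \<epsilon>) * \<phi> x / x\<^sup>2) \<partial>lborel)"
    using q0 \<phi>0 by (intro nn_integral_two_sided) auto
  also have "\<dots> + ennreal (2 * \<epsilon>) * (\<integral>\<^sup>+x. ennreal (indicator {0<..} x * (\<phi> x / x\<^sup>2)) \<partial>lborel)
      \<le> ennreal (p ^ 4) * ennreal (2 * S) + ennreal (2 * \<epsilon>) * ennreal (pi / 2 * p)"
  proof (intro add_mono mult_left_mono)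
    have "(\<integral>\<^sup>+x. ennreal ((q x - \<epsilon>) * \<phi> x / x\<^sup>2) \<partial>lborel) \<le> ennreal (p ^ 4) * (\<integral>\<^sup>+x. ennreal (x\<^sup>2 * \<gamma> x) \<partial>lborel)"
      unfolding \<phi>_def p_def q_def using g(2) N by (intro nn_integral_periodization_le sums) auto
    also have "\<dots> \<le> ennreal (p ^ 4) * ennreal (2 * S)" by (intro mult_left_mono two_S) auto
    finally show "(\<integral>\<^sup>+x. ennreal ((q x - \<epsilon>) * \<phi> x / x\<^sup>2) \<partial>lborel) \<le> ennreal (p ^ 4) * ennreal (2 * S)" .
    show "(\<integral>\<^sup>+x. ennreal (indicator {0<..} x * (\<phi> x / x\<^sup>2)) \<partial>lborel) \<le> ennreal (pi / 2 * p)"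
      unfolding \<phi>_def by (rule nn_integral_sin4_div_sq_le[OF p0])
  qed auto
  also have "\<dots> = ennreal (2 * p ^ 4 * (S + 1 / N))"
  proof -
    have "p ^ 4 * (2 * S) + 2 * \<epsilon> * (pi / 2 * p) = 2 * p ^ 4 * (S + 1 / N)"
      using N0 by (simp add: \<epsilon>_def field_simps power4_eq_xxxx power3_eq_cube)
    then show ?thesis using S(2) \<epsilon>0 p0 by (simp add: ennreal_mult[symmetric] ennreal_plus[symmetric] del: ennreal_plus)
  qed
  finally have upper: "(\<integral>\<^sup>+x. ennreal (indicator {0<..} x * ((q x + q (- x)) * \<phi> x / x\<^sup>2)) \<partial>lborel) \<le> ennreal (2 * p ^ 4 * (S + 1 / N))" .
  have "(\<integral>\<^sup>+x. ennreal (indicator {0<..} x * (x * \<gamma> x * (sin (p * x) / (p * x)) ^ 4)) \<partial>lborel)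
      \<le> (\<integral>\<^sup>+x. ennreal (1 / (2 * p ^ 4)) * ennreal (indicator {0<..} x * ((q x + q (- x)) * \<phi> x / x ^ 3)) \<partial>lborel)"
  proof (intro nn_integral_mono)
    fix x :: real
    show "ennreal (indicator {0<..} x * (x * \<gamma> x * (sin (p * x) / (p * x)) ^ 4))
      \<le> ennreal (1 / (2 * p ^ 4)) * ennreal (indicator {0<..} x * ((q x + q (- x)) * \<phi> x / x ^ 3))"
    proof (cases "x > 0")
      case True
      have "x * \<gamma> x * (sin (p * x) / (p * x)) ^ 4 = 1 / (2 * p ^ 4) * (2 * \<gamma> x * (\<phi> x / x ^ 3))"
        using True p0 by (simp add: \<phi>_def power_divide power_mult_distrib power4_eq_xxxx power3_eq_cube)
      also have "\<dots> \<le> 1 / (2 * p ^ 4) * ((q x + q (- x)) * (\<phi> x / x ^ 3))"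
        using q_ge[of x] q_ge[of "- x"] g(3)[of x] \<epsilon>0 \<phi>0[of x] True p0 by (intro mult_left_mono mult_right_mono) auto
      finally show ?thesis using True p0 by (simp add: ennreal_mult'[symmetric] ennreal_leI)
    qed simp
  qed
  also have "\<dots> = ennreal (1 / (2 * p ^ 4)) * (\<integral>\<^sup>+x. ennreal (indicator {0<..} x * ((q x + q (- x)) * \<phi> x / x ^ 3)) \<partial>lborel)"
    by (intro nn_integral_cmult) measurable
  also have "\<dots> \<le> ennreal (1 / (2 * p ^ 4)) * (ennreal c * (\<integral>\<^sup>+x. ennreal (indicator {0<..} x * ((q x + q (- x)) * \<phi> x / x\<^sup>2)) \<partial>lborel))"
    using square_trig_poly_inequality[OF a, where \<delta> = "2 * p" and b = b] p0 unfolding q_def \<phi>_def c by (intro mult_left_mono) auto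
  also have "\<dots> \<le> ennreal (1 / (2 * p ^ 4)) * (ennreal c * ennreal (2 * p ^ 4 * (S + 1 / N)))"
    by (intro mult_left_mono upper) auto
  also have "\<dots> = ennreal (c * (S + 1 / N))"
    using p0 c0 S(2) by (simp add: ennreal_mult'[symmetric] field_simps)
  finally show ?thesis unfolding c_def p_def .
qed

text \<open>As \<open>N\<close> grows the window tends to \<open>1\<close> and Fatou's lemma applies.\<close>

lemma moment_inequality:
  fixes g :: "complex \<Rightarrow> complex"
  assumes hol: "g holomorphic_on UNIV"
    and bd: "\<And>z. cmod (g z) \<le> D * exp (2 * pi * \<bar>Im z\<bar>) / (1 + (cmod z)\<^sup>2)"
    and g: "\<And>x::real. g (of_real x) = of_real (\<gamma> x)" "\<And>x. \<gamma> x \<ge> 0" "\<And>x. \<gamma> (- x) = \<gamma> x"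
    and S: "(\<integral>\<^sup>+x. ennreal (indicator {0<..} x * (x\<^sup>2 * \<gamma> x)) \<partial>lborel) \<le> ennreal S" "S \<ge> 0"
  shows "(\<integral>\<^sup>+x. ennreal (indicator {0<..} x * (x * \<gamma> x)) \<partial>lborel) \<le> ennreal (3137 / 2000 * S)"
proof -
  define w where "w = (\<lambda>n x. indicator {0<..} x * (x * \<gamma> x * (sin (pi / real (Suc n) * x) / (pi / real (Suc n) * x)) ^ 4) :: real)"
  have "continuous_on UNIV (\<lambda>x. Re (g (of_real x)))"
    by (intro continuous_intros continuous_on_compose2[OF holomorphic_on_imp_continuous_on[OF hol]]) auto
  then have "continuous_on UNIV \<gamma>" by (simp add: g(1))
  then have [measurable]: "\<gamma> \<in> borel_measurable borel" by (rule borel_measurable_continuous_onI)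
  have lim: "(\<lambda>n. w n x) \<longlonglongrightarrow> indicator {0<..} x * (x * \<gamma> x)" for x
  proof (cases "x > 0")
    case True
    have "((\<lambda>u::real. sin u / u) \<longlongrightarrow> 1) (at 0)" by real_asymp
    moreover have "filterlim (\<lambda>n. pi / real (Suc n) * x) (at 0) sequentially"
    proof (rule filterlim_atI)
      show "(\<lambda>n. pi / real (Suc n) * x) \<longlonglongrightarrow> 0" by real_asymp
      show "\<forall>\<^sub>F n in sequentially. pi / real (Suc n) * x \<noteq> 0" using True by (auto intro!: always_eventually)
    qed
    ultimately have "(\<lambda>n. sin (pi / real (Suc n) * x) / (pi / real (Suc n) * x)) \<longlonglongrightarrow> 1" by (rule filterlim_compose)
    then have "(\<lambda>n. indicator {0<..} x * (x * \<gamma> x * (sin (pi / real (Suc n) * x) / (pi / real (Suc n) * x)) ^ 4)) \<longlonglongrightarrow> indicator {0<..} x * (x * \<gamma> x * 1 ^ 4)"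
      by (intro tendsto_mult tendsto_const tendsto_power)
    then show ?thesis by (simp add: w_def)
  qed (simp add: w_def)
  have "(\<integral>\<^sup>+x. ennreal (indicator {0<..} x * (x * \<gamma> x)) \<partial>lborel) = (\<integral>\<^sup>+x. liminf (\<lambda>n. ennreal (w n x)) \<partial>lborel)"
    using lim by (intro nn_integral_cong lim_imp_Liminf[symmetric] tendsto_ennrealI) auto
  also have "\<dots> \<le> liminf (\<lambda>n. \<integral>\<^sup>+x. ennreal (w n x) \<partial>lborel)"
    unfolding w_def by (intro nn_integral_liminf) measurable
  also have "\<dots> \<le> liminf (\<lambda>n. ennreal (3137 / 2000 * (1 + 2 / real (Suc n)) * (S + 1 / real (Suc n))))"
    unfolding w_def
    by (intro Liminf_mono always_eventually allI windowed_moment_inequality[OF hol bd g _ S]) simp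
  also have "\<dots> = ennreal (3137 / 2000 * S)"
  proof (intro lim_imp_Liminf tendsto_ennrealI)
    show "(\<lambda>n. 3137 / 2000 * (1 + 2 / real (Suc n)) * (S + 1 / real (Suc n))) \<longlonglongrightarrow> 3137 / 2000 * S" by real_asymp
  qed simp
  finally show ?thesis .
qed

text \<open>With \<open>F' = - x \<gamma>\<close>, the moment inequality reads \<open>F 0 \<le> 3137/2000 \<cdot> \<parallel>F\<parallel>\<^sub>1 / 2\<close>.\<close>

theorem A1_lower:
  assumes F: "F \<in> F1" "even_fun F" "F 0 = 1"
  shows "4000 / 3137 \<le> norm_L1 F"
proof -
  obtain g D where g: "g holomorphic_on UNIV" "\<And>z. deriv F z = - (z * g z)"
    "\<And>z. cmod (g z) \<le> D * exp (2 * pi * \<bar>Im z\<bar>) / (1 + (cmod z)\<^sup>2)"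
    "\<And>x::real. g (of_real x) \<in> \<real>\<^sub>\<ge>\<^sub>0" "\<And>z. g (- z) = g z"
    using F1_even_derivative[OF F(1,2)] by blast
  define \<gamma> where "\<gamma> = (\<lambda>x::real. Re (g (of_real x)))"
  have \<gamma>: "g (of_real x) = of_real (\<gamma> x)" "\<gamma> x \<ge> 0" "\<gamma> (- x) = \<gamma> x" for x
    using g(4)[of x] g(5)[of "of_real x"] by (auto simp: \<gamma>_def complex_nonneg_Reals_iff complex_eq_iff)
  note m = F1_even_moments[OF F holomorphic_on_imp_continuous_on[OF g(1)] g(2) \<gamma>(1,2)]
  have "1 \<le> ennreal (3137 / 2000 * (norm_L1 F / 2))"
    using moment_inequality[OF g(1,3) \<gamma> m(2)] norm_L1_nonneg[of F] unfolding m(1) by simp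
  then have "1 \<le> 3137 / 2000 * (norm_L1 F / 2)" by (simp add: ennreal_1[symmetric] ennreal_le_iff2 del: ennreal_1)
  then show ?thesis by simp
qed

theorem theorem1:
  shows "(\<exists>F\<in>F1. even_fun F \<and> F 0 = 1 \<and> norm_L1 F / Re (F 0) = A1) \<and>
         (\<forall>F. even_extremizer F \<longrightarrow>
            {z. F z = 0} \<subseteq> {z. \<bar>Re z\<bar> > \<bar>Im z\<bar> \<and> \<bar>Im z\<bar> > 0}) \<and>
         1.2750 < A1 \<and> A1 < 1.27714"
proof -
  obtain f0 where f0: "f0 \<in> F1" "f0 0 \<noteq> 0" "norm_L1 f0 / Re (f0 0) < 1.27714" using A1_upper by blast
  obtain F where F: "F \<in> F1" "even_fun F" "F 0 = 1" "norm_L1 F = A1"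
    using even_extremizer_exists[OF f0(1,2)] by blast
  have "norm_L1 F / Re (F 0) = A1" using F(3,4) by simp
  then have "\<exists>F\<in>F1. even_fun F \<and> F 0 = 1 \<and> norm_L1 F / Re (F 0) = A1" using F(1-3) by blast
  moreover have "\<forall>F. even_extremizer F \<longrightarrow> {z. F z = 0} \<subseteq> {z. \<bar>Re z\<bar> > \<bar>Im z\<bar> \<and> \<bar>Im z\<bar> > 0}"
    using even_extremizer_zeros by blast
  moreover have "1.2750 < A1" using A1_lower[OF F(1-3)] F(4) by simp
  moreover have "A1 < 1.27714" using A1_le[OF f0(1,2)] f0(3) by (rule le_less_trans)
  ultimately show ?thesis by blast
qed

end
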